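(* Let $G$ be a compact Lie group and let $\rho: G\to O(V)$ be an orthogonal representation of $G$ on a finite-dimensional real inner product space $V$ which is polar, with section $\Sigma$ (a linear subspace of $V$) and generalized Weyl group $W(\Sigma)=N_G(\Sigma)/Z_G(\Sigma)$. Let $B\subset V$ be an open ball centered at $0$. Then restriction of differential forms (pullback along the inclusion $i:\Sigma\cap B\to B$) induces, for every $p\ge 0$, an isomorphism $$\Omega^p_{\mathrm{hor}}(B)^G \xrightarrow{\ \cong\ } \Omega^p(\Sigma\cap B)^{W(\Sigma)}.$$
   Context: For an isometric action of a Lie group $G$ on a Riemannian manifold $M$, a section is a closed submanifold $\Sigma\subset M$ which meets every $G$-orbit and meets each orbit orthogonally (at every intersection point $x$, $T_x\Sigma$ is orthogonal to $T_x(G.x)$). An orthogonal representation admitting a section is called polar; the section is then a linear subspace. $N_G(\Sigma)=\{g\in G: g.\Sigma=\Sigma\}$, $Z_G(\Sigma)=\{g\in G: g.s=s \text{ for all } s\in\Sigma\}$, and the generalized Weyl group $W(\Sigma)=N_G(\Sigma)/Z_G(\Sigma)$ acts on $\Sigma$. A differential form $\varphi\in\Omega^p(M)$ is $G$-invariant if $g^*\varphi=\varphi$ for all $g\in G$, and horizontal if $\varphi$ vanishes whenever one of its arguments is tangent to a $G$-orbit. $\Omega^p_{\mathrm{hor}}(M)^G$ denotes the space of horizontal $G$-invariant $p$-forms (basic forms), and $\Omega^p(\Sigma)^{W(\Sigma)}$ the space of $W(\Sigma)$-invariant $p$-forms on $\Sigma$. *)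

theory Defs
  imports "HOL-Analysis.Analysis"
begin

text \<open>A compact Lie group acting orthogonally on V is modelled by its image K in O(V):
  a compact (pointwise topology, equal to the operator topology on O(V)) subgroup of the
  orthogonal linear maps of V.\<close>
definition compact_orth_group :: "('v::euclidean_space \<Rightarrow> 'v) set \<Rightarrow> bool" where
  "compact_orth_group K \<longleftrightarrow>
     (\<forall>g\<in>K. orthogonal_transformation g) \<and> id \<in> K \<and>
     (\<forall>g\<in>K. \<forall>h\<in>K. g \<circ> h \<in> K) \<and> (\<forall>g\<in>K. inv g \<in> K) \<and> compact K"

definition orbit :: "('v \<Rightarrow> 'v) set \<Rightarrow> 'v \<Rightarrow> 'v set" where
  "orbit K x = (\<lambda>g. g x) ` K"

text \<open>Tangent space of the orbit K.x at x: velocities of differentiable curves in the orbit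
  through x.\<close>
definition orbit_tangent :: "('v::euclidean_space \<Rightarrow> 'v) set \<Rightarrow> 'v \<Rightarrow> 'v set" where
  "orbit_tangent K x = {u. \<exists>c::real \<Rightarrow> 'v. (\<forall>t. c t \<in> orbit K x) \<and> c 0 = x \<and>
                              (c has_vector_derivative u) (at 0)}"

definition is_section :: "('v::euclidean_space \<Rightarrow> 'v) set \<Rightarrow> 'v set \<Rightarrow> bool" where
  "is_section K \<Sigma> \<longleftrightarrow> subspace \<Sigma> \<and> (\<forall>x. \<exists>g\<in>K. g x \<in> \<Sigma>) \<and>
     (\<forall>x\<in>\<Sigma>. \<forall>u\<in>orbit_tangent K x. \<forall>s\<in>\<Sigma>. u \<bullet> s = 0)"

text \<open>Generalized Weyl group N_K(Sigma)/Z_K(Sigma), realised (canonically) as the group of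
  restrictions to Sigma of the elements of the normaliser.\<close>
definition weyl :: "('v \<Rightarrow> 'v) set \<Rightarrow> 'v set \<Rightarrow> ('v \<Rightarrow> 'v) set" where
  "weyl K \<Sigma> = (\<lambda>g. restrict g \<Sigma>) ` {g\<in>K. g ` \<Sigma> = \<Sigma>}"

text \<open>C^k functions on a set S which is open in the linear subspace T (differentiation in the
  directions of T).\<close>
fun Ck :: "nat \<Rightarrow> 'v::euclidean_space set \<Rightarrow> 'v set \<Rightarrow> ('v \<Rightarrow> real) \<Rightarrow> bool" where
  "Ck 0 T S f = continuous_on S f"
| "Ck (Suc k) T S f = (continuous_on S f \<and>
     (\<exists>Df. (\<forall>x\<in>S. (f has_derivative Df x) (at x within S)) \<and> (\<forall>h\<in>T. Ck k T S (\<lambda>x. Df x h))))"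

definition smooth_on :: "'v::euclidean_space set \<Rightarrow> 'v set \<Rightarrow> ('v \<Rightarrow> real) \<Rightarrow> bool" where
  "smooth_on T S f \<longleftrightarrow> (\<forall>k. Ck k T S f)"

text \<open>Alternating p-linear forms on T; arguments are sequences nat => 'v of which only the first
  p entries matter; the form is 0 when one of those is not in T (extensional convention).\<close>
definition alt_form :: "nat \<Rightarrow> 'v::euclidean_space set \<Rightarrow> ((nat \<Rightarrow> 'v) \<Rightarrow> real) \<Rightarrow> bool" where
  "alt_form p T a \<longleftrightarrow>
     (\<forall>v w. (\<forall>i<p. v i = w i) \<longrightarrow> a v = a w) \<and>
     (\<forall>v. (\<exists>i<p. v i \<notin> T) \<longrightarrow> a v = 0) \<and>
     (\<forall>i<p. \<forall>v. (\<forall>j<p. v j \<in> T) \<longrightarrow>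
        (\<forall>c y z. y \<in> T \<longrightarrow> z \<in> T \<longrightarrow>
           a (v(i := c *\<^sub>R y + z)) = c * a (v(i := y)) + a (v(i := z)))) \<and>
     (\<forall>v. \<forall>i<p. \<forall>j<p. i \<noteq> j \<longrightarrow> v i = v j \<longrightarrow> a v = 0)"

text \<open>Smooth differential p-forms on S (open in the subspace T), extended by 0 outside S.\<close>
definition forms :: "nat \<Rightarrow> 'v::euclidean_space set \<Rightarrow> 'v set \<Rightarrow> ('v \<Rightarrow> (nat \<Rightarrow> 'v) \<Rightarrow> real) set" where
  "forms p T S = {\<omega>. (\<forall>x. x \<notin> S \<longrightarrow> \<omega> x = (\<lambda>v. 0)) \<and> (\<forall>x\<in>S. alt_form p T (\<omega> x)) \<and>
                     (\<forall>v. (\<forall>i<p. v i \<in> T) \<longrightarrow> smooth_on T S (\<lambda>x. \<omega> x v))}"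

definition invariant_form :: "('v \<Rightarrow> 'v) set \<Rightarrow> nat \<Rightarrow> 'v set \<Rightarrow> 'v set \<Rightarrow> ('v \<Rightarrow> (nat \<Rightarrow> 'v) \<Rightarrow> real) \<Rightarrow> bool" where
  "invariant_form H p T S \<omega> \<longleftrightarrow>
     (\<forall>g\<in>H. \<forall>x\<in>S. \<forall>v. (\<forall>i<p. v i \<in> T) \<longrightarrow> \<omega> (g x) (g \<circ> v) = \<omega> x v)"

definition horizontal_form :: "('v::euclidean_space \<Rightarrow> 'v) set \<Rightarrow> nat \<Rightarrow> 'v set \<Rightarrow> ('v \<Rightarrow> (nat \<Rightarrow> 'v) \<Rightarrow> real) \<Rightarrow> bool" where
  "horizontal_form K p S \<omega> \<longleftrightarrow> (\<forall>x\<in>S. \<forall>v. (\<exists>i<p. v i \<in> orbit_tangent K x) \<longrightarrow> \<omega> x v = 0)"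

definition basic_forms :: "('v::euclidean_space \<Rightarrow> 'v) set \<Rightarrow> nat \<Rightarrow> 'v set \<Rightarrow> ('v \<Rightarrow> (nat \<Rightarrow> 'v) \<Rightarrow> real) set" where
  "basic_forms K p U = {\<omega> \<in> forms p UNIV U. invariant_form K p UNIV U \<omega> \<and> horizontal_form K p U \<omega>}"

definition inv_forms_on :: "('v::euclidean_space \<Rightarrow> 'v) set \<Rightarrow> nat \<Rightarrow> 'v set \<Rightarrow> 'v set \<Rightarrow> ('v \<Rightarrow> (nat \<Rightarrow> 'v) \<Rightarrow> real) set" where
  "inv_forms_on W p \<Sigma> S = {\<omega> \<in> forms p \<Sigma> S. invariant_form W p \<Sigma> S \<omega>}"

definition pullback_incl :: "nat \<Rightarrow> 'v set \<Rightarrow> 'v set \<Rightarrow> ('v \<Rightarrow> (nat \<Rightarrow> 'v) \<Rightarrow> real) \<Rightarrow> ('v \<Rightarrow> (nat \<Rightarrow> 'v) \<Rightarrow> real)" where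
  "pullback_incl p \<Sigma> S \<omega> = (\<lambda>x v. if x \<in> S \<and> (\<forall>i<p. v i \<in> \<Sigma>) then \<omega> x v else 0)"

end

theory Submission
  imports Defs
begin

text \<open>
  At a regular point of \<open>\<Sigma>\<close> the orbit directions fill the orthogonal complement of \<open>\<Sigma>\<close>, so a basic
  form is determined there by its restriction; regular points are dense, whence injectivity.

  For surjectivity, let \<open>L\<close> be the Lie algebra of the group. The maps \<open>X x\<^sub>0 \<mapsto> X y\<close>, \<open>y \<in> \<Sigma>\<close>, are
  commuting symmetric operators on the complement of \<open>\<Sigma>\<close>; diagonalising them gives an orthonormal
  basis \<open>E\<close> and roots \<open>a e \<in> \<Sigma>\<close> with \<open>X\<^sub>e y = (a e \<bullet> y) e\<close>, and \<open>y \<in> \<Sigma>\<close> is singular exactly on the root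
  hyperplanes. A Weyl invariant form on \<open>\<Sigma>\<close> extends uniquely to an invariant horizontal tensor field
  \<open>T\<^sub>0\<close> on the regular set, with iterated derivatives \<open>T\<^sub>k\<close>, and the point is that every \<open>T\<^sub>k\<close> restricted to
  \<open>\<Sigma>\<close> extends smoothly across the root hyperplanes. Equivariance gives
  \<open>(a e \<bullet> y) T\<^sub>k\<^sub>+\<^sub>1 y (e, ws) = - (X\<^sub>e \<cdot> T\<^sub>k) y ws\<close>, so it suffices that the right hand side vanishes on
  the hyperplane of \<open>a e\<close>; this follows from invariance under the rank one subgroup fixing the
  hyperplane, once \<open>T\<^sub>k\<close> is known to extend to the slice spanned by \<open>\<Sigma>\<close> and the basis vectors with root
  parallel to \<open>a e\<close>. There the subgroup acts transitively on spheres, and smoothness of \<open>T\<^sub>0\<close> reduces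
  to the fact that an even smooth function of the norm is smooth. Finally, by equivariance all \<open>T\<^sub>k\<close> are
  locally bounded; the singular set of the ambient space has codimension at least two, so generic
  segments avoid it, all \<open>T\<^sub>k\<close> are locally Lipschitz, and \<open>T\<^sub>0\<close> extends smoothly to the ball.
\<close>

section \<open>The Lie algebra of a compact group\<close>

text \<open>Neither a slice theorem nor the exponential map of a Lie group is available here, so
  group elements come from compactness: as limits of powers, or as optimisers over closed subsets of
  \<open>G\<close>. The resulting choice of elements returning points to \<Sigma> is differentiable
  at one point only, too little to differentiate an invariant form repeatedly. This is why each
  \<open>T k\<close> is treated as an equivariant tensor field of rank k + p in its own right:
  passing from \<open>T k\<close> to \<open>T (Suc k)\<close> uses one derivative at one point, and
  equivariance is inherited.

  On \<Sigma>, derivatives in directions of \<Sigma> cost nothing, while in a direction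
  \<open>e\<close> equivariance determines the derivative up to division by a root. The vanishing
  needed for that division is proved at points of the hyperplane where no further root vanishes:
  there the directions normal to the slice are recovered by solving a linear system with invertible
  diagonal part. Continuity does the rest.

  Off \<Sigma> only local bounds are transported, because the group acts by isometries and these
  survive a discontinuous choice of group elements.\<close>

primrec bpow :: "('v::real_normed_vector \<Rightarrow>\<^sub>L 'v) \<Rightarrow> nat \<Rightarrow> ('v \<Rightarrow>\<^sub>L 'v)" where
  "bpow A 0 = id_blinfun"
| "bpow A (Suc n) = A o\<^sub>L bpow A n"

lemmas blc_simps =
  bounded_bilinear.diff_left[OF bounded_bilinear_blinfun_compose]
  bounded_bilinear.diff_right[OF bounded_bilinear_blinfun_compose]
  bounded_bilinear.add_left[OF bounded_bilinear_blinfun_compose]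
  bounded_bilinear.add_right[OF bounded_bilinear_blinfun_compose]
  bounded_bilinear.scaleR_left[OF bounded_bilinear_blinfun_compose]
  bounded_bilinear.scaleR_right[OF bounded_bilinear_blinfun_compose]
  bounded_bilinear.minus_left[OF bounded_bilinear_blinfun_compose]
  bounded_bilinear.minus_right[OF bounded_bilinear_blinfun_compose]

lemmas bl_simps = blinfun.diff_left blinfun.diff_right blinfun.add_left blinfun.add_right
  blinfun.scaleR_left blinfun.scaleR_right blinfun.minus_left blinfun.minus_right

lemma id_comp [simp]: "id_blinfun o\<^sub>L A = A" "A o\<^sub>L id_blinfun = A"
  by (auto intro: blinfun_eqI)

lemma norm_id_blinfun_le: "norm (id_blinfun :: 'v::real_normed_vector \<Rightarrow>\<^sub>L 'v) \<le> 1"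
  by (rule norm_blinfun_bound) auto

lemma norm_bpow_le:
  assumes "norm A \<le> M" "1 \<le> M" shows "norm (bpow A n) \<le> M ^ n"
proof (induction n)
  case 0 show ?case using norm_id_blinfun_le by simp
next
  case (Suc n)
  have "norm (bpow A (Suc n)) \<le> norm A * norm (bpow A n)" by (simp add: norm_blinfun_compose)
  also have "\<dots> \<le> M * M ^ n" using Suc assms by (intro mult_mono) auto
  finally show ?case by simp
qed

text \<open>Telescoping: the difference of the powers of order n + 1 is \<open>g\<close> times the
  difference of order n plus \<open>g - A\<close> times a power of \<open>A\<close>. Since
  \<open>g\<close> is a contraction, only powers of \<open>M\<close> accumulate.\<close>

lemma norm_bpow_diff_le:
  assumes "norm g \<le> 1" "norm A \<le> M" "1 \<le> M"
  shows "norm (bpow g n - bpow A n) \<le> real n * norm (g - A) * M ^ n"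
proof (induction n)
  case (Suc n)
  have "bpow g (Suc n) - bpow A (Suc n) = (g o\<^sub>L (bpow g n - bpow A n)) + ((g - A) o\<^sub>L bpow A n)"
    by (simp add: blc_simps)
  then have "norm (bpow g (Suc n) - bpow A (Suc n))
      \<le> norm g * norm (bpow g n - bpow A n) + norm (g - A) * norm (bpow A n)"
    by (metis norm_triangle_le add_mono norm_blinfun_compose)
  also have "\<dots> \<le> 1 * (real n * norm (g - A) * M ^ n) + norm (g - A) * M ^ n"
    using assms Suc norm_bpow_le[of A M n] by (intro add_mono mult_mono) auto
  also have "\<dots> = (real (Suc n) * norm (g - A)) * M ^ n" by (simp add: algebra_simps)
  also have "\<dots> \<le> (real (Suc n) * norm (g - A)) * M ^ Suc n"
    using assms by (intro mult_left_mono power_increasing) auto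
  finally show ?case .
qed simp

text \<open>The binomial expansion beyond first order has nonnegative coefficients, so it is
  dominated by the same expression with \<open>norm Y\<close> in place of \<open>Y\<close>. This
  yields the quadratic error of the substitute for exp.\<close>

lemma norm_bpow_one_plus_le:
  "norm (bpow (id_blinfun + Y) n - id_blinfun - real n *\<^sub>R Y) \<le> (1 + norm Y) ^ n - 1 - real n * norm Y"
proof (induction n)
  case (Suc n)
  have "bpow (id_blinfun + Y) (Suc n) - id_blinfun - real (Suc n) *\<^sub>R Y
     = ((id_blinfun + Y) o\<^sub>L (bpow (id_blinfun + Y) n - id_blinfun - real n *\<^sub>R Y)) + real n *\<^sub>R (Y o\<^sub>L Y)"
    by (simp add: blc_simps algebra_simps)
  then have "norm (bpow (id_blinfun + Y) (Suc n) - id_blinfun - real (Suc n) *\<^sub>R Y)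
      \<le> norm ((id_blinfun + Y) o\<^sub>L (bpow (id_blinfun + Y) n - id_blinfun - real n *\<^sub>R Y)) + norm (real n *\<^sub>R (Y o\<^sub>L Y))"
    by (metis norm_triangle_ineq)
  also have "\<dots> \<le> (1 + norm Y) * ((1 + norm Y) ^ n - 1 - real n * norm Y) + real n * (norm Y * norm Y)"
  proof (intro add_mono)
    have "norm ((id_blinfun :: 'a \<Rightarrow>\<^sub>L 'a) + Y) \<le> 1 + norm Y"
      by (meson add_right_mono norm_id_blinfun_le norm_triangle_le)
    then show "norm ((id_blinfun + Y) o\<^sub>L (bpow (id_blinfun + Y) n - id_blinfun - real n *\<^sub>R Y))
      \<le> (1 + norm Y) * ((1 + norm Y) ^ n - 1 - real n * norm Y)"
      using Suc by (intro order_trans[OF norm_blinfun_compose] mult_mono) auto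
    show "norm (real n *\<^sub>R (Y o\<^sub>L Y)) \<le> real n * (norm Y * norm Y)"
      by (simp add: mult_left_mono norm_blinfun_compose)
  qed
  also have "\<dots> = (1 + norm Y) ^ Suc n - 1 - real (Suc n) * norm Y" by (simp add: algebra_simps)
  finally show ?case .
qed simp

lemma tendsto_blinfun_compose:
  assumes "(f \<longlongrightarrow> A) F" "(g \<longlongrightarrow> B) F"
  shows "((\<lambda>x. f x o\<^sub>L g x) \<longlongrightarrow> A o\<^sub>L B) F"
  using bounded_bilinear.tendsto[OF bounded_bilinear_blinfun_compose assms] .

locale cogroup =
  fixes K :: "('v::euclidean_space \<Rightarrow> 'v) set"
  assumes cog: "compact_orth_group K"
begin

text \<open>The group as a set of bounded operators, so that limits, compactness and derivatives
  refer to the operator norm.\<close>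

definition G :: "('v \<Rightarrow>\<^sub>L 'v) set" where "G = {g. blinfun_apply g \<in> K}"

lemma K_bounded_linear: "k \<in> K \<Longrightarrow> bounded_linear k"
  using cog unfolding compact_orth_group_def
  using linear_conv_bounded_linear orthogonal_transformation_linear by blast

lemma Blinfun_G: "k \<in> K \<Longrightarrow> Blinfun k \<in> G" "k \<in> K \<Longrightarrow> blinfun_apply (Blinfun k) = k"
  by (auto simp: G_def bounded_linear_Blinfun_apply K_bounded_linear)

lemma G_orth: "g \<in> G \<Longrightarrow> orthogonal_transformation (blinfun_apply g)"
  using cog unfolding compact_orth_group_def G_def by blast

lemma G_norm [simp]: "g \<in> G \<Longrightarrow> norm (blinfun_apply g x) = norm x"
  using G_orth orthogonal_transformation_norm by blast

lemma G_inner [simp]: "g \<in> G \<Longrightarrow> blinfun_apply g x \<bullet> blinfun_apply g y = x \<bullet> y"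
  using G_orth orthogonal_transformation_def by blast

lemma G_id [simp]: "id_blinfun \<in> G"
proof -
  have "blinfun_apply (id_blinfun :: 'v \<Rightarrow>\<^sub>L 'v) = id" by (auto simp: id_def)
  then show ?thesis using cog by (simp add: compact_orth_group_def G_def)
qed

lemma G_comp [simp]: assumes "g \<in> G" "h \<in> G" shows "g o\<^sub>L h \<in> G"
proof -
  have "blinfun_apply (g o\<^sub>L h) = blinfun_apply g \<circ> blinfun_apply h" by auto
  then show ?thesis using cog assms by (simp add: compact_orth_group_def G_def)
qed

definition gi :: "('v \<Rightarrow>\<^sub>L 'v) \<Rightarrow> ('v \<Rightarrow>\<^sub>L 'v)" where "gi g = Blinfun (inv (blinfun_apply g))"

lemma inv_in_K: "g \<in> G \<Longrightarrow> inv (blinfun_apply g) \<in> K"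
  using cog by (simp add: compact_orth_group_def G_def)

lemma gi_G [simp]: "g \<in> G \<Longrightarrow> gi g \<in> G"
  unfolding gi_def by (rule Blinfun_G(1)[OF inv_in_K])

lemma gi_apply: "g \<in> G \<Longrightarrow> blinfun_apply (gi g) = inv (blinfun_apply g)"
  unfolding gi_def by (rule Blinfun_G(2)[OF inv_in_K])

lemma gi_left [simp]: "g \<in> G \<Longrightarrow> blinfun_apply (gi g) (blinfun_apply g x) = x"
  by (simp add: gi_apply G_orth orthogonal_transformation_inj)

lemma gi_right [simp]: "g \<in> G \<Longrightarrow> blinfun_apply g (blinfun_apply (gi g) x) = x"
  by (metis G_orth gi_apply orthogonal_transformation_surj surj_f_inv_f)

lemma gi_comp [simp]: "g \<in> G \<Longrightarrow> gi g o\<^sub>L g = id_blinfun" "g \<in> G \<Longrightarrow> g o\<^sub>L gi g = id_blinfun"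
  by (auto intro: blinfun_eqI)

lemma gi_inner: "g \<in> G \<Longrightarrow> blinfun_apply (gi g) x \<bullet> y = x \<bullet> blinfun_apply g y"
  by (metis G_inner gi_right)

lemma G_norm_le: "g \<in> G \<Longrightarrow> norm g \<le> 1"
  by (rule norm_blinfun_bound) auto

lemma G_comp_norm: assumes "g \<in> G" shows "norm (g o\<^sub>L A) = norm A"
proof (rule antisym)
  have 1: "norm (h o\<^sub>L B) \<le> norm B" if "h \<in> G" for h B
    using norm_blinfun_compose[of h B] G_norm_le[OF that]
    by (meson mult_left_le_one_le norm_ge_zero order_trans)
  show "norm (g o\<^sub>L A) \<le> norm A" by (rule 1[OF assms])
  have "A = gi g o\<^sub>L (g o\<^sub>L A)" using assms by (auto intro: blinfun_eqI)
  then show "norm A \<le> norm (g o\<^sub>L A)" using 1[OF gi_G[OF assms], of "g o\<^sub>L A"] by simp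
qed

lemma gi_norm: assumes "g \<in> G" shows "norm (gi g - id_blinfun) = norm (g - id_blinfun)"
proof -
  have "g o\<^sub>L (gi g - id_blinfun) = - (g - id_blinfun)" using assms by (simp add: blc_simps)
  then show ?thesis using G_comp_norm[OF assms, of "gi g - id_blinfun"] by (simp add: norm_minus_commute)
qed

text \<open>Left multiplication by a group element is an isometry; closeness of two elements thus
  becomes closeness of one element to the identity.\<close>

lemma gi_diff_norm: assumes "g \<in> G" "h \<in> G" shows "norm ((gi g o\<^sub>L h) - id_blinfun) = norm (h - g)"
proof -
  have "gi g o\<^sub>L (h - g) = (gi g o\<^sub>L h) - id_blinfun" using assms by (simp add: blc_simps)
  then show ?thesis using G_comp_norm[OF gi_G[OF assms(1)], of "h - g"] by simp
qed

text \<open>\<open>K\<close> is compact in the topology of pointwise convergence. A linear map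
  depends continuously on its finitely many matrix entries, so \<open>G\<close> is a continuous
  image of \<open>K\<close>.\<close>

lemma compact_G: "compact G"
proof -
  let ?T = "\<lambda>f::'v \<Rightarrow> 'v. blinfun_of_matrix (\<lambda>i j. f j \<bullet> i) :: 'v \<Rightarrow>\<^sub>L 'v"
  have eq: "?T k = Blinfun k" if "k \<in> K" for k
    using Blinfun_eq_matrix[OF K_bounded_linear[OF that]] by simp
  have "G = ?T ` K"
  proof
    show "G \<subseteq> ?T ` K"
      using eq by (auto simp: G_def blinfun_apply_inverse intro!: image_eqI)
    show "?T ` K \<subseteq> G" using eq Blinfun_G by auto
  qed
  moreover have "continuous_on K ?T"
    by (intro continuous_on_blinfun_of_matrix continuous_intros
        continuous_on_subset[OF continuous_on_product_coordinates]) auto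
  moreover have "compact K" using cog by (simp add: compact_orth_group_def)
  ultimately show ?thesis by (metis compact_continuous_image)
qed

lemma G_subseq:
  assumes "\<And>n::nat. g n \<in> G"
  obtains r h where "strict_mono (r :: nat \<Rightarrow> nat)" "h \<in> G" "(g \<circ> r) \<longlonglongrightarrow> h"
  using compact_G assms unfolding compact_def by metis

lemma bpow_G: "g \<in> G \<Longrightarrow> bpow g n \<in> G"
  by (induction n) auto

text \<open>Limits of secants at the identity, since no differentiable structure on the group is given.\<close>

definition L :: "('v \<Rightarrow>\<^sub>L 'v) set" where
  "L = {X. \<exists>g t. (\<forall>n::nat. g n \<in> G \<and> 0 < t n) \<and> t \<longlonglongrightarrow> (0::real) \<and>
            (\<lambda>n. (1 / t n) *\<^sub>R (g n - id_blinfun)) \<longlonglongrightarrow> X}"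

text \<open>The element h below plays the role of exp X; it is obtained as a limit of powers of
  elements of the group close to the identity, so no exponential series is needed.\<close>

lemma L_exp:
  assumes "X \<in> L"
  shows "\<exists>h\<in>G. (\<forall>v. blinfun_apply X v = 0 \<longrightarrow> blinfun_apply h v = v)
      \<and> (\<forall>S. subspace S \<and> (\<forall>v\<in>S. blinfun_apply X v \<in> S) \<longrightarrow> (\<forall>v\<in>S. blinfun_apply h v \<in> S))
      \<and> (norm X \<le> 1 \<longrightarrow> norm (h - id_blinfun - X) \<le> (norm X)\<^sup>2)"
proof -
  obtain g t where gt: "\<And>n::nat. g n \<in> G" "\<And>n. 0 < t n" "t \<longlonglongrightarrow> (0::real)"
     "(\<lambda>n. (1 / t n) *\<^sub>R (g n - id_blinfun)) \<longlonglongrightarrow> X"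
    using assms unfolding L_def by blast
  \<comment> \<open>About 1 / t steps of length t reach time 1, so \<open>real (m n) * t n\<close>
    tends to 1.\<close>
  define m where "m n = nat \<lfloor>1 / t n\<rfloor>" for n
  have m: "real (m n) * t n \<le> 1" "1 - t n \<le> real (m n) * t n" for n
  proof -
    have *: "real (m n) = of_int \<lfloor>1 / t n\<rfloor>" unfolding m_def using gt(2)[of n] by simp
    have "of_int \<lfloor>1 / t n\<rfloor> \<le> 1 / t n" "1 / t n \<le> of_int \<lfloor>1 / t n\<rfloor> + 1" by linarith+
    then have "of_int \<lfloor>1 / t n\<rfloor> * t n \<le> (1 / t n) * t n" "(1 / t n) * t n \<le> (of_int \<lfloor>1 / t n\<rfloor> + 1) * t n"
      using gt(2)[of n] by (intro mult_right_mono; simp)+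
    then show "real (m n) * t n \<le> 1" "1 - t n \<le> real (m n) * t n"
      using gt(2)[of n] unfolding * by (auto simp: algebra_simps)
  qed
  have mt: "(\<lambda>n. real (m n) * t n) \<longlonglongrightarrow> 1"
  proof (rule tendsto_sandwich[of "\<lambda>n. 1 - t n" _ _ "\<lambda>n. 1"])
    show "(\<lambda>n. 1 - t n) \<longlonglongrightarrow> 1" using tendsto_diff[OF tendsto_const gt(3), of 1] by simp
  qed (use m in auto)
  \<comment> \<open>\<open>B n\<close> stays in the group; \<open>C n\<close> is the Euler product
    for exp X and visibly respects kernel vectors and invariant subspaces of X. Their difference
    tends to 0, so a limit of a subsequence of \<open>B\<close> has both kinds of
    properties.\<close>
  define B where "B n = bpow (g n) (m n)" for n
  define C where "C n = bpow (id_blinfun + t n *\<^sub>R X) (m n)" for n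
  have BC: "norm (B n - C n) \<le> norm ((1 / t n) *\<^sub>R (g n - id_blinfun) - X) * exp (norm X)" for n
  proof -
    let ?M = "1 + t n * norm X"
    have A: "norm (id_blinfun + t n *\<^sub>R X) \<le> ?M"
      using norm_triangle_ineq[of id_blinfun "t n *\<^sub>R X"] norm_id_blinfun_le[where 'v='v] gt(2)[of n] by simp
    have M1: "1 \<le> ?M" using gt(2)[of n] by simp
    have "norm (B n - C n) \<le> real (m n) * norm (g n - (id_blinfun + t n *\<^sub>R X)) * ?M ^ m n"
      unfolding B_def C_def by (rule norm_bpow_diff_le[OF G_norm_le[OF gt(1)] A M1])
    also have "g n - (id_blinfun + t n *\<^sub>R X) = t n *\<^sub>R ((1 / t n) *\<^sub>R (g n - id_blinfun) - X)"
      using gt(2)[of n] by (simp add: algebra_simps)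
    also have "real (m n) * norm (\<dots>) * ?M ^ m n
        = (real (m n) * t n) * norm ((1 / t n) *\<^sub>R (g n - id_blinfun) - X) * ?M ^ m n"
      using gt(2)[of n] by simp
    also have "\<dots> \<le> 1 * norm ((1 / t n) *\<^sub>R (g n - id_blinfun) - X) * exp (norm X)"
    proof (intro mult_mono)
      have "?M ^ m n \<le> exp (t n * norm X) ^ m n"
        using gt(2)[of n] by (intro power_mono exp_ge_add_one_self) simp
      also have "\<dots> = exp ((real (m n) * t n) * norm X)"
        by (simp add: exp_of_nat_mult[symmetric] mult.assoc)
      also have "\<dots> \<le> exp (norm X)" using m(1)[of n] by (simp add: mult_left_le_one_le gt(2) less_imp_le)
      finally show "?M ^ m n \<le> exp (norm X)" .
    qed (use m gt(2)[of n] in auto)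
    finally show ?thesis by simp
  qed
  have BC0: "(\<lambda>n. B n - C n) \<longlonglongrightarrow> 0"
  proof (rule Lim_null_comparison[of _ "\<lambda>n. norm ((1 / t n) *\<^sub>R (g n - id_blinfun) - X) * exp (norm X)"])
    show "(\<lambda>n. norm ((1 / t n) *\<^sub>R (g n - id_blinfun) - X) * exp (norm X)) \<longlonglongrightarrow> 0"
      using tendsto_mult_right[OF tendsto_norm[OF LIM_zero[OF gt(4)]], of "exp (norm X)"] by simp
  qed (use BC in auto)
  have "B n \<in> G" for n unfolding B_def by (rule bpow_G[OF gt(1)])
  then obtain r h where r: "strict_mono (r :: nat \<Rightarrow> nat)" "h \<in> G" "(B \<circ> r) \<longlonglongrightarrow> h"
    using G_subseq by blast
  have Ch: "(\<lambda>n. C (r n)) \<longlonglongrightarrow> h"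
    using tendsto_diff[OF r(3) LIMSEQ_subseq_LIMSEQ[OF BC0 r(1)]] by (simp add: o_def)
  have Chv: "(\<lambda>n. C (r n) v) \<longlonglongrightarrow> h v" for v
    using Ch by (intro tendsto_intros)
  have "h v = v" if "X v = 0" for v
  proof -
    have "bpow (id_blinfun + s *\<^sub>R X) n v = v" for s n
      by (induction n) (auto simp: that bl_simps)
    then have "(\<lambda>n. v) \<longlonglongrightarrow> h v" using Chv[of v] by (simp add: C_def)
    then show ?thesis using LIMSEQ_unique tendsto_const by blast
  qed
  moreover have "h v \<in> S" if S: "subspace S" "\<forall>v\<in>S. X v \<in> S" "v \<in> S" for S v
  proof -
    have "bpow (id_blinfun + s *\<^sub>R X) n v \<in> S" for s n
      by (induction n) (auto simp: S bl_simps subspace_add subspace_scale)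
    then show ?thesis
      using closed_sequentially[OF closed_subspace[OF S(1)] _ Chv[of v]] by (simp add: C_def)
  qed
  moreover have "norm (h - id_blinfun - X) \<le> (norm X)\<^sup>2" if X1: "norm X \<le> 1"
  proof -
    have le: "norm (C n - id_blinfun - (real (m n) * t n) *\<^sub>R X) \<le> (norm X)\<^sup>2" for n
    proof -
      have tp: "0 \<le> t n" using gt(2)[of n] by simp
      have y: "real (m n) * (t n * norm X) \<le> norm X"
        using m(1)[of n] tp by (simp add: mult.assoc[symmetric] mult_left_le_one_le)
      have y0: "0 \<le> real (m n) * (t n * norm X)" using tp by simp
      have "norm (C n - id_blinfun - (real (m n) * t n) *\<^sub>R X)
          \<le> (1 + norm (t n *\<^sub>R X)) ^ m n - 1 - real (m n) * norm (t n *\<^sub>R X)"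
        using norm_bpow_one_plus_le[of "t n *\<^sub>R X" "m n"] by (simp add: C_def)
      also have "\<dots> \<le> exp (real (m n) * (t n * norm X)) - 1 - real (m n) * (t n * norm X)"
      proof -
        have "(1 + t n * norm X) ^ m n \<le> exp (t n * norm X) ^ m n"
          using tp by (intro power_mono exp_ge_add_one_self) simp
        then show ?thesis using tp by (simp add: exp_of_nat_mult[symmetric])
      qed
      also have "\<dots> \<le> (real (m n) * (t n * norm X))\<^sup>2"
        using exp_bound[OF y0] y X1 by simp
      also have "\<dots> \<le> (norm X)\<^sup>2" using y y0 by (intro power_mono)
      finally show ?thesis .
    qed
    have "(\<lambda>n. norm (C (r n) - id_blinfun - (real (m (r n)) * t (r n)) *\<^sub>R X))
       \<longlonglongrightarrow> norm (h - id_blinfun - 1 *\<^sub>R X)"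
      using Ch LIMSEQ_subseq_LIMSEQ[OF mt r(1)]
      by (intro tendsto_intros) (simp_all add: o_def)
    then show ?thesis using le by (intro LIMSEQ_le_const2[where a="(norm X)\<^sup>2"]) auto
  qed
  ultimately show ?thesis using r(2) by blast
qed

text \<open>A chosen substitute for exp, with just the four properties of \<open>L_exp\<close>.
  Nothing relates the values at different multiples of X, so this is no one-parameter group; the
  quadratic error bound alone provides a curve with velocity X at 0.\<close>

definition ex :: "('v \<Rightarrow>\<^sub>L 'v) \<Rightarrow> ('v \<Rightarrow>\<^sub>L 'v)" where
  "ex X = (SOME h. h \<in> G \<and> (\<forall>v. blinfun_apply X v = 0 \<longrightarrow> blinfun_apply h v = v)
      \<and> (\<forall>S. subspace S \<and> (\<forall>v\<in>S. blinfun_apply X v \<in> S) \<longrightarrow> (\<forall>v\<in>S. blinfun_apply h v \<in> S))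
      \<and> (norm X \<le> 1 \<longrightarrow> norm (h - id_blinfun - X) \<le> (norm X)\<^sup>2))"

lemma
  assumes "X \<in> L"
  shows ex_G: "ex X \<in> G"
    and ex_fix: "blinfun_apply X v = 0 \<Longrightarrow> blinfun_apply (ex X) v = v"
    and ex_subspace: "subspace S \<Longrightarrow> (\<And>v. v \<in> S \<Longrightarrow> blinfun_apply X v \<in> S) \<Longrightarrow> v \<in> S \<Longrightarrow> blinfun_apply (ex X) v \<in> S"
    and ex_approx: "norm X \<le> 1 \<Longrightarrow> norm (ex X - id_blinfun - X) \<le> (norm X)\<^sup>2"
proof -
  have "ex X \<in> G \<and> (\<forall>v. blinfun_apply X v = 0 \<longrightarrow> blinfun_apply (ex X) v = v)
      \<and> (\<forall>S. subspace S \<and> (\<forall>v\<in>S. blinfun_apply X v \<in> S) \<longrightarrow> (\<forall>v\<in>S. blinfun_apply (ex X) v \<in> S))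
      \<and> (norm X \<le> 1 \<longrightarrow> norm (ex X - id_blinfun - X) \<le> (norm X)\<^sup>2)"
    unfolding ex_def by (rule someI_ex) (use L_exp[OF assms] in blast)
  then show "ex X \<in> G" "blinfun_apply X v = 0 \<Longrightarrow> blinfun_apply (ex X) v = v"
    "subspace S \<Longrightarrow> (\<And>v. v \<in> S \<Longrightarrow> blinfun_apply X v \<in> S) \<Longrightarrow> v \<in> S \<Longrightarrow> blinfun_apply (ex X) v \<in> S"
    "norm X \<le> 1 \<Longrightarrow> norm (ex X - id_blinfun - X) \<le> (norm X)\<^sup>2"
    by blast+
qed

lemma LI:
  assumes "\<And>n::nat. g n \<in> G" "\<And>n. 0 < t n" "t \<longlonglongrightarrow> (0::real)"
     "(\<lambda>n. (1 / t n) *\<^sub>R (g n - id_blinfun)) \<longlonglongrightarrow> X"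
  shows "X \<in> L"
  using assms unfolding L_def by blast

lemma L_pos_scale: assumes "X \<in> L" "0 < c" shows "c *\<^sub>R X \<in> L"
proof -
  obtain g t where gt: "\<And>n::nat. g n \<in> G" "\<And>n. 0 < t n" "t \<longlonglongrightarrow> (0::real)"
     "(\<lambda>n. (1 / t n) *\<^sub>R (g n - id_blinfun)) \<longlonglongrightarrow> X"
    using assms unfolding L_def by blast
  show ?thesis
  proof (rule LI[of g "\<lambda>n. t n / c"])
    show "(\<lambda>n. t n / c) \<longlonglongrightarrow> 0" using tendsto_divide[OF gt(3) tendsto_const, of c] assms by simp
    show "(\<lambda>n. (1 / (t n / c)) *\<^sub>R (g n - id_blinfun)) \<longlonglongrightarrow> c *\<^sub>R X"
      using tendsto_scaleR[OF tendsto_const gt(4), of c] by (simp add: mult.commute)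
  qed (use gt assms in auto)
qed

lemma L_seq_tendsto_id:
  assumes "t \<longlonglongrightarrow> (0::real)" "\<And>n. 0 < t n" "(\<lambda>n. (1 / t n) *\<^sub>R (g n - id_blinfun)) \<longlonglongrightarrow> X"
  shows "g \<longlonglongrightarrow> id_blinfun"
proof -
  have "(\<lambda>n. t n *\<^sub>R ((1 / t n) *\<^sub>R (g n - id_blinfun)) + id_blinfun) \<longlonglongrightarrow> 0 *\<^sub>R X + id_blinfun"
    by (intro tendsto_intros assms)
  moreover have "t n *\<^sub>R ((1 / t n) *\<^sub>R (g n - id_blinfun)) + id_blinfun = g n" for n
    using assms(2)[of n] by simp
  ultimately show ?thesis by simp
qed

lemma L_minus: assumes "X \<in> L" shows "- X \<in> L"
proof -
  obtain g t where gt: "\<And>n::nat. g n \<in> G" "\<And>n. 0 < t n" "t \<longlonglongrightarrow> (0::real)"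
     "(\<lambda>n. (1 / t n) *\<^sub>R (g n - id_blinfun)) \<longlonglongrightarrow> X"
    using assms unfolding L_def by blast
  have g1: "g \<longlonglongrightarrow> id_blinfun" by (rule L_seq_tendsto_id[OF gt(3,2,4)])
  have "(\<lambda>n. norm (gi (g n) - id_blinfun)) \<longlonglongrightarrow> 0"
    using g1 gi_norm[OF gt(1)] by (simp add: LIM_zero tendsto_norm_zero)
  then have "(\<lambda>n. gi (g n)) \<longlonglongrightarrow> id_blinfun" by (metis LIM_zero_cancel tendsto_norm_zero_cancel)
  then have "(\<lambda>n. - (gi (g n) o\<^sub>L ((1 / t n) *\<^sub>R (g n - id_blinfun)))) \<longlonglongrightarrow> - (id_blinfun o\<^sub>L X)"
    by (intro tendsto_minus tendsto_blinfun_compose gt)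
  then have "(\<lambda>n. (1 / t n) *\<^sub>R (gi (g n) - id_blinfun)) \<longlonglongrightarrow> - X"
    by (simp add: blc_simps gt(1) scaleR_right_diff_distrib)
  then show ?thesis by (intro LI[OF _ gt(2,3), of "\<lambda>n. gi (g n)"]) (use gt(1) in auto)
qed

lemma L_zero: "0 \<in> L"
proof (rule LI[of "\<lambda>_. id_blinfun" "\<lambda>n. 1 / real (Suc n)"])
  show "(\<lambda>n. 1 / real (Suc n)) \<longlonglongrightarrow> 0" using LIMSEQ_Suc[OF lim_1_over_n] by simp
qed auto

lemma L_scale: assumes "X \<in> L" shows "c *\<^sub>R X \<in> L"
proof (cases "c = 0")
  case False
  show ?thesis
  proof (cases "0 < c")
    case False
    with \<open>c \<noteq> 0\<close> have "(- c) *\<^sub>R X \<in> L" using L_pos_scale[OF assms, of "- c"] by simp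
    from L_minus[OF this] show ?thesis by simp
  qed (rule L_pos_scale[OF assms])
qed (simp add: L_zero)

lemma ex_deriv: assumes "X \<in> L"
  shows "((\<lambda>s. ex (s *\<^sub>R X)) has_vector_derivative X) (at 0)"
proof -
  have ex0: "ex 0 = id_blinfun"
    using ex_approx[OF L_zero] by simp
  have "((\<lambda>s. norm (ex (s *\<^sub>R X) - id_blinfun - s *\<^sub>R X) / norm s) \<longlongrightarrow> 0) (at 0)"
  proof (rule Lim_null_comparison[of _ "\<lambda>s. \<bar>s\<bar> * (norm X)\<^sup>2"])
    show "((\<lambda>s. \<bar>s\<bar> * (norm X)\<^sup>2) \<longlongrightarrow> 0) (at 0)"
      by (rule tendsto_eq_intros | simp)+
    have "norm (norm (ex (s *\<^sub>R X) - id_blinfun - s *\<^sub>R X) / norm s) \<le> \<bar>s\<bar> * (norm X)\<^sup>2"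
      if "s \<noteq> 0" "dist s 0 < 1 / (1 + norm X)" for s
    proof -
      have "\<bar>s\<bar> * norm X \<le> 1" using that(2)
        by (smt (verit, ccfv_SIG) dist_0_norm dist_commute divide_less_eq mult.commute mult_left_mono norm_ge_zero real_norm_def
             less_divide_eq)
      then have "norm (ex (s *\<^sub>R X) - id_blinfun - s *\<^sub>R X) \<le> (norm (s *\<^sub>R X))\<^sup>2"
        using ex_approx[OF L_scale[OF assms], of s] by simp
      then show ?thesis using that(1)
        by (simp add: divide_simps power2_eq_square mult_ac)
    qed
    then show "\<forall>\<^sub>F s in at 0. norm (norm (ex (s *\<^sub>R X) - id_blinfun - s *\<^sub>R X) / norm s) \<le> \<bar>s\<bar> * (norm X)\<^sup>2"
      unfolding eventually_at by (intro exI[of _ "1 / (1 + norm X)"]) (auto simp: add_pos_nonneg)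
  qed
  then show ?thesis
    unfolding has_vector_derivative_def has_derivative_at
    by (auto simp: ex0 bounded_linear_scaleR_left tendsto_norm_zero_iff)
qed

lemma ex_0 [simp]: "ex 0 = id_blinfun"
  using ex_approx[OF L_zero] by simp

lemma vector_derivative_quotient:
  fixes h :: "real \<Rightarrow> 'b::real_normed_vector"
  assumes "(h has_vector_derivative X) (at 0)"
  shows "((\<lambda>s. (1 / s) *\<^sub>R (h s - h 0)) \<longlongrightarrow> X) (at 0)"
    and "(\<lambda>n. real (Suc n) *\<^sub>R (h (1 / real (Suc n)) - h 0)) \<longlonglongrightarrow> X"
proof -
  have "((\<lambda>s. norm (h s - h 0 - s *\<^sub>R X) / norm s) \<longlongrightarrow> 0) (at 0)"
    using assms unfolding has_vector_derivative_def has_derivative_at by simp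
  moreover have "\<forall>\<^sub>F s in at 0. norm (h s - h 0 - s *\<^sub>R X) / norm s = norm ((1 / s) *\<^sub>R (h s - h 0) - X)"
  proof (rule eventually_mono)
    show "\<forall>\<^sub>F s in at (0::real). s \<noteq> 0" by (simp add: eventually_at_filter)
    fix s :: real assume s: "s \<noteq> 0"
    then have "(1 / s) *\<^sub>R (h s - h 0) - X = (1 / s) *\<^sub>R (h s - h 0 - s *\<^sub>R X)"
      by (simp add: scaleR_right_diff_distrib)
    then show "norm (h s - h 0 - s *\<^sub>R X) / norm s = norm ((1 / s) *\<^sub>R (h s - h 0) - X)"
      by simp
  qed
  ultimately have "((\<lambda>s. norm ((1 / s) *\<^sub>R (h s - h 0) - X)) \<longlongrightarrow> 0) (at 0)"
    by (rule Lim_transform_eventually)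
  then show *: "((\<lambda>s. (1 / s) *\<^sub>R (h s - h 0)) \<longlongrightarrow> X) (at 0)"
    by (metis LIM_zero_cancel tendsto_norm_zero_cancel)
  have "filterlim (\<lambda>n. 1 / real (Suc n)) (at 0) sequentially"
    using LIMSEQ_Suc[OF lim_1_over_n] by (auto simp: filterlim_at)
  from filterlim_compose[OF * this]
  show "(\<lambda>n. real (Suc n) *\<^sub>R (h (1 / real (Suc n)) - h 0)) \<longlonglongrightarrow> X" by simp
qed

text \<open>Differentiability at 0 alone is asked, so products and conjugates of the curves given by
  \<open>ex\<close> qualify, although these may be discontinuous elsewhere.\<close>

lemma L_of_curve:
  assumes "\<And>s::real. h s \<in> G" "h 0 = id_blinfun" "(h has_vector_derivative X) (at 0)"
  shows "X \<in> L"
proof (rule LI[of "\<lambda>n. h (1 / real (Suc n))" "\<lambda>n. 1 / real (Suc n)"])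
  show "(\<lambda>n. 1 / real (Suc n)) \<longlonglongrightarrow> 0" using LIMSEQ_Suc[OF lim_1_over_n] by simp
  show "(\<lambda>n. (1 / (1 / real (Suc n))) *\<^sub>R (h (1 / real (Suc n)) - id_blinfun)) \<longlonglongrightarrow> X"
    using vector_derivative_quotient(2)[OF assms(3)] assms(2) by simp
qed (use assms in auto)

lemma ex_comp_deriv:
  assumes "X \<in> L" "Y \<in> L"
  shows "((\<lambda>s. ex (s *\<^sub>R X) o\<^sub>L ex (s *\<^sub>R Y)) has_vector_derivative (X + Y)) (at 0)"
  using bounded_bilinear.has_vector_derivative[OF bounded_bilinear_blinfun_compose
      ex_deriv[OF assms(1)] ex_deriv[OF assms(2)]]
  by (simp add: add.commute)

lemma L_add: assumes "X \<in> L" "Y \<in> L" shows "X + Y \<in> L"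
  by (rule L_of_curve[OF _ _ ex_comp_deriv[OF assms]]) (auto intro!: G_comp ex_G L_scale assms)

lemma L_subspace: "subspace L"
  by (auto simp: subspace_def L_zero L_add L_scale)

lemma L_diff: "X \<in> L \<Longrightarrow> Y \<in> L \<Longrightarrow> X - Y \<in> L"
  using L_subspace subspace_diff by blast

lemma L_sum: "(\<And>i. i \<in> I \<Longrightarrow> f i \<in> L) \<Longrightarrow> sum f I \<in> L"
  using L_subspace subspace_sum by blast

lemma L_Ad: assumes "g \<in> G" "X \<in> L" shows "(g o\<^sub>L X) o\<^sub>L gi g \<in> L"
proof (rule L_of_curve)
  show "((\<lambda>s. (g o\<^sub>L ex (s *\<^sub>R X)) o\<^sub>L gi g) has_vector_derivative ((g o\<^sub>L X) o\<^sub>L gi g)) (at 0)"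
    by (intro bounded_linear.has_vector_derivative[OF bounded_bilinear.bounded_linear_left[OF bounded_bilinear_blinfun_compose]]
       bounded_linear.has_vector_derivative[OF bounded_bilinear.bounded_linear_right[OF bounded_bilinear_blinfun_compose]]
       ex_deriv assms)
qed (use assms in \<open>auto intro!: G_comp ex_G L_scale\<close>)

lemma apply_deriv:
  fixes h :: "real \<Rightarrow> 'a::real_normed_vector \<Rightarrow>\<^sub>L 'b::real_normed_vector"
  assumes "(h has_vector_derivative X) F"
  shows "((\<lambda>s. blinfun_apply (h s) v) has_vector_derivative blinfun_apply X v) F"
  by (rule bounded_linear.has_vector_derivative[OF blinfun.bounded_linear_left assms])

lemma L_skew: assumes "X \<in> L" shows "blinfun_apply X v \<bullet> w = - (v \<bullet> blinfun_apply X w)"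
proof -
  have "((\<lambda>s. blinfun_apply (ex (s *\<^sub>R X)) v \<bullet> blinfun_apply (ex (s *\<^sub>R X)) w)
     has_vector_derivative (v \<bullet> X w + X v \<bullet> w)) (at 0)"
    using bounded_bilinear.has_vector_derivative[OF bounded_bilinear_inner
      apply_deriv[OF ex_deriv[OF assms], of v] apply_deriv[OF ex_deriv[OF assms], of w]] by simp
  moreover have "(\<lambda>s. blinfun_apply (ex (s *\<^sub>R X)) v \<bullet> blinfun_apply (ex (s *\<^sub>R X)) w) = (\<lambda>s. v \<bullet> w)"
    using ex_G[OF L_scale[OF assms]] by auto
  ultimately have "((\<lambda>s. v \<bullet> w) has_vector_derivative (v \<bullet> X w + X v \<bullet> w)) (at 0)" by simp
  then have "v \<bullet> X w + X v \<bullet> w = 0"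
    using vector_derivative_unique_at has_vector_derivative_const by blast
  then show ?thesis by simp
qed

text \<open>Diagonal choice: for each n, one secant close to \<open>X n\<close>, with parameter
  below 1 / (n + 1).\<close>

lemma L_closed: assumes "\<And>n::nat. X n \<in> L" "X \<longlonglongrightarrow> Y" shows "Y \<in> L"
proof -
  have "\<exists>g t. g \<in> G \<and> 0 < t \<and> t < 1 / real (Suc n) \<and> norm ((1 / t) *\<^sub>R (g - id_blinfun) - X n) < 1 / real (Suc n)" for n
  proof -
    obtain g t where gt: "\<And>n::nat. g n \<in> G" "\<And>n. 0 < t n" "t \<longlonglongrightarrow> (0::real)"
     "(\<lambda>n. (1 / t n) *\<^sub>R (g n - id_blinfun)) \<longlonglongrightarrow> X n"
      using assms(1)[of n] unfolding L_def by blast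
    have "\<forall>\<^sub>F j in sequentially. t j < 1 / real (Suc n)"
      using gt(3) by (rule order_tendstoD(2)) simp
    moreover have "\<forall>\<^sub>F j in sequentially. dist ((1 / t j) *\<^sub>R (g j - id_blinfun)) (X n) < 1 / real (Suc n)"
      using gt(4) by (rule tendstoD) simp
    ultimately have *: "\<forall>\<^sub>F j in sequentially. t j < 1 / real (Suc n) \<and> dist ((1 / t j) *\<^sub>R (g j - id_blinfun)) (X n) < 1 / real (Suc n)"
      by eventually_elim simp
    then obtain j where "t j < 1 / real (Suc n)" "dist ((1 / t j) *\<^sub>R (g j - id_blinfun)) (X n) < 1 / real (Suc n)"
      using eventually_happens[OF *] by auto
    then show ?thesis using gt(1,2)[of j] by (auto simp: dist_norm)
  qed
  then have "\<forall>n. \<exists>g t. g \<in> G \<and> 0 < t \<and> t < 1 / real (Suc n) \<and> norm ((1 / t) *\<^sub>R (g - id_blinfun) - X n) < 1 / real (Suc n)"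
    by (rule allI)
  from choice[OF this] obtain g where
    "\<forall>n. \<exists>t. g n \<in> G \<and> 0 < t \<and> t < 1 / real (Suc n) \<and> norm ((1 / t) *\<^sub>R (g n - id_blinfun) - X n) < 1 / real (Suc n)" ..
  from choice[OF this] obtain t where
    "\<forall>n. g n \<in> G \<and> 0 < t n \<and> t n < 1 / real (Suc n) \<and> norm ((1 / t n) *\<^sub>R (g n - id_blinfun) - X n) < 1 / real (Suc n)" ..
  then have gt: "\<And>n. g n \<in> G" "\<And>n. 0 < t n" "\<And>n. t n < 1 / real (Suc n)"
     "\<And>n. norm ((1 / t n) *\<^sub>R (g n - id_blinfun) - X n) < 1 / real (Suc n)" by (simp_all only:)
  have l: "(\<lambda>n. 1 / real (Suc n)) \<longlonglongrightarrow> 0" using LIMSEQ_Suc[OF lim_1_over_n] by simp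
  have t0: "t \<longlonglongrightarrow> 0"
    by (rule tendsto_sandwich[OF _ _ tendsto_const l]) (use gt(2,3) in \<open>simp_all add: less_imp_le\<close>)
  have "(\<lambda>n. (1 / t n) *\<^sub>R (g n - id_blinfun) - X n) \<longlonglongrightarrow> 0"
    by (rule Lim_null_comparison[OF _ l]) (use gt(4) in \<open>simp add: less_imp_le\<close>)
  from tendsto_add[OF this assms(2)]
  have "(\<lambda>n. (1 / t n) *\<^sub>R (g n - id_blinfun)) \<longlonglongrightarrow> Y" by simp
  with gt(1,2) t0 show ?thesis by (rule LI)
qed

text \<open>The bracket is the derivative at 0 of the conjugates of \<open>Y\<close> by
  \<open>h = ex (s X)\<close>. The difference quotients of the conjugates lie in \<open>L\<close>,
  which is closed. They differ from those of \<open>h Y - Y h\<close> by a right factor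
  \<open>gi h\<close>, which tends to the identity.\<close>

lemma L_bracket: assumes "X \<in> L" "Y \<in> L" shows "(X o\<^sub>L Y) - (Y o\<^sub>L X) \<in> L"
proof -
  let ?h = "\<lambda>s. ex (s *\<^sub>R X)"
  let ?k = "\<lambda>s. (?h s o\<^sub>L Y) - (Y o\<^sub>L ?h s)"
  have hG: "?h s \<in> G" for s using ex_G[OF L_scale[OF assms(1)]] .
  have "(?k has_vector_derivative ((X o\<^sub>L Y) - (Y o\<^sub>L X))) (at 0)"
    by (intro has_vector_derivative_diff
       bounded_linear.has_vector_derivative[OF bounded_bilinear.bounded_linear_left[OF bounded_bilinear_blinfun_compose]]
       bounded_linear.has_vector_derivative[OF bounded_bilinear.bounded_linear_right[OF bounded_bilinear_blinfun_compose]]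
       ex_deriv assms)
  from vector_derivative_quotient(2)[OF this]
  have 1: "(\<lambda>n. real (Suc n) *\<^sub>R ?k (1 / real (Suc n))) \<longlonglongrightarrow> (X o\<^sub>L Y) - (Y o\<^sub>L X)" by simp
  have "((\<lambda>s. ?h s) \<longlongrightarrow> ?h 0) (at 0)"
    using has_vector_derivative_continuous[OF ex_deriv[OF assms(1)]] by (simp add: continuous_within)
  then have "((\<lambda>s. norm (?h s - id_blinfun)) \<longlongrightarrow> 0) (at 0)"
    by (simp add: LIM_zero tendsto_norm_zero)
  then have "((\<lambda>s. norm (gi (?h s) - id_blinfun)) \<longlongrightarrow> 0) (at 0)" by (simp add: gi_norm[OF hG])
  then have "((\<lambda>s. gi (?h s)) \<longlongrightarrow> id_blinfun) (at 0)" by (metis LIM_zero_cancel tendsto_norm_zero_cancel)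
  moreover have "filterlim (\<lambda>n. 1 / real (Suc n)) (at 0) sequentially"
    using LIMSEQ_Suc[OF lim_1_over_n] by (auto simp: filterlim_at)
  ultimately have "(\<lambda>n. gi (?h (1 / real (Suc n)))) \<longlonglongrightarrow> id_blinfun" by (rule filterlim_compose)
  from tendsto_blinfun_compose[OF 1 this]
  have 2: "(\<lambda>n. (real (Suc n) *\<^sub>R ?k (1 / real (Suc n))) o\<^sub>L gi (?h (1 / real (Suc n)))) \<longlonglongrightarrow> (X o\<^sub>L Y) - (Y o\<^sub>L X)"
    by simp
  show ?thesis
  proof (rule L_closed[OF _ 2])
    fix n
    have "?k s o\<^sub>L gi (?h s) = ((?h s o\<^sub>L Y) o\<^sub>L gi (?h s)) - Y" for s
      using hG[of s] by (auto intro!: blinfun_eqI simp: bl_simps)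
    then have "?k s o\<^sub>L gi (?h s) \<in> L" for s
      using L_diff[OF L_Ad[OF hG assms(2)] assms(2), of s] by simp
    from L_scale[OF this]
    show "(real (Suc n) *\<^sub>R ?k (1 / real (Suc n))) o\<^sub>L gi (?h (1 / real (Suc n))) \<in> L"
      unfolding bounded_bilinear.scaleR_left[OF bounded_bilinear_blinfun_compose] .
  qed
qed

text \<open>Uniform tangency of the group to \<open>L\<close> at the identity. A sequence violating
  it would, after normalising \<open>g - id_blinfun\<close> to length one, have a limit point, which
  is an element of \<open>L\<close> by definition.\<close>

lemma L_tangent:
  assumes "0 < \<eta>"
  shows "\<exists>\<delta>>0. \<forall>g\<in>G. norm (g - id_blinfun) < \<delta> \<longrightarrow>
     (\<exists>Y\<in>L. norm (g - id_blinfun - Y) \<le> \<eta> * norm (g - id_blinfun))"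
proof (rule ccontr)
  assume neg: "\<not> ?thesis"
  have "\<exists>g\<in>G. norm (g - id_blinfun) < 1 / real (Suc n) \<and>
     (\<forall>Y\<in>L. \<eta> * norm (g - id_blinfun) < norm (g - id_blinfun - Y))" for n
  proof -
    have "0 < 1 / real (Suc n)" by simp
    then show ?thesis using neg by (meson not_le)
  qed
  then obtain g where g: "\<And>n. g n \<in> G" "\<And>n. norm (g n - id_blinfun) < 1 / real (Suc n)"
    "\<And>n Y. Y \<in> L \<Longrightarrow> \<eta> * norm (g n - id_blinfun) < norm (g n - id_blinfun - Y)" by metis
  let ?t = "\<lambda>n. norm (g n - id_blinfun)"
  have tpos: "0 < ?t n" for n using g(3)[OF L_zero, of n]
    by (cases "?t n = 0") auto
  have l: "(\<lambda>n. 1 / real (Suc n)) \<longlonglongrightarrow> 0" using LIMSEQ_Suc[OF lim_1_over_n] by simp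
  have t0: "?t \<longlonglongrightarrow> 0"
    by (rule tendsto_sandwich[OF _ _ tendsto_const l]) (use g(2) in \<open>simp_all add: less_imp_le\<close>)
  define A where "A n = (1 / ?t n) *\<^sub>R (g n - id_blinfun)" for n
  have "bounded (range A)" unfolding bounded_iff A_def using tpos by (intro exI[of _ 1]) auto
  then obtain B r where r: "strict_mono (r::nat\<Rightarrow>nat)" "(A \<circ> r) \<longlonglongrightarrow> B"
    using bounded_imp_convergent_subsequence by blast
  have BL: "B \<in> L"
  proof (rule LI[of "\<lambda>n. g (r n)" "\<lambda>n. ?t (r n)"])
    show "(\<lambda>n. ?t (r n)) \<longlonglongrightarrow> 0" using LIMSEQ_subseq_LIMSEQ[OF t0 r(1)] by (simp only: o_def)
    show "(\<lambda>n. (1 / ?t (r n)) *\<^sub>R (g (r n) - id_blinfun)) \<longlonglongrightarrow> B"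
      using r(2) by (simp only: o_def A_def)
  qed (rule g(1) tpos)+
  obtain n where n: "norm (A (r n) - B) < \<eta>"
    using tendstoD[OF r(2) assms] by (auto simp: eventually_sequentially dist_norm)
  have "norm (g (r n) - id_blinfun - ?t (r n) *\<^sub>R B) = ?t (r n) * norm (A (r n) - B)"
  proof -
    have "g (r n) - id_blinfun - ?t (r n) *\<^sub>R B = ?t (r n) *\<^sub>R (A (r n) - B)"
      using tpos[of "r n"] by (simp add: A_def scaleR_right_diff_distrib)
    then show ?thesis by simp
  qed
  also have "\<dots> \<le> \<eta> * ?t (r n)" using n tpos[of "r n"] by (simp add: mult.commute)
  finally show False using g(3)[OF L_scale[OF BL], of "r n" "?t (r n)"] by simp
qed

lemma L_orbit_tangent: assumes "X \<in> L" shows "blinfun_apply X x \<in> orbit_tangent K x"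
  unfolding orbit_tangent_def
proof (intro CollectI exI[of _ "\<lambda>s. blinfun_apply (ex (s *\<^sub>R X)) x"] conjI allI)
  show "blinfun_apply (ex (t *\<^sub>R X)) x \<in> orbit K x" for t
    using ex_G[OF L_scale[OF assms]] by (auto simp: orbit_def G_def)
  show "((\<lambda>s. blinfun_apply (ex (s *\<^sub>R X)) x) has_vector_derivative blinfun_apply X x) (at 0)"
    by (rule apply_deriv[OF ex_deriv[OF assms]])
qed simp

text \<open>The tangent space of the orbit of \<open>x\<close>, described through the Lie algebra;
  its dimension serves as the dimension of the orbit.\<close>

definition LX :: "'v \<Rightarrow> 'v set" where "LX x = (\<lambda>X. blinfun_apply X x) ` L"

lemma LX_subspace: "subspace (LX x)"
  unfolding LX_def
  by (rule linear_subspace_image[OF _ L_subspace])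
     (simp add: bounded_linear.linear blinfun.bounded_linear_left)

lemma LX_G: assumes "g \<in> G" shows "LX (blinfun_apply g x) = blinfun_apply g ` LX x"
proof -
  have 1: "blinfun_apply h ` LX y \<subseteq> LX (blinfun_apply h y)" if "h \<in> G" for h y
  proof
    fix z assume "z \<in> blinfun_apply h ` LX y"
    then obtain X where X: "X \<in> L" "z = h (X y)" by (auto simp: LX_def)
    then have "z = blinfun_apply ((h o\<^sub>L X) o\<^sub>L gi h) (blinfun_apply h y)" using that by simp
    then show "z \<in> LX (blinfun_apply h y)" unfolding LX_def using L_Ad[OF that X(1)] by (rule image_eqI)
  qed
  have "LX (g x) \<subseteq> blinfun_apply g ` LX x"
  proof
    fix z assume z: "z \<in> LX (g x)"
    have "gi g z \<in> LX (gi g (g x))" using 1[OF gi_G[OF assms], of "g x"] z by blast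
    then have "gi g z \<in> LX x" using assms by simp
    then show "z \<in> blinfun_apply g ` LX x" using assms by (metis gi_right image_eqI)
  qed
  with 1[OF assms] show ?thesis by blast
qed

lemma dim_LX_G: assumes "g \<in> G" shows "dim (LX (blinfun_apply g x)) = dim (LX x)"
proof -
  have "inj (blinfun_apply g)" using G_orth[OF assms] orthogonal_transformation_inj by blast
  then show ?thesis unfolding LX_G[OF assms]
    by (intro dim_image_eq) (auto simp: bounded_linear.linear blinfun.bounded_linear_right intro: inj_on_subset)
qed

end

section \<open>Orbits of constant dimension\<close>

definition pr :: "'v::euclidean_space set \<Rightarrow> 'v \<Rightarrow> 'v" where
  "pr M y = (THE z. z \<in> M \<and> (\<forall>w\<in>M. (y - z) \<bullet> w = 0))"

lemma pr_unique:
  assumes "subspace M" "z \<in> M" "\<And>w. w \<in> M \<Longrightarrow> (y - z) \<bullet> w = 0"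
  shows "pr M y = z"
  unfolding pr_def
proof (rule the_equality)
  fix z' assume z': "z' \<in> M \<and> (\<forall>w\<in>M. (y - z') \<bullet> w = 0)"
  have m: "z - z' \<in> M" using assms z' by (simp add: subspace_diff)
  then have "(z - z') \<bullet> (z - z') = (y - z') \<bullet> (z - z') - (y - z) \<bullet> (z - z')"
    by (simp add: inner_diff_left)
  also have "\<dots> = 0" using m z' assms by simp
  finally show "z' = z" by simp
qed (use assms in auto)

lemma
  assumes "subspace M"
  shows pr_in [simp]: "pr M y \<in> M" and pr_orth: "w \<in> M \<Longrightarrow> (y - pr M y) \<bullet> w = 0"
proof -
  obtain a b where ab: "a \<in> span M" "\<And>w. w \<in> span M \<Longrightarrow> orthogonal b w" "y = a + b"
    using orthogonal_subspace_decomp_exists[of M y] by metis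
  have sp: "span M = M" using assms by (rule span_eq_iff[THEN iffD2])
  have "pr M y = a"
    using ab unfolding sp by (intro pr_unique assms) (auto simp: orthogonal_def)
  then show "pr M y \<in> M" "w \<in> M \<Longrightarrow> (y - pr M y) \<bullet> w = 0"
    using ab unfolding sp by (auto simp: orthogonal_def)
qed

lemma pr_self [simp]: "subspace M \<Longrightarrow> y \<in> M \<Longrightarrow> pr M y = y"
  by (rule pr_unique) auto

lemma pr_orth_zero: "subspace M \<Longrightarrow> (\<And>w. w \<in> M \<Longrightarrow> y \<bullet> w = 0) \<Longrightarrow> pr M y = 0"
  by (rule pr_unique) (auto simp: subspace_0)

lemma pr_inner: "subspace M \<Longrightarrow> w \<in> M \<Longrightarrow> pr M y \<bullet> w = y \<bullet> w"
  using pr_orth[of M w y] by (simp add: inner_diff_left)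

lemma pr_linear: assumes "subspace M" shows "linear (pr M)"
proof (rule linearI)
  show "pr M (x + y) = pr M x + pr M y" for x y
    using pr_inner[OF assms]
    by (intro pr_unique assms) (auto simp: assms subspace_add inner_diff_left inner_add_left)
  show "pr M (c *\<^sub>R x) = c *\<^sub>R pr M x" for c x
    using pr_inner[OF assms]
    by (intro pr_unique assms) (auto simp: assms subspace_scale inner_diff_left)
qed

lemmas pr_add = linear_add[OF pr_linear]
lemmas pr_diff = linear_diff[OF pr_linear]
lemmas pr_scale = linear_cmul[OF pr_linear]

lemma pr_bounded_linear: "subspace M \<Longrightarrow> bounded_linear (pr M)"
  by (simp add: linear_conv_bounded_linear[symmetric] pr_linear)

lemma pr_pythagoras: assumes "subspace M" shows "(norm y)\<^sup>2 = (norm (pr M y))\<^sup>2 + (norm (y - pr M y))\<^sup>2"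
proof -
  have "(y - pr M y) \<bullet> pr M y = 0" using pr_orth[OF assms pr_in[OF assms]] .
  then show ?thesis
    unfolding power2_norm_eq_inner by (simp add: inner_diff_left inner_diff_right inner_commute)
qed

lemma pr_norm_le: "subspace M \<Longrightarrow> norm (pr M y) \<le> norm y"
  and pr_conorm_le: "subspace M \<Longrightarrow> norm (y - pr M y) \<le> norm y"
  using pr_pythagoras[of M y] by (smt (verit) norm_ge_zero power2_le_imp_le zero_le_power2)+

section \<open>Trace and squared Hilbert-Schmidt norm\<close>

definition tr :: "('v::euclidean_space \<Rightarrow>\<^sub>L 'v) \<Rightarrow> real" where
  "tr A = (\<Sum>b\<in>Basis. blinfun_apply A b \<bullet> b)"

definition hs :: "('v::euclidean_space \<Rightarrow>\<^sub>L 'v) \<Rightarrow> real" where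
  "hs A = (\<Sum>b\<in>Basis. (norm (blinfun_apply A b))\<^sup>2)"

lemma tr_add: "tr (A + B) = tr A + tr B" and tr_diff: "tr (A - B) = tr A - tr B"
  by (simp_all add: tr_def bl_simps inner_add_left inner_diff_left sum.distrib sum_subtractf)

lemma abs_tr_le: "\<bar>tr (A :: 'v::euclidean_space \<Rightarrow>\<^sub>L 'v)\<bar> \<le> DIM('v) * norm A"
proof -
  have "\<bar>tr A\<bar> \<le> (\<Sum>b\<in>(Basis::'v set). norm A)"
    unfolding tr_def
  proof (intro order_trans[OF sum_abs] sum_mono)
    fix b :: 'v assume "b \<in> Basis"
    then show "\<bar>blinfun_apply A b \<bullet> b\<bar> \<le> norm A"
      using Cauchy_Schwarz_ineq2[of "blinfun_apply A b" b] norm_blinfun[of A b] by simp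
  qed
  then show ?thesis by simp
qed

lemma bounded_linear_tr: "bounded_linear tr"
  unfolding tr_def
  by (intro bounded_linear_sum bounded_linear_inner_left_comp blinfun.bounded_linear_left)

lemma norm_le_hs: "(norm (A :: 'v::euclidean_space \<Rightarrow>\<^sub>L 'v))\<^sup>2 \<le> DIM('v) * hs A"
proof -
  have "(norm A)\<^sup>2 \<le> (\<Sum>b\<in>Basis. norm (blinfun_apply A b))\<^sup>2"
    by (intro power_mono norm_blinfun_euclidean_le) simp
  also have "\<dots> \<le> (\<Sum>b\<in>(Basis::'v set). (norm (blinfun_apply A b))\<^sup>2) * card (Basis::'v set)"
    by (rule sum_squared_le_sum_of_squares)
  finally show ?thesis by (simp add: hs_def mult.commute)
qed

lemma hs_le_norm: "hs (A :: 'v::euclidean_space \<Rightarrow>\<^sub>L 'v) \<le> DIM('v) * (norm A)\<^sup>2"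
proof -
  have "hs A \<le> (\<Sum>b\<in>(Basis::'v set). (norm A)\<^sup>2)"
    unfolding hs_def
  proof (intro sum_mono power_mono)
    fix b :: 'v assume "b \<in> Basis"
    then show "norm (blinfun_apply A b) \<le> norm A" using norm_blinfun[of A b] by simp
  qed simp
  then show ?thesis by simp
qed

lemma lipschitz_param_negligible:
  fixes p q :: "'i \<Rightarrow> 'v::euclidean_space"
  assumes "negligible D" "\<And>i. i \<in> I \<Longrightarrow> q i \<in> D"
    and lip: "\<And>i j. i \<in> I \<Longrightarrow> j \<in> I \<Longrightarrow> norm (p i - p j) \<le> C * norm (q i - q j)"
  shows "negligible (p ` I)"
proof -
  define f where "f d = p (SOME i. i \<in> I \<and> q i = d)" for d
  have f: "\<exists>j\<in>I. f (q i) = p j \<and> q j = q i" if "i \<in> I" for i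
  proof -
    have "\<exists>j. j \<in> I \<and> q j = q i" using that by blast
    then have "(SOME j. j \<in> I \<and> q j = q i) \<in> I \<and> q (SOME j. j \<in> I \<and> q j = q i) = q i" by (rule someI_ex)
    then show ?thesis unfolding f_def by blast
  qed
  have fq: "f (q i) = p i" if "i \<in> I" for i
  proof -
    obtain j where "j \<in> I" "f (q i) = p j" "q j = q i" using f[OF \<open>i \<in> I\<close>] by blast
    then show ?thesis using lip[OF \<open>j \<in> I\<close> that] by simp
  qed
  have "negligible (f ` (q ` I))"
  proof (rule negligible_locally_Lipschitz_image)
    show "negligible (q ` I)" by (rule negligible_subset[OF assms(1)]) (use assms(2) in auto)
    fix x assume "x \<in> q ` I"
    then show "\<exists>T B. open T \<and> x \<in> T \<and> (\<forall>y\<in>q ` I \<inter> T. norm (f y - f x) \<le> B * norm (y - x))"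
      by (intro exI[of _ UNIV] exI[of _ C]) (auto simp: fq intro: lip)
  qed simp
  moreover have "f ` (q ` I) = p ` I" by (force simp: fq)
  ultimately show ?thesis by simp
qed

section \<open>Linear control of group elements by the displacement they cause\<close>

context cogroup
begin

text \<open>Being close to the identity in the Hilbert-Schmidt norm therefore means having large
  trace.\<close>

lemma hs_G: assumes "g \<in> G" shows "hs (g - id_blinfun) = 2 * DIM('v) - 2 * tr g"
proof -
  have "hs (g - id_blinfun) = (\<Sum>b\<in>(Basis::'v set). 2 - 2 * (blinfun_apply g b \<bullet> b))"
    unfolding hs_def
  proof (rule sum.cong)
    fix b :: 'v assume b: "b \<in> Basis"
    have "(norm (blinfun_apply g b - b))\<^sup>2 = (norm (blinfun_apply g b))\<^sup>2 + (norm b)\<^sup>2 - 2 * (blinfun_apply g b \<bullet> b)"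
      unfolding power2_norm_eq_inner by (simp add: inner_diff_left inner_diff_right inner_commute)
    then show "(norm (blinfun_apply (g - id_blinfun) b))\<^sup>2 = 2 - 2 * (blinfun_apply g b \<bullet> b)"
      using assms b by (simp add: bl_simps)
  qed simp
  then show ?thesis by (simp add: tr_def sum_subtractf sum_distrib_left)
qed

lemma tr_L: assumes "Z \<in> L" shows "tr Z = 0"
  unfolding tr_def
proof (rule sum.neutral, safe)
  fix b :: 'v
  show "blinfun_apply Z b \<bullet> b = 0" using L_skew[OF assms, of b b] by (simp add: inner_commute)
qed

lemma tr_L_square: assumes "Z \<in> L" shows "tr (Z o\<^sub>L Z) = - hs Z"
  using L_skew[OF assms]
  by (simp add: tr_def hs_def power2_norm_eq_inner sum_negf)

lemma LX_I: "X \<in> L \<Longrightarrow> blinfun_apply X x \<in> LX x"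
  by (auto simp: LX_def)

text \<open>An infinitesimal motion that moves \<open>x\<close> little is close to one fixing
  \<open>x\<close>, uniformly along a stratum of constant orbit dimension. Elements of
  \<open>L\<close> whose values at \<open>x1\<close> form an orthonormal basis of
  \<open>LX x1\<close> keep independent values at nearby \<open>x\<close>; by equality of dimensions
  these span \<open>LX x\<close>, so a combination of them, small with \<open>X x\<close>, can be
  subtracted from \<open>X\<close>.\<close>

lemma stabilizer_approx:
  shows "\<exists>\<delta>>0. \<exists>C>0. \<forall>x. norm (x - x1) < \<delta> \<and> dim (LX x) = dim (LX x1) \<longrightarrow>
     (\<forall>X\<in>L. \<exists>Z\<in>L. blinfun_apply Z x = 0 \<and> norm (X - Z) \<le> C * norm (blinfun_apply X x))"
proof -
  obtain B where B: "B \<subseteq> LX x1" "pairwise orthogonal B" "\<And>b. b \<in> B \<Longrightarrow> norm b = 1"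
     "independent B" "card B = dim (LX x1)" "span B = LX x1"
    using orthonormal_basis_subspace[OF LX_subspace] by metis
  have finB: "finite B" using B(4) by (simp add: independent_imp_finite)
  have "\<forall>b\<in>B. \<exists>Y\<in>L. b = blinfun_apply Y x1" using B(1) unfolding LX_def by blast
  then obtain Y where Y: "\<And>b. b \<in> B \<Longrightarrow> Y b \<in> L" "\<And>b. b \<in> B \<Longrightarrow> blinfun_apply (Y b) x1 = b" by metis
  define M where "M = (\<Sum>b\<in>B. norm (Y b))"
  define D where "D = real (card B) + 1"
  have M0: "0 \<le> M" by (simp add: M_def sum_nonneg)
  have D0: "0 < D" by (simp add: D_def add_pos_nonneg)
  \<comment> \<open>Makes \<open>D * M * \<delta>\<close> at most 1/2, so that in
    \<open>lower\<close> the error of replacing \<open>x\<close> by \<open>x1\<close> is absorbed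
    into the left hand side.\<close>
  define \<delta> where "\<delta> = 1 / (2 * D * (M + 1))"
  have \<delta>: "0 < \<delta>" using D0 M0 by (simp add: \<delta>_def)
  have inner_sum: "(\<Sum>b\<in>B. c b *\<^sub>R b) \<bullet> b' = c b'" if "b' \<in> B" for c b'
  proof -
    have "(\<Sum>b\<in>B. c b *\<^sub>R b) \<bullet> b' = (\<Sum>b\<in>B. if b = b' then c b else 0)"
      unfolding inner_sum_left
    proof (rule sum.cong)
      fix b assume b: "b \<in> B"
      show "(c b *\<^sub>R b) \<bullet> b' = (if b = b' then c b else 0)"
        using B(2,3) b that by (auto simp: pairwise_def orthogonal_def dot_square_norm)
    qed simp
    then show ?thesis using finB that by simp
  qed
  have lower: "(\<Sum>b\<in>B. \<bar>c b\<bar>) \<le> 2 * D * norm (\<Sum>b\<in>B. c b *\<^sub>R blinfun_apply (Y b) x)"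
    if x: "norm (x - x1) < \<delta>" for c x
  proof -
    let ?s = "\<Sum>b\<in>B. \<bar>c b\<bar>"
    have "?s \<le> (\<Sum>b\<in>B. norm (\<Sum>b\<in>B. c b *\<^sub>R b))"
    proof (rule sum_mono)
      fix b' assume b': "b' \<in> B"
      show "\<bar>c b'\<bar> \<le> norm (\<Sum>b\<in>B. c b *\<^sub>R b)"
        using Cauchy_Schwarz_ineq2[of "\<Sum>b\<in>B. c b *\<^sub>R b" b'] inner_sum[OF b', of c] B(3)[OF b'] by simp
    qed
    also have "\<dots> \<le> D * norm (\<Sum>b\<in>B. c b *\<^sub>R b)" by (simp add: D_def mult_right_mono)
    finally have 1: "?s \<le> D * norm (\<Sum>b\<in>B. c b *\<^sub>R b)" .
    have s0: "0 \<le> ?s" by (simp add: sum_nonneg)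
    have "(\<Sum>b\<in>B. c b *\<^sub>R b) = (\<Sum>b\<in>B. c b *\<^sub>R blinfun_apply (Y b) x) - (\<Sum>b\<in>B. c b *\<^sub>R blinfun_apply (Y b) (x - x1))"
      using Y(2) by (simp add: sum_subtractf[symmetric] scaleR_right_diff_distrib[symmetric] bl_simps)
    then have "norm (\<Sum>b\<in>B. c b *\<^sub>R b) \<le> norm (\<Sum>b\<in>B. c b *\<^sub>R blinfun_apply (Y b) x)
        + norm (\<Sum>b\<in>B. c b *\<^sub>R blinfun_apply (Y b) (x - x1))"
      by (simp only: norm_triangle_ineq4)
    moreover have "norm (\<Sum>b\<in>B. c b *\<^sub>R blinfun_apply (Y b) (x - x1)) \<le> (\<Sum>b\<in>B. \<bar>c b\<bar> * (M * \<delta>))"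
    proof (rule order_trans[OF norm_sum], rule sum_mono)
      fix b assume b: "b \<in> B"
      have "norm (blinfun_apply (Y b) (x - x1)) \<le> norm (Y b) * norm (x - x1)" by (rule norm_blinfun)
      also have "\<dots> \<le> M * \<delta>"
        using x M0 member_le_sum[OF b, of "\<lambda>b. norm (Y b)"] finB
        by (intro mult_mono) (auto simp: M_def)
      finally show "norm (c b *\<^sub>R blinfun_apply (Y b) (x - x1)) \<le> \<bar>c b\<bar> * (M * \<delta>)"
        by (simp add: mult_left_mono)
    qed
    ultimately have "norm (\<Sum>b\<in>B. c b *\<^sub>R b) \<le> norm (\<Sum>b\<in>B. c b *\<^sub>R blinfun_apply (Y b) x) + ?s * (M * \<delta>)"
      by (simp add: sum_distrib_right)
    then have "?s \<le> D * (norm (\<Sum>b\<in>B. c b *\<^sub>R blinfun_apply (Y b) x) + ?s * (M * \<delta>))"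
      using 1 D0 by (meson order_trans mult_left_mono less_imp_le)
    also have "\<dots> = D * norm (\<Sum>b\<in>B. c b *\<^sub>R blinfun_apply (Y b) x) + ?s * (D * M * \<delta>)"
      by (simp add: algebra_simps)
    also have "?s * (D * M * \<delta>) \<le> ?s * (1/2)"
    proof (rule mult_left_mono[OF _ s0])
      have "D * M * \<delta> = M / (M + 1) / 2" using D0 M0 by (simp add: \<delta>_def divide_simps)
      also have "\<dots> \<le> 1/2" using M0 by (simp add: divide_simps)
      finally show "D * M * \<delta> \<le> 1/2" .
    qed
    finally show ?thesis by simp
  qed
  have main: "\<exists>Z\<in>L. blinfun_apply Z x = 0 \<and> norm (X - Z) \<le> (2 * D * M + 1) * norm (blinfun_apply X x)"
    if x: "norm (x - x1) < \<delta>" "dim (LX x) = dim (LX x1)" and X: "X \<in> L" for x X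
  proof -
    define \<phi> where "\<phi> w = (\<Sum>b\<in>B. (w \<bullet> b) *\<^sub>R blinfun_apply (Y b) x)" for w
    have lin: "linear \<phi>" unfolding \<phi>_def
      by (intro linear_compose_sum ballI linearI) (auto simp: inner_add_left scaleR_left_distrib)
    have "inj_on \<phi> (span B)"
    proof (subst linear_inj_on_iff_eq_0[OF lin subspace_span], intro ballI impI)
      fix w assume w: "w \<in> span B" "\<phi> w = 0"
      have "(\<Sum>b\<in>B. \<bar>w \<bullet> b\<bar>) \<le> 0" using lower[OF x(1), of "\<lambda>b. w \<bullet> b"] w(2) by (simp add: \<phi>_def)
      then have "(\<Sum>b\<in>B. \<bar>w \<bullet> b\<bar>) = 0" by (intro antisym sum_nonneg) auto
      then have "\<forall>b\<in>B. w \<bullet> b = 0" using finB by (simp add: sum_nonneg_eq_0_iff)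
      then have "w \<bullet> w = 0" using orthogonal_to_span[OF w(1), of w] by (auto simp: orthogonal_def)
      then show "w = 0" by simp
    qed
    then have d: "dim (\<phi> ` LX x1) = dim (LX x1)"
      using B(6) by (intro dim_image_eq[OF lin]) (simp add: span_eq_iff[THEN iffD2, OF LX_subspace])
    have sub: "\<phi> ` LX x1 \<subseteq> LX x"
    proof
      fix z assume "z \<in> \<phi> ` LX x1"
      then obtain w where "z = \<phi> w" by blast
      then show "z \<in> LX x" unfolding \<phi>_def
        by (auto intro!: subspace_sum[OF LX_subspace] subspace_scale[OF LX_subspace] LX_I Y(1))
    qed
    \<comment> \<open>The hypothesis of constant orbit dimension enters here.\<close>
    have "\<phi> ` LX x1 = LX x"
      by (rule subspace_dim_equal[OF linear_subspace_image[OF lin LX_subspace] LX_subspace sub])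
         (simp only: d x(2) order_refl)
    then have "blinfun_apply X x \<in> \<phi> ` LX x1" using LX_I[OF X] by simp
    then obtain w where w: "blinfun_apply X x = \<phi> w" by (rule imageE)
    define Z where "Z = X - (\<Sum>b\<in>B. (w \<bullet> b) *\<^sub>R Y b)"
    have "Z \<in> L" unfolding Z_def by (intro L_diff X L_sum L_scale Y(1))
    moreover have "blinfun_apply Z x = 0"
      using w by (simp add: Z_def \<phi>_def bl_simps blinfun.sum_left)
    moreover have "norm (X - Z) \<le> (2 * D * M + 1) * norm (blinfun_apply X x)"
    proof -
      have "norm (X - Z) \<le> (\<Sum>b\<in>B. \<bar>w \<bullet> b\<bar> * M)"
        unfolding Z_def
        using member_le_sum[of _ B "\<lambda>b. norm (Y b)"] finB
        by (auto intro!: order_trans[OF norm_sum] sum_mono mult_left_mono simp: M_def)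
      also have "\<dots> = M * (\<Sum>b\<in>B. \<bar>w \<bullet> b\<bar>)" by (simp add: sum_distrib_left mult.commute)
      also have "\<dots> \<le> M * (2 * D * norm (blinfun_apply X x))"
        using lower[OF x(1), of "\<lambda>b. w \<bullet> b"] M0 w by (intro mult_left_mono) (auto simp: \<phi>_def)
      also have "\<dots> \<le> (2 * D * M + 1) * norm (blinfun_apply X x)" by (simp add: algebra_simps)
      finally show ?thesis .
    qed
    ultimately show ?thesis by blast
  qed
  show ?thesis
    by (intro exI[of _ \<delta>] exI[of _ "2 * D * M + 1"] conjI \<delta>)
       (use main D0 M0 in \<open>auto intro!: add_nonneg_pos\<close>)
qed

text \<open>Maximising the trace over the coset of the stabiliser of x picks the representative closest to the
  identity.\<close>

lemma tr_maximal:
  assumes "h \<in> G"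
  obtains h' where "h' \<in> G" "blinfun_apply h' x = blinfun_apply h x"
    "norm (h' - id_blinfun) \<le> DIM('v) * norm (h - id_blinfun)"
    "\<And>Z. Z \<in> L \<Longrightarrow> blinfun_apply Z x = 0 \<Longrightarrow> tr ((h' - id_blinfun) o\<^sub>L Z) = 0"
proof -
  let ?S = "G \<inter> {k. blinfun_apply k x = blinfun_apply h x}"
  have "closed {k. blinfun_apply k x = blinfun_apply h x}"
    by (intro closed_Collect_eq continuous_intros)
  with compact_G have "compact ?S" by (rule compact_Int_closed)
  moreover have "?S \<noteq> {}" using assms by auto
  moreover have "continuous_on ?S tr"
    using bounded_linear_tr linear_continuous_on by blast
  ultimately obtain h' where h': "h' \<in> ?S" "\<forall>k\<in>?S. tr k \<le> tr h'"
    using continuous_attains_sup by blast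
  have h'G: "h' \<in> G" using h' by simp
  show thesis
  proof (rule that)
    show "h' \<in> G" "blinfun_apply h' x = blinfun_apply h x" using h' by auto
    have "hs (h' - id_blinfun) \<le> hs (h - id_blinfun)"
      using h' assms by (simp add: hs_G)
    then have "(norm (h' - id_blinfun))\<^sup>2 \<le> DIM('v) * hs (h - id_blinfun)"
      using norm_le_hs[of "h' - id_blinfun"] by (smt (verit) mult_left_mono of_nat_0_le_iff)
    also have "\<dots> \<le> DIM('v) * (DIM('v) * (norm (h - id_blinfun))\<^sup>2)"
      by (intro mult_left_mono hs_le_norm) simp
    also have "\<dots> = (DIM('v) * norm (h - id_blinfun))\<^sup>2" by (simp add: power2_eq_square)
    finally show "norm (h' - id_blinfun) \<le> DIM('v) * norm (h - id_blinfun)"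
      by (rule power2_le_imp_le) simp
    fix Z assume Z: "Z \<in> L" "blinfun_apply Z x = 0"
    let ?f = "\<lambda>s. tr (h' o\<^sub>L ex (s *\<^sub>R Z))"
    have "(?f has_vector_derivative tr (h' o\<^sub>L Z)) (at 0)"
      by (intro bounded_linear.has_vector_derivative[OF bounded_linear_tr]
        bounded_linear.has_vector_derivative[OF bounded_bilinear.bounded_linear_right[OF bounded_bilinear_blinfun_compose]]
        ex_deriv Z)
    then have d: "DERIV ?f 0 :> tr (h' o\<^sub>L Z)" by (simp add: has_real_derivative_iff_has_vector_derivative)
    have "?f s \<le> ?f 0" for s
    proof -
      have "blinfun_apply (ex (s *\<^sub>R Z)) x = x"
        by (rule ex_fix[OF L_scale[OF Z(1)]]) (simp add: bl_simps Z)
      then have "h' o\<^sub>L ex (s *\<^sub>R Z) \<in> ?S"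
        using h' ex_G[OF L_scale[OF Z(1)]] by simp
      then show ?thesis using h'(2) by simp
    qed
    then have "tr (h' o\<^sub>L Z) = 0" by (intro DERIV_local_max[OF d, of 1]) auto
    then show "tr ((h' - id_blinfun) o\<^sub>L Z) = 0"
      using tr_L[OF Z(1)] by (simp add: blc_simps tr_diff)
  qed
qed

text \<open>The coset of the stabiliser contains elements far from the identity even when
  \<open>x\<close> barely moves, hence the passage to \<open>h'\<close>. Take \<open>h'\<close> of
  maximal trace and approximate \<open>h' - id_blinfun\<close> by \<open>Y\<close> in
  \<open>L\<close>. Stationarity of the trace makes the part \<open>Z\<close> of \<open>Y\<close>
  that fixes \<open>x\<close> small, and what remains of \<open>Y\<close> is controlled by
  \<open>Y x\<close>, hence by the displacement.\<close>

lemma orbit_lift: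
  "\<exists>\<epsilon>>0. \<exists>C>0. \<forall>x h. norm (x - x1) < \<epsilon> \<and> dim (LX x) = dim (LX x1) \<and> h \<in> G \<and> norm (h - id_blinfun) < \<epsilon> \<longrightarrow>
     (\<exists>h'\<in>G. blinfun_apply h' x = blinfun_apply h x \<and> norm (h' - id_blinfun) \<le> C * norm (blinfun_apply h x - x))"
proof -
  obtain \<delta> C0 where C0: "0 < \<delta>" "0 < C0" and st: "\<And>x X. norm (x - x1) < \<delta> \<Longrightarrow> dim (LX x) = dim (LX x1) \<Longrightarrow>
     X \<in> L \<Longrightarrow> \<exists>Z\<in>L. blinfun_apply Z x = 0 \<and> norm (X - Z) \<le> C0 * norm (blinfun_apply X x)"
    using stabilizer_approx[of x1] by blast
  define n where "n = real DIM('v)"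
  have n1: "1 \<le> n" unfolding n_def using DIM_positive[where 'a='v] by linarith
  define R where "R = norm x1 + \<delta>"
  have R0: "0 < R" using C0 by (simp add: R_def add_nonneg_pos)
  define m where "m = n\<^sup>2 + 1"
  have m0: "0 < m" by (simp add: m_def add_nonneg_pos)
  \<comment> \<open>Chosen so that in the final estimate all terms proportional to the norm of
    \<open>h' - id_blinfun\<close> add up to half of that norm.\<close>
  define \<eta> where "\<eta> = 1 / (2 * m * (C0 * R + 1))"
  have \<eta>: "0 < \<eta>" using m0 C0 R0 by (simp add: \<eta>_def add_pos_pos)
  have \<eta>': "m * (C0 * R + 1) * \<eta> = 1/2"
  proof -
    have "C0 * R + 1 \<noteq> 0" using C0 R0 by (simp add: add_pos_pos pos_add_strict less_imp_neq[symmetric])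
    then show ?thesis using m0 by (simp add: \<eta>_def)
  qed
  obtain \<delta>' where \<delta>': "0 < \<delta>'" and tan: "\<And>g. g \<in> G \<Longrightarrow> norm (g - id_blinfun) < \<delta>' \<Longrightarrow>
     \<exists>Y\<in>L. norm (g - id_blinfun - Y) \<le> \<eta> * norm (g - id_blinfun)"
    using L_tangent[OF \<eta>] by blast
  define \<epsilon> where "\<epsilon> = min \<delta> (\<delta>' / n)"
  have \<epsilon>: "0 < \<epsilon>" using C0 \<delta>' n1 by (simp add: \<epsilon>_def)
  have "\<exists>h'\<in>G. blinfun_apply h' x = blinfun_apply h x \<and> norm (h' - id_blinfun) \<le> (2 * m * C0) * norm (blinfun_apply h x - x)"
    if x: "norm (x - x1) < \<epsilon>" "dim (LX x) = dim (LX x1)" and h: "h \<in> G" "norm (h - id_blinfun) < \<epsilon>" for x h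
  proof -
    obtain h' where h': "h' \<in> G" "blinfun_apply h' x = blinfun_apply h x"
      "norm (h' - id_blinfun) \<le> DIM('v) * norm (h - id_blinfun)"
      and trz: "\<And>Z. Z \<in> L \<Longrightarrow> blinfun_apply Z x = 0 \<Longrightarrow> tr ((h' - id_blinfun) o\<^sub>L Z) = 0"
      using tr_maximal[OF h(1), of x] by metis
    let ?\<rho> = "norm (h' - id_blinfun)"
    have "?\<rho> < n * \<epsilon>" using h'(3) h(2) n1 unfolding n_def[symmetric] by (smt (verit) mult_strict_left_mono)
    also have "\<dots> \<le> \<delta>'" using n1 by (simp add: \<epsilon>_def min_def field_simps)
    finally obtain Y where Y: "Y \<in> L" "norm (h' - id_blinfun - Y) \<le> \<eta> * ?\<rho>" using tan[OF h'(1)] by blast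
    define r where "r = h' - id_blinfun - Y"
    have r: "norm r \<le> \<eta> * ?\<rho>" using Y by (simp add: r_def)
    have xd: "norm (x - x1) < \<delta>" using x by (simp add: \<epsilon>_def)
    obtain Z where Z: "Z \<in> L" "blinfun_apply Z x = 0" "norm (Y - Z) \<le> C0 * norm (blinfun_apply Y x)"
      using st[OF xd x(2) Y(1)] by blast
    have "tr ((h' - id_blinfun) o\<^sub>L Z) = tr (Y o\<^sub>L Z) + tr (r o\<^sub>L Z)"
      by (simp add: r_def tr_add[symmetric] blc_simps)
    then have 1: "tr (Y o\<^sub>L Z) = - tr (r o\<^sub>L Z)" using trz[OF Z(1,2)] by simp
    \<comment> \<open>Stationarity trades \<open>tr (Y Z)\<close> for the remainder
      \<open>r\<close>; the squared size of \<open>Z\<close> is thus bounded by the size of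
      \<open>Z\<close> times small quantities, which bounds \<open>Z\<close> itself.\<close>
    have "hs Z = - tr (Z o\<^sub>L Z)" using tr_L_square[OF Z(1)] by simp
    also have "\<dots> = tr ((Y - Z) o\<^sub>L Z) - tr (Y o\<^sub>L Z)" by (simp add: blc_simps tr_diff)
    also have "\<dots> = tr ((Y - Z) o\<^sub>L Z) + tr (r o\<^sub>L Z)" using 1 by simp
    also have "\<dots> \<le> n * (norm (Y - Z) * norm Z) + n * (norm r * norm Z)"
    proof -
      have *: "tr (A o\<^sub>L Z) \<le> n * (norm A * norm Z)" for A
      proof -
        have "tr (A o\<^sub>L Z) \<le> n * norm (A o\<^sub>L Z)" using abs_tr_le[of "A o\<^sub>L Z"] unfolding n_def by linarith
        also have "\<dots> \<le> n * (norm A * norm Z)" using n1 by (intro mult_left_mono norm_blinfun_compose) simp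
        finally show ?thesis .
      qed
      show ?thesis by (rule add_mono[OF * *])
    qed
    finally have "hs Z \<le> n * (norm (Y - Z) + norm r) * norm Z" by (simp add: algebra_simps)
    then have "n * hs Z \<le> n * (n * (norm (Y - Z) + norm r) * norm Z)" using n1 by (intro mult_left_mono) auto
    then have "(norm Z)\<^sup>2 \<le> n\<^sup>2 * (norm (Y - Z) + norm r) * norm Z"
      using norm_le_hs[of Z] unfolding n_def[symmetric] by (simp add: power2_eq_square algebra_simps)
    then have Zle: "norm Z \<le> n\<^sup>2 * (norm (Y - Z) + norm r)"
      by (cases "norm Z = 0") (auto simp: power2_eq_square)
    have "?\<rho> = norm ((Y - Z) + Z + r)" by (simp add: r_def)
    also have "\<dots> \<le> norm (Y - Z) + norm Z + norm r"
      by (metis norm_triangle_le add_right_mono norm_triangle_ineq)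
    also have "\<dots> \<le> m * (norm (Y - Z) + norm r)" using Zle by (simp add: m_def algebra_simps)
    also have "\<dots> \<le> m * (C0 * norm (blinfun_apply Y x) + \<eta> * ?\<rho>)"
      using Z(3) r m0 by (intro mult_left_mono add_mono) auto
    also have "\<dots> \<le> m * (C0 * (norm (blinfun_apply h x - x) + \<eta> * ?\<rho> * R) + \<eta> * ?\<rho>)"
    proof -
      have "blinfun_apply Y x = (blinfun_apply h x - x) - blinfun_apply r x"
        using h'(2) by (simp add: r_def bl_simps)
      then have "norm (blinfun_apply Y x) \<le> norm (blinfun_apply h x - x) + norm (blinfun_apply r x)"
        by (simp only: norm_triangle_ineq4)
      also have "norm (blinfun_apply r x) \<le> norm r * norm x" by (rule norm_blinfun)
      also have "\<dots> \<le> \<eta> * ?\<rho> * R"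
        using r xd \<eta> norm_triangle_ineq[of x1 "x - x1"] by (intro mult_mono) (auto simp: R_def)
      finally show ?thesis using C0 m0 by (simp add: mult_left_mono)
    qed
    also have "\<dots> = m * C0 * norm (blinfun_apply h x - x) + (m * (C0 * R + 1) * \<eta>) * ?\<rho>"
      by (simp add: algebra_simps)
    finally have "?\<rho> \<le> 2 * m * C0 * norm (blinfun_apply h x - x)" unfolding \<eta>' by simp
    then show ?thesis using h' by blast
  qed
  then show ?thesis using \<epsilon> m0 C0 by (intro exI[of _ \<epsilon>] conjI exI[of _ "2 * m * C0"]) auto
qed

text \<open>Near \<open>x1\<close> the points \<open>g x\<close> form a Lipschitz graph over the
  tangent space \<open>LX x1\<close> and the parameter \<open>x\<close>: along one orbit a short
  displacement points almost in the direction of \<open>LX x1\<close>, and a change of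
  \<open>x\<close> costs at most its own length because the group is isometric.\<close>

lemma orbit_graph:
  "\<exists>\<epsilon>>0. \<forall>x x' g g'. norm (x - x1) < \<epsilon> \<and> dim (LX x) = dim (LX x1) \<and> g \<in> G \<and> g' \<in> G
      \<and> norm (g - id_blinfun) < \<epsilon> \<and> norm (g' - id_blinfun) < \<epsilon> \<longrightarrow>
     norm (blinfun_apply g x - blinfun_apply g' x') \<le>
       3 * (norm (pr (LX x1) (blinfun_apply g x - blinfun_apply g' x')) + norm (x - x'))"
proof -
  let ?P = "pr (LX x1)"
  obtain \<epsilon>0 C where C: "0 < \<epsilon>0" "0 < C" and lift: "\<And>x h. norm (x - x1) < \<epsilon>0 \<Longrightarrow> dim (LX x) = dim (LX x1) \<Longrightarrow>
     h \<in> G \<Longrightarrow> norm (h - id_blinfun) < \<epsilon>0 \<Longrightarrow>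
     \<exists>h'\<in>G. blinfun_apply h' x = blinfun_apply h x \<and> norm (h' - id_blinfun) \<le> C * norm (blinfun_apply h x - x)"
    using orbit_lift[of x1] by blast
  define R where "R = norm x1 + 1"
  have R: "1 \<le> R" by (simp add: R_def)
  define \<eta> where "\<eta> = min 1 (1 / (8 * C * R))"
  have \<eta>: "0 < \<eta>" "\<eta> \<le> 1" using C R by (auto simp: \<eta>_def)
  have \<eta>': "\<eta> * C * R \<le> 1/8"
  proof -
    have "\<eta> * (C * R) \<le> 1 / (8 * C * R) * (C * R)" using C R by (intro mult_right_mono) (auto simp: \<eta>_def)
    then show ?thesis using C R by (simp add: mult.assoc)
  qed
  obtain \<delta>' where \<delta>': "0 < \<delta>'" and tan: "\<And>g. g \<in> G \<Longrightarrow> norm (g - id_blinfun) < \<delta>' \<Longrightarrow>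
     \<exists>Y\<in>L. norm (g - id_blinfun - Y) \<le> \<eta> * norm (g - id_blinfun)"
    using L_tangent[OF \<eta>(1)] by blast
  define \<epsilon> where "\<epsilon> = min (min 1 (1/4)) (min (\<epsilon>0 / 2) (min (1 / (16 * C)) (\<delta>' / (2 * C * R))))"
  have \<epsilon>: "0 < \<epsilon>" using C R \<delta>' by (simp add: \<epsilon>_def)
  have \<epsilon>1: "\<epsilon> \<le> 1" "\<epsilon> \<le> 1/4" "\<epsilon> \<le> \<epsilon>0 / 2" "\<epsilon> \<le> 1 / (16 * C)" "\<epsilon> \<le> \<delta>' / (2 * C * R)" by (auto simp: \<epsilon>_def)
  have \<epsilon>C: "\<epsilon> * C \<le> 1/16" and \<epsilon>CR: "2 * C * R * \<epsilon> \<le> \<delta>'"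
    using \<epsilon>1(4,5) C R by (simp_all add: field_simps)
  have "norm (blinfun_apply g x - blinfun_apply g' x') \<le>
       3 * (norm (?P (blinfun_apply g x - blinfun_apply g' x')) + norm (x - x'))"
    if x: "norm (x - x1) < \<epsilon>" "dim (LX x) = dim (LX x1)" and g: "g \<in> G" "g' \<in> G"
      "norm (g - id_blinfun) < \<epsilon>" "norm (g' - id_blinfun) < \<epsilon>" for x x' g g'
  proof -
    \<comment> \<open>Both group elements are compared on the orbit of \<open>x\<close>.
      \<open>h\<close> is then exchanged for \<open>h'\<close>, whose distance to the identity is
      linear in the displacement \<open>y\<close>; without this the tangency error could not be
      measured against \<open>y\<close>.\<close>
    define h where "h = gi g' o\<^sub>L g"
    have h: "h \<in> G" using g by (simp add: h_def)
    have hn: "norm (h - id_blinfun) < 2 * \<epsilon>"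
      using gi_diff_norm[OF g(2,1)] norm_triangle_ineq4[of "g - id_blinfun" "g' - id_blinfun"] g(3,4)
      by (simp add: h_def)
    have x0: "norm (x - x1) < \<epsilon>0" and h0: "norm (h - id_blinfun) < \<epsilon>0" using x hn \<epsilon>1 C by auto
    obtain h' where h': "h' \<in> G" "blinfun_apply h' x = blinfun_apply h x"
      "norm (h' - id_blinfun) \<le> C * norm (blinfun_apply h x - x)"
      using lift[OF x0 x(2) h h0] by blast
    define y where "y = blinfun_apply h x - x"
    have nx: "norm x \<le> R" using x(1) \<epsilon>1(1) norm_triangle_ineq[of x1 "x - x1"] by (simp add: R_def)
    have "norm y \<le> norm (h - id_blinfun) * norm x"
      using norm_blinfun[of "h - id_blinfun" x] by (simp add: y_def bl_simps)
    also have "\<dots> < 2 * \<epsilon> * R"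
      by (rule le_less_trans[OF mult_left_mono[OF nx] mult_strict_right_mono[OF hn]]) (use R in auto)
    finally have "C * norm y < C * (2 * \<epsilon> * R)" using C by simp
    then have "norm (h' - id_blinfun) < \<delta>'" using h'(3) \<epsilon>CR by (simp add: y_def algebra_simps)
    then obtain Y where Y: "Y \<in> L" "norm (h' - id_blinfun - Y) \<le> \<eta> * norm (h' - id_blinfun)"
      using tan[OF h'(1)] by blast
    let ?\<rho> = "norm (h' - id_blinfun)"
    define r where "r = h' - id_blinfun - Y"
    have nY: "norm Y \<le> 2 * ?\<rho>"
    proof -
      have "norm Y \<le> ?\<rho> + norm r" using norm_triangle_ineq4[of "h' - id_blinfun" r] by (simp add: r_def)
      also have "norm r \<le> \<eta> * ?\<rho>" using Y(2) by (simp add: r_def)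
      also have "\<eta> * ?\<rho> \<le> 1 * ?\<rho>" by (rule mult_right_mono[OF \<eta>(2)]) simp
      finally show ?thesis by simp
    qed
    have yeq: "y = blinfun_apply Y x1 + (blinfun_apply Y (x - x1) + blinfun_apply r x)"
      unfolding y_def using h'(2) by (simp add: r_def bl_simps)
    have YM: "?P (blinfun_apply Y x1) = blinfun_apply Y x1"
      using Y(1) by (intro pr_self LX_subspace) (auto simp: LX_def)
    \<comment> \<open>The leading term \<open>Y x1\<close> lies in \<open>LX x1\<close>, so only
      error terms have a normal component, and the constants make it at most a quarter of
      \<open>y\<close>.\<close>
    have "norm (y - ?P y) \<le> norm (blinfun_apply Y (x - x1) + blinfun_apply r x)"
      unfolding yeq using YM pr_conorm_le[OF LX_subspace, of "blinfun_apply Y (x - x1) + blinfun_apply r x" x1]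
      by (simp add: pr_add[OF LX_subspace])
    also have "\<dots> \<le> norm Y * norm (x - x1) + norm r * norm x"
      by (intro order_trans[OF norm_triangle_ineq] add_mono norm_blinfun)
    also have "\<dots> \<le> (2 * ?\<rho>) * \<epsilon> + (\<eta> * ?\<rho>) * R"
      using nY x(1) Y(2) nx \<eta> by (intro add_mono mult_mono) (auto simp: r_def)
    also have "\<dots> = (2 * \<epsilon> + \<eta> * R) * ?\<rho>" by (simp add: algebra_simps)
    also have "\<dots> \<le> (2 * \<epsilon> + \<eta> * R) * (C * norm y)"
      using h'(3) \<epsilon> \<eta> R by (intro mult_left_mono) (auto simp: y_def)
    also have "\<dots> = (2 * (\<epsilon> * C) + \<eta> * C * R) * norm y" by (simp add: algebra_simps)
    also have "\<dots> \<le> (1/4) * norm y" using \<epsilon>C \<eta>' by (intro mult_right_mono) auto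
    finally have py: "norm (y - ?P y) \<le> (1/4) * norm y" .
    let ?z = "blinfun_apply g x - blinfun_apply g' x"
    have z: "?z = blinfun_apply g' y" using g by (simp add: y_def h_def bl_simps)
    have nz: "norm ?z = norm y" unfolding z using g by simp
    have zy: "norm (?z - y) \<le> (1/4) * norm y"
    proof -
      have "?z - y = blinfun_apply (g' - id_blinfun) y" unfolding z by (simp add: bl_simps)
      then have "norm (?z - y) \<le> norm (g' - id_blinfun) * norm y" by (metis norm_blinfun)
      also have "\<dots> \<le> (1/4) * norm y" using g(4) \<epsilon>1(2) by (intro mult_right_mono) auto
      finally show ?thesis .
    qed
    have "norm (?z - ?P ?z) \<le> norm (y - ?P y) + norm ((?z - y) - ?P (?z - y))"
    proof -
      have "z' - ?P z' = (y - ?P y) + ((z' - y) - ?P (z' - y))" for z'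
        using pr_diff[OF LX_subspace, of x1 z' y] by simp
      from this[of ?z] show ?thesis
        using norm_triangle_ineq[of "y - ?P y" "(?z - y) - ?P (?z - y)"] by presburger
    qed
    also have "\<dots> \<le> (1/4) * norm y + (1/4) * norm y"
      by (intro add_mono py order_trans[OF pr_conorm_le[OF LX_subspace] zy])
    finally have "norm ?z \<le> 2 * norm (?P ?z)"
      using norm_triangle_ineq[of "?P ?z" "?z - ?P ?z"] nz by simp
    moreover have "norm (?P ?z) \<le> norm (?P (blinfun_apply g x - blinfun_apply g' x')) + norm (x - x')"
    proof -
      have "?P ?z = ?P (blinfun_apply g x - blinfun_apply g' x') - ?P (blinfun_apply g' (x - x'))"
        by (simp add: pr_diff[OF LX_subspace] bl_simps)
      then have "norm (?P ?z) \<le> norm (?P (blinfun_apply g x - blinfun_apply g' x')) + norm (?P (blinfun_apply g' (x - x')))"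
        by (metis norm_triangle_ineq4)
      also have "norm (?P (blinfun_apply g' (x - x'))) \<le> norm (x - x')"
        using pr_norm_le[OF LX_subspace, of x1 "blinfun_apply g' (x - x')"] g by simp
      finally show ?thesis by simp
    qed
    moreover have "norm (blinfun_apply g x - blinfun_apply g' x') \<le> norm ?z + norm (x - x')"
    proof -
      have "blinfun_apply g x - blinfun_apply g' x' = ?z + blinfun_apply g' (x - x')" by (simp add: bl_simps)
      then show ?thesis
        using norm_triangle_ineq[of ?z "blinfun_apply g' (x - x')"] G_norm[OF g(2), of "x - x'"] by (simp only:)
    qed
    ultimately show ?thesis
      using norm_ge_zero[of "?P (blinfun_apply g x - blinfun_apply g' x')"] unfolding distrib_left by linarith
  qed
  then show ?thesis using \<epsilon> by (intro exI[of _ \<epsilon>]) blast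
qed

text \<open>Counting parameters: d along the orbit, then those of \<open>Q\<close> and
  \<open>U\<close>, fewer than the dimension of the space in total. \<open>orbit_graph\<close> makes
  the count rigorous locally, and countably many local pieces suffice. The summand \<open>U\<close>
  later carries translations along a line.\<close>

lemma negligible_lowdim_orbits:
  assumes Q: "subspace Q" and U: "subspace U" and d: "d + dim Q + dim U < DIM('v)"
  shows "negligible {blinfun_apply g x + w | g x w. g \<in> G \<and> x \<in> Q \<and> dim (LX x) = d \<and> w \<in> U}"
proof -
  define P where "P = {x \<in> Q. dim (LX x) = d}"
  have "\<forall>x1. \<exists>\<epsilon>>0. \<forall>x x' g g'. norm (x - x1) < \<epsilon> \<and> dim (LX x) = dim (LX x1) \<and> g \<in> G \<and> g' \<in> G
      \<and> norm (g - id_blinfun) < \<epsilon> \<and> norm (g' - id_blinfun) < \<epsilon> \<longrightarrow>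
     norm (blinfun_apply g x - blinfun_apply g' x') \<le>
       3 * (norm (pr (LX x1) (blinfun_apply g x - blinfun_apply g' x')) + norm (x - x'))"
    using orbit_graph by blast
  from choice[OF this] obtain e where e: "\<And>x1. 0 < e x1" and gr: "\<And>x1 x x' g g'. norm (x - x1) < e x1 \<Longrightarrow>
     dim (LX x) = dim (LX x1) \<Longrightarrow> g \<in> G \<Longrightarrow> g' \<in> G
      \<Longrightarrow> norm (g - id_blinfun) < e x1 \<Longrightarrow> norm (g' - id_blinfun) < e x1 \<Longrightarrow>
     norm (blinfun_apply g x - blinfun_apply g' x') \<le>
       3 * (norm (pr (LX x1) (blinfun_apply g x - blinfun_apply g' x')) + norm (x - x'))" by metis
  \<comment> \<open>The piece with group elements near \<open>g0\<close> and base points near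
    \<open>x1\<close>; left translation by \<open>g0\<close> reduces it to elements near the
    identity.\<close>
  define A where "A x1 g0 = {blinfun_apply g0 (blinfun_apply g x) + w | g x w. g \<in> G \<and> norm (g - id_blinfun) < e x1
      \<and> x \<in> P \<and> norm (x - x1) < e x1 \<and> w \<in> U}" for x1 g0
  have neg: "negligible (A x1 g0)" if x1: "x1 \<in> P" and g0: "g0 \<in> G" for x1 g0
  proof -
    define I where "I = {(g, x, w). g \<in> G \<and> norm (g - id_blinfun) < e x1 \<and> x \<in> P \<and> norm (x - x1) < e x1 \<and> w \<in> U}"
    obtain b :: 'v where b: "b \<in> Basis" using nonempty_Basis by blast
    let ?T = "{y. b \<bullet> y = 0}"
    let ?S = "LX x1 \<times> (Q \<times> U)"
    have S: "subspace ?S" by (intro subspace_Times LX_subspace Q U)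
    have "dim ?S = d + (dim Q + dim U)"
      using x1 by (simp add: dim_Times LX_subspace Q U subspace_Times P_def)
    moreover have bn: "b \<noteq> 0" using b by auto
    ultimately have "dim ?S \<le> dim ?T" using d dim_hyperplane[OF bn] by simp
    \<comment> \<open>Since the parameter space has too small a dimension, it embeds isometrically
      into a hyperplane of the ambient space, which is the null set to which the Lipschitz criterion
      is applied.\<close>
    then obtain f where f: "linear f" "f \<in> ?S \<rightarrow> ?T" "\<And>y. y \<in> ?S \<Longrightarrow> norm (f y) = norm y"
      using isometry_subset_subspace[OF S subspace_hyperplane] by blast
    define p where "p = (\<lambda>(g :: 'v \<Rightarrow>\<^sub>L 'v, x :: 'v, w :: 'v). blinfun_apply g0 (blinfun_apply g x) + w)"
    define q where "q = (\<lambda>(g :: 'v \<Rightarrow>\<^sub>L 'v, x :: 'v, w :: 'v). f (pr (LX x1) (blinfun_apply g x), x, w))"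
    have "negligible (p ` I)"
    proof (rule lipschitz_param_negligible)
      show "negligible ?T" using bn by (intro negligible_hyperplane) simp
      have inS: "(pr (LX x1) (blinfun_apply g x), x, w) \<in> ?S" if "(g, x, w) \<in> I" for g x w
        using that by (auto simp: I_def P_def LX_subspace)
      show "q i \<in> ?T" if "i \<in> I" for i
        using inS that f(2) unfolding q_def by (cases i) auto
      fix i j assume ij: "i \<in> I" "j \<in> I"
      obtain g x w where i: "i = (g, x, w)" by (cases i)
      obtain g' x' w' where j: "j = (g', x', w')" by (cases j)
      let ?u = "(pr (LX x1) (blinfun_apply g x), x, w) - (pr (LX x1) (blinfun_apply g' x'), x', w')"
      have uS: "?u \<in> ?S" using inS[of g x w] inS[of g' x' w'] ij i j by (intro subspace_diff S) auto
      have qu: "norm (q i - q j) = norm ?u"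
        using f(3)[OF uS] by (simp add: i j q_def linear_diff[OF f(1), symmetric])
      have n1: "norm (pr (LX x1) (blinfun_apply g x - blinfun_apply g' x')) \<le> norm ?u"
        using norm_fst_le[of "pr (LX x1) (blinfun_apply g x) - pr (LX x1) (blinfun_apply g' x')" "(x - x', w - w')"]
        by (simp add: pr_diff[OF LX_subspace])
      have n23: "norm (x - x') \<le> norm ?u" "norm (w - w') \<le> norm ?u"
        using norm_snd_le[of "(x - x', w - w')" "pr (LX x1) (blinfun_apply g x) - pr (LX x1) (blinfun_apply g' x')"]
           norm_fst_le[of "x - x'" "w - w'"] norm_snd_le[of "w - w'" "x - x'"] by auto
      have "p i - p j = blinfun_apply g0 (blinfun_apply g x - blinfun_apply g' x') + (w - w')"
        by (simp add: i j p_def bl_simps)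
      then have "norm (p i - p j) \<le> norm (blinfun_apply g0 (blinfun_apply g x - blinfun_apply g' x')) + norm (w - w')"
        by (metis norm_triangle_ineq)
      also have "\<dots> \<le> 3 * (norm (pr (LX x1) (blinfun_apply g x - blinfun_apply g' x')) + norm (x - x')) + norm (w - w')"
        using gr[of x x1 g g' x'] ij i j g0 x1 by (simp add: I_def P_def)
      also have "\<dots> \<le> 7 * norm ?u"
      proof -
        have "3 * (a + b) + c \<le> 3 * (u + u) + u" if "a \<le> u" "b \<le> u" "c \<le> u" for a b c u :: real
          by (intro add_mono mult_left_mono that) simp
        from this[OF n1 n23] show ?thesis by simp
      qed
      finally show "norm (p i - p j) \<le> 7 * norm (q i - q j)" unfolding qu .
    qed
    moreover have "p ` I = A x1 g0" unfolding p_def I_def A_def by force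
    ultimately show ?thesis by simp
  qed
  \<comment> \<open>The radius depends on the centre, so Lindelof gives countably many centres
    first; compactness then gives finitely many \<open>g0\<close> for each of them.\<close>
  obtain P' where P': "P' \<subseteq> P" "countable P'" "P \<subseteq> (\<Union>x1\<in>P'. ball x1 (e x1))"
  proof -
    obtain F where F: "F \<subseteq> (\<lambda>x. ball x (e x)) ` P" "countable F" "\<Union>F = \<Union>((\<lambda>x. ball x (e x)) ` P)"
      using Lindelof[of "(\<lambda>x. ball x (e x)) ` P"] by blast
    then obtain P' where "P' \<subseteq> P" "countable P'" "F = (\<lambda>x. ball x (e x)) ` P'"
      by (metis countable_subset_image)
    moreover have "P \<subseteq> \<Union>((\<lambda>x. ball x (e x)) ` P)" using e by force
    ultimately show thesis using F that by metis
  qed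
  have "\<forall>x1. \<exists>F. finite F \<and> F \<subseteq> G \<and> G \<subseteq> (\<Union>g\<in>F. ball g (e x1))"
  proof
    fix x1
    have "G \<subseteq> (\<Union>g\<in>G. ball g (e x1))" using e by force
    then obtain F where "F \<subseteq> G" "finite F" "G \<subseteq> (\<Union>g\<in>F. ball g (e x1))"
      using compactE_image[OF compact_G, of G "\<lambda>g. ball g (e x1)"] by auto
    then show "\<exists>F. finite F \<and> F \<subseteq> G \<and> G \<subseteq> (\<Union>g\<in>F. ball g (e x1))" by blast
  qed
  from choice[OF this] obtain F where F: "\<And>x1. finite (F x1)" "\<And>x1. F x1 \<subseteq> G" "\<And>x1. G \<subseteq> (\<Union>g\<in>F x1. ball g (e x1))" by metis
  have "negligible (\<Union>x1\<in>P'. \<Union>(A x1 ` F x1))"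
  proof (rule negligible_countable_Union)
    show "countable ((\<lambda>x1. \<Union>(A x1 ` F x1)) ` P')" using P' by simp
    fix S assume "S \<in> (\<lambda>x1. \<Union>(A x1 ` F x1)) ` P'"
    then obtain x1 where x1: "x1 \<in> P'" "S = \<Union>(A x1 ` F x1)" by blast
    show "negligible S" unfolding x1(2)
      using x1(1) P'(1) F(1,2) by (intro negligible_Union) (auto intro!: neg)
  qed
  then show ?thesis
  proof (rule negligible_subset, safe)
    fix g x w assume g: "g \<in> G" and x: "x \<in> Q" "d = dim (LX x)" and w: "w \<in> U"
    then have "x \<in> P" by (simp add: P_def)
    then obtain x1 where x1: "x1 \<in> P'" "norm (x - x1) < e x1" using P'(3) by (auto simp: dist_norm norm_minus_commute)
    obtain g0 where g0: "g0 \<in> F x1" "norm (g - g0) < e x1"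
      using F(3)[of x1] g by (auto simp: dist_norm norm_minus_commute)
    then have g0G: "g0 \<in> G" using F(2) by blast
    have "blinfun_apply g x + w = blinfun_apply g0 (blinfun_apply (gi g0 o\<^sub>L g) x) + w" using g0G by simp
    then have "blinfun_apply g x + w \<in> A x1 g0" unfolding A_def
      using x1 g0 g g0G w \<open>x \<in> P\<close> gi_diff_norm[OF g0G g] gi_G[OF g0G] G_comp[OF gi_G[OF g0G] g]
      by (intro CollectI exI[of _ "gi g0 o\<^sub>L g"] exI[of _ x] exI[of _ w]) simp
    then show "blinfun_apply g x + w \<in> (\<Union>x1\<in>P'. \<Union>(A x1 ` F x1))" using x1 g0 by blast
  qed
qed

end

section \<open>Polar representations and roots\<close>

locale polar = cogroup K for K :: "('v::euclidean_space \<Rightarrow> 'v) set" +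
  fixes \<Sigma> :: "'v set"
  assumes sec: "is_section K \<Sigma>"
begin

lemma sub\<Sigma>: "subspace \<Sigma>" using sec by (simp add: is_section_def)

lemma meet\<Sigma>: "\<exists>g\<in>G. blinfun_apply g x \<in> \<Sigma>"
  using sec Blinfun_G unfolding is_section_def by metis

lemma orth\<Sigma>: "x \<in> \<Sigma> \<Longrightarrow> u \<in> orbit_tangent K x \<Longrightarrow> s \<in> \<Sigma> \<Longrightarrow> u \<bullet> s = 0"
  using sec by (auto simp: is_section_def)

lemma L_orth\<Sigma>: "X \<in> L \<Longrightarrow> x \<in> \<Sigma> \<Longrightarrow> s \<in> \<Sigma> \<Longrightarrow> blinfun_apply X x \<bullet> s = 0"
  using orth\<Sigma> L_orbit_tangent by blast

definition Sp :: "'v set" where "Sp = {v. \<forall>s\<in>\<Sigma>. v \<bullet> s = 0}"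

lemma subSp: "subspace Sp"
  by (auto simp: subspace_def Sp_def inner_add_left)

lemma dimSp: "dim Sp + dim \<Sigma> = DIM('v)"
  using dim_subspace_orthogonal_to_vectors[OF sub\<Sigma> subspace_UNIV]
  by (simp add: Sp_def orthogonal_def inner_commute)

lemma L_Sp: "X \<in> L \<Longrightarrow> x \<in> \<Sigma> \<Longrightarrow> blinfun_apply X x \<in> Sp"
  by (simp add: Sp_def L_orth\<Sigma>)

text \<open>Otherwise every orbit through \<Sigma> has dimension less than the codimension of
  \<Sigma>. The whole space is the union of these orbits, hence a countable union of null
  sets.\<close>

lemma ex_regular: "\<exists>x0\<in>\<Sigma>. LX x0 = Sp"
proof (rule ccontr)
  assume neg: "\<not> ?thesis"
  have sub: "LX x \<subseteq> Sp" if "x \<in> \<Sigma>" for x using L_Sp that by (auto simp: LX_def)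
  have lt: "dim (LX x) + dim \<Sigma> < DIM('v)" if "x \<in> \<Sigma>" for x
  proof (rule ccontr)
    assume "\<not> ?thesis"
    then have "dim Sp \<le> dim (LX x)" using dimSp by linarith
    then have "LX x = Sp" using subspace_dim_equal[OF LX_subspace subSp sub[OF that]] by simp
    then show False using neg that by blast
  qed
  define N where "N d = (if d + dim \<Sigma> < DIM('v) then {blinfun_apply g x + w | g x w. g \<in> G \<and> x \<in> \<Sigma> \<and> dim (LX x) = d \<and> w \<in> {0}} else {})" for d
  have "negligible (N d)" for d
    using negligible_lowdim_orbits[OF sub\<Sigma> subspace_single_0, of d] by (auto simp: N_def)
  then have "negligible (\<Union>d. N d)" by (intro negligible_countable_Union) auto
  moreover have "(\<Union>d. N d) = UNIV"
  proof (rule, simp, rule)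
    fix v :: 'v
    obtain g where g: "g \<in> G" "blinfun_apply g v \<in> \<Sigma>" using meet\<Sigma> by blast
    have "v = blinfun_apply (gi g) (blinfun_apply g v) + 0" using g by simp
    then have "v \<in> N (dim (LX (blinfun_apply g v)))"
      unfolding N_def using lt[OF g(2)] g gi_G[OF g(1)] by (force intro: exI[of _ "gi g"])
    then show "v \<in> (\<Union>d. N d)" by blast
  qed
  ultimately show False by simp
qed

end

section \<open>Simultaneous diagonalisation of commuting symmetric operators\<close>

text \<open>A maximiser of the Rayleigh quotient on the unit sphere of \<open>F\<close> is an
  eigenvector, by the first variation.\<close>

lemma symmetric_eigenvector:
  fixes A :: "'v::euclidean_space \<Rightarrow> 'v"
  assumes F: "subspace F" "F \<noteq> {0}" and A: "linear A" "\<And>v. v \<in> F \<Longrightarrow> A v \<in> F"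
    and sym: "\<And>v w. v \<in> F \<Longrightarrow> w \<in> F \<Longrightarrow> A v \<bullet> w = v \<bullet> A w"
  shows "\<exists>u\<in>F. u \<noteq> 0 \<and> (\<exists>c. A u = c *\<^sub>R u)"
proof -
  let ?S = "F \<inter> sphere 0 1"
  have cont: "continuous_on T A" for T
    using A(1) linear_continuous_on linear_conv_bounded_linear by blast
  have "compact ?S" by (intro closed_Int_compact closed_subspace F compact_sphere)
  moreover obtain v where v: "v \<in> F" "v \<noteq> 0" using F subspace_0 by blast
  have "(1 / norm v) *\<^sub>R v \<in> ?S" using v F by (simp add: subspace_scale)
  then have "?S \<noteq> {}" by blast
  moreover have "continuous_on ?S (\<lambda>u. u \<bullet> A u)" by (intro continuous_intros cont)
  ultimately obtain u where u: "u \<in> ?S" "\<forall>v\<in>?S. v \<bullet> A v \<le> u \<bullet> A u"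
    using continuous_attains_sup by blast
  define c where "c = u \<bullet> A u"
  have le: "v \<bullet> A v \<le> c * (v \<bullet> v)" if v: "v \<in> F" for v
  proof (cases "v = 0")
    case False
    have "(1 / norm v) *\<^sub>R v \<in> ?S" using v F(1) False by (simp add: subspace_scale)
    then have "((1 / norm v) *\<^sub>R v) \<bullet> A ((1 / norm v) *\<^sub>R v) \<le> c"
      using u(2) unfolding c_def by (rule bspec[rotated])
    then have "(v \<bullet> A v) / (norm v)\<^sup>2 \<le> c"
      by (simp add: linear_cmul[OF A(1)] power2_eq_square)
    then show ?thesis using False by (simp add: divide_le_eq power2_norm_eq_inner)
  qed (simp add: linear_0[OF A(1)])
  have crit: "(A u - c *\<^sub>R u) \<bullet> w = 0" if w: "w \<in> F" for w
  proof -
    \<comment> \<open>The homogeneous form of the maximality, valid without normalising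
      \<open>u + t w\<close>: \<open>?q\<close> is at most 0 and vanishes at 0.\<close>
    let ?q = "\<lambda>t. (u + t *\<^sub>R w) \<bullet> A (u + t *\<^sub>R w) - c * ((u + t *\<^sub>R w) \<bullet> (u + t *\<^sub>R w))"
    have uF: "u \<in> F" using u by simp
    have qe: "?q t = 2 * t * ((A u - c *\<^sub>R u) \<bullet> w) + t\<^sup>2 * (w \<bullet> A w - c * (w \<bullet> w))" for t
    proof -
      have uu: "u \<bullet> u = 1" using u by (simp add: norm_eq_1)
      have p1: "u \<bullet> A w = A u \<bullet> w" using sym[OF uF w] by simp
      have p2: "w \<bullet> A u = A u \<bullet> w" by (rule inner_commute)
      have q1: "(u + t *\<^sub>R w) \<bullet> A (u + t *\<^sub>R w) = u \<bullet> A u + t * (u \<bullet> A w) + t * (w \<bullet> A u) + t * (t * (w \<bullet> A w))"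
        by (simp add: linear_add[OF A(1)] linear_cmul[OF A(1)] inner_add_left inner_add_right algebra_simps)
      have q2: "(u + t *\<^sub>R w) \<bullet> (u + t *\<^sub>R w) = u \<bullet> u + 2 * t * (u \<bullet> w) + t * (t * (w \<bullet> w))"
        by (simp add: inner_add_left inner_add_right inner_commute[of w u] algebra_simps)
      have q3: "(A u - c *\<^sub>R u) \<bullet> w = A u \<bullet> w - c * (u \<bullet> w)" by (simp add: inner_diff_left)
      show ?thesis unfolding q1 q2 q3 p1 p2 uu c_def[symmetric] by (simp add: power2_eq_square algebra_simps)
    qed
    have "DERIV ?q 0 :> 2 * ((A u - c *\<^sub>R u) \<bullet> w)"
      unfolding qe by (auto intro!: derivative_eq_intros)
    moreover have "?q t \<le> ?q 0" for t
      using le[of "u + t *\<^sub>R w"] uF w F qe[of 0] by (simp add: subspace_add subspace_scale)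
    ultimately have "2 * ((A u - c *\<^sub>R u) \<bullet> w) = 0"
      by (intro DERIV_local_max[of ?q _ 0 1]) auto
    then show ?thesis by simp
  qed
  have "A u - c *\<^sub>R u \<in> F" using u A(2) F by (simp add: subspace_diff subspace_scale)
  from crit[OF this] have "A u = c *\<^sub>R u" by simp
  then show ?thesis using u by (intro bexI[of _ u]) auto
qed

text \<open>On a nonzero common invariant subspace of least dimension each operator is a scalar: it
  has an eigenvector there, and the eigenspace is invariant under all the others.\<close>

lemma commuting_eigenvector:
  fixes A :: "'i \<Rightarrow> 'v::euclidean_space \<Rightarrow> 'v"
  assumes F: "subspace F" "F \<noteq> {0}" and A: "\<And>i. i \<in> I \<Longrightarrow> linear (A i)" "\<And>i v. i \<in> I \<Longrightarrow> v \<in> F \<Longrightarrow> A i v \<in> F"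
    and sym: "\<And>i v w. i \<in> I \<Longrightarrow> v \<in> F \<Longrightarrow> w \<in> F \<Longrightarrow> A i v \<bullet> w = v \<bullet> A i w"
    and comm: "\<And>i j v. i \<in> I \<Longrightarrow> j \<in> I \<Longrightarrow> v \<in> F \<Longrightarrow> A i (A j v) = A j (A i v)"
  shows "\<exists>u\<in>F. u \<noteq> 0 \<and> (\<forall>i\<in>I. \<exists>c. A i u = c *\<^sub>R u)"
proof -
  \<comment> \<open>Locally, this predicate singles out the nonzero common invariant subspaces of
    \<open>F\<close>.\<close>
  define smooth_level where "smooth_level F' \<longleftrightarrow> subspace F' \<and> F' \<noteq> {0} \<and> F' \<subseteq> F \<and> (\<forall>i\<in>I. \<forall>v\<in>F'. A i v \<in> F')" for F'
  have "smooth_level F" using assms by (auto simp: smooth_level_def)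
  then obtain F0 where F0: "smooth_level F0" and min: "\<And>F'. smooth_level F' \<Longrightarrow> dim F0 \<le> dim F'"
    using ex_has_least_nat[of smooth_level F dim] by blast
  have ev: "\<exists>c. \<forall>v\<in>F0. A i v = c *\<^sub>R v" if i: "i \<in> I" for i
  proof -
    have "\<exists>u\<in>F0. u \<noteq> 0 \<and> (\<exists>c. A i u = c *\<^sub>R u)"
      using F0 A(1)[OF i] sym[OF i] i by (intro symmetric_eigenvector) (auto simp: smooth_level_def)
    then obtain u c where u: "u \<in> F0" "u \<noteq> 0" "A i u = c *\<^sub>R u" by blast
    define F1 where "F1 = {v \<in> F0. A i v = c *\<^sub>R v}"
    have s1: "subspace F1"
      using F0 A(1)[OF i] unfolding F1_def smooth_level_def subspace_def
      by (auto simp: linear_0 linear_add linear_cmul scaleR_right_distrib)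
    have "A j v \<in> F1" if j: "j \<in> I" and v: "v \<in> F1" for j v
    proof -
      have vF: "v \<in> F0" "v \<in> F" and Av: "A i v = c *\<^sub>R v" using v F0 by (auto simp: F1_def smooth_level_def)
      have "A i (A j v) = A j (A i v)" by (rule comm[OF i j vF(2)])
      also have "\<dots> = c *\<^sub>R A j v" unfolding Av by (simp add: linear_cmul[OF A(1)[OF j]])
      finally show ?thesis using F0 j vF(1) by (simp add: F1_def smooth_level_def)
    qed
    then have "smooth_level F1" using s1 u F0 by (auto simp: smooth_level_def F1_def)
    then have "F1 = F0" using min[of F1] s1 F0
      by (intro subspace_dim_equal) (auto simp: smooth_level_def F1_def)
    then show ?thesis by (auto simp: F1_def)
  qed
  have "F0 \<noteq> {0}" "0 \<in> F0" "F0 \<subseteq> F" using F0 subspace_0 by (auto simp: smooth_level_def)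
  then obtain u where u: "u \<in> F0" "u \<noteq> 0" "u \<in> F" by blast
  have "\<forall>i\<in>I. \<exists>c. A i u = c *\<^sub>R u" using ev u(1) by (meson bspec)
  with u show ?thesis by blast
qed

lemma commuting_eigenbasis:
  fixes A :: "'i \<Rightarrow> 'v::euclidean_space \<Rightarrow> 'v"
  assumes "subspace F" "\<And>i. i \<in> I \<Longrightarrow> linear (A i)" "\<And>i v. i \<in> I \<Longrightarrow> v \<in> F \<Longrightarrow> A i v \<in> F"
    and "\<And>i v w. i \<in> I \<Longrightarrow> v \<in> F \<Longrightarrow> w \<in> F \<Longrightarrow> A i v \<bullet> w = v \<bullet> A i w"
    and "\<And>i j v. i \<in> I \<Longrightarrow> j \<in> I \<Longrightarrow> v \<in> F \<Longrightarrow> A i (A j v) = A j (A i v)"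
  shows "\<exists>E. finite E \<and> span E = F \<and> (\<forall>e\<in>E. \<forall>f\<in>E. e \<bullet> f = (if e = f then 1 else 0))
     \<and> (\<forall>e\<in>E. \<forall>i\<in>I. \<exists>c. A i e = c *\<^sub>R e)"
  using assms
proof (induction "dim F" arbitrary: F rule: less_induct)
  case less
  note A1 = less.prems(2)
  show ?case
  proof (cases "F = {0}")
    case True then show ?thesis by (intro exI[of _ "{}"]) auto
  next
    case False
    have "\<exists>u\<in>F. u \<noteq> 0 \<and> (\<forall>i\<in>I. \<exists>c. A i u = c *\<^sub>R u)"
      using less.prems(1) False less.prems(2-5) by (rule commuting_eigenvector)
    then obtain u0 where u0: "u0 \<in> F" "u0 \<noteq> 0" "\<And>i. i \<in> I \<Longrightarrow> \<exists>c. A i u0 = c *\<^sub>R u0"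
      by blast
    define u where "u = (1 / norm u0) *\<^sub>R u0"
    have u: "u \<in> F" "u \<bullet> u = 1"
      using u0 less.prems(1) by (auto simp: u_def subspace_scale dot_square_norm power2_eq_square)
    have ev: "\<exists>c. A i u = c *\<^sub>R u" if "i \<in> I" for i
      using u0(3)[OF that] linear_cmul[OF A1[OF that]] unfolding u_def by (metis scaleR_left_commute)
    define F' where "F' = {v \<in> F. u \<bullet> v = 0}"
    have s: "subspace F'" using less.prems(1) by (auto simp: F'_def subspace_def inner_add_right)
    have "dim F' < dim F"
    proof (rule ccontr)
      assume "\<not> ?thesis"
      then have "F' = F"
        using s less.prems(1) by (intro subspace_dim_equal) (auto simp: F'_def)
      then have "u \<in> F'" using u(1) by simp
      then show False using u(2) by (simp add: F'_def)
    qed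
    moreover have "A i v \<in> F'" if iv: "i \<in> I" "v \<in> F'" for i v
    proof -
      obtain c where c: "A i u = c *\<^sub>R u" using ev[OF iv(1)] by blast
      have vF: "v \<in> F" "u \<bullet> v = 0" using iv(2) by (auto simp: F'_def)
      have "u \<bullet> A i v = A i u \<bullet> v" using less.prems(4)[OF iv(1) u(1) vF(1)] by simp
      also have "\<dots> = 0" using c vF(2) by simp
      finally show ?thesis using less.prems(3)[OF iv(1) vF(1)] by (simp add: F'_def)
    qed
    moreover have "A i v \<bullet> w = v \<bullet> A i w" if "i \<in> I" "v \<in> F'" "w \<in> F'" for i v w
      using less.prems(4)[of i v w] that by (simp add: F'_def)
    moreover have "A i (A j v) = A j (A i v)" if "i \<in> I" "j \<in> I" "v \<in> F'" for i j v
      using less.prems(5)[of i j v] that by (simp add: F'_def)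
    ultimately have "\<exists>E. finite E \<and> span E = F' \<and> (\<forall>e\<in>E. \<forall>f\<in>E. e \<bullet> f = (if e = f then 1 else 0))
     \<and> (\<forall>e\<in>E. \<forall>i\<in>I. \<exists>c. A i e = c *\<^sub>R e)"
      using less.hyps[OF _ s A1] by simp
    then obtain E where E: "finite E" "span E = F'" "\<forall>e\<in>E. \<forall>f\<in>E. e \<bullet> f = (if e = f then 1 else 0)"
      "\<forall>e\<in>E. \<forall>i\<in>I. \<exists>c. A i e = c *\<^sub>R e"
      by (elim exE conjE)
    have orth: "u \<bullet> e = 0" if "e \<in> E" for e
      using span_base[OF that] E(2) by (simp add: F'_def)
    have "span (insert u E) = F"
    proof
      show "span (insert u E) \<subseteq> F"
        using u E(2) less.prems(1) span_base[of _ E] by (intro span_minimal) (auto simp: F'_def)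
      show "F \<subseteq> span (insert u E)"
      proof
        fix v assume v: "v \<in> F"
        have "v - (u \<bullet> v) *\<^sub>R u \<in> F'"
          using v u less.prems(1) by (simp add: F'_def subspace_diff subspace_scale inner_diff_right)
        then have "v - (u \<bullet> v) *\<^sub>R u \<in> span (insert u E)"
          using E(2) span_mono[of E "insert u E"] by blast
        then have "(v - (u \<bullet> v) *\<^sub>R u) + (u \<bullet> v) *\<^sub>R u \<in> span (insert u E)"
          by (rule span_add) (intro span_scale span_base insertI1)
        then show "v \<in> span (insert u E)" by simp
      qed
    qed
    moreover have "\<forall>e\<in>insert u E. \<forall>f\<in>insert u E. e \<bullet> f = (if e = f then 1 else 0)"
    proof (intro ballI)
      fix e f assume ef: "e \<in> insert u E" "f \<in> insert u E"
      have uE: "u \<notin> E" using orth[of u] u(2) by auto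
      show "e \<bullet> f = (if e = f then 1 else 0)"
      proof (cases "e = u")
        case True then show ?thesis using ef uE u(2) orth[of f] by auto
      next
        case False
        then have e: "e \<in> E" using ef by simp
        show ?thesis
        proof (cases "f = u")
          case True then show ?thesis using e uE orth[OF e] by (auto simp: inner_commute)
        next
          case False then show ?thesis using ef E(3) e by simp
        qed
      qed
    qed
    moreover have "\<forall>e\<in>insert u E. \<forall>i\<in>I. \<exists>c. A i e = c *\<^sub>R e" using ev E(4) by simp
    ultimately show ?thesis using E(1) by (intro exI[of _ "insert u E"] conjI) simp_all
  qed
qed

lemma orthonormal_expand:
  fixes E :: "'v::euclidean_space set"
  assumes "finite E" "\<And>e f. e \<in> E \<Longrightarrow> f \<in> E \<Longrightarrow> e \<bullet> f = (if e = f then 1 else 0)" "u \<in> span E"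
  shows "u = (\<Sum>e\<in>E. (u \<bullet> e) *\<^sub>R e)"
proof -
  define w where "w = u - (\<Sum>e\<in>E. (u \<bullet> e) *\<^sub>R e)"
  have "w \<bullet> f = 0" if "f \<in> E" for f
  proof -
    have "(\<Sum>e\<in>E. (u \<bullet> e) *\<^sub>R e) \<bullet> f = (\<Sum>e\<in>E. if e = f then u \<bullet> e else 0)"
      unfolding inner_sum_left using assms(2) that by (intro sum.cong) auto
    then show ?thesis using assms(1) that by (simp add: w_def inner_diff_left)
  qed
  moreover have "w \<in> span E" unfolding w_def
    by (intro span_diff assms(3) span_sum span_scale span_base)
  ultimately have "w \<bullet> w = 0" using orthogonal_to_span[of w E w] by (auto simp: orthogonal_def)
  then show ?thesis by (simp add: w_def)
qed

text \<open>On a line \<open>u + t h\<close> each functional vanishes for at most one t, unless it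
  is constant there; a constant one takes its nonzero value at \<open>u\<close>.\<close>

lemma generic_vector:
  fixes H :: "'v::euclidean_space set"
  assumes "finite A" "subspace H" "\<And>a. a \<in> A \<Longrightarrow> \<exists>h\<in>H. a \<bullet> h \<noteq> 0"
  shows "\<exists>u\<in>H. \<forall>a\<in>A. a \<bullet> u \<noteq> 0"
  using assms(1,3)
proof (induction A rule: finite_induct)
  case empty then show ?case using assms(2) subspace_0 by auto
next
  case (insert b A)
  then obtain u where u: "u \<in> H" "\<And>a. a \<in> A \<Longrightarrow> a \<bullet> u \<noteq> 0" by blast
  obtain h where h: "h \<in> H" "b \<bullet> h \<noteq> 0" using insert.prems by blast
  define B where "B = insert 0 ((\<lambda>a. - (a \<bullet> u) / (a \<bullet> h)) ` insert b A)"
  have "finite B" using insert by (simp add: B_def)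
  then obtain t where t: "t \<notin> B" using ex_new_if_finite[OF infinite_UNIV_char_0[where 'a=real]] by blast
  have "a \<bullet> (u + t *\<^sub>R h) \<noteq> 0" if "a \<in> insert b A" for a
  proof (cases "a \<bullet> h = 0")
    case True
    then show ?thesis using that h u by (auto simp: inner_add_right)
  next
    case False
    have "t \<noteq> - (a \<bullet> u) / (a \<bullet> h)" using t that unfolding B_def by blast
    then show ?thesis using False by (simp add: inner_add_right field_simps add_eq_0_iff)
  qed
  then show ?case using u h assms(2)
    by (intro bexI[of _ "u + t *\<^sub>R h"]) (auto simp: subspace_add subspace_scale)
qed

section \<open>The roots of a polar representation\<close>

context polar
begin

text \<open>The bracket of \<open>X\<close> and \<open>Y\<close> lies in \<open>L\<close> and so
  moves points of \<Sigma> orthogonally to \<Sigma>; skewness rewrites this as a symmetry. Both the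
  symmetry and the commutation of the operators in \<open>ex_roots\<close> come from this
  identity.\<close>

lemma L_bk:
  assumes "X \<in> L" "Y \<in> L" "y \<in> \<Sigma>" "z \<in> \<Sigma>"
  shows "blinfun_apply X y \<bullet> blinfun_apply Y z = blinfun_apply Y y \<bullet> blinfun_apply X z"
proof -
  have "blinfun_apply ((X o\<^sub>L Y) - (Y o\<^sub>L X)) z \<bullet> y = 0"
    by (rule L_orth\<Sigma>[OF L_bracket[OF assms(1,2)] assms(4,3)])
  then have "y \<bullet> blinfun_apply X (blinfun_apply Y z) = y \<bullet> blinfun_apply Y (blinfun_apply X z)"
    by (simp add: bl_simps inner_diff_right inner_commute[of _ y])
  then show ?thesis using L_skew[OF assms(1), of y] L_skew[OF assms(2), of y] by simp
qed

lemma mem\<Sigma>_iff: "v \<in> \<Sigma> \<longleftrightarrow> (\<forall>w\<in>Sp. v \<bullet> w = 0)"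
proof
  assume r: "\<forall>w\<in>Sp. v \<bullet> w = 0"
  have m: "v - pr \<Sigma> v \<in> Sp" using pr_orth[OF sub\<Sigma>] by (simp add: Sp_def)
  have "(v - pr \<Sigma> v) \<bullet> (v - pr \<Sigma> v) = v \<bullet> (v - pr \<Sigma> v) - (v - pr \<Sigma> v) \<bullet> pr \<Sigma> v"
    by (simp add: inner_diff_left inner_diff_right inner_commute)
  also have "\<dots> = 0" using r m pr_orth[OF sub\<Sigma> pr_in[OF sub\<Sigma>]] by simp
  finally have "v = pr \<Sigma> v" by simp
  then show "v \<in> \<Sigma>" using pr_in[OF sub\<Sigma>] by metis
qed (auto simp: Sp_def inner_commute)

text \<open>\<open>A y u\<close> is \<open>X y\<close> for any \<open>X\<close> in \<open>L\<close>
  with \<open>X x0 = u\<close>. Such an \<open>X\<close> exists because \<open>x0\<close> is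
  regular; that its choice does not matter is the point of \<open>wd0\<close>.\<close>

lemma ex_roots:
  "\<exists>E a XX x0. x0 \<in> \<Sigma> \<and> finite E \<and> (\<forall>e\<in>E. \<forall>f\<in>E. e \<bullet> f = (if e = f then 1 else 0)) \<and> span E = Sp
    \<and> (\<forall>e\<in>E. a e \<in> \<Sigma> \<and> a e \<bullet> x0 = 1 \<and> XX e \<in> L \<and> (\<forall>y\<in>\<Sigma>. blinfun_apply (XX e) y = (a e \<bullet> y) *\<^sub>R e))
    \<and> (\<forall>X\<in>L. \<forall>y\<in>\<Sigma>. blinfun_apply X y = (\<Sum>e\<in>E. ((blinfun_apply X x0 \<bullet> e) * (a e \<bullet> y)) *\<^sub>R e))"
proof -
  obtain x0 where x0: "x0 \<in> \<Sigma>" "LX x0 = Sp" using ex_regular by blast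
  define lift where "lift u = (SOME X. X \<in> L \<and> blinfun_apply X x0 = pr Sp u)" for u
  have lift: "lift u \<in> L" "blinfun_apply (lift u) x0 = pr Sp u" for u
  proof -
    have "pr Sp u \<in> LX x0" using x0 pr_in[OF subSp] by simp
    then have "\<exists>X. X \<in> L \<and> blinfun_apply X x0 = pr Sp u" by (auto simp: LX_def)
    then have "lift u \<in> L \<and> blinfun_apply (lift u) x0 = pr Sp u" unfolding lift_def by (rule someI_ex)
    then show "lift u \<in> L" "blinfun_apply (lift u) x0 = pr Sp u" by auto
  qed
  define A where "A y u = blinfun_apply (lift u) y" for y u
  \<comment> \<open>By \<open>L_bk\<close> the vector \<open>X y\<close> is orthogonal to every
    \<open>Y x0\<close>, that is to all of \<open>Sp\<close>, in which it lies.\<close>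
  have wd0: "blinfun_apply X y = 0" if X: "X \<in> L" "blinfun_apply X x0 = 0" "y \<in> \<Sigma>" for X y
  proof -
    have "blinfun_apply X y \<bullet> blinfun_apply Y x0 = 0" if "Y \<in> L" for Y
      using L_bk[OF X(1) that X(3) x0(1)] X(2) by simp
    moreover have "blinfun_apply X y \<in> LX x0" using L_Sp[OF X(1,3)] x0(2) by simp
    then obtain Y where "Y \<in> L" "blinfun_apply X y = blinfun_apply Y x0" by (auto simp: LX_def)
    ultimately have "blinfun_apply X y \<bullet> blinfun_apply X y = 0" by metis
    then show ?thesis by simp
  qed
  have wd: "A y u = blinfun_apply X y" if "X \<in> L" "blinfun_apply X x0 = pr Sp u" "y \<in> \<Sigma>" for X y u
    using wd0[OF L_diff[OF lift(1) that(1)] _ that(3)] that lift(2) by (simp add: A_def bl_simps)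
  have ASp: "A y u \<in> Sp" if "y \<in> \<Sigma>" for y u
    unfolding A_def by (rule L_Sp[OF lift(1) that])
  have lin: "linear (A y)" if y: "y \<in> \<Sigma>" for y
  proof (rule linearI)
    show "A y (u + v) = A y u + A y v" for u v
      using wd[OF L_add[OF lift(1) lift(1)] _ y, of u v "u + v"]
      by (simp add: bl_simps lift pr_add[OF subSp] A_def)
    show "A y (c *\<^sub>R u) = c *\<^sub>R A y u" for c u
      using wd[OF L_scale[OF lift(1)] _ y, of c u "c *\<^sub>R u"]
      by (simp add: bl_simps lift pr_scale[OF subSp] A_def)
  qed
  have sym: "A y u \<bullet> v = u \<bullet> A y v" if "y \<in> \<Sigma>" "u \<in> Sp" "v \<in> Sp" for y u v
    using L_bk[OF lift(1)[of u] lift(1)[of v] that(1) x0(1)] that lift(2)[of u] lift(2)[of v]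
    by (simp add: A_def subSp inner_commute)
  have comm: "A y (A z u) = A z (A y u)" if yz: "y \<in> \<Sigma>" "z \<in> \<Sigma>" and u: "u \<in> Sp" for y z u
  proof -
    have "(A y (A z u) - A z (A y u)) \<bullet> v = 0" if v: "v \<in> Sp" for v
    proof -
      have "A y (A z u) \<bullet> v = A z u \<bullet> A y v" by (rule sym[OF yz(1) ASp[OF yz(2)] v])
      moreover have "A z (A y u) \<bullet> v = A y u \<bullet> A z v" by (rule sym[OF yz(2) ASp[OF yz(1)] v])
      moreover have "A z u \<bullet> A y v = A y u \<bullet> A z v"
        using L_bk[OF lift(1)[of u] lift(1)[of v] yz(2,1)] by (simp add: A_def inner_commute)
      ultimately show ?thesis by (simp add: inner_diff_left)
    qed
    from this[OF subspace_diff[OF subSp ASp[OF yz(1)] ASp[OF yz(2)], of "A z u" "A y u"]]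
    show ?thesis by simp
  qed
  have "\<exists>E. finite E \<and> span E = Sp \<and> (\<forall>e\<in>E. \<forall>f\<in>E. e \<bullet> f = (if e = f then 1 else 0))
     \<and> (\<forall>e\<in>E. \<forall>y\<in>\<Sigma>. \<exists>c. A y e = c *\<^sub>R e)"
    by (rule commuting_eigenbasis[OF subSp lin ASp sym comm])
  then obtain E where E: "finite E" "span E = Sp" "\<forall>e\<in>E. \<forall>f\<in>E. e \<bullet> f = (if e = f then 1 else 0)"
    and ev: "\<forall>e\<in>E. \<forall>y\<in>\<Sigma>. \<exists>c. A y e = c *\<^sub>R e"
    by (elim exE conjE)
  \<comment> \<open>The eigenvalue on \<open>e\<close> is \<open>A y e \<bullet> e\<close>. Skewness
    turns it into the inner product of \<open>y\<close> with \<open>- lift e e\<close>, which is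
    linear in \<open>y\<close>; the projection yields the representing vector in \<Sigma>.\<close>
  define a where "a e = pr \<Sigma> (- blinfun_apply (lift e) e)" for e
  have ESp: "e \<in> Sp" if "e \<in> E" for e using span_base[OF that] E(2) by simp
  have XXy: "blinfun_apply (lift e) y = (a e \<bullet> y) *\<^sub>R e" if e: "e \<in> E" and y: "y \<in> \<Sigma>" for e y
  proof -
    obtain c where c: "A y e = c *\<^sub>R e" using ev e y by blast
    have "e \<bullet> e = 1" using E(3) e by auto
    then have "c = A y e \<bullet> e" using c by simp
    also have "\<dots> = - (y \<bullet> blinfun_apply (lift e) e)" unfolding A_def by (rule L_skew[OF lift(1)])
    also have "\<dots> = a e \<bullet> y" unfolding a_def
      using pr_inner[OF sub\<Sigma> y, of "- blinfun_apply (lift e) e"] by (simp add: inner_commute)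
    finally show ?thesis using c by (simp add: A_def)
  qed
  have ax0: "a e \<bullet> x0 = 1" if e: "e \<in> E" for e
  proof -
    have "(a e \<bullet> x0) *\<^sub>R e = e" using XXy[OF e x0(1)] lift(2)[of e] ESp[OF e] subSp by simp
    then have "(a e \<bullet> x0) * (e \<bullet> e) = e \<bullet> e" by (metis inner_scaleR_left)
    then show ?thesis using E(3) e by simp
  qed
  have exp: "blinfun_apply X y = (\<Sum>e\<in>E. ((blinfun_apply X x0 \<bullet> e) * (a e \<bullet> y)) *\<^sub>R e)"
    if X: "X \<in> L" and y: "y \<in> \<Sigma>" for X y
  proof -
    let ?u = "blinfun_apply X x0"
    have uSp: "?u \<in> Sp" by (rule L_Sp[OF X x0(1)])
    have "blinfun_apply X y = A y ?u" using wd[OF X _ y, of ?u] uSp subSp by simp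
    also have "?u = (\<Sum>e\<in>E. (?u \<bullet> e) *\<^sub>R e)"
      using E uSp by (intro orthonormal_expand) auto
    also have "A y \<dots> = (\<Sum>e\<in>E. (?u \<bullet> e) *\<^sub>R A y e)"
      by (simp add: linear_sum[OF lin[OF y]] linear_cmul[OF lin[OF y]])
    also have "\<dots> = (\<Sum>e\<in>E. ((?u \<bullet> e) * (a e \<bullet> y)) *\<^sub>R e)"
      using XXy y by (intro sum.cong) (auto simp: A_def)
    finally show ?thesis .
  qed
  show ?thesis
  proof (rule exI[of _ E], rule exI[of _ a], rule exI[of _ lift], rule exI[of _ x0], intro conjI ballI)
    fix e assume e: "e \<in> E"
    show "a e \<in> \<Sigma>" unfolding a_def by (rule pr_in[OF sub\<Sigma>])
    show "a e \<bullet> x0 = 1" by (rule ax0[OF e])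
    show "lift e \<in> L" by (rule lift)
    show "blinfun_apply (lift e) y = (a e \<bullet> y) *\<^sub>R e" if "y \<in> \<Sigma>" for y by (rule XXy[OF e that])
  next
    show "e \<bullet> f = (if e = f then 1 else 0)" if "e \<in> E" "f \<in> E" for e f using E(3) that by blast
  next
    fix X y assume "X \<in> L" "y \<in> \<Sigma>"
    then show "blinfun_apply X y = (\<Sum>e\<in>E. ((blinfun_apply X x0 \<bullet> e) * (a e \<bullet> y)) *\<^sub>R e)" by (rule exp)
  qed (rule x0(1) E(1) E(2))+
qed

end

text \<open>\<open>E\<close> is an orthonormal basis of the complement of \<open>\<Sigma>\<close> by simultaneous eigenvectors, \<open>a\<close> the roots.
  Roots are scaled by \<open>a e \<bullet> x0 = 1\<close> and occur with multiplicity.\<close>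

locale roots = polar K \<Sigma> for K :: "('v::euclidean_space \<Rightarrow> 'v) set" and \<Sigma> +
  fixes E :: "'v set" and a :: "'v \<Rightarrow> 'v" and XX :: "'v \<Rightarrow> ('v \<Rightarrow>\<^sub>L 'v)" and x0 :: 'v
  assumes x0\<Sigma>: "x0 \<in> \<Sigma>" and finE: "finite E"
    and orthE: "\<And>e f. e \<in> E \<Longrightarrow> f \<in> E \<Longrightarrow> e \<bullet> f = (if e = f then 1 else 0)"
    and spanE: "span E = Sp"
    and a\<Sigma>: "\<And>e. e \<in> E \<Longrightarrow> a e \<in> \<Sigma>" and a_x0: "\<And>e. e \<in> E \<Longrightarrow> a e \<bullet> x0 = 1"
    and XXL: "\<And>e. e \<in> E \<Longrightarrow> XX e \<in> L"
    and XXy: "\<And>e y. e \<in> E \<Longrightarrow> y \<in> \<Sigma> \<Longrightarrow> blinfun_apply (XX e) y = (a e \<bullet> y) *\<^sub>R e"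
    and L_exp: "\<And>X y. X \<in> L \<Longrightarrow> y \<in> \<Sigma> \<Longrightarrow>
        blinfun_apply X y = (\<Sum>e\<in>E. ((blinfun_apply X x0 \<bullet> e) * (a e \<bullet> y)) *\<^sub>R e)"
begin

lemma E_Sp: "e \<in> E \<Longrightarrow> e \<in> Sp"
  using spanE span_base by blast

lemma E\<Sigma>: "e \<in> E \<Longrightarrow> s \<in> \<Sigma> \<Longrightarrow> e \<bullet> s = 0" "e \<in> E \<Longrightarrow> s \<in> \<Sigma> \<Longrightarrow> s \<bullet> e = 0"
  using E_Sp by (auto simp: Sp_def inner_commute)

lemma E_nz: "e \<in> E \<Longrightarrow> e \<noteq> 0" using orthE[of e e] by auto

lemma a_nz: "e \<in> E \<Longrightarrow> a e \<noteq> 0" using a_x0[of e] by auto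

lemma decomp: "v = pr \<Sigma> v + (\<Sum>e\<in>E. (v \<bullet> e) *\<^sub>R e)"
proof -
  have "v - pr \<Sigma> v \<in> Sp" using pr_orth[OF sub\<Sigma>] by (simp add: Sp_def)
  then have "v - pr \<Sigma> v = (\<Sum>e\<in>E. ((v - pr \<Sigma> v) \<bullet> e) *\<^sub>R e)"
    using finE orthE spanE by (intro orthonormal_expand) auto
  also have "\<dots> = (\<Sum>e\<in>E. (v \<bullet> e) *\<^sub>R e)"
    using E\<Sigma> pr_in[OF sub\<Sigma>] by (intro sum.cong) (auto simp: inner_diff_left)
  finally show ?thesis by (simp add: algebra_simps)
qed

lemma indepE: "F \<subseteq> E \<Longrightarrow> independent F"
  using orthE E_nz by (intro pairwise_orthogonal_independent) (auto simp: pairwise_def orthogonal_def subset_eq)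

lemma cardE: "card E = dim Sp"
  using dim_span_eq_card_independent[OF indepE[of E]] spanE by simp

lemma LX\<Sigma>: assumes x: "x \<in> \<Sigma>" shows "LX x = span {e\<in>E. a e \<bullet> x \<noteq> 0}"
proof
  show "LX x \<subseteq> span {e\<in>E. a e \<bullet> x \<noteq> 0}"
  proof
    fix z assume "z \<in> LX x"
    then obtain X where X: "X \<in> L" "z = blinfun_apply X x" by (auto simp: LX_def)
    have "((blinfun_apply X x0 \<bullet> e) * (a e \<bullet> x)) *\<^sub>R e \<in> span {e\<in>E. a e \<bullet> x \<noteq> 0}" if "e \<in> E" for e
    proof (cases "a e \<bullet> x = 0")
      case False
      then show ?thesis using that by (intro span_scale span_base) auto
    qed (simp add: span_zero)
    then show "z \<in> span {e\<in>E. a e \<bullet> x \<noteq> 0}"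
      unfolding X(2) L_exp[OF X(1) x] by (rule span_sum)
  qed
  show "span {e\<in>E. a e \<bullet> x \<noteq> 0} \<subseteq> LX x"
  proof (rule span_minimal[OF _ LX_subspace], safe)
    fix e assume e: "e \<in> E" "a e \<bullet> x \<noteq> 0"
    have "(1 / (a e \<bullet> x)) *\<^sub>R blinfun_apply (XX e) x \<in> LX x"
      by (intro subspace_scale[OF LX_subspace] LX_I XXL e)
    then show "e \<in> LX x" using e XXy[OF e(1) x] by simp
  qed
qed

lemma dimLX\<Sigma>: assumes x: "x \<in> \<Sigma>" shows "dim (LX x) = card {e\<in>E. a e \<bullet> x \<noteq> 0}"
  unfolding LX\<Sigma>[OF x] by (intro dim_span_eq_card_independent indepE) auto

text \<open>\<open>card E\<close> is the codimension of \<Sigma>, the largest possible orbit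
  dimension.\<close>

definition reg :: "'v \<Rightarrow> bool" where "reg v \<longleftrightarrow> dim (LX v) = card E"

lemma reg\<Sigma>: assumes x: "x \<in> \<Sigma>" shows "reg x \<longleftrightarrow> (\<forall>e\<in>E. a e \<bullet> x \<noteq> 0)"
proof
  assume "reg x"
  then have c: "card {e\<in>E. a e \<bullet> x \<noteq> 0} = card E" by (simp add: reg_def dimLX\<Sigma>[OF x])
  have "{e\<in>E. a e \<bullet> x \<noteq> 0} = E" by (rule card_subset_eq[OF finE _ c]) auto
  then show "\<forall>e\<in>E. a e \<bullet> x \<noteq> 0" by blast
next
  assume "\<forall>e\<in>E. a e \<bullet> x \<noteq> 0"
  then have "{e\<in>E. a e \<bullet> x \<noteq> 0} = E" by blast
  then show "reg x" by (simp add: reg_def dimLX\<Sigma>[OF x])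
qed

lemma reg_G: "g \<in> G \<Longrightarrow> reg (blinfun_apply g v) \<longleftrightarrow> reg v"
  by (simp add: reg_def dim_LX_G)

lemma reg_LX: assumes "x \<in> \<Sigma>" "reg x" shows "LX x = Sp"
proof -
  have "{e\<in>E. a e \<bullet> x \<noteq> 0} = E" using assms reg\<Sigma> by blast
  then show ?thesis using LX\<Sigma>[OF assms(1)] spanE by simp
qed

text \<open>At regular points of \<Sigma> the orbit tangent space is all of \<open>Sp\<close>, and
  \<open>g\<close> carries orbit tangent spaces to orbit tangent spaces; so \<open>g\<close>
  preserves \<open>Sp\<close> and with it the complement \<Sigma>. Hence two elements bringing the
  same regular point into \<Sigma> differ by an element of the normaliser.\<close>

lemma reg_normalizer:
  assumes g: "g \<in> G" and x: "x \<in> \<Sigma>" "blinfun_apply g x \<in> \<Sigma>" "reg x" and s: "s \<in> \<Sigma>"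
  shows "blinfun_apply g s \<in> \<Sigma>"
proof -
  have "blinfun_apply g ` Sp = Sp"
    using LX_G[OF g, of x] reg_LX[OF x(1,3)] reg_LX[OF x(2)] reg_G[OF g] x by simp
  show ?thesis unfolding mem\<Sigma>_iff
  proof
    fix w assume "w \<in> Sp"
    then obtain w' where "w' \<in> Sp" "w = blinfun_apply g w'" using \<open>blinfun_apply g ` Sp = Sp\<close> by blast
    then show "blinfun_apply g s \<bullet> w = 0" using g s by (simp add: Sp_def inner_commute)
  qed
qed

lemma G_image\<Sigma>:
  assumes g: "g \<in> G" and "\<And>s. s \<in> \<Sigma> \<Longrightarrow> blinfun_apply g s \<in> \<Sigma>"
  shows "blinfun_apply g ` \<Sigma> = \<Sigma>"
proof (rule subspace_dim_equal)
  have inj: "inj_on (blinfun_apply g) (span \<Sigma>)"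
    using G_orth[OF g] orthogonal_transformation_inj inj_on_subset by blast
  have lin: "linear (blinfun_apply g)" by (simp add: bounded_linear.linear blinfun.bounded_linear_right)
  show "subspace (blinfun_apply g ` \<Sigma>)" by (rule linear_subspace_image[OF lin sub\<Sigma>])
  show "dim \<Sigma> \<le> dim (blinfun_apply g ` \<Sigma>)" using dim_image_eq[OF lin inj] by simp
qed (use sub\<Sigma> assms in auto)

text \<open>Singular points are moved into \<Sigma>, where some root vanishes; compactness of the
  group lets this pass to a limit.\<close>

lemma open_reg: "open {v. reg v}"
proof -
  have le: "dim (LX v) \<le> card E" for v
  proof -
    obtain g where g: "g \<in> G" "blinfun_apply g v \<in> \<Sigma>" using meet\<Sigma> by blast
    have "dim (LX v) = dim (LX (blinfun_apply g v))" using dim_LX_G[OF g(1)] by simp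
    also have "\<dots> \<le> card E" unfolding dimLX\<Sigma>[OF g(2)] by (intro card_mono finE) auto
    finally show ?thesis .
  qed
  have "closed {v. \<not> reg v}"
  proof (subst closed_sequential_limits, intro allI impI, elim conjE)
    fix v l assume v: "\<forall>n. v n \<in> {v. \<not> reg v}" and l: "v \<longlonglongrightarrow> l"
    have "\<forall>n. \<exists>g. g \<in> G \<and> blinfun_apply g (v n) \<in> \<Sigma>" using meet\<Sigma> by blast
    from choice[OF this] obtain g where g: "\<And>n. g n \<in> G" "\<And>n. blinfun_apply (g n) (v n) \<in> \<Sigma>" by blast
    have ex: "\<exists>e. e \<in> E \<and> a e \<bullet> blinfun_apply (g n) (v n) = 0" for n
      using reg\<Sigma>[OF g(2)[of n]] reg_G[OF g(1)[of n]] v by auto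
    obtain r h where r: "strict_mono (r :: nat \<Rightarrow> nat)" "h \<in> G" "(g \<circ> r) \<longlonglongrightarrow> h" by (rule G_subseq[OF g(1)])
    have lim: "(\<lambda>n. blinfun_apply (g (r n)) (v (r n))) \<longlonglongrightarrow> blinfun_apply h l"
      using r(3) LIMSEQ_subseq_LIMSEQ[OF l r(1)] unfolding o_def by (intro tendsto_intros)
    have h\<Sigma>: "blinfun_apply h l \<in> \<Sigma>"
      by (rule closed_sequentially[OF closed_subspace[OF sub\<Sigma>] _ lim]) (rule g(2))
    \<comment> \<open>The vanishing root may change with n; the product of all roots turns this into
      one closed condition.\<close>
    have "(\<lambda>n. \<Prod>e\<in>E. a e \<bullet> blinfun_apply (g (r n)) (v (r n))) \<longlonglongrightarrow> (\<Prod>e\<in>E. a e \<bullet> blinfun_apply h l)"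
      by (intro tendsto_intros lim)
    moreover have "(\<Prod>e\<in>E. a e \<bullet> blinfun_apply (g n) (v n)) = 0" for n
      using ex[of n] finE by (simp add: prod_zero_iff) blast
    ultimately have "(\<Prod>e\<in>E. a e \<bullet> blinfun_apply h l) = 0"
      by (simp add: LIMSEQ_const_iff)
    then have "\<not> reg (blinfun_apply h l)" using reg\<Sigma>[OF h\<Sigma>] finE by auto
    then show "l \<in> {v. \<not> reg v}" using reg_G[OF r(2)] by simp
  qed
  then show ?thesis by (simp add: closed_def Collect_neg_eq[symmetric])
qed

end

text \<open>\<open>K1\<close> acts on \<open>N\<close>, the span of \<open>\<alpha>\<close> and the \<open>e\<close> whose root is parallel to \<open>\<alpha>\<close>, transitively on spheres.\<close>

locale rank_one = roots K \<Sigma> E a XX x0 for K :: "('v::euclidean_space \<Rightarrow> 'v) set" and \<Sigma> E a XX x0 +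
  fixes f :: 'v
  assumes fE: "f \<in> E"
begin

definition \<alpha> :: 'v where "\<alpha> = (1 / norm (a f)) *\<^sub>R a f"
definition E1 :: "'v set" where "E1 = {e\<in>E. \<exists>c. a e = c *\<^sub>R \<alpha>}"
text \<open>The hyperplane of the root \<open>a f\<close> in \<Sigma>, called its wall below;
  \<alpha> is a unit normal.\<close>

definition H :: "'v set" where "H = {y\<in>\<Sigma>. y \<bullet> \<alpha> = 0}"
definition N :: "'v set" where "N = {v. (\<forall>y\<in>H. v \<bullet> y = 0) \<and> (\<forall>e\<in>E - E1. v \<bullet> e = 0)}"
text \<open>Invariance of \<open>N\<close> is part of the definition: it is a closed condition, so
  \<open>K1\<close> is compact, and the elements \<open>ex (s XX e)\<close> satisfy it because
  \<open>XX e\<close> preserves \<open>N\<close>.\<close>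

definition K1 :: "('v \<Rightarrow>\<^sub>L 'v) set" where
  "K1 = {g\<in>G. (\<forall>y\<in>H. blinfun_apply g y = y) \<and> (\<forall>v\<in>N. blinfun_apply g v \<in> N)}"

lemma \<alpha>\<Sigma>: "\<alpha> \<in> \<Sigma>" by (simp add: \<alpha>_def subspace_scale sub\<Sigma> a\<Sigma> fE)

lemma \<alpha>1: "\<alpha> \<bullet> \<alpha> = 1" "norm \<alpha> = 1"
proof -
  show "norm \<alpha> = 1" using a_nz[OF fE] by (simp add: \<alpha>_def)
  then show "\<alpha> \<bullet> \<alpha> = 1" by (simp add: dot_square_norm)
qed

lemma a_f: "a f = norm (a f) *\<^sub>R \<alpha>" using a_nz[OF fE] by (simp add: \<alpha>_def)

lemma fE1: "f \<in> E1" using fE a_f by (auto simp: E1_def)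

lemma E1E: "e \<in> E1 \<Longrightarrow> e \<in> E" by (simp add: E1_def)

lemma a_E1: "e \<in> E1 \<Longrightarrow> a e = (a e \<bullet> \<alpha>) *\<^sub>R \<alpha>"
  using \<alpha>1 by (auto simp: E1_def)

lemma a_E1_nz: assumes "e \<in> E1" shows "a e \<bullet> \<alpha> \<noteq> 0"
  using a_E1[OF assms] a_nz[OF E1E[OF assms]] by (metis scaleR_zero_left)

lemma a_E1_H: assumes "e \<in> E1" "y \<in> H" shows "a e \<bullet> y = 0"
proof -
  have "a e \<bullet> y = (a e \<bullet> \<alpha>) * (\<alpha> \<bullet> y)" using a_E1[OF assms(1)] by (metis inner_scaleR_left)
  then show ?thesis using assms(2) by (simp add: H_def inner_commute)
qed

lemma subH: "subspace H" using sub\<Sigma> by (auto simp: H_def subspace_def inner_add_left)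
lemma H\<Sigma>: "y \<in> H \<Longrightarrow> y \<in> \<Sigma>" by (simp add: H_def)
lemma subN: "subspace N" by (auto simp: N_def subspace_def inner_add_left)

lemma \<alpha>N: "\<alpha> \<in> N" using E\<Sigma>(2)[OF _ \<alpha>\<Sigma>] by (auto simp: N_def H_def inner_commute)

lemma prH: "pr \<Sigma> v - (v \<bullet> \<alpha>) *\<^sub>R \<alpha> \<in> H"
  using pr_inner[OF sub\<Sigma> \<alpha>\<Sigma>, of v] \<alpha>1 pr_in[OF sub\<Sigma>] \<alpha>\<Sigma>
  by (simp add: H_def subspace_diff subspace_scale sub\<Sigma> inner_diff_left)

lemma N_pr: assumes "v \<in> N" shows "pr \<Sigma> v = (v \<bullet> \<alpha>) *\<^sub>R \<alpha>"
proof -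
  let ?w = "pr \<Sigma> v - (v \<bullet> \<alpha>) *\<^sub>R \<alpha>"
  have "?w \<bullet> ?w = pr \<Sigma> v \<bullet> ?w - (v \<bullet> \<alpha>) * (\<alpha> \<bullet> ?w)" by (simp add: inner_diff_left)
  also have "pr \<Sigma> v \<bullet> ?w = v \<bullet> ?w" by (rule pr_inner[OF sub\<Sigma> H\<Sigma>[OF prH]])
  also have "v \<bullet> ?w = 0" using assms prH by (auto simp: N_def)
  also have "\<alpha> \<bullet> ?w = 0" using prH[of v] by (simp add: H_def inner_commute)
  finally show ?thesis by simp
qed

text \<open>A root vanishing on all of \<open>H\<close> would be a multiple of \<alpha>.\<close>

lemma generic_H: "\<exists>y\<in>H. \<forall>e\<in>E - E1. a e \<bullet> y \<noteq> 0"
proof -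
  have "\<exists>y\<in>H. \<forall>b\<in>a ` (E - E1). b \<bullet> y \<noteq> 0"
  proof (rule generic_vector[OF _ subH])
    fix b assume "b \<in> a ` (E - E1)"
    then obtain e where e: "e \<in> E" "e \<notin> E1" "b = a e" by blast
    let ?h = "a e - (a e \<bullet> \<alpha>) *\<^sub>R \<alpha>"
    have "?h \<noteq> 0" using e by (auto simp: E1_def)
    have hH: "?h \<in> H" using prH[of "a e"] pr_self[OF sub\<Sigma> a\<Sigma>[OF e(1)]] by simp
    have "a e \<bullet> ?h = ?h \<bullet> ?h + (a e \<bullet> \<alpha>) * (\<alpha> \<bullet> ?h)" by (simp add: inner_diff_left)
    also have "\<alpha> \<bullet> ?h = 0" using hH by (simp add: H_def inner_commute)
    finally have "a e \<bullet> ?h \<noteq> 0" using \<open>?h \<noteq> 0\<close> by simp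
    then show "\<exists>h\<in>H. b \<bullet> h \<noteq> 0" using hH e(3) by blast
  qed (use finE in auto)
  then show ?thesis by blast
qed

lemma XX_H: "e \<in> E1 \<Longrightarrow> y \<in> H \<Longrightarrow> blinfun_apply (XX e) y = 0"
  using XXy[OF E1E H\<Sigma>] a_E1_H by simp

text \<open>For generic \<open>y\<close> in \<open>H\<close> the vector \<open>f'\<close> is a
  multiple of \<open>XX f' y\<close>. Since \<open>XX e\<close> kills \<open>y\<close>, pairing
  \<open>XX e w\<close> with it amounts to pairing \<open>w\<close> with the bracket of
  \<open>XX e\<close> and \<open>XX f'\<close> at \<open>y\<close>. Elements of \<open>L\<close>
  send \<open>y\<close> into the span of \<open>E - E1\<close>, to which \<open>w\<close> is
  orthogonal.\<close>

lemma XX_N: assumes e: "e \<in> E1" and w: "w \<in> N" shows "blinfun_apply (XX e) w \<in> N"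
  unfolding N_def
proof (intro CollectI conjI ballI)
  have XL: "XX e \<in> L" by (rule XXL[OF E1E[OF e]])
  show "blinfun_apply (XX e) w \<bullet> y = 0" if "y \<in> H" for y
    using L_skew[OF XL, of w y] XX_H[OF e that] by simp
  fix f' assume f': "f' \<in> E - E1"
  obtain y where y: "y \<in> H" "\<forall>e\<in>E - E1. a e \<bullet> y \<noteq> 0" using generic_H by blast
  let ?Y = "XX f'"
  have YL: "?Y \<in> L" using f' XXL by blast
  let ?Z = "(XX e o\<^sub>L ?Y) - (?Y o\<^sub>L XX e)"
  have ZL: "?Z \<in> L" by (rule L_bracket[OF XL YL])
  have "w \<bullet> blinfun_apply ?Z y = (\<Sum>e'\<in>E. ((blinfun_apply ?Z x0 \<bullet> e') * (a e' \<bullet> y)) * (w \<bullet> e'))"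
    unfolding L_exp[OF ZL H\<Sigma>[OF y(1)]] by (simp add: inner_sum_right)
  also have "\<dots> = 0"
  proof (rule sum.neutral, rule ballI)
    fix e' assume "e' \<in> E"
    show "((blinfun_apply ?Z x0 \<bullet> e') * (a e' \<bullet> y)) * (w \<bullet> e') = 0"
    proof (cases "e' \<in> E1")
      case True then show ?thesis using a_E1_H y(1) by simp
    next
      case False then show ?thesis using w \<open>e' \<in> E\<close> by (simp add: N_def)
    qed
  qed
  finally have "w \<bullet> blinfun_apply (XX e) (blinfun_apply ?Y y) = 0"
    using XX_H[OF e y(1)] by (simp add: bl_simps)
  then have "blinfun_apply (XX e) w \<bullet> blinfun_apply ?Y y = 0"
    using L_skew[OF XL, of w] by simp
  then show "blinfun_apply (XX e) w \<bullet> f' = 0"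
    using XXy[of f' y] f' y H\<Sigma> by auto
qed

lemma K1_G: "g \<in> K1 \<Longrightarrow> g \<in> G" by (simp add: K1_def)
lemma K1_H: "g \<in> K1 \<Longrightarrow> y \<in> H \<Longrightarrow> blinfun_apply g y = y" by (simp add: K1_def)
lemma K1_N: "g \<in> K1 \<Longrightarrow> v \<in> N \<Longrightarrow> blinfun_apply g v \<in> N" by (simp add: K1_def)
lemma K1_comp: "g \<in> K1 \<Longrightarrow> h \<in> K1 \<Longrightarrow> g o\<^sub>L h \<in> K1" by (simp add: K1_def)
lemma K1_id: "id_blinfun \<in> K1" by (simp add: K1_def)

lemma K1_gi: assumes g: "g \<in> K1" shows "gi g \<in> K1"
proof -
  have gG: "g \<in> G" by (rule K1_G[OF g])
  have lin: "linear (blinfun_apply g)" by (simp add: bounded_linear.linear blinfun.bounded_linear_right)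
  have inj: "inj_on (blinfun_apply g) (span N)"
    using G_orth[OF gG] orthogonal_transformation_inj inj_on_subset by blast
  have "blinfun_apply g ` N = N"
    by (rule subspace_dim_equal[OF linear_subspace_image[OF lin subN] subN])
       (use K1_N[OF g] dim_image_eq[OF lin inj] in auto)
  then have "blinfun_apply (gi g) v \<in> N" if "v \<in> N" for v
  proof -
    have "v \<in> blinfun_apply g ` N" using that \<open>blinfun_apply g ` N = N\<close> by simp
    then show ?thesis using gG by auto
  qed
  moreover have "blinfun_apply (gi g) y = y" if "y \<in> H" for y
    using gi_left[OF gG, of y] K1_H[OF g that] by simp
  ultimately show ?thesis using gG by (simp add: K1_def)
qed

lemma ex_K1: assumes e: "e \<in> E1" shows "ex (s *\<^sub>R XX e) \<in> K1"
proof -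
  have L: "s *\<^sub>R XX e \<in> L" by (rule L_scale[OF XXL[OF E1E[OF e]]])
  have "blinfun_apply (ex (s *\<^sub>R XX e)) y = y" if "y \<in> H" for y
    by (rule ex_fix[OF L]) (simp add: bl_simps XX_H[OF e that])
  moreover have "blinfun_apply (ex (s *\<^sub>R XX e)) v \<in> N" if "v \<in> N" for v
    by (rule ex_subspace[OF L subN _ that]) (simp add: bl_simps subspace_scale[OF subN XX_N[OF e]])
  ultimately show ?thesis using ex_G[OF L] by (simp add: K1_def)
qed

lemma compact_K1: "compact K1"
proof -
  have c: "closed {g. blinfun_apply g v \<in> N}" for v
    using continuous_closed_vimage[OF closed_subspace[OF subN], of "\<lambda>g. blinfun_apply g v"]
    by (simp add: vimage_def continuous_intros)
  have "K1 = G \<inter> ((\<Inter>y\<in>H. {g. blinfun_apply g y = y}) \<inter> (\<Inter>v\<in>N. {g. blinfun_apply g v \<in> N}))"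
    by (auto simp: K1_def)
  moreover have "closed ((\<Inter>y\<in>H. {g::'v \<Rightarrow>\<^sub>L 'v. blinfun_apply g y = y}) \<inter> (\<Inter>v\<in>N. {g. blinfun_apply g v \<in> N}))"
    by (intro closed_Int closed_INT ballI closed_Collect_eq continuous_intros c)
  ultimately show ?thesis using compact_Int_closed[OF compact_G] by simp
qed

text \<open>At a maximiser of the \<alpha>-component over the \<open>K1\<close>-orbit of
  \<open>u\<close>, the derivative along \<open>ex (s XX e)\<close> vanishes, which kills the
  component along every \<open>e\<close> in \<open>E1\<close>. Only a multiple of \<alpha> is
  left.\<close>

lemma sphere_max:
  assumes u: "u \<in> N"
  shows "\<exists>g\<in>K1. (\<forall>h\<in>K1. blinfun_apply h u \<bullet> \<alpha> \<le> blinfun_apply g u \<bullet> \<alpha>)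
     \<and> (blinfun_apply g u = norm u *\<^sub>R \<alpha> \<or> blinfun_apply g u = - norm u *\<^sub>R \<alpha>)"
proof -
  have "continuous_on K1 (\<lambda>g. blinfun_apply g u \<bullet> \<alpha>)" by (intro continuous_intros)
  then obtain g where g: "g \<in> K1" "\<forall>h\<in>K1. blinfun_apply h u \<bullet> \<alpha> \<le> blinfun_apply g u \<bullet> \<alpha>"
    using continuous_attains_sup[OF compact_K1] K1_id by blast
  let ?v = "blinfun_apply g u"
  have vN: "?v \<in> N" by (rule K1_N[OF g(1) u])
  have ve: "?v \<bullet> e = 0" if e: "e \<in> E1" for e
  proof -
    let ?f = "\<lambda>s. blinfun_apply (ex (s *\<^sub>R XX e)) ?v \<bullet> \<alpha>"
    have XL: "XX e \<in> L" by (rule XXL[OF E1E[OF e]])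
    have "(?f has_vector_derivative blinfun_apply (XX e) ?v \<bullet> \<alpha>) (at 0)"
      by (intro bounded_linear.has_vector_derivative[OF bounded_linear_inner_left] apply_deriv ex_deriv XL)
    then have d: "DERIV ?f 0 :> blinfun_apply (XX e) ?v \<bullet> \<alpha>"
      by (simp add: has_real_derivative_iff_has_vector_derivative)
    have "?f s \<le> ?f 0" for s
      using bspec[OF g(2) K1_comp[OF ex_K1[OF e] g(1)]] by simp
    then have "blinfun_apply (XX e) ?v \<bullet> \<alpha> = 0" by (intro DERIV_local_max[OF d, of 1]) auto
    then have "?v \<bullet> blinfun_apply (XX e) \<alpha> = 0" using L_skew[OF XL, of ?v \<alpha>] by simp
    then show ?thesis using XXy[OF E1E[OF e] \<alpha>\<Sigma>] a_E1_nz[OF e] by simp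
  qed
  have "?v \<bullet> e = 0" if "e \<in> E" for e
    using ve vN that by (cases "e \<in> E1") (auto simp: N_def)
  then have "?v = pr \<Sigma> ?v" using decomp[of ?v] by simp
  then have v: "?v = (?v \<bullet> \<alpha>) *\<^sub>R \<alpha>" using N_pr[OF vN] by simp
  have "\<bar>?v \<bullet> \<alpha>\<bar> = norm u"
    using arg_cong[OF v, of norm] G_norm[OF K1_G[OF g(1)]] \<alpha>1 by simp
  then have "?v \<bullet> \<alpha> = norm u \<or> ?v \<bullet> \<alpha> = - norm u" by linarith
  then show ?thesis using g v by metis
qed

text \<open>\<open>sphere_max\<close> for \<open>- \<alpha>\<close>. Were the maximal
  \<alpha>-component -1, every element of \<open>K1\<close> would fix \<alpha>; but
  \<open>ex (s XX f)\<close> moves it with velocity a nonzero multiple of \<open>f\<close>.\<close>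

lemma reflection: "\<exists>r\<in>K1. blinfun_apply r \<alpha> = - \<alpha>"
proof -
  obtain g where g: "g \<in> K1" "\<forall>h\<in>K1. blinfun_apply h (- \<alpha>) \<bullet> \<alpha> \<le> blinfun_apply g (- \<alpha>) \<bullet> \<alpha>"
     "blinfun_apply g (- \<alpha>) = norm (- \<alpha>) *\<^sub>R \<alpha> \<or> blinfun_apply g (- \<alpha>) = - norm (- \<alpha>) *\<^sub>R \<alpha>"
    using sphere_max[OF subspace_neg[OF subN \<alpha>N]] by blast
  show ?thesis
  proof (cases "blinfun_apply g (- \<alpha>) = \<alpha>")
    case True
    then have "blinfun_apply g \<alpha> = - \<alpha>" by (simp add: bl_simps) (metis minus_minus)
    then show ?thesis using g(1) by blast
  next
    case False
    then have ga: "blinfun_apply g (- \<alpha>) = - \<alpha>" using g(3) \<alpha>1 by simp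
    have fixa: "blinfun_apply h \<alpha> = \<alpha>" if h: "h \<in> K1" for h
    proof -
      have "1 \<le> blinfun_apply h \<alpha> \<bullet> \<alpha>" using bspec[OF g(2) h] ga \<alpha>1 by (simp add: bl_simps)
      then have "(norm (blinfun_apply h \<alpha> - \<alpha>))\<^sup>2 \<le> 0"
        using G_inner[OF K1_G[OF h], of \<alpha> \<alpha>] \<alpha>1
        by (simp add: power2_norm_eq_inner inner_diff_left inner_diff_right inner_commute)
      then show ?thesis by simp
    qed
    have "((\<lambda>s. blinfun_apply (ex (s *\<^sub>R XX f)) \<alpha>) has_vector_derivative blinfun_apply (XX f) \<alpha>) (at 0)"
      by (intro apply_deriv ex_deriv XXL fE)
    then have "((\<lambda>s. \<alpha>) has_vector_derivative blinfun_apply (XX f) \<alpha>) (at 0)"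
      using fixa[OF ex_K1[OF fE1]] by simp
    then have "blinfun_apply (XX f) \<alpha> = 0"
      using vector_derivative_unique_at has_vector_derivative_const by blast
    then show ?thesis using XXy[OF fE \<alpha>\<Sigma>] a_E1_nz[OF fE1] E_nz[OF fE] by simp
  qed
qed

lemma transitive: assumes u: "u \<in> N" shows "\<exists>g\<in>K1. blinfun_apply g (norm u *\<^sub>R \<alpha>) = u"
proof -
  obtain r where r: "r \<in> K1" "blinfun_apply r \<alpha> = - \<alpha>" using reflection by blast
  obtain g where g: "g \<in> K1" "blinfun_apply g u = norm u *\<^sub>R \<alpha> \<or> blinfun_apply g u = - norm u *\<^sub>R \<alpha>"
    using sphere_max[OF u] by blast
  obtain h where h: "h \<in> K1" "blinfun_apply h u = norm u *\<^sub>R \<alpha>"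
  proof (cases "blinfun_apply g u = norm u *\<^sub>R \<alpha>")
    case True then show thesis using that g by blast
  next
    case False
    then have "blinfun_apply (r o\<^sub>L g) u = norm u *\<^sub>R \<alpha>" using g r by (simp add: bl_simps)
    then show thesis using that K1_comp[OF r(1) g(1)] by blast
  qed
  then show ?thesis using K1_gi[OF h(1)] gi_left[OF K1_G[OF h(1)], of u] by (intro bexI[of _ "gi h"]) auto
qed

end

section \<open>Smooth functions on subspaces\<close>

definition ropen :: "'v::euclidean_space set \<Rightarrow> 'v set \<Rightarrow> bool" where
  "ropen T S \<longleftrightarrow> subspace T \<and> S \<subseteq> T \<and> (\<forall>x\<in>S. \<exists>\<delta>>0. \<forall>h\<in>T. norm h < \<delta> \<longrightarrow> x + h \<in> S)"

lemma ropen_ball: assumes "subspace T" shows "ropen T (T \<inter> ball c r)"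
  unfolding ropen_def
proof (intro conjI assms ballI)
  fix x assume x: "x \<in> T \<inter> ball c r"
  show "\<exists>\<delta>>0. \<forall>h\<in>T. norm h < \<delta> \<longrightarrow> x + h \<in> T \<inter> ball c r"
  proof (intro exI[of _ "r - dist c x"] conjI ballI impI)
    fix h assume h: "h \<in> T" "norm h < r - dist c x"
    have "dist c (x + h) \<le> dist c x + norm h"
      using dist_triangle[of c "x + h" x] by (simp add: dist_norm)
    then show "x + h \<in> T \<inter> ball c r" using x h assms by (simp add: subspace_add)
  qed (use x in simp)
qed simp

lemma Ck_continuous: "Ck k T S f \<Longrightarrow> continuous_on S f"
  by (cases k) auto

lemma Ck_SucD: "Ck (Suc k) T S f \<Longrightarrow> Ck k T S f"
proof (induction k arbitrary: f)
  case 0 then show ?case by simp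
next
  case (Suc k)
  then obtain Df where "\<forall>x\<in>S. (f has_derivative Df x) (at x within S)" "\<forall>h\<in>T. Ck (Suc k) T S (\<lambda>x. Df x h)"
    by auto
  then show ?case using Suc.IH Suc.prems by auto
qed

lemma Ck_const [simp]: "Ck k T S (\<lambda>x. c)"
  by (induction k arbitrary: c) (auto intro!: exI[of _ "\<lambda>x h. 0"])

lemma Ck_bounded_linear: assumes "bounded_linear f" shows "Ck k T S f"
proof (cases k)
  case 0 then show ?thesis using assms by (simp add: linear_continuous_on)
next
  case (Suc n)
  then show ?thesis using assms
    by (auto intro!: exI[of _ "\<lambda>x. f"] bounded_linear_imp_has_derivative simp: linear_continuous_on)
qed

lemma Ck_add: "Ck k T S f \<Longrightarrow> Ck k T S g \<Longrightarrow> Ck k T S (\<lambda>x. f x + g x)"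
proof (induction k arbitrary: f g)
  case 0 then show ?case by (auto intro: continuous_intros)
next
  case (Suc k)
  obtain Df where f: "\<forall>x\<in>S. (f has_derivative Df x) (at x within S)" "\<forall>h\<in>T. Ck k T S (\<lambda>x. Df x h)"
    using Suc.prems(1) by auto
  obtain Dg where g: "\<forall>x\<in>S. (g has_derivative Dg x) (at x within S)" "\<forall>h\<in>T. Ck k T S (\<lambda>x. Dg x h)"
    using Suc.prems(2) by auto
  have "continuous_on S (\<lambda>x. f x + g x)" using Suc.prems by (auto intro: continuous_intros)
  moreover have "\<forall>x\<in>S. ((\<lambda>x. f x + g x) has_derivative (\<lambda>h. Df x h + Dg x h)) (at x within S)"
    using f g by (auto intro: has_derivative_add)
  moreover have "\<forall>h\<in>T. Ck k T S (\<lambda>x. Df x h + Dg x h)" using Suc.IH f g by blast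
  ultimately show ?case by (auto intro!: exI[of _ "\<lambda>x h. Df x h + Dg x h"])
qed

lemma Ck_mult: "Ck k T S f \<Longrightarrow> Ck k T S g \<Longrightarrow> Ck k T S (\<lambda>x. f x * g x)"
proof (induction k arbitrary: f g)
  case 0 then show ?case by (auto intro: continuous_intros)
next
  case (Suc k)
  obtain Df where f: "\<forall>x\<in>S. (f has_derivative Df x) (at x within S)" "\<forall>h\<in>T. Ck k T S (\<lambda>x. Df x h)"
    using Suc.prems(1) by auto
  obtain Dg where g: "\<forall>x\<in>S. (g has_derivative Dg x) (at x within S)" "\<forall>h\<in>T. Ck k T S (\<lambda>x. Dg x h)"
    using Suc.prems(2) by auto
  have k: "Ck k T S f" "Ck k T S g" using Suc.prems Ck_SucD by blast+
  have "continuous_on S (\<lambda>x. f x * g x)" using Suc.prems by (auto intro: continuous_intros)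
  moreover have "\<forall>x\<in>S. ((\<lambda>x. f x * g x) has_derivative (\<lambda>h. f x * Dg x h + Df x h * g x)) (at x within S)"
    using f g by (auto intro: has_derivative_mult)
  moreover have "\<forall>h\<in>T. Ck k T S (\<lambda>x. f x * Dg x h + Df x h * g x)"
    using f g k Suc.IH by (auto intro!: Ck_add)
  ultimately show ?case by (auto intro!: exI[of _ "\<lambda>x h. f x * Dg x h + Df x h * g x"])
qed

lemma Ck_inverse: "Ck k T S f \<Longrightarrow> (\<And>x. x \<in> S \<Longrightarrow> f x \<noteq> 0) \<Longrightarrow> Ck k T S (\<lambda>x. inverse (f x))"
proof (induction k)
  case 0 then show ?case by (auto intro: continuous_intros)
next
  case (Suc k)
  obtain Df where f: "\<forall>x\<in>S. (f has_derivative Df x) (at x within S)" "\<forall>h\<in>T. Ck k T S (\<lambda>x. Df x h)"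
    using Suc.prems(1) by auto
  have i: "Ck k T S (\<lambda>x. inverse (f x))" using Suc Ck_SucD by blast
  have "continuous_on S (\<lambda>x. inverse (f x))" using Suc.prems by (auto intro: continuous_intros)
  moreover have "\<forall>x\<in>S. ((\<lambda>x. inverse (f x)) has_derivative (\<lambda>h. - (inverse (f x) * Df x h * inverse (f x)))) (at x within S)"
    using f Suc.prems by (auto intro: has_derivative_inverse)
  moreover have "\<forall>h\<in>T. Ck k T S (\<lambda>x. - (inverse (f x) * Df x h * inverse (f x)))"
  proof
    fix h assume "h \<in> T"
    then have "Ck k T S (\<lambda>x. (- 1) * (inverse (f x) * Df x h * inverse (f x)))"
      using f i by (intro Ck_mult Ck_const) auto
    then show "Ck k T S (\<lambda>x. - (inverse (f x) * Df x h * inverse (f x)))" by simp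
  qed
  ultimately show ?case
    by (auto intro!: exI[of _ "\<lambda>x h. - (inverse (f x) * Df x h * inverse (f x))"])
qed

lemma Ck_cong: assumes "\<And>x. x \<in> S \<Longrightarrow> f x = g x" "Ck k T S f" shows "Ck k T S g"
proof (cases k)
  case 0 then show ?thesis using assms by (metis Ck.simps(1) continuous_on_cong)
next
  case (Suc n)
  then obtain Df where f: "\<forall>x\<in>S. (f has_derivative Df x) (at x within S)" "\<forall>h\<in>T. Ck n T S (\<lambda>x. Df x h)"
    using assms(2) by auto
  have "continuous_on S g" using assms Ck_continuous by (metis continuous_on_cong)
  moreover have "\<forall>x\<in>S. (g has_derivative Df x) (at x within S)"
  proof
    fix x assume x: "x \<in> S"
    show "(g has_derivative Df x) (at x within S)"
      by (rule has_derivative_transform[OF x _ bspec[OF f(1) x]]) (use assms(1) in auto)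
  qed
  ultimately show ?thesis using f Suc by auto
qed

lemma Ck_subset: "Ck k T S f \<Longrightarrow> T' \<subseteq> T \<Longrightarrow> S' \<subseteq> S \<Longrightarrow> Ck k T' S' f"
proof (induction k arbitrary: f)
  case 0 then show ?case by (auto intro: continuous_on_subset)
next
  case (Suc k)
  then obtain Df where f: "\<forall>x\<in>S. (f has_derivative Df x) (at x within S)" "\<forall>h\<in>T. Ck k T S (\<lambda>x. Df x h)"
    by auto
  have "\<forall>x\<in>S'. (f has_derivative Df x) (at x within S')"
    using f(1) Suc.prems(3) has_derivative_subset by blast
  moreover have "\<forall>h\<in>T'. Ck k T' S' (\<lambda>x. Df x h)" using Suc f(2) by blast
  moreover have "continuous_on S' f" using Suc.prems continuous_on_subset by auto
  ultimately show ?case by auto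
qed

lemma smooth_const [simp]: "smooth_on T S (\<lambda>x. c)" by (simp add: smooth_on_def)
lemma smooth_bounded_linear: "bounded_linear f \<Longrightarrow> smooth_on T S f"
  by (simp add: smooth_on_def Ck_bounded_linear)
lemma smooth_add: "smooth_on T S f \<Longrightarrow> smooth_on T S g \<Longrightarrow> smooth_on T S (\<lambda>x. f x + g x)"
  by (simp add: smooth_on_def Ck_add)
lemma smooth_mult: "smooth_on T S f \<Longrightarrow> smooth_on T S g \<Longrightarrow> smooth_on T S (\<lambda>x. f x * g x)"
  by (simp add: smooth_on_def Ck_mult)
lemma smooth_cmult: "smooth_on T S f \<Longrightarrow> smooth_on T S (\<lambda>x. c * f x)"
  by (intro smooth_mult smooth_const)
lemma smooth_minus: "smooth_on T S f \<Longrightarrow> smooth_on T S (\<lambda>x. - f x)"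
  using smooth_cmult[of T S f "- 1"] by simp
lemma smooth_diff: "smooth_on T S f \<Longrightarrow> smooth_on T S g \<Longrightarrow> smooth_on T S (\<lambda>x. f x - g x)"
  using smooth_add[OF _ smooth_minus, of T S f g] by simp
lemma smooth_sum: "(\<And>i. i \<in> I \<Longrightarrow> smooth_on T S (f i)) \<Longrightarrow> smooth_on T S (\<lambda>x. \<Sum>i\<in>I. f i x)"
  by (induction I rule: infinite_finite_induct) (auto intro: smooth_add)
lemma smooth_inverse: "smooth_on T S f \<Longrightarrow> (\<And>x. x \<in> S \<Longrightarrow> f x \<noteq> 0) \<Longrightarrow> smooth_on T S (\<lambda>x. inverse (f x))"
  by (simp add: smooth_on_def Ck_inverse)
lemma smooth_cong: "smooth_on T S f \<Longrightarrow> (\<And>x. x \<in> S \<Longrightarrow> f x = g x) \<Longrightarrow> smooth_on T S g"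
  unfolding smooth_on_def using Ck_cong by blast
lemma smooth_subset: "smooth_on T S f \<Longrightarrow> T' \<subseteq> T \<Longrightarrow> S' \<subseteq> S \<Longrightarrow> smooth_on T' S' f"
  unfolding smooth_on_def using Ck_subset by blast
lemma smooth_continuous: "smooth_on T S f \<Longrightarrow> continuous_on S f"
  unfolding smooth_on_def using Ck_continuous by blast

text \<open>Meant for the family of all extended iterated derivatives at once, which spares a
  separate induction on the order for each function.\<close>

lemma smooth_coinduct:
  assumes F: "\<And>f. f \<in> F \<Longrightarrow> \<exists>Df. (\<forall>x\<in>S. (f has_derivative Df x) (at x within S)) \<and> (\<forall>h\<in>T. (\<lambda>x. Df x h) \<in> F)"
    and f: "f \<in> F"
  shows "smooth_on T S f"
proof -
  have cont: "continuous_on S f" if "f \<in> F" for f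
    using F[OF that] has_derivative_continuous_on by blast
  have "Ck k T S f" if "f \<in> F" for k f
    using that
  proof (induction k arbitrary: f)
    case 0 then show ?case using cont by simp
  next
    case (Suc k)
    then obtain Df where "\<forall>x\<in>S. (f has_derivative Df x) (at x within S)" "\<forall>h\<in>T. (\<lambda>x. Df x h) \<in> F"
      using F by blast
    then show ?case using Suc cont by auto
  qed
  then show ?thesis using f by (simp add: smooth_on_def)
qed

text \<open>A derivative within \<open>S\<close> is undetermined in directions off \<open>T\<close>.
  For a direction in \<open>T\<close>, restriction to a short line in \<open>S\<close> gives an
  ordinary derivative in one variable.\<close>

lemma ropen_derivative_unique:
  assumes S: "ropen T S" and x: "x \<in> S" and h: "h \<in> T"
    and D: "(f has_derivative D1) (at x within S)" "(f has_derivative D2) (at x within S)"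
  shows "D1 h = D2 h"
proof -
  obtain \<delta> where \<delta>: "0 < \<delta>" "\<And>h. h \<in> T \<Longrightarrow> norm h < \<delta> \<Longrightarrow> x + h \<in> S"
    using S x unfolding ropen_def by blast
  have T: "subspace T" using S by (simp add: ropen_def)
  define U where "U = ball (0::real) (\<delta> / (norm h + 1))"
  have U0: "0 \<in> U" "open U" using \<delta> by (auto simp: U_def add_nonneg_pos)
  have US: "x + t *\<^sub>R h \<in> S" if "t \<in> U" for t
  proof (rule \<delta>(2))
    show "t *\<^sub>R h \<in> T" using h T by (simp add: subspace_scale)
    have "0 < norm h + 1" by (simp add: add_nonneg_pos)
    then have "\<bar>t\<bar> * (norm h + 1) < \<delta>" using that unfolding U_def by (simp add: pos_less_divide_eq)
    then show "norm (t *\<^sub>R h) < \<delta>"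
      using abs_ge_zero[of t] unfolding norm_scaleR distrib_left by linarith
  qed
  have *: "((\<lambda>t. f (x + t *\<^sub>R h)) has_derivative (\<lambda>t. D (t *\<^sub>R h))) (at 0)"
    if D: "(f has_derivative D) (at x within S)" for D
  proof -
    have "((\<lambda>t. x + t *\<^sub>R h) has_derivative (\<lambda>t. t *\<^sub>R h)) (at 0 within U)"
      by (auto intro!: derivative_eq_intros)
    moreover have "(f has_derivative D) (at (x + 0 *\<^sub>R h) within (\<lambda>t. x + t *\<^sub>R h) ` U)"
      using has_derivative_subset[OF D, of "(\<lambda>t. x + t *\<^sub>R h) ` U"] US by auto
    ultimately have "((\<lambda>t. f (x + t *\<^sub>R h)) has_derivative (\<lambda>t. D (t *\<^sub>R h))) (at 0 within U)"
      by (rule has_derivative_in_compose)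
    then show ?thesis using at_within_open[OF U0] by simp
  qed
  from has_derivative_unique[OF *[OF D(1)] *[OF D(2)]]
  have "D1 (1 *\<^sub>R h) = D2 (1 *\<^sub>R h)" by (rule fun_cong)
  then show ?thesis by simp
qed

text \<open>\<open>Ck\<close> supplies derivatives existentially, possibly different ones for each
  order. Taking the gradient inside \<open>T\<close> normalises the choice, so that one map serves
  all orders.\<close>

lemma smooth_gradient:
  assumes f: "smooth_on T S f" and S: "ropen T S"
  obtains g where "\<And>x. x \<in> S \<Longrightarrow> (f has_derivative (\<lambda>h. g x \<bullet> h)) (at x within S)"
    "\<And>x. g x \<in> T" "\<And>c. smooth_on T S (\<lambda>x. g x \<bullet> c)" "continuous_on S g"
proof -
  have T: "subspace T" and ST: "S \<subseteq> T" using S by (auto simp: ropen_def)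
  have "Ck (Suc 0) T S f" using f unfolding smooth_on_def by blast
  then obtain Df where D: "\<And>x. x \<in> S \<Longrightarrow> (f has_derivative Df x) (at x within S)" by auto
  obtain B where B: "B \<subseteq> T" "pairwise orthogonal B" "\<And>b. b \<in> B \<Longrightarrow> norm b = 1"
     "independent B" "card B = dim T" "span B = T"
    using orthonormal_basis_subspace[OF T] by metis
  have finB: "finite B" using B(4) by (simp add: independent_imp_finite)
  have oB: "e \<bullet> e' = (if e = e' then 1 else 0)" if "e \<in> B" "e' \<in> B" for e e'
    using B(2,3) that by (auto simp: pairwise_def orthogonal_def dot_square_norm)
  define g where "g x = (\<Sum>b\<in>B. Df x b *\<^sub>R b)" for x
  \<comment> \<open>The derivative provided at order k need not be \<open>Df\<close>, but both agree
    on \<open>T\<close>.\<close>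
  have smooth_germ: "smooth_on T S (\<lambda>x. Df x h)" if h: "h \<in> T" for h
    unfolding smooth_on_def
  proof
    fix k
    have "Ck (Suc k) T S f" using f unfolding smooth_on_def by blast
    then obtain D' where D': "\<And>x. x \<in> S \<Longrightarrow> (f has_derivative D' x) (at x within S)" "Ck k T S (\<lambda>x. D' x h)"
      using h by auto
    show "Ck k T S (\<lambda>x. Df x h)"
      by (rule Ck_cong[OF ropen_derivative_unique[OF S _ h D'(1) D] D'(2)])
  qed
  have gh: "g x \<bullet> h = Df x h" if x: "x \<in> S" and h: "h \<in> T" for x h
  proof -
    have lin: "linear (Df x)" using D[OF x] has_derivative_linear by blast
    have "h = (\<Sum>b\<in>B. (h \<bullet> b) *\<^sub>R b)" by (rule orthonormal_expand[OF finB oB]) (use B(6) h in auto)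
    then have "Df x h = Df x (\<Sum>b\<in>B. (h \<bullet> b) *\<^sub>R b)" by simp
    also have "\<dots> = (\<Sum>b\<in>B. (h \<bullet> b) * Df x b)" by (simp add: linear_sum[OF lin] linear_cmul[OF lin])
    also have "\<dots> = g x \<bullet> h" unfolding g_def inner_sum_left inner_scaleR_left
      by (intro sum.cong) (simp_all add: inner_commute)
    finally show ?thesis by simp
  qed
  show thesis
  proof (rule that)
    show "(f has_derivative (\<lambda>h. g x \<bullet> h)) (at x within S)" if x: "x \<in> S" for x
    proof -
      have 1: "((\<lambda>y. (1 / norm (y - x)) *\<^sub>R (f y - (f x + Df x (y - x)))) \<longlongrightarrow> 0) (at x within S)"
        using D[OF x] unfolding has_derivative_within by blast
      have "((\<lambda>y. (1 / norm (y - x)) *\<^sub>R (f y - (f x + g x \<bullet> (y - x)))) \<longlongrightarrow> 0) (at x within S)"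
      proof (rule Lim_transform_eventually[OF 1])
        show "\<forall>\<^sub>F y in at x within S. (1 / norm (y - x)) *\<^sub>R (f y - (f x + Df x (y - x)))
             = (1 / norm (y - x)) *\<^sub>R (f y - (f x + g x \<bullet> (y - x)))"
          unfolding eventually_at_filter
        proof (rule always_eventually, intro allI impI)
          fix y assume "y \<in> S"
          then have "y - x \<in> T" using x ST T by (auto intro: subspace_diff)
          from gh[OF x this] show "(1 / norm (y - x)) *\<^sub>R (f y - (f x + Df x (y - x)))
             = (1 / norm (y - x)) *\<^sub>R (f y - (f x + g x \<bullet> (y - x)))" by simp
        qed
      qed
      then show ?thesis unfolding has_derivative_within by (auto simp: bounded_linear_inner_right)
    qed
    show "g x \<in> T" for x unfolding g_def using B(1) T by (intro subspace_sum subspace_scale) auto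
    show gs: "smooth_on T S (\<lambda>x. g x \<bullet> c)" for c
      unfolding g_def inner_sum_left inner_scaleR_left
      using B(1) by (intro smooth_sum smooth_mult smooth_const smooth_germ) auto
    show "continuous_on S g" unfolding g_def
      using B(1) by (intro continuous_intros smooth_continuous[OF smooth_germ]) auto
  qed
qed

section \<open>Division of smooth functions by a linear form\<close>

text \<open>\<open>A t\<close> multiplies the coordinate along \<open>a\<close> by t and keeps the
  others. The weight \<open>t ^ m\<close> is there because differentiation along \<open>a\<close>
  produces a further factor t: the family with all weights is closed under differentiation.\<close>

lemma integral_family_smooth:
  fixes a :: "'v::euclidean_space"
  assumes T: "subspace T" and a: "a \<in> T" "norm a = 1" and S: "S = T \<inter> ball 0 r"
  defines "A \<equiv> \<lambda>t x. x - ((1 - t) * (x \<bullet> a)) *\<^sub>R a"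
  shows "smooth_on T S \<psi> \<Longrightarrow> smooth_on T S (\<lambda>x. integral (cbox 0 1) (\<lambda>t. t ^ m * \<psi> (A t x)))"
proof -
  have rS: "ropen T S" unfolding S by (rule ropen_ball[OF T])
  have cS: "convex S" unfolding S by (intro convex_Int subspace_imp_convex T convex_ball)
  have aa: "a \<bullet> a = 1" using a by (simp add: dot_square_norm)
  have AS: "A t x \<in> S" if "x \<in> S" "t \<in> cbox 0 (1::real)" for t x
  proof -
    let ?s = "x \<bullet> a"
    have "(norm (A t x))\<^sup>2 = (norm x)\<^sup>2 - (1 - t\<^sup>2) * ?s\<^sup>2"
      unfolding power2_norm_eq_inner A_def
      by (simp add: inner_diff_left inner_diff_right inner_commute[of a x] aa power2_eq_square algebra_simps)
    also have "\<dots> \<le> (norm x)\<^sup>2" using that(2) by (simp add: power_le_one)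
    finally have "norm (A t x) \<le> norm x" by (rule power2_le_imp_le) simp
    moreover have "A t x \<in> T" using that a T unfolding A_def S by (auto intro: subspace_diff subspace_scale)
    ultimately show ?thesis using that by (simp add: S)
  qed
  have Asym: "u \<bullet> A t h = A t u \<bullet> h" for u t h
    by (simp add: A_def inner_diff_left inner_diff_right inner_commute[of a] algebra_simps)
  have contA: "continuous_on (S \<times> cbox 0 1) (\<lambda>p. A (snd p) (fst p))"
    unfolding A_def by (intro continuous_intros)
  have cont: "continuous_on (S \<times> cbox 0 1) (\<lambda>p. g (A (snd p) (fst p)))" if "continuous_on S g" for g :: "'v \<Rightarrow> 'b::topological_space"
  proof -
    have "(\<lambda>p. A (snd p) (fst p)) ` (S \<times> cbox 0 1) \<subseteq> S" using AS by (auto simp del: cbox_interval)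
    from continuous_on_compose2[OF that contA this] show ?thesis .
  qed
  have int: "(\<lambda>t. t ^ m * g (A t x)) integrable_on cbox 0 1" if g: "continuous_on S g" and x: "x \<in> S" for g :: "'v \<Rightarrow> real" and x m
  proof (rule integrable_continuous)
    have "continuous_on (cbox 0 1) (\<lambda>t. A t x)" unfolding A_def by (intro continuous_intros)
    moreover have "(\<lambda>t. A t x) ` cbox 0 1 \<subseteq> S" using AS[OF x] by (auto simp del: cbox_interval)
    ultimately have "continuous_on (cbox 0 1) (\<lambda>t. g (A t x))" by (rule continuous_on_compose2[OF g])
    then show "continuous_on (cbox 0 1) (\<lambda>t. t ^ m * g (A t x))" by (intro continuous_intros)
  qed
  have deriv: "\<exists>g. (\<forall>c. smooth_on T S (\<lambda>x. g x \<bullet> c)) \<and> (\<forall>x\<in>S. ((\<lambda>x. integral (cbox 0 1) (\<lambda>t. t ^ m * \<psi> (A t x))) has_derivative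
     (\<lambda>h. integral (cbox 0 1) (\<lambda>t. t ^ m * (g (A t x) \<bullet> A t h)))) (at x within S)) \<and> continuous_on S g"
    if \<psi>: "smooth_on T S \<psi>" for \<psi> m
  proof -
    obtain g where g: "\<And>x. x \<in> S \<Longrightarrow> (\<psi> has_derivative (\<lambda>h. g x \<bullet> h)) (at x within S)"
      "\<And>x. g x \<in> T" "\<And>c. smooth_on T S (\<lambda>x. g x \<bullet> c)" "continuous_on S g"
      by (rule smooth_gradient[OF \<psi> rS]) blast
    define fx where "fx x t = blinfun_inner_right (t ^ m *\<^sub>R A t (g (A t x)))" for x and t :: real
    have fxa: "blinfun_apply (fx x t) h = t ^ m * (g (A t x) \<bullet> A t h)" for x t h
      by (simp add: fx_def blinfun_inner_right.rep_eq Asym)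
    have cfx: "continuous_on (S \<times> cbox 0 1) (\<lambda>(x, t). fx x t)"
    proof -
      have "continuous_on (S \<times> cbox 0 1) (\<lambda>p. g (A (snd p) (fst p)))" by (rule cont[OF g(4)])
      moreover define u where "u p = g (A (snd p) (fst p))" for p
      ultimately have "continuous_on (S \<times> cbox 0 1) u" by simp
      then have "continuous_on (S \<times> cbox 0 1) (\<lambda>p. (snd p) ^ m *\<^sub>R (u p - ((1 - snd p) * (u p \<bullet> a)) *\<^sub>R a))"
        by (intro continuous_intros)
      then have "continuous_on (S \<times> cbox 0 1) (\<lambda>p. (snd p) ^ m *\<^sub>R A (snd p) (g (A (snd p) (fst p))))"
        by (simp only: A_def u_def)
      then show ?thesis unfolding fx_def split_beta
        by (intro bounded_linear.continuous_on[OF bounded_linear_blinfun_inner_right])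
    qed
    have der: "((\<lambda>x. integral (cbox 0 1) (\<lambda>t. t ^ m * \<psi> (A t x))) has_derivative
       blinfun_apply (integral (cbox 0 1) (fx x))) (at x within S)" if x: "x \<in> S" for x
    proof (rule leibniz_rule[OF _ _ cfx x cS])
      show "(\<lambda>t. t ^ m * \<psi> (A t y)) integrable_on cbox 0 1" if "y \<in> S" for y
        by (rule int[OF smooth_continuous[OF \<psi>] that])
      fix y and t :: real assume y: "y \<in> S" and t: "t \<in> cbox 0 1"
      have blA: "bounded_linear (A t)" unfolding A_def
        by (intro bounded_linear_sub bounded_linear_ident bounded_linear_scaleR_const bounded_linear_const_mult bounded_linear_inner_left)
      have "(\<psi> has_derivative (\<lambda>h. g (A t y) \<bullet> h)) (at (A t y) within A t ` S)"
        by (rule has_derivative_subset[OF g(1)[OF AS[OF y t]]]) (use AS t in auto)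
      from has_derivative_in_compose[OF bounded_linear_imp_has_derivative[OF blA] this]
      have "((\<lambda>x. \<psi> (A t x)) has_derivative (\<lambda>h. g (A t y) \<bullet> A t h)) (at y within S)" .
      then have "((\<lambda>x. t ^ m * \<psi> (A t x)) has_derivative (\<lambda>h. t ^ m * (g (A t y) \<bullet> A t h))) (at y within S)"
        by (rule has_derivative_mult_right)
      then show "((\<lambda>x. t ^ m * \<psi> (A t x)) has_derivative blinfun_apply (fx y t)) (at y within S)"
        by (simp add: fxa[abs_def])
    qed
    have "blinfun_apply (integral (cbox 0 1) (fx x)) = (\<lambda>h. integral (cbox 0 1) (\<lambda>t. t ^ m * (g (A t x) \<bullet> A t h)))" if x: "x \<in> S" for x
    proof
      fix h
      have "continuous_on (cbox 0 1) (\<lambda>t. (\<lambda>(x, t). fx x t) (x, t))"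
        by (rule continuous_on_compose2[OF cfx]) (use x in \<open>auto intro!: continuous_intros\<close>)
      then have "fx x integrable_on cbox 0 1" by (intro integrable_continuous) simp
      from blinfun_apply_integral[OF this]
      show "blinfun_apply (integral (cbox 0 1) (fx x)) h = integral (cbox 0 1) (\<lambda>t. t ^ m * (g (A t x) \<bullet> A t h))"
        by (simp add: fxa)
    qed
    then have "((\<lambda>x. integral (cbox 0 1) (\<lambda>t. t ^ m * \<psi> (A t x))) has_derivative
     (\<lambda>h. integral (cbox 0 1) (\<lambda>t. t ^ m * (g (A t x) \<bullet> A t h)))) (at x within S)" if "x \<in> S" for x
      using der[OF that] that by (simp only:)
    then show ?thesis using g(3,4) by (intro exI[of _ g] conjI allI ballI)
  qed
  have main: "Ck k T S (\<lambda>x. integral (cbox 0 1) (\<lambda>t. t ^ m * \<psi> (A t x)))" if "smooth_on T S \<psi>" for k m \<psi>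
    using that
  proof (induction k arbitrary: m \<psi>)
    case 0
    from deriv[OF 0, of m] obtain g where
      D: "\<forall>x\<in>S. ((\<lambda>x. integral (cbox 0 1) (\<lambda>t. t ^ m * \<psi> (A t x))) has_derivative
     (\<lambda>h. integral (cbox 0 1) (\<lambda>t. t ^ m * (g (A t x) \<bullet> A t h)))) (at x within S)"
      by (elim exE conjE)
    have "continuous_on S (\<lambda>x. integral (cbox 0 1) (\<lambda>t. t ^ m * \<psi> (A t x)))"
      by (rule has_derivative_continuous_on[OF bspec[OF D]])
    then show ?case by (simp only: Ck.simps)
  next
    case (Suc k)
    from deriv[OF Suc.prems, of m] obtain g where g0: "\<forall>c. smooth_on T S (\<lambda>x. g x \<bullet> c)" and
      D: "\<forall>x\<in>S. ((\<lambda>x. integral (cbox 0 1) (\<lambda>t. t ^ m * \<psi> (A t x))) has_derivative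
     (\<lambda>h. integral (cbox 0 1) (\<lambda>t. t ^ m * (g (A t x) \<bullet> A t h)))) (at x within S)"
      by (elim exE conjE)
    note g = spec[OF g0]
    \<comment> \<open>Splits \<open>h\<close> into the part orthogonal to \<open>a\<close>, which
      \<open>A t\<close> fixes, and the part along \<open>a\<close>, which raises the weight by
      one.\<close>
    have eq: "integral (cbox 0 1) (\<lambda>t. t ^ m * (g (A t x) \<bullet> A t h))
        = integral (cbox 0 1) (\<lambda>t. t ^ m * (g (A t x) \<bullet> (h - (h \<bullet> a) *\<^sub>R a)))
        + (h \<bullet> a) * integral (cbox 0 1) (\<lambda>t. t ^ Suc m * (g (A t x) \<bullet> a))" if x: "x \<in> S" for x h
    proof -
      have i1: "(\<lambda>t. t ^ m * (g (A t x) \<bullet> c)) integrable_on cbox 0 1" for c m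
        by (rule int[OF smooth_continuous[OF g] x])
      have "integral (cbox 0 1) (\<lambda>t. t ^ m * (g (A t x) \<bullet> A t h))
         = integral (cbox 0 1) (\<lambda>t. t ^ m * (g (A t x) \<bullet> (h - (h \<bullet> a) *\<^sub>R a)) + (h \<bullet> a) * (t ^ Suc m * (g (A t x) \<bullet> a)))"
      proof (rule integral_cong)
        fix t :: real
        have Ah: "A t h = h - ((1 - t) * (h \<bullet> a)) *\<^sub>R a" by (simp only: A_def)
        show "t ^ m * (g (A t x) \<bullet> A t h) = t ^ m * (g (A t x) \<bullet> (h - (h \<bullet> a) *\<^sub>R a)) + (h \<bullet> a) * (t ^ Suc m * (g (A t x) \<bullet> a))"
          unfolding Ah inner_diff_right inner_scaleR_right power_Suc by algebra
      qed
      also have "\<dots> = integral (cbox 0 1) (\<lambda>t. t ^ m * (g (A t x) \<bullet> (h - (h \<bullet> a) *\<^sub>R a)))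
        + integral (cbox 0 1) (\<lambda>t. (h \<bullet> a) * (t ^ Suc m * (g (A t x) \<bullet> a)))"
        by (intro integral_add i1 integrable_on_mult_right)
      finally show ?thesis by (simp only: integral_mult_right)
    qed
    have "Ck k T S (\<lambda>x. integral (cbox 0 1) (\<lambda>t. t ^ m * (g (A t x) \<bullet> A t h)))" for h
    proof -
      have "Ck k T S (\<lambda>x. integral (cbox 0 1) (\<lambda>t. t ^ m * (g (A t x) \<bullet> (h - (h \<bullet> a) *\<^sub>R a)))
        + (h \<bullet> a) * integral (cbox 0 1) (\<lambda>t. t ^ Suc m * (g (A t x) \<bullet> a)))"
        using Suc.IH[OF g, of m "h - (h \<bullet> a) *\<^sub>R a"] Suc.IH[OF g, of "Suc m" a]
        by (intro Ck_add Ck_mult Ck_const)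
      from Ck_cong[OF _ this] eq[symmetric] show ?thesis .
    qed
    moreover have "continuous_on S (\<lambda>x. integral (cbox 0 1) (\<lambda>t. t ^ m * \<psi> (A t x)))"
      by (rule has_derivative_continuous_on[OF bspec[OF D]])
    ultimately show ?case using D unfolding Ck.simps
      by (intro conjI exI[of _ "\<lambda>x h. integral (cbox 0 1) (\<lambda>t. t ^ m * (g (A t x) \<bullet> A t h))"] ballI)
         (assumption | rule bspec[OF D], assumption)+
  qed
  show "smooth_on T S \<psi> \<Longrightarrow> smooth_on T S (\<lambda>x. integral (cbox 0 1) (\<lambda>t. t ^ m * \<psi> (A t x)))"
    unfolding smooth_on_def[of T S "\<lambda>x. integral (cbox 0 1) (\<lambda>t. t ^ m * \<psi> (A t x))"]
    by (intro allI main)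
qed

text \<open>The quotient is the average of the derivative along \<open>a\<close> over the segment
  from the foot \<open>A 0 x\<close>, where \<open>g\<close> vanishes, to \<open>x\<close>.\<close>

lemma hadamard_division:
  fixes a :: "'v::euclidean_space"
  assumes T: "subspace T" and a: "a \<in> T" "norm a = 1" and S: "S = T \<inter> ball 0 r"
    and g: "smooth_on T S g" and van: "\<And>x. x \<in> S \<Longrightarrow> x \<bullet> a = 0 \<Longrightarrow> g x = 0"
  obtains q where "smooth_on T S q" "\<And>x. x \<in> S \<Longrightarrow> g x = (x \<bullet> a) * q x"
proof -
  define A where "A = (\<lambda>t x. x - ((1 - t) * (x \<bullet> a)) *\<^sub>R a)"
  have rS: "ropen T S" unfolding S by (rule ropen_ball[OF T])
  have aa: "a \<bullet> a = 1" using a by (simp add: dot_square_norm)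
  have AS: "A t x \<in> S" if "x \<in> S" "t \<in> cbox 0 (1::real)" for t x
  proof -
    let ?s = "x \<bullet> a"
    have "(norm (A t x))\<^sup>2 = (norm x)\<^sup>2 - (1 - t\<^sup>2) * ?s\<^sup>2"
      unfolding power2_norm_eq_inner A_def
      by (simp add: inner_diff_left inner_diff_right inner_commute[of a x] aa power2_eq_square algebra_simps)
    also have "\<dots> \<le> (norm x)\<^sup>2" using that(2) by (simp add: power_le_one)
    finally have "norm (A t x) \<le> norm x" by (rule power2_le_imp_le) simp
    moreover have "A t x \<in> T" using that a T unfolding A_def S by (auto intro: subspace_diff subspace_scale)
    ultimately show ?thesis using that by (simp add: S)
  qed
  obtain gr where gr: "\<And>x. x \<in> S \<Longrightarrow> (g has_derivative (\<lambda>h. gr x \<bullet> h)) (at x within S)"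
      "\<And>x. gr x \<in> T" "\<And>c. smooth_on T S (\<lambda>x. gr x \<bullet> c)" "continuous_on S gr"
    by (rule smooth_gradient[OF g rS]) blast
  define q where "q x = integral (cbox 0 1) (\<lambda>t. t ^ 0 * (gr (A t x) \<bullet> a))" for x
  have "smooth_on T S q" unfolding q_def A_def
    by (rule integral_family_smooth[OF T a S gr(3)])
  moreover have "g x = (x \<bullet> a) * q x" if x: "x \<in> S" for x
  proof -
    have "((\<lambda>t. g (A t x)) has_vector_derivative (x \<bullet> a) * (gr (A t x) \<bullet> a)) (at t within {0..1})" if t: "t \<in> {0..1}" for t
    proof -
      have d: "((\<lambda>t. A t x) has_derivative (\<lambda>s. (s * (x \<bullet> a)) *\<^sub>R a)) (at t within {0..1})"
        unfolding A_def by (auto intro!: derivative_eq_intros simp: algebra_simps)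
      have "(g has_derivative (\<lambda>h. gr (A t x) \<bullet> h)) (at (A t x) within (\<lambda>t. A t x) ` {0..1})"
        by (rule has_derivative_subset[OF gr(1)[OF AS[OF x]]]) (use AS[OF x] t in auto)
      from has_derivative_in_compose[OF d this]
      show ?thesis unfolding has_vector_derivative_def by (simp add: algebra_simps)
    qed
    then have "((\<lambda>t. (x \<bullet> a) * (gr (A t x) \<bullet> a)) has_integral (g (A 1 x) - g (A 0 x))) {0..1}"
      by (intro fundamental_theorem_of_calculus) auto
    then have "g (A 1 x) - g (A 0 x) = integral {0..1} (\<lambda>t. (x \<bullet> a) * (gr (A t x) \<bullet> a))"
      by (rule integral_unique[symmetric])
    also have "\<dots> = (x \<bullet> a) * q x" by (simp add: q_def)
    finally have "g (A 1 x) - g (A 0 x) = (x \<bullet> a) * q x" .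
    moreover have "g (A 0 x) = 0"
      using AS[OF x, of 0] by (intro van) (auto simp: A_def inner_diff_left aa)
    moreover have "A 1 x = x" by (simp add: A_def)
    ultimately show ?thesis by simp
  qed
  ultimately show thesis by (rule that)
qed

section \<open>Equivariant tensor fields\<close>

text \<open>Arguments are lists so that a direction of differentiation is prepended by
  \<open>#\<close>. Nothing is required on lists of other lengths.\<close>

definition mlin :: "nat \<Rightarrow> ('v::real_vector list \<Rightarrow> real) \<Rightarrow> bool" where
  "mlin q t \<longleftrightarrow> (\<forall>xs ys. length xs + length ys + 1 = q \<longrightarrow> linear (\<lambda>w. t (xs @ w # ys)))"

text \<open>The Lie algebra acting on tensors as a derivation, without the minus sign of the dual
  action; that sign appears in \<open>field_L_derivative\<close>.\<close>

definition act :: "('v::real_normed_vector \<Rightarrow>\<^sub>L 'v) \<Rightarrow> ('v list \<Rightarrow> real) \<Rightarrow> 'v list \<Rightarrow> real" where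
  "act X t ws = (\<Sum>i<length ws. t (ws[i := blinfun_apply X (ws ! i)]))"

lemma mlinD: "mlin q t \<Longrightarrow> length xs + length ys + 1 = q \<Longrightarrow> linear (\<lambda>w. t (xs @ w # ys))"
  by (simp add: mlin_def)

lemma mlin_expand:
  fixes t :: "'v::euclidean_space list \<Rightarrow> real"
  assumes "mlin q t" "length xs + length ys + 1 = q"
  shows "t (xs @ w # ys) = (\<Sum>b\<in>Basis. (w \<bullet> b) * t (xs @ b # ys))"
proof -
  note lin = mlinD[OF assms]
  have "t (xs @ w # ys) = t (xs @ (\<Sum>b\<in>Basis. (w \<bullet> b) *\<^sub>R b) # ys)" by (simp add: euclidean_representation)
  then show ?thesis by (simp add: linear_sum[OF lin] linear_cmul[OF lin])
qed

text \<open>The product rule over the slots. Expanding one slot in the standard basis reduces it to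
  the product rule for two real functions; the inert tail \<open>ws2\<close> collects the slots
  already expanded.\<close>

lemma mlin_map_deriv:
  fixes t :: "'v::euclidean_space list \<Rightarrow> real"
  assumes t: "mlin q t" and h: "(h has_vector_derivative X) (at 0)" "h 0 = id_blinfun"
  shows "length ws1 + length ws2 = q \<Longrightarrow>
    ((\<lambda>s. t (map (blinfun_apply (h s)) ws1 @ ws2)) has_vector_derivative
       (\<Sum>i<length ws1. t ((ws1 @ ws2)[i := blinfun_apply X (ws1 ! i)]))) (at 0)"
proof (induction ws1 arbitrary: ws2 rule: rev_induct)
  case Nil then show ?case by simp
next
  case (snoc w ws1)
  have len: "length ws1 + length ws2 + 1 = q" using snoc.prems by simp
  let ?D = "\<lambda>b. \<Sum>i<length ws1. t ((ws1 @ b # ws2)[i := blinfun_apply X (ws1 ! i)])"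
  have mid: "map (blinfun_apply id_blinfun) ws1 = ws1" by (simp add: map_idI)
  have "((\<lambda>s. (blinfun_apply (h s) w \<bullet> b) * t (map (blinfun_apply (h s)) ws1 @ b # ws2)) has_vector_derivative
      (w \<bullet> b) * ?D b + (blinfun_apply X w \<bullet> b) * t (ws1 @ b # ws2)) (at 0)" for b
  proof -
    have 1: "((\<lambda>s. blinfun_apply (h s) w \<bullet> b) has_vector_derivative blinfun_apply X w \<bullet> b) (at 0)"
      by (intro bounded_linear.has_vector_derivative[OF bounded_linear_inner_left]
          bounded_linear.has_vector_derivative[OF blinfun.bounded_linear_left] h)
    have 2: "((\<lambda>s. t (map (blinfun_apply (h s)) ws1 @ b # ws2)) has_vector_derivative ?D b) (at 0)"
      using snoc.IH[of "b # ws2"] len by simp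
    show ?thesis using has_vector_derivative_mult[OF 1 2] by (simp add: h(2) mid)
  qed
  then have "((\<lambda>s. \<Sum>b\<in>Basis. (blinfun_apply (h s) w \<bullet> b) * t (map (blinfun_apply (h s)) ws1 @ b # ws2)) has_vector_derivative
      (\<Sum>b\<in>Basis. (w \<bullet> b) * ?D b + (blinfun_apply X w \<bullet> b) * t (ws1 @ b # ws2))) (at 0)"
    by (intro has_vector_derivative_sum) auto
  moreover have "t (map (blinfun_apply (h s)) (ws1 @ [w]) @ ws2)
      = (\<Sum>b\<in>Basis. (blinfun_apply (h s) w \<bullet> b) * t (map (blinfun_apply (h s)) ws1 @ b # ws2))" for s
    using mlin_expand[OF t, of "map (blinfun_apply (h s)) ws1" ws2 "blinfun_apply (h s) w"] len by simp
  moreover have "(\<Sum>b\<in>Basis. (w \<bullet> b) * ?D b + (blinfun_apply X w \<bullet> b) * t (ws1 @ b # ws2))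
     = (\<Sum>i<length (ws1 @ [w]). t (((ws1 @ [w]) @ ws2)[i := blinfun_apply X ((ws1 @ [w]) ! i)]))"
  proof -
    have "(\<Sum>b\<in>Basis. (w \<bullet> b) * ?D b) = (\<Sum>i<length ws1. \<Sum>b\<in>Basis. (w \<bullet> b) * t (ws1[i := blinfun_apply X (ws1 ! i)] @ b # ws2))"
      unfolding sum_distrib_left by (subst sum.swap) (simp add: list_update_append)
    also have "\<dots> = (\<Sum>i<length ws1. t (ws1[i := blinfun_apply X (ws1 ! i)] @ w # ws2))"
      using mlin_expand[OF t, of _ ws2 w] len by (intro sum.cong) auto
    also have "\<dots> = (\<Sum>i<length ws1. t (((ws1 @ [w]) @ ws2)[i := blinfun_apply X ((ws1 @ [w]) ! i)]))"
      by (intro sum.cong) (auto simp: list_update_append nth_append)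
    finally have A: "(\<Sum>b\<in>Basis. (w \<bullet> b) * ?D b) = \<dots>" .
    have B: "(\<Sum>b\<in>Basis. (blinfun_apply X w \<bullet> b) * t (ws1 @ b # ws2)) = t (ws1 @ blinfun_apply X w # ws2)"
      using mlin_expand[OF t len, of "blinfun_apply X w"] by simp
    show ?thesis unfolding sum.distrib A B by (simp add: list_update_append nth_append)
  qed
  ultimately show ?case by simp
qed

lemma act_deriv:
  fixes t :: "'v::euclidean_space list \<Rightarrow> real"
  assumes "mlin (length ws) t" "(h has_vector_derivative X) (at 0)" "h 0 = id_blinfun"
  shows "((\<lambda>s. t (map (blinfun_apply (h s)) ws)) has_vector_derivative act X t ws) (at 0)"
  using mlin_map_deriv[OF assms, of ws "[]"] by (simp add: act_def)

lemma mlin_map_differentiable: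
  fixes t :: "'w \<Rightarrow> 'v::euclidean_space list \<Rightarrow> real" and \<zeta> :: "'u::real_normed_vector \<Rightarrow> 'w"
  assumes t: "\<And>v. mlin q (t v)" and \<gamma>: "\<gamma> differentiable (at x)"
    and d: "\<And>ws. length ws = q \<Longrightarrow> (\<lambda>v. t (\<zeta> v) ws) differentiable (at x)"
  shows "length ws1 + length ws2 = q \<Longrightarrow>
    (\<lambda>v. t (\<zeta> v) (map (blinfun_apply (\<gamma> v)) ws1 @ ws2)) differentiable (at x)"
proof (induction ws1 arbitrary: ws2 rule: rev_induct)
  case Nil then show ?case using d by simp
next
  case (snoc w ws1)
  have len: "length ws1 + length ws2 + 1 = q" using snoc.prems by simp
  have 1: "(\<lambda>v. blinfun_apply (\<gamma> v) w \<bullet> b) differentiable (at x)" for b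
  proof -
    obtain \<gamma>' where "(\<gamma> has_derivative \<gamma>') (at x)" using \<gamma> by (auto simp: differentiable_def)
    then have "((\<lambda>v. blinfun_apply (\<gamma> v) w \<bullet> b) has_derivative (\<lambda>u. blinfun_apply (\<gamma>' u) w \<bullet> b)) (at x)"
      by (intro bounded_linear.has_derivative[OF bounded_linear_inner_left]
          bounded_linear.has_derivative[OF blinfun.bounded_linear_left])
    then show ?thesis by (auto simp: differentiable_def)
  qed
  have "(\<lambda>v. \<Sum>b\<in>Basis. (blinfun_apply (\<gamma> v) w \<bullet> b) * t (\<zeta> v) (map (blinfun_apply (\<gamma> v)) ws1 @ b # ws2)) differentiable (at x)"
    using len by (intro differentiable_sum ballI differentiable_mult 1 snoc.IH) auto
  moreover have "t (\<zeta> v) (map (blinfun_apply (\<gamma> v)) (ws1 @ [w]) @ ws2)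
      = (\<Sum>b\<in>Basis. (blinfun_apply (\<gamma> v) w \<bullet> b) * t (\<zeta> v) (map (blinfun_apply (\<gamma> v)) ws1 @ b # ws2))" for v
    using mlin_expand[OF t[of "\<zeta> v"], of "map (blinfun_apply (\<gamma> v)) ws1" ws2 "blinfun_apply (\<gamma> v) w"] len by simp
  ultimately show ?case by simp
qed

context cogroup
begin

text \<open>As \<open>ex (- s X)\<close> need not be the inverse of \<open>ex (s X)\<close>, the
  derivative of the inverse is obtained from
  \<open>gi h - id_blinfun = - gi h (h - id_blinfun)\<close> and \<open>gi h\<close> tending to the
  identity.\<close>

lemma gi_ex_deriv: assumes X: "X \<in> L"
  shows "((\<lambda>s. gi (ex (s *\<^sub>R X))) has_vector_derivative - X) (at 0)"
proof -
  let ?h = "\<lambda>s. ex (s *\<^sub>R X)"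
  have hG: "?h s \<in> G" for s using ex_G[OF L_scale[OF X]] .
  have gi0: "gi (ex (0 *\<^sub>R X)) = id_blinfun"
    using gi_comp(1)[OF G_id] by simp
  have "((\<lambda>s. ?h s) \<longlongrightarrow> ?h 0) (at 0)"
    using has_vector_derivative_continuous[OF ex_deriv[OF X]] by (simp add: continuous_within)
  then have "((\<lambda>s. norm (?h s - id_blinfun)) \<longlongrightarrow> 0) (at 0)"
    by (simp add: LIM_zero tendsto_norm_zero)
  then have "((\<lambda>s. norm (gi (?h s) - id_blinfun)) \<longlongrightarrow> 0) (at 0)" by (simp add: gi_norm[OF hG])
  then have g1: "((\<lambda>s. gi (?h s)) \<longlongrightarrow> id_blinfun) (at 0)" by (metis LIM_zero_cancel tendsto_norm_zero_cancel)
  have "((\<lambda>s. (1 / s) *\<^sub>R (?h s - id_blinfun)) \<longlongrightarrow> X) (at 0)"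
    using vector_derivative_quotient(1)[OF ex_deriv[OF X]] by simp
  from tendsto_minus[OF tendsto_blinfun_compose[OF g1 this]]
  have "((\<lambda>s. (1 / s) *\<^sub>R (gi (?h s) - id_blinfun)) \<longlongrightarrow> - X) (at 0)"
    by (simp add: blc_simps hG scaleR_right_diff_distrib)
  from tendsto_norm_zero[OF LIM_zero[OF this]]
  have "((\<lambda>s. norm ((1 / s) *\<^sub>R (gi (?h s) - id_blinfun) - - X)) \<longlongrightarrow> 0) (at 0)" .
  moreover have "\<forall>\<^sub>F s in at 0. norm ((1 / s) *\<^sub>R (gi (?h s) - id_blinfun) - - X) = norm (gi (?h s) - id_blinfun - s *\<^sub>R (- X)) / norm s"
  proof (rule eventually_mono)
    show "\<forall>\<^sub>F s in at (0::real). s \<noteq> 0" by (simp add: eventually_at_filter)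
    fix s :: real assume s: "s \<noteq> 0"
    then have "(1 / s) *\<^sub>R (gi (?h s) - id_blinfun) - - X = (1 / s) *\<^sub>R (gi (?h s) - id_blinfun - s *\<^sub>R (- X))"
      by (simp add: scaleR_right_diff_distrib scaleR_right_distrib)
    then show "norm ((1 / s) *\<^sub>R (gi (?h s) - id_blinfun) - - X) = norm (gi (?h s) - id_blinfun - s *\<^sub>R (- X)) / norm s"
      by simp
  qed
  ultimately have "((\<lambda>s. norm (gi (?h s) - id_blinfun - s *\<^sub>R (- X)) / norm s) \<longlongrightarrow> 0) (at 0)"
    by (rule Lim_transform_eventually)
  then show ?thesis unfolding has_vector_derivative_def has_derivative_at
    using gi0 by (simp add: bounded_linear_minus[OF bounded_linear_scaleR_left])
qed

definition equiv_field :: "nat \<Rightarrow> ('v \<Rightarrow> 'v list \<Rightarrow> real) \<Rightarrow> bool" where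
  "equiv_field q t \<longleftrightarrow> (\<forall>v. mlin q (t v)) \<and>
     (\<forall>g\<in>G. \<forall>v ws. length ws = q \<longrightarrow> t (blinfun_apply g v) (map (blinfun_apply g) ws) = t v ws)"

lemma equiv_mlin: "equiv_field q t \<Longrightarrow> mlin q (t v)"
  and equiv_G: "equiv_field q t \<Longrightarrow> g \<in> G \<Longrightarrow> length ws = q \<Longrightarrow>
     t (blinfun_apply g v) (map (blinfun_apply g) ws) = t v ws"
  by (auto simp: equiv_field_def)

lemma equiv_gi: assumes "equiv_field q t" "g \<in> G" "length ws = q"
  shows "t (blinfun_apply g v) ws = t v (map (blinfun_apply (gi g)) ws)"
proof -
  have "t (blinfun_apply (gi g) (blinfun_apply g v)) (map (blinfun_apply (gi g)) ws) = t (blinfun_apply g v) ws"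
    by (rule equiv_G[OF assms(1) gi_G[OF assms(2)] assms(3)])
  then show ?thesis using assms(2) by simp
qed

text \<open>Differentiate the identity \<open>t (h v) ws = t v (map (gi h) ws)\<close> along
  \<open>h = ex (s X)\<close>. Derivatives along orbits are thereby algebraic expressions in the
  field itself.\<close>

lemma field_L_derivative:
  assumes t: "equiv_field q t" and ws: "length ws = q" and X: "X \<in> L"
    and D: "((\<lambda>v. t v ws) has_derivative D) (at v)"
  shows "D (blinfun_apply X v) = - act X (t v) ws"
proof -
  let ?h = "\<lambda>s. ex (s *\<^sub>R X)"
  have hG: "?h s \<in> G" for s using ex_G[OF L_scale[OF X]] .
  have "((\<lambda>s. blinfun_apply (?h s) v) has_vector_derivative blinfun_apply X v) (at 0)"
    by (rule apply_deriv[OF ex_deriv[OF X]])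
  moreover have "((\<lambda>v. t v ws) has_derivative D) (at (blinfun_apply (?h 0) v))" using D by simp
  ultimately have "((\<lambda>s. t (blinfun_apply (?h s) v) ws) has_derivative (\<lambda>s. D (s *\<^sub>R blinfun_apply X v))) (at 0)"
    unfolding has_vector_derivative_def by (rule has_derivative_compose)
  then have 1: "((\<lambda>s. t (blinfun_apply (?h s) v) ws) has_vector_derivative D (blinfun_apply X v)) (at 0)"
    unfolding has_vector_derivative_def
    using linear_cmul[OF has_derivative_linear[OF D]] by simp
  have "((\<lambda>s. t v (map (blinfun_apply (gi (?h s))) ws)) has_vector_derivative act (- X) (t v) ws) (at 0)"
    using gi_comp(1)[OF G_id] equiv_mlin[OF t] ws by (intro act_deriv gi_ex_deriv X) auto
  then have 2: "((\<lambda>s. t (blinfun_apply (?h s) v) ws) has_vector_derivative act (- X) (t v) ws) (at 0)"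
    using equiv_gi[OF t hG ws] by simp
  have "act (- X) (t v) ws = - act X (t v) ws"
    unfolding act_def sum_negf[symmetric]
  proof (rule sum.cong)
    fix i assume "i \<in> {..<length ws}"
    then have i: "i < length ws" by simp
    have lin: "linear (\<lambda>w. t v (take i ws @ w # drop (Suc i) ws))"
      by (rule mlinD[OF equiv_mlin[OF t]]) (use i ws in simp)
    show "t v (ws[i := blinfun_apply (- X) (ws ! i)]) = - t v (ws[i := blinfun_apply X (ws ! i)])"
      using linear_neg[OF lin, of "blinfun_apply X (ws ! i)"] i by (simp add: upd_conv_take_nth_drop bl_simps)
  qed simp
  then show ?thesis using vector_derivative_unique_at[OF 1 2] by simp
qed

lemma act_zero_of_invariant:
  assumes "mlin (length ws) t" "X \<in> L" "\<And>s. t (map (blinfun_apply (ex (s *\<^sub>R X))) ws) = t ws"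
  shows "act X t ws = 0"
proof -
  have "((\<lambda>s. t (map (blinfun_apply (ex (s *\<^sub>R X))) ws)) has_vector_derivative act X t ws) (at 0)"
    by (rule act_deriv[OF assms(1) ex_deriv[OF assms(2)]]) simp
  then have "((\<lambda>s. t ws) has_vector_derivative act X t ws) (at (0::real))" using assms(3) by simp
  then show ?thesis using vector_derivative_unique_at has_vector_derivative_const by blast
qed

end

section \<open>Returning to \<Sigma> near a regular point, differentiably\<close>

context roots
begin

text \<open>Elements carrying points \<open>v n\<close>, with limit \<open>x\<close>, into \<Sigma>
  subconverge to some \<open>h\<close> with \<open>h x\<close> in \<Sigma>. As \<open>x\<close> is
  regular, \<open>h\<close> normalises \<Sigma>; correcting by its inverse gives elements near the
  identity.\<close>

lemma near_section:
  assumes x: "x \<in> \<Sigma>" "reg x" and \<epsilon>: "0 < \<epsilon>"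
  shows "\<exists>\<delta>>0. \<forall>v. norm (v - x) < \<delta> \<longrightarrow> (\<exists>g\<in>G. blinfun_apply g v \<in> \<Sigma> \<and> norm (g - id_blinfun) < \<epsilon>)"
proof (rule ccontr)
  assume neg: "\<not> ?thesis"
  have "\<forall>n. \<exists>v. norm (v - x) < 1 / real (Suc n) \<and> (\<forall>g\<in>G. blinfun_apply g v \<in> \<Sigma> \<longrightarrow> \<epsilon> \<le> norm (g - id_blinfun))"
  proof
    fix n :: nat
    have "0 < 1 / real (Suc n)" by simp
    then show "\<exists>v. norm (v - x) < 1 / real (Suc n) \<and> (\<forall>g\<in>G. blinfun_apply g v \<in> \<Sigma> \<longrightarrow> \<epsilon> \<le> norm (g - id_blinfun))"
      using neg by (meson not_le)
  qed
  from choice[OF this] obtain v where v: "\<And>n. norm (v n - x) < 1 / real (Suc n)"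
    "\<And>n g. g \<in> G \<Longrightarrow> blinfun_apply g (v n) \<in> \<Sigma> \<Longrightarrow> \<epsilon> \<le> norm (g - id_blinfun)" by blast
  have l: "(\<lambda>n. 1 / real (Suc n)) \<longlonglongrightarrow> 0" using LIMSEQ_Suc[OF lim_1_over_n] by simp
  have "(\<lambda>n. v n - x) \<longlonglongrightarrow> 0"
    by (rule Lim_null_comparison[OF _ l]) (use v(1) in \<open>simp add: less_imp_le\<close>)
  then have vx: "v \<longlonglongrightarrow> x" by (rule LIM_zero_cancel)
  have "\<forall>n. \<exists>g. g \<in> G \<and> blinfun_apply g (v n) \<in> \<Sigma>" using meet\<Sigma> by blast
  from choice[OF this] obtain g where g: "\<And>n. g n \<in> G" "\<And>n. blinfun_apply (g n) (v n) \<in> \<Sigma>" by blast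
  obtain r h where r: "strict_mono (r :: nat \<Rightarrow> nat)" "h \<in> G" "(g \<circ> r) \<longlonglongrightarrow> h" by (rule G_subseq[OF g(1)])
  have lim: "(\<lambda>n. blinfun_apply (g (r n)) (v (r n))) \<longlonglongrightarrow> blinfun_apply h x"
    using r(3) LIMSEQ_subseq_LIMSEQ[OF vx r(1)] unfolding o_def by (intro tendsto_intros)
  have hx: "blinfun_apply h x \<in> \<Sigma>"
    by (rule closed_sequentially[OF closed_subspace[OF sub\<Sigma>] _ lim]) (rule g(2))
  have im: "blinfun_apply h ` \<Sigma> = \<Sigma>"
    by (rule G_image\<Sigma>[OF r(2)]) (rule reg_normalizer[OF r(2) x(1) hx x(2)])
  have gih: "blinfun_apply (gi h) s \<in> \<Sigma>" if "s \<in> \<Sigma>" for s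
  proof -
    have "s \<in> blinfun_apply h ` \<Sigma>" using that im by simp
    then obtain s' where "s = blinfun_apply h s'" "s' \<in> \<Sigma>" by (rule imageE)
    then show ?thesis using r(2) by simp
  qed
  obtain n where n: "norm (g (r n) - h) < \<epsilon>"
    using tendstoD[OF r(3) \<epsilon>] by (auto simp: eventually_sequentially dist_norm)
  have "\<epsilon> \<le> norm ((gi h o\<^sub>L g (r n)) - id_blinfun)"
    by (rule v(2)[of _ "r n"]) (use g r(2) gih in auto)
  then show False using n gi_diff_norm[OF r(2) g(1)[of "r n"]] by simp
qed

text \<open>The infinitesimal rotation moving \<open>x\<close> in direction \<open>u\<close> modulo \<open>\<Sigma>\<close>; its negative is the derivative of a
  local choice of group elements returning a neighbourhood of \<open>x\<close> to \<open>\<Sigma>\<close>.\<close>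

definition lift_dir :: "'v \<Rightarrow> 'v \<Rightarrow> ('v \<Rightarrow>\<^sub>L 'v)" where
  "lift_dir x u = (\<Sum>e\<in>E. ((u \<bullet> e) / (a e \<bullet> x)) *\<^sub>R XX e)"

lemma lift_dir_bounded_linear: "bounded_linear (lift_dir x)"
  unfolding lift_dir_def divide_inverse
  by (intro bounded_linear_sum bounded_linear_scaleR_const bounded_linear_mult_const bounded_linear_inner_left)

lemma error_term_identity:
  fixes \<eta> C d R n m b X :: real
  shows "(\<eta> * (2 * C * d) * R + 4 * C * d * n * (m * (3 * d))) / b * X
    = \<eta> * d * (X / b * (2 * C * R)) + d * d * (X * m / b * (12 * C * n))"
  unfolding divide_inverse by algebra

text \<open>An element near the identity carries \<open>v\<close> to some \<open>z\<close> in
  \<Sigma>, and \<open>orbit_lift\<close> returns from \<open>z\<close> to \<open>v\<close> by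
  \<open>h'\<close> with linear control; \<open>h' - id_blinfun\<close> is close to some
  \<open>W\<close> in \<open>L\<close>. The coefficients of \<open>W\<close> along the
  \<open>XX e\<close> can be read off from \<open>v - x\<close>. The rest of \<open>W\<close>
  annihilates \<Sigma> and is removed by a further group element fixing \<open>z\<close>.\<close>

lemma section_approx:
  assumes x: "x \<in> \<Sigma>" "reg x" and \<eta>: "0 < \<eta>"
  shows "\<exists>\<delta>>0. \<forall>v. norm (v - x) < \<delta> \<longrightarrow> (\<exists>g\<in>G. blinfun_apply g v \<in> \<Sigma> \<and>
     norm (g - id_blinfun + lift_dir x (v - x)) \<le> \<eta> * norm (v - x))"
proof -
  obtain \<epsilon>0 C where C: "0 < \<epsilon>0" "0 < C" and lift: "\<And>z h. norm (z - x) < \<epsilon>0 \<Longrightarrow> dim (LX z) = dim (LX x) \<Longrightarrow>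
     h \<in> G \<Longrightarrow> norm (h - id_blinfun) < \<epsilon>0 \<Longrightarrow>
     \<exists>h'\<in>G. blinfun_apply h' z = blinfun_apply h z \<and> norm (h' - id_blinfun) \<le> C * norm (blinfun_apply h z - z)"
    using orbit_lift[of x] by blast
  have b: "a e \<bullet> x \<noteq> 0" if "e \<in> E" for e using reg\<Sigma>[OF x(1)] x(2) that by blast
  define R where "R = norm x + 1"
  have R: "1 \<le> R" by (simp add: R_def)
  define s1 where "s1 = (\<Sum>e\<in>E. norm (XX e))"
  define s2 where "s2 = (\<Sum>e\<in>E. norm (XX e) / \<bar>a e \<bullet> x\<bar>)"
  define s3 where "s3 = (\<Sum>e\<in>E. norm (XX e) * norm (a e) / \<bar>a e \<bullet> x\<bar>)"
  have s: "0 \<le> s1" "0 \<le> s2" "0 \<le> s3" by (auto simp: s1_def s2_def s3_def intro!: sum_nonneg)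
  \<comment> \<open>\<open>C3 d\<close> will bound the part of \<open>W\<close> annihilating
    \<Sigma>, where d is the distance from \<open>v\<close> to \<open>x\<close>. \<open>A1\<close>
    and \<open>A2\<close> collect the coefficients of \<open>\<eta>' * d\<close> and of d squared in
    the final estimate.\<close>
  define C3 where "C3 = 4 * C * (1 + norm x0 * s1)"
  have C3: "0 < C3" using C s by (simp add: C3_def add_pos_nonneg)
  define A1 where "A1 = 2 * C + s2 * (2 * C * R)"
  define A2 where "A2 = 4 * C * C3 + C3\<^sup>2 + 4 * C\<^sup>2 + s3 * (12 * C * norm x0)"
  have A1: "0 \<le> A1" "0 \<le> A2" using C C3 s R by (auto simp: A1_def A2_def intro!: add_nonneg_nonneg mult_nonneg_nonneg)
  define \<eta>' where "\<eta>' = min 1 (min (1 / (2 * C * R)) (\<eta> / (2 * (A1 + 1))))"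
  have \<eta>': "0 < \<eta>'" "\<eta>' \<le> 1" "\<eta>' \<le> 1 / (2 * C * R)" "\<eta>' \<le> \<eta> / (2 * (A1 + 1))"
    using C R \<eta> A1 by (auto simp: \<eta>'_def)
  have \<eta>CR: "\<eta>' * C * R \<le> 1/2"
  proof -
    have "0 < 2 * C * R" using C R by simp
    then have "\<eta>' * (2 * C * R) \<le> 1" using \<eta>'(3) by (simp only: pos_le_divide_eq)
    then show ?thesis by (simp add: mult_ac)
  qed
  have \<eta>A: "A1 * \<eta>' \<le> \<eta> / 2"
  proof -
    have "0 < 2 * (A1 + 1)" using A1 by simp
    then have "\<eta>' * (2 * (A1 + 1)) \<le> \<eta>" using \<eta>'(4) by (simp only: pos_le_divide_eq)
    then show ?thesis using \<eta>'(1) by (simp add: algebra_simps)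
  qed
  obtain \<delta>1 where \<delta>1: "0 < \<delta>1" and tan: "\<And>g. g \<in> G \<Longrightarrow> norm (g - id_blinfun) < \<delta>1 \<Longrightarrow>
     \<exists>Y\<in>L. norm (g - id_blinfun - Y) \<le> \<eta>' * norm (g - id_blinfun)"
    using L_tangent[OF \<eta>'(1)] by blast
  obtain \<epsilon>2 where \<epsilon>2: "0 < \<epsilon>2" "ball x \<epsilon>2 \<subseteq> {v. reg v}"
    using open_reg x(2) unfolding open_contains_ball by blast
  \<comment> \<open>Small enough that \<open>z\<close> is regular and in the range of
    \<open>orbit_lift\<close>, and that \<open>h'\<close> is in the range of
    \<open>tan\<close>.\<close>
  define \<epsilon>1 where "\<epsilon>1 = min (min \<epsilon>0 1) (min \<epsilon>0 (min \<epsilon>2 (min 1 (\<delta>1 / (C + 1)))) / (2 * (R + 1)))"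
  have \<epsilon>1: "0 < \<epsilon>1" "\<epsilon>1 \<le> \<epsilon>0" "\<epsilon>1 \<le> 1" using C \<epsilon>2 R \<delta>1 by (auto simp: \<epsilon>1_def)
  have \<epsilon>1R: "2 * (R + 1) * \<epsilon>1 \<le> min \<epsilon>0 (min \<epsilon>2 (min 1 (\<delta>1 / (C + 1))))"
  proof -
    have "0 < 2 * (R + 1)" using R by simp
    moreover have "\<epsilon>1 \<le> min \<epsilon>0 (min \<epsilon>2 (min 1 (\<delta>1 / (C + 1)))) / (2 * (R + 1))" by (simp add: \<epsilon>1_def)
    ultimately show ?thesis by (simp only: pos_le_divide_eq mult.commute)
  qed
  obtain \<delta>3 where \<delta>3: "0 < \<delta>3" and near: "\<And>v. norm (v - x) < \<delta>3 \<Longrightarrow> \<exists>g\<in>G. blinfun_apply g v \<in> \<Sigma> \<and> norm (g - id_blinfun) < \<epsilon>1"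
    using near_section[OF x \<epsilon>1(1)] by blast
  define \<delta> where "\<delta> = min (min \<delta>3 \<epsilon>1) (min (1 / C3) (\<eta> / (2 * (A2 + 1))))"
  have \<delta>: "0 < \<delta>" "\<delta> \<le> \<delta>3" "\<delta> \<le> \<epsilon>1" "\<delta> \<le> 1 / C3" "\<delta> \<le> \<eta> / (2 * (A2 + 1))"
    using \<delta>3 \<epsilon>1 C3 \<eta> A1 by (auto simp: \<delta>_def)
  have "\<exists>g\<in>G. blinfun_apply g v \<in> \<Sigma> \<and> norm (g - id_blinfun + lift_dir x (v - x)) \<le> \<eta> * norm (v - x)"
    if v: "norm (v - x) < \<delta>" for v
  proof -
    define d where "d = norm (v - x)"
    have d: "0 \<le> d" "d < \<delta>" using v by (auto simp: d_def)
    have d1: "d < \<epsilon>1" "d \<le> 1" using d \<delta>(3) \<epsilon>1(3) by auto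
    obtain g where g: "g \<in> G" "blinfun_apply g v \<in> \<Sigma>" "norm (g - id_blinfun) < \<epsilon>1"
      using near[of v] v \<delta>(2) by auto
    define z where "z = blinfun_apply g v"
    have z\<Sigma>: "z \<in> \<Sigma>" using g by (simp add: z_def)
    have nv: "norm v \<le> R" using d1 norm_triangle_ineq[of x "v - x"] by (simp add: R_def d_def)
    have nz: "norm z \<le> R" using nv g by (simp add: z_def)
    have zx: "norm (z - x) < 2 * (R + 1) * \<epsilon>1"
    proof -
      have "z - x = blinfun_apply (g - id_blinfun) v + (v - x)" by (simp add: z_def bl_simps)
      then have "norm (z - x) \<le> norm (blinfun_apply (g - id_blinfun) v) + d"
        using norm_triangle_ineq[of "blinfun_apply (g - id_blinfun) v" "v - x"] by (simp only: d_def)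
      also have "norm (blinfun_apply (g - id_blinfun) v) \<le> norm (g - id_blinfun) * norm v" by (rule norm_blinfun)
      also have "\<dots> \<le> \<epsilon>1 * R"
        by (rule mult_mono[OF less_imp_le[OF g(3)] nv]) (use \<epsilon>1(1) in simp_all)
      finally have "norm (z - x) < \<epsilon>1 * R + \<epsilon>1" using d1 by linarith
      also have "\<dots> \<le> 2 * (R + 1) * \<epsilon>1" using \<epsilon>1(1) R by (simp add: algebra_simps)
      finally show ?thesis .
    qed
    then have zx0: "norm (z - x) < \<epsilon>0" and zx2: "norm (z - x) < \<epsilon>2" using \<epsilon>1R by auto
    have regz: "reg z" using \<epsilon>2(2) zx2 by (auto simp: dist_norm norm_minus_commute)
    then have dz: "dim (LX z) = dim (LX x)" using x(2) by (simp add: reg_def)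
    have gz: "blinfun_apply (gi g) z = v" using g by (simp add: z_def)
    have "norm (gi g - id_blinfun) < \<epsilon>0" using gi_norm[OF g(1)] g(3) \<epsilon>1(2) by simp
    then obtain h' where h': "h' \<in> G" "blinfun_apply h' z = v" "norm (h' - id_blinfun) \<le> C * norm (v - z)"
      using lift[OF zx0 dz gi_G[OF g(1)]] gz by auto
    define \<rho> where "\<rho> = norm (h' - id_blinfun)"
    have "norm (v - z) < (2 * (R + 1)) * \<epsilon>1"
    proof -
      have "v - z = - blinfun_apply (g - id_blinfun) v" by (simp add: z_def bl_simps)
      then have "norm (v - z) \<le> norm (g - id_blinfun) * norm v" by (simp only: norm_minus_cancel norm_blinfun)
      also have "\<dots> \<le> \<epsilon>1 * R"
        by (rule mult_mono[OF less_imp_le[OF g(3)] nv]) (use \<epsilon>1(1) in simp_all)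
      also have "\<dots> < 2 * (R + 1) * \<epsilon>1" using \<epsilon>1(1) R by (simp add: algebra_simps add_strict_increasing)
      finally show ?thesis .
    qed
    then have "norm (v - z) < \<delta>1 / (C + 1)" using \<epsilon>1R by auto
    then have "norm (v - z) * (C + 1) < \<delta>1" using C by (simp add: pos_less_divide_eq)
    moreover have "C * norm (v - z) \<le> norm (v - z) * (C + 1)" by (simp add: algebra_simps)
    ultimately have "\<rho> < \<delta>1" using h'(3) unfolding \<rho>_def by linarith
    then obtain W where W: "W \<in> L" "norm (h' - id_blinfun - W) \<le> \<eta>' * \<rho>"
      using tan[OF h'(1)] by (auto simp: \<rho>_def)
    define rr where "rr = h' - id_blinfun - W"
    have rr: "norm rr \<le> \<eta>' * \<rho>" using W by (simp add: rr_def)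
    have vz: "v - z = blinfun_apply W z + blinfun_apply rr z" using h'(2) by (simp add: rr_def bl_simps)
    have Wz: "blinfun_apply W z \<in> Sp" by (rule L_Sp[OF W(1) z\<Sigma>])
    have prW: "pr \<Sigma> (blinfun_apply W z) = 0" using Wz by (intro pr_orth_zero sub\<Sigma>) (auto simp: Sp_def)
    \<comment> \<open>\<open>W z\<close> is orthogonal to \<Sigma>, so the \<Sigma>-component of
      \<open>v - z\<close> comes from the remainder alone. The normal component is that of
      \<open>v - x\<close>, since \<open>z - x\<close> lies in \<Sigma>. Together they bound
      \<open>v - z\<close> by twice the distance from \<open>v\<close> to \<open>x\<close>.\<close>
    have p1: "norm (pr \<Sigma> (v - z)) \<le> (1/2) * norm (v - z)"
    proof -
      have "norm (pr \<Sigma> (v - z)) = norm (pr \<Sigma> (blinfun_apply rr z))"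
        unfolding vz by (simp add: pr_add[OF sub\<Sigma>] prW)
      also have "\<dots> \<le> norm (blinfun_apply rr z)" by (rule pr_norm_le[OF sub\<Sigma>])
      also have "\<dots> \<le> norm rr * norm z" by (rule norm_blinfun)
      also have "\<dots> \<le> (\<eta>' * (C * norm (v - z))) * R"
      proof (rule mult_mono[OF _ nz])
        have "\<eta>' * \<rho> \<le> \<eta>' * (C * norm (v - z))"
          using h'(3) \<eta>'(1) unfolding \<rho>_def by (intro mult_left_mono) auto
        with rr show "norm rr \<le> \<eta>' * (C * norm (v - z))" by (rule order_trans)
      qed (use \<eta>'(1) C in auto)
      also have "\<dots> = (\<eta>' * C * R) * norm (v - z)" by (simp add: mult_ac)
      also have "\<dots> \<le> (1/2) * norm (v - z)" using \<eta>CR by (intro mult_right_mono) auto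
      finally show ?thesis .
    qed
    have zxS: "pr \<Sigma> (z - x) = z - x" using z\<Sigma> x(1) sub\<Sigma> by (intro pr_self) (auto intro: subspace_diff)
    have cq: "(v - z) - pr \<Sigma> (v - z) = (v - x) - pr \<Sigma> (v - x)"
    proof -
      have "pr \<Sigma> (v - z) = pr \<Sigma> (v - x) - pr \<Sigma> (z - x)" by (simp add: pr_diff[OF sub\<Sigma>, symmetric])
      then show ?thesis unfolding zxS by simp
    qed
    have "norm ((v - z) - pr \<Sigma> (v - z)) \<le> d" unfolding cq d_def by (rule pr_conorm_le[OF sub\<Sigma>])
    then have vzd: "norm (v - z) \<le> 2 * d"
      using p1 norm_triangle_ineq[of "pr \<Sigma> (v - z)" "(v - z) - pr \<Sigma> (v - z)"] by simp
    have "\<rho> \<le> C * (2 * d)"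
      unfolding \<rho>_def by (rule order_trans[OF h'(3) mult_left_mono[OF vzd less_imp_le[OF C(2)]]])
    then have \<rho>d: "\<rho> \<le> 2 * C * d" by (simp add: mult_ac)
    have \<rho>0: "0 \<le> \<rho>" by (simp add: \<rho>_def)
    have zxd: "norm (z - x) \<le> 3 * d"
      using norm_triangle_ineq[of "z - v" "v - x"] vzd by (simp add: d_def norm_minus_commute)
    have rrd: "norm rr \<le> \<eta>' * (2 * C * d)"
      by (rule order_trans[OF rr mult_left_mono[OF \<rho>d]]) (use \<eta>'(1) in simp)
    have "norm rr \<le> 1 * \<rho>" by (rule order_trans[OF rr mult_right_mono[OF \<eta>'(2) \<rho>0]])
    then have nW: "norm W \<le> 4 * C * d"
      using norm_triangle_ineq4[of "h' - id_blinfun" rr] \<rho>d by (simp add: rr_def \<rho>_def)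
    define c where "c e = blinfun_apply W x0 \<bullet> e" for e
    have cd: "\<bar>c e\<bar> \<le> 4 * C * d * norm x0" if e: "e \<in> E" for e
    proof -
      have "norm e = 1" using orthE[OF e e] by (simp add: norm_eq_1)
      then have "\<bar>c e\<bar> \<le> norm (blinfun_apply W x0)"
        using Cauchy_Schwarz_ineq2[of "blinfun_apply W x0" e] by (simp add: c_def)
      also have "\<dots> \<le> norm W * norm x0" by (rule norm_blinfun)
      also have "\<dots> \<le> 4 * C * d * norm x0" by (intro mult_right_mono nW) simp
      finally show ?thesis .
    qed
    have ce: "\<bar>(v - x) \<bullet> e / (a e \<bullet> x) - c e\<bar> \<le> (\<eta>' * (2 * C * d) * R + 4 * C * d * norm x0 * (norm (a e) * (3 * d))) / \<bar>a e \<bullet> x\<bar>"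
      if e: "e \<in> E" for e
    proof -
      have ne: "norm e = 1" using orthE[OF e e] by (simp add: norm_eq_1)
      have Wze: "blinfun_apply W z \<bullet> e = c e * (a e \<bullet> z)"
      proof -
        have "blinfun_apply W z \<bullet> e = (\<Sum>e'\<in>E. if e' = e then c e' * (a e' \<bullet> z) else 0)"
          unfolding L_exp[OF W(1) z\<Sigma>] inner_sum_left
          by (intro sum.cong) (use orthE e in \<open>auto simp: c_def\<close>)
        then show ?thesis using finE e by simp
      qed
      have "(v - x) \<bullet> e = (v - z) \<bullet> e"
        using E\<Sigma>(2)[OF e z\<Sigma>] E\<Sigma>(2)[OF e x(1)] by (simp add: inner_diff_left)
      also have "\<dots> = c e * (a e \<bullet> z) + blinfun_apply rr z \<bullet> e" unfolding vz inner_add_left Wze ..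
      finally have "(v - x) \<bullet> e - c e * (a e \<bullet> x) = blinfun_apply rr z \<bullet> e + c e * (a e \<bullet> (z - x))"
        by (simp add: inner_diff_right algebra_simps)
      then have "\<bar>(v - x) \<bullet> e - c e * (a e \<bullet> x)\<bar> \<le> \<bar>blinfun_apply rr z \<bullet> e\<bar> + \<bar>c e\<bar> * \<bar>a e \<bullet> (z - x)\<bar>"
        by (metis abs_mult abs_triangle_ineq)
      also have "\<dots> \<le> \<eta>' * (2 * C * d) * R + 4 * C * d * norm x0 * (norm (a e) * (3 * d))"
      proof (intro add_mono mult_mono cd e)
        have "\<bar>blinfun_apply rr z \<bullet> e\<bar> \<le> norm (blinfun_apply rr z)"
          using Cauchy_Schwarz_ineq2[of "blinfun_apply rr z" e] ne by simp
        also have "\<dots> \<le> norm rr * norm z" by (rule norm_blinfun)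
        also have "\<dots> \<le> \<eta>' * (2 * C * d) * R" using rrd nz \<eta>'(1) C d by (intro mult_mono) auto
        finally show "\<bar>blinfun_apply rr z \<bullet> e\<bar> \<le> \<eta>' * (2 * C * d) * R" .
        have "\<bar>a e \<bullet> (z - x)\<bar> \<le> norm (a e) * norm (z - x)" by (rule Cauchy_Schwarz_ineq2)
        also have "\<dots> \<le> norm (a e) * (3 * d)" by (intro mult_left_mono zxd) simp
        finally show "\<bar>a e \<bullet> (z - x)\<bar> \<le> norm (a e) * (3 * d)" .
      qed (use C d in auto)
      finally have "\<bar>(v - x) \<bullet> e - c e * (a e \<bullet> x)\<bar> / \<bar>a e \<bullet> x\<bar>
         \<le> (\<eta>' * (2 * C * d) * R + 4 * C * d * norm x0 * (norm (a e) * (3 * d))) / \<bar>a e \<bullet> x\<bar>"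
        by (intro divide_right_mono) auto
      moreover have "(v - x) \<bullet> e / (a e \<bullet> x) - c e = ((v - x) \<bullet> e - c e * (a e \<bullet> x)) / (a e \<bullet> x)"
        using b[OF e] by (simp add: diff_divide_distrib)
      ultimately show ?thesis by (simp add: abs_divide)
    qed
    \<comment> \<open>Invisible on \<Sigma>, hence not determined by \<open>v - x\<close>, but
      \<open>ex Z\<close> fixes \<open>z\<close> and cancels \<open>Z\<close> up to second
      order.\<close>
    define Z where "Z = W - (\<Sum>e\<in>E. c e *\<^sub>R XX e)"
    have ZL: "Z \<in> L" unfolding Z_def by (intro L_diff W(1) L_sum L_scale XXL)
    have Z\<Sigma>: "blinfun_apply Z y = 0" if y: "y \<in> \<Sigma>" for y
    proof -
      have "(\<Sum>e\<in>E. c e *\<^sub>R blinfun_apply (XX e) y) = (\<Sum>e\<in>E. (c e * (a e \<bullet> y)) *\<^sub>R e)"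
        using XXy[OF _ y] by (intro sum.cong) auto
      then show ?thesis using L_exp[OF W(1) y]
        by (simp add: Z_def bl_simps blinfun.sum_left c_def)
    qed
    have nZ: "norm Z \<le> C3 * d"
    proof -
      have "norm (\<Sum>e\<in>E. c e *\<^sub>R XX e) \<le> (\<Sum>e\<in>E. (4 * C * d * norm x0) * norm (XX e))"
        by (intro order_trans[OF norm_sum] sum_mono) (use cd in \<open>auto intro!: mult_right_mono\<close>)
      also have "\<dots> = 4 * C * d * norm x0 * s1" by (simp add: s1_def sum_distrib_left)
      finally have "norm Z \<le> 4 * C * d + 4 * C * d * norm x0 * s1"
        unfolding Z_def using nW norm_triangle_ineq4[of W "\<Sum>e\<in>E. c e *\<^sub>R XX e"] by linarith
      then show ?thesis by (simp add: C3_def algebra_simps)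
    qed
    have nZ1: "norm Z \<le> 1"
    proof -
      have "C3 * d \<le> C3 * (1 / C3)" using d \<delta>(4) C3 by (intro mult_left_mono) auto
      then show ?thesis using nZ C3 by simp
    qed
    define k where "k = ex Z"
    have kG: "k \<in> G" unfolding k_def by (rule ex_G[OF ZL])
    have kz: "blinfun_apply k z = z" unfolding k_def by (rule ex_fix[OF ZL Z\<Sigma>[OF z\<Sigma>]])
    have k2: "norm (k - id_blinfun - Z) \<le> (C3 * d)\<^sup>2"
      unfolding k_def by (rule order_trans[OF ex_approx[OF ZL nZ1] power_mono[OF nZ]]) simp
    have k1: "norm (k - id_blinfun) \<le> 2 * (C3 * d)"
    proof -
      have "norm (k - id_blinfun - Z) \<le> norm Z * norm Z"
        unfolding k_def using ex_approx[OF ZL nZ1] by (simp add: power2_eq_square)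
      also have "\<dots> \<le> 1 * norm Z" by (rule mult_right_mono[OF nZ1]) simp
      finally show ?thesis using norm_triangle_ineq[of "k - id_blinfun - Z" Z] nZ by simp
    qed
    have gh: "norm (gi h' - id_blinfun + W) \<le> \<eta>' * (2 * C * d) + (2 * C * d) * (2 * C * d)"
    proof -
      have "gi h' - id_blinfun = - (gi h' o\<^sub>L (h' - id_blinfun))" using h'(1) by (simp add: blc_simps)
      then have "gi h' - id_blinfun + W = - rr - ((gi h' - id_blinfun) o\<^sub>L (h' - id_blinfun))"
        unfolding rr_def by (simp add: blc_simps h'(1))
      then have "norm (gi h' - id_blinfun + W) \<le> norm (- rr) + norm ((gi h' - id_blinfun) o\<^sub>L (h' - id_blinfun))"
        using norm_triangle_ineq4[of "- rr" "(gi h' - id_blinfun) o\<^sub>L (h' - id_blinfun)"] by simp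
      also have "\<dots> \<le> norm rr + \<rho> * \<rho>"
        using norm_blinfun_compose[of "gi h' - id_blinfun" "h' - id_blinfun"] gi_norm[OF h'(1)] by (simp add: \<rho>_def)
      also have "\<dots> \<le> \<eta>' * (2 * C * d) + (2 * C * d) * (2 * C * d)"
        using C d by (intro add_mono rrd mult_mono \<rho>d \<rho>0) auto
      finally show ?thesis .
    qed
    define g' where "g' = k o\<^sub>L gi h'"
    have g'G: "g' \<in> G" unfolding g'_def using kG h'(1) by simp
    have g'v: "blinfun_apply g' v = z" unfolding g'_def using h'(1,2) kz gi_left[OF h'(1), of z] by simp
    have eq: "g' - id_blinfun + lift_dir x (v - x) = ((k - id_blinfun) o\<^sub>L (gi h' - id_blinfun)) + (k - id_blinfun - Z)
       + (gi h' - id_blinfun + W) + (\<Sum>e\<in>E. ((v - x) \<bullet> e / (a e \<bullet> x) - c e) *\<^sub>R XX e)"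
      unfolding g'_def Z_def lift_dir_def by (simp add: blc_simps scaleR_left_diff_distrib sum_subtractf)
    have t1: "norm ((k - id_blinfun) o\<^sub>L (gi h' - id_blinfun)) \<le> 2 * (C3 * d) * (2 * C * d)"
    proof (rule order_trans[OF norm_blinfun_compose mult_mono[OF k1]])
      show "norm (gi h' - id_blinfun) \<le> 2 * C * d" using \<rho>d gi_norm[OF h'(1)] by (simp add: \<rho>_def)
    qed (use C3 d in auto)
    have t4: "norm (\<Sum>e\<in>E. ((v - x) \<bullet> e / (a e \<bullet> x) - c e) *\<^sub>R XX e) \<le>
         (\<Sum>e\<in>E. (\<eta>' * (2 * C * d) * R + 4 * C * d * norm x0 * (norm (a e) * (3 * d))) / \<bar>a e \<bullet> x\<bar> * norm (XX e))"
    proof (rule order_trans[OF norm_sum], rule sum_mono)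
      fix e assume e: "e \<in> E"
      show "norm (((v - x) \<bullet> e / (a e \<bullet> x) - c e) *\<^sub>R XX e)
        \<le> (\<eta>' * (2 * C * d) * R + 4 * C * d * norm x0 * (norm (a e) * (3 * d))) / \<bar>a e \<bullet> x\<bar> * norm (XX e)"
        unfolding norm_scaleR by (rule mult_right_mono[OF ce[OF e] norm_ge_zero])
    qed
    have "norm (g' - id_blinfun + lift_dir x (v - x)) \<le> 2 * (C3 * d) * (2 * C * d) + (C3 * d)\<^sup>2
       + (\<eta>' * (2 * C * d) + (2 * C * d) * (2 * C * d))
       + (\<Sum>e\<in>E. (\<eta>' * (2 * C * d) * R + 4 * C * d * norm x0 * (norm (a e) * (3 * d))) / \<bar>a e \<bullet> x\<bar> * norm (XX e))"
      unfolding eq by (rule norm_triangle_mono[OF norm_triangle_mono[OF norm_triangle_mono[OF t1 k2] gh] t4])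
    also have "(\<Sum>e\<in>E. (\<eta>' * (2 * C * d) * R + 4 * C * d * norm x0 * (norm (a e) * (3 * d))) / \<bar>a e \<bullet> x\<bar> * norm (XX e))
       = \<eta>' * d * (s2 * (2 * C * R)) + d * d * (s3 * (12 * C * norm x0))"
      unfolding s2_def s3_def sum_distrib_left sum_distrib_right sum.distrib[symmetric]
      by (rule sum.cong[OF refl], rule error_term_identity)
    also have "2 * (C3 * d) * (2 * C * d) + (C3 * d)\<^sup>2 + (\<eta>' * (2 * C * d) + (2 * C * d) * (2 * C * d))
       + (\<eta>' * d * (s2 * (2 * C * R)) + d * d * (s3 * (12 * C * norm x0))) = (A1 * \<eta>' + A2 * d) * d"
      by (simp add: A1_def A2_def power2_eq_square algebra_simps)
    also have "\<dots> \<le> \<eta> * d"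
    proof (rule mult_right_mono[OF _ d(1)])
      have "0 < 2 * (A2 + 1)" using A1 by simp
      then have "\<delta> * (2 * (A2 + 1)) \<le> \<eta>" using \<delta>(5) by (simp only: pos_le_divide_eq)
      moreover have "d * (2 * (A2 + 1)) \<le> \<delta> * (2 * (A2 + 1))" using d A1 by (intro mult_right_mono) auto
      ultimately have "A2 * d \<le> \<eta> / 2" using d(1) by (simp add: algebra_simps)
      then show "A1 * \<eta>' + A2 * d \<le> \<eta>" using \<eta>A by linarith
    qed
    finally show ?thesis using g'G g'v z\<Sigma> by (auto simp: d_def)
  qed
  then show ?thesis using \<delta>(1) by blast
qed

text \<open>For every \<open>v\<close>, \<open>\<gamma> v\<close> minimises the deviation from the
  predicted first order behaviour among all elements carrying \<open>v\<close> into \<Sigma>. The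
  element found in \<open>section_approx\<close> may depend on the tolerance, but the minimiser is
  at least as good for every tolerance.\<close>

lemma local_section:
  assumes x: "x \<in> \<Sigma>" "reg x"
  obtains \<gamma> where "\<gamma> differentiable (at x)" "\<gamma> x = id_blinfun"
    "\<And>v. \<gamma> v \<in> G" "\<And>v. blinfun_apply (\<gamma> v) v \<in> \<Sigma>"
proof -
  let ?err = "\<lambda>v g. norm (g - id_blinfun + lift_dir x (v - x))"
  have "\<forall>v. \<exists>g. g \<in> G \<and> blinfun_apply g v \<in> \<Sigma> \<and> (\<forall>h\<in>G. blinfun_apply h v \<in> \<Sigma> \<longrightarrow> ?err v g \<le> ?err v h)"
  proof
    fix v
    let ?S = "G \<inter> {g. blinfun_apply g v \<in> \<Sigma>}"
    have "closed {g. blinfun_apply g v \<in> \<Sigma>}"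
      using continuous_closed_vimage[OF closed_subspace[OF sub\<Sigma>], of "\<lambda>g. blinfun_apply g v"]
      by (simp add: vimage_def continuous_intros)
    with compact_G have "compact ?S" by (rule compact_Int_closed)
    moreover have "?S \<noteq> {}" using meet\<Sigma> by blast
    moreover have "continuous_on ?S (?err v)" by (intro continuous_intros)
    ultimately obtain g where g: "g \<in> ?S" "\<forall>h\<in>?S. ?err v g \<le> ?err v h"
      using continuous_attains_inf by blast
    then show "\<exists>g. g \<in> G \<and> blinfun_apply g v \<in> \<Sigma> \<and> (\<forall>h\<in>G. blinfun_apply h v \<in> \<Sigma> \<longrightarrow> ?err v g \<le> ?err v h)"
      by (intro exI[of _ g]) simp
  qed
  from choice[OF this] obtain \<gamma> where \<gamma>: "\<And>v. \<gamma> v \<in> G" "\<And>v. blinfun_apply (\<gamma> v) v \<in> \<Sigma>"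
    "\<And>v h. h \<in> G \<Longrightarrow> blinfun_apply h v \<in> \<Sigma> \<Longrightarrow> ?err v (\<gamma> v) \<le> ?err v h" by blast
  have Y0: "lift_dir x 0 = 0" using bounded_linear.linear[OF lift_dir_bounded_linear] linear_0 by blast
  have gx: "\<gamma> x = id_blinfun"
    using \<gamma>(3)[OF G_id, of x] x(1) Y0 by simp
  have "(\<gamma> has_derivative (\<lambda>u. - lift_dir x u)) (at x)"
    unfolding has_derivative_at_alt
  proof (intro conjI allI impI)
    show "bounded_linear (\<lambda>u. - lift_dir x u)" by (rule bounded_linear_minus[OF lift_dir_bounded_linear])
    fix \<eta> :: real assume "0 < \<eta>"
    from section_approx[OF x this] obtain \<delta> where \<delta>: "0 < \<delta>" "\<And>v. norm (v - x) < \<delta> \<Longrightarrow> \<exists>g\<in>G. blinfun_apply g v \<in> \<Sigma> \<and>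
     ?err v g \<le> \<eta> * norm (v - x)" by blast
    show "\<exists>d>0. \<forall>y. norm (y - x) < d \<longrightarrow> norm (\<gamma> y - \<gamma> x - - lift_dir x (y - x)) \<le> \<eta> * norm (y - x)"
    proof (intro exI[of _ \<delta>] conjI \<delta> allI impI)
      fix y assume "norm (y - x) < \<delta>"
      then obtain g where g: "g \<in> G" "blinfun_apply g y \<in> \<Sigma>" "?err y g \<le> \<eta> * norm (y - x)" using \<delta>(2) by blast
      show "norm (\<gamma> y - \<gamma> x - - lift_dir x (y - x)) \<le> \<eta> * norm (y - x)"
        using order_trans[OF \<gamma>(3)[OF g(1,2)] g(3)] gx by simp
    qed
  qed
  then have "\<gamma> differentiable (at x)" by (auto simp: differentiable_def)
  then show thesis using that gx \<gamma>(1,2) by blast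
qed

text \<open>By equivariance \<open>t v ws\<close> equals the value at the point
  \<open>\<gamma> v v\<close> of \<Sigma> on the arguments moved by \<open>\<gamma> v\<close>, so
  differentiability within \<Sigma> and of \<gamma> at \<open>x\<close> is enough.\<close>

lemma equiv_field_differentiable:
  assumes t: "equiv_field q t" and x: "x \<in> \<Sigma>" "reg x" and U: "open U" "x \<in> U"
    and d: "\<And>ws. length ws = q \<Longrightarrow> (\<lambda>v. t v ws) differentiable (at x within \<Sigma> \<inter> U)"
    and ws: "length ws = q"
  shows "(\<lambda>v. t v ws) differentiable (at x)"
proof -
  obtain \<gamma> where \<gamma>: "\<gamma> differentiable (at x)" "\<gamma> x = id_blinfun"
    "\<And>v. \<gamma> v \<in> G" "\<And>v. blinfun_apply (\<gamma> v) v \<in> \<Sigma>" by (rule local_section[OF x]) blast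
  define \<zeta> where "\<zeta> v = blinfun_apply (\<gamma> v) v" for v
  have \<zeta>x: "\<zeta> x = x" by (simp add: \<zeta>_def \<gamma>)
  obtain \<gamma>' where \<gamma>': "(\<gamma> has_derivative \<gamma>') (at x)" using \<gamma>(1) by (auto simp: differentiable_def)
  obtain \<zeta>' where \<zeta>': "(\<zeta> has_derivative \<zeta>') (at x)"
    unfolding \<zeta>_def using bounded_bilinear.FDERIV[OF bounded_bilinear_blinfun_apply \<gamma>' has_derivative_ident] by blast
  have "continuous (at x) \<zeta>" using \<zeta>' has_derivative_continuous by blast
  from iffD1[OF continuous_at_open this, rule_format, of U]
  obtain N where N: "open N" "x \<in> N" "\<And>v. v \<in> N \<Longrightarrow> \<zeta> v \<in> U" using U \<zeta>x by auto
  have dz: "(\<lambda>v. t (\<zeta> v) ws) differentiable (at x)" if l: "length ws = q" for ws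
  proof -
    obtain D where D: "((\<lambda>v. t v ws) has_derivative D) (at x within \<Sigma> \<inter> U)"
      using d[OF l] by (auto simp: differentiable_def)
    have "((\<lambda>v. t v ws) has_derivative D) (at (\<zeta> x) within \<zeta> ` N)"
      unfolding \<zeta>x by (rule has_derivative_subset[OF D]) (use N \<gamma>(4) in \<open>auto simp: \<zeta>_def\<close>)
    from has_derivative_in_compose[OF has_derivative_at_withinI[OF \<zeta>'] this]
    have "((\<lambda>v. t (\<zeta> v) ws) has_derivative (\<lambda>u. D (\<zeta>' u))) (at x within N)" .
    then show ?thesis using at_within_open[OF N(2,1)] by (auto simp: differentiable_def)
  qed
  have "(\<lambda>v. t (\<zeta> v) (map (blinfun_apply (\<gamma> v)) ws @ [])) differentiable (at x)"
    by (rule mlin_map_differentiable[where q = q and t = t and \<zeta> = \<zeta> and \<gamma> = \<gamma>])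
       (use ws equiv_mlin[OF t] \<gamma>(1) dz in simp_all)
  moreover have "t (\<zeta> v) (map (blinfun_apply (\<gamma> v)) ws @ []) = t v ws" for v
    unfolding \<zeta>_def using equiv_G[OF t \<gamma>(3) ws] by simp
  ultimately show ?thesis by simp
qed

end

section \<open>The rank one slice\<close>

context rank_one
begin

text \<open>The orthogonal sum of \<open>H\<close> and \<open>N\<close>. At a point of
  \<open>H\<close> where no root outside \<open>E1\<close> vanishes it is the normal space of the
  orbit, that is the linear slice.\<close>

definition nu :: "'v set" where "nu = {v. \<forall>e\<in>E - E1. v \<bullet> e = 0}"

lemma subnu: "subspace nu" by (auto simp: nu_def subspace_def inner_add_left)
lemma \<Sigma>nu: "y \<in> \<Sigma> \<Longrightarrow> y \<in> nu" using E\<Sigma>(2) by (auto simp: nu_def)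
lemma Nnu: "v \<in> N \<Longrightarrow> v \<in> nu" by (auto simp: nu_def N_def)
lemma Hnu: "y \<in> H \<Longrightarrow> y \<in> nu" using \<Sigma>nu H\<Sigma> by blast

text \<open>\<open>\<kappa> v\<close> is the point of the half space \<open>H + [0, \<infinity>) \<alpha>\<close> on the \<open>K1\<close>-orbit of \<open>v \<in> nu\<close>.\<close>

definition hp :: "'v \<Rightarrow> 'v" where "hp v = pr \<Sigma> v - (v \<bullet> \<alpha>) *\<^sub>R \<alpha>"
definition wp :: "'v \<Rightarrow> 'v" where "wp v = v - hp v"
definition \<kappa> :: "'v \<Rightarrow> 'v" where "\<kappa> v = hp v + norm (wp v) *\<^sub>R \<alpha>"
definition rf :: "'v \<Rightarrow> 'v" where "rf v = v - (2 * (v \<bullet> \<alpha>)) *\<^sub>R \<alpha>"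

lemma hpH: "hp v \<in> H" unfolding hp_def by (rule prH)

lemma hp_bounded_linear: "bounded_linear hp"
  unfolding hp_def
  by (intro bounded_linear_sub pr_bounded_linear sub\<Sigma> bounded_linear_scaleR_const bounded_linear_inner_left)

lemma wp_bounded_linear: "bounded_linear wp"
  unfolding wp_def by (intro bounded_linear_sub bounded_linear_ident hp_bounded_linear)

lemmas hp_diff = linear_diff[OF bounded_linear.linear[OF hp_bounded_linear]]
lemmas wp_diff = linear_diff[OF bounded_linear.linear[OF wp_bounded_linear]]

lemma hp_inner: assumes "y \<in> H" shows "hp v \<bullet> y = v \<bullet> y"
proof -
  have "\<alpha> \<bullet> y = 0" using assms by (simp add: H_def inner_commute)
  then show ?thesis unfolding hp_def using pr_inner[OF sub\<Sigma> H\<Sigma>[OF assms], of v] by (simp add: inner_diff_left)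
qed

lemma wp_hp: "wp v \<bullet> hp u = 0"
  using hp_inner[OF hpH, of v u] by (simp add: wp_def inner_diff_left)

lemma wpN: assumes "v \<in> nu" shows "wp v \<in> N"
  unfolding N_def
proof (intro CollectI conjI ballI)
  show "wp v \<bullet> y = 0" if "y \<in> H" for y using hp_inner[OF that, of v] by (simp add: wp_def inner_diff_left)
  show "wp v \<bullet> e = 0" if "e \<in> E - E1" for e
    using assms that E\<Sigma>(2)[OF _ H\<Sigma>[OF hpH]] by (auto simp: wp_def nu_def inner_diff_left)
qed

lemma hp_\<alpha>: "hp v \<bullet> \<alpha> = 0" using hpH[of v] by (simp add: H_def)

lemma \<kappa>\<alpha>: "\<kappa> v \<bullet> \<alpha> = norm (wp v)"
  unfolding \<kappa>_def using hp_\<alpha> \<alpha>1 by (simp add: inner_add_left)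

lemma \<kappa>\<Sigma>: "\<kappa> v \<in> \<Sigma>"
  unfolding \<kappa>_def by (intro subspace_add subspace_scale sub\<Sigma> \<alpha>\<Sigma> H\<Sigma> hpH)

lemma \<kappa>_norm: "norm (\<kappa> v) = norm v"
proof -
  have 1: "(norm (hp v + u))\<^sup>2 = (norm (hp v))\<^sup>2 + (norm u)\<^sup>2" if "hp v \<bullet> u = 0" for u
    using that by (simp add: power2_norm_eq_inner inner_add_left inner_add_right inner_commute)
  have "(norm (\<kappa> v))\<^sup>2 = (norm (hp v))\<^sup>2 + (norm (wp v))\<^sup>2"
    unfolding \<kappa>_def using 1[of "norm (wp v) *\<^sub>R \<alpha>"] hp_\<alpha> \<alpha>1 by simp
  moreover have "(norm v)\<^sup>2 = (norm (hp v))\<^sup>2 + (norm (wp v))\<^sup>2"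
    using 1[of "wp v"] wp_hp[of v v] by (simp add: wp_def inner_commute)
  ultimately show ?thesis by (metis norm_ge_zero power2_eq_imp_eq)
qed

lemma rf\<Sigma>: "x \<in> \<Sigma> \<Longrightarrow> rf x \<in> \<Sigma>"
  unfolding rf_def by (intro subspace_diff subspace_scale sub\<Sigma> \<alpha>\<Sigma>)
lemma rf_bounded_linear: "bounded_linear rf"
  unfolding rf_def by (intro bounded_linear_sub bounded_linear_ident bounded_linear_scaleR_const bounded_linear_const_mult bounded_linear_inner_left)
lemma rf_norm: "norm (rf x) = norm x"
proof -
  have "(norm (rf x))\<^sup>2 = (norm x)\<^sup>2"
    unfolding power2_norm_eq_inner rf_def
    by (simp add: inner_diff_left inner_diff_right inner_commute[of \<alpha> x] \<alpha>1 power2_eq_square algebra_simps)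
  then show ?thesis by (metis norm_ge_zero power2_eq_imp_eq)
qed
lemma rf_\<alpha>: "rf x \<bullet> \<alpha> = - (x \<bullet> \<alpha>)" by (simp add: rf_def inner_diff_left \<alpha>1)
lemma rf_H: "x \<bullet> \<alpha> = 0 \<Longrightarrow> rf x = x" by (simp add: rf_def)

lemma even_quotient:
  assumes \<phi>: "smooth_on \<Sigma> (\<Sigma> \<inter> ball 0 r) \<phi>" and odd: "\<And>x. x \<in> \<Sigma> \<inter> ball 0 r \<Longrightarrow> \<phi> (rf x) = - \<phi> x"
  obtains \<xi> where "smooth_on \<Sigma> (\<Sigma> \<inter> ball 0 r) \<xi>" "\<And>x. x \<in> \<Sigma> \<inter> ball 0 r \<Longrightarrow> \<phi> x = (x \<bullet> \<alpha>) * \<xi> x"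
    "\<And>x. x \<in> \<Sigma> \<inter> ball 0 r \<Longrightarrow> \<xi> (rf x) = \<xi> x"
proof -
  have van: "\<phi> x = 0" if "x \<in> \<Sigma> \<inter> ball 0 r" "x \<bullet> \<alpha> = 0" for x
    using odd[OF that(1)] rf_H[OF that(2)] by simp
  obtain \<xi> where \<xi>: "smooth_on \<Sigma> (\<Sigma> \<inter> ball 0 r) \<xi>" "\<And>x. x \<in> \<Sigma> \<inter> ball 0 r \<Longrightarrow> \<phi> x = (x \<bullet> \<alpha>) * \<xi> x"
  proof (rule hadamard_division[OF sub\<Sigma> \<alpha>\<Sigma> \<alpha>1(2) refl \<phi> van])
    fix q assume "smooth_on \<Sigma> (\<Sigma> \<inter> ball 0 r) q" "\<And>x. x \<in> \<Sigma> \<inter> ball 0 r \<Longrightarrow> \<phi> x = (x \<bullet> \<alpha>) * q x"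
    then show thesis by (rule that)
  qed
  show thesis
  proof (rule that[OF \<xi>])
    fix x assume x: "x \<in> \<Sigma> \<inter> ball 0 r"
    then have rx: "rf x \<in> \<Sigma> \<inter> ball 0 r" using rf\<Sigma> rf_norm by simp
    show "\<xi> (rf x) = \<xi> x"
    proof (cases "x \<bullet> \<alpha> = 0")
      case True then show ?thesis using rf_H by simp
    next
      case False
      have "- (x \<bullet> \<alpha>) * \<xi> (rf x) = - (x \<bullet> \<alpha>) * \<xi> x"
        using \<xi>(2)[OF rx] \<xi>(2)[OF x] odd[OF x] unfolding rf_\<alpha> by linarith
      moreover have "- (x \<bullet> \<alpha>) \<noteq> 0" using False by simp
      ultimately show ?thesis by (rule mult_left_cancel[THEN iffD1, rotated])
    qed
  qed
qed

text \<open>Off \<open>H\<close> this is the chain rule, where the factor \<open>norm (wp v)\<close>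
  of the derivative of \<phi> along \<alpha> cancels the denominator from differentiating a norm. At
  a point of \<open>H\<close>, \<kappa> preserves distances to that point and the gradient has no
  \<alpha>-component, so the estimate for \<phi> carries over directly.\<close>

lemma fold_derivative:
  assumes S: "S = \<Sigma> \<inter> ball 0 r"
    and g: "\<And>x. x \<in> S \<Longrightarrow> (\<phi> has_derivative (\<lambda>h. g x \<bullet> h)) (at x within S)"
    and \<xi>: "\<And>x. x \<in> S \<Longrightarrow> g x \<bullet> \<alpha> = (x \<bullet> \<alpha>) * \<xi> x"
    and v: "v \<in> nu \<inter> ball 0 r"
  shows "((\<lambda>v. \<phi> (\<kappa> v)) has_derivative (\<lambda>u. g (\<kappa> v) \<bullet> hp u + \<xi> (\<kappa> v) * (wp v \<bullet> u))) (at v within nu \<inter> ball 0 r)"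
proof -
  let ?V = "nu \<inter> ball 0 r"
  have \<kappa>S: "\<kappa> v' \<in> S" if "v' \<in> ?V" for v' using that \<kappa>\<Sigma> \<kappa>_norm by (simp add: S)
  have im: "\<kappa> ` ?V \<subseteq> S" using \<kappa>S by blast
  show ?thesis
  proof (cases "wp v = 0")
    case False
    have "((\<lambda>v. norm (wp v)) has_derivative (\<lambda>u. sgn (wp v) \<bullet> wp u)) (at v within ?V)"
      using has_derivative_compose[OF bounded_linear_imp_has_derivative[OF wp_bounded_linear] has_derivative_norm[OF False]]
      by (simp add: inner_commute)
    then have "(\<kappa> has_derivative (\<lambda>u. hp u + (sgn (wp v) \<bullet> wp u) *\<^sub>R \<alpha>)) (at v within ?V)"
      unfolding \<kappa>_def
      by (intro has_derivative_add bounded_linear_imp_has_derivative[OF hp_bounded_linear] has_derivative_scaleR_left)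
    moreover have "(\<phi> has_derivative (\<lambda>h. g (\<kappa> v) \<bullet> h)) (at (\<kappa> v) within \<kappa> ` ?V)"
      by (rule has_derivative_subset[OF g[OF \<kappa>S[OF v]] im])
    ultimately have D: "((\<lambda>v. \<phi> (\<kappa> v)) has_derivative (\<lambda>u. g (\<kappa> v) \<bullet> (hp u + (sgn (wp v) \<bullet> wp u) *\<^sub>R \<alpha>))) (at v within ?V)"
      by (rule has_derivative_in_compose)
    have "g (\<kappa> v) \<bullet> (hp u + (sgn (wp v) \<bullet> wp u) *\<^sub>R \<alpha>) = g (\<kappa> v) \<bullet> hp u + \<xi> (\<kappa> v) * (wp v \<bullet> u)" for u
    proof -
      have "wp v \<bullet> wp u = wp v \<bullet> u" using wp_hp[of v u] by (simp add: wp_def[of u] inner_diff_right)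
      then show ?thesis using \<xi>[OF \<kappa>S[OF v]] False
        by (simp add: inner_add_right \<kappa>\<alpha> sgn_div_norm)
    qed
    then show ?thesis using D by simp
  next
    case True
    then have vh: "v = hp v" by (simp add: wp_def)
    have \<kappa>v: "\<kappa> v = v" using True vh by (simp add: \<kappa>_def)
    have ga: "g v \<bullet> \<alpha> = 0" using \<xi>[OF \<kappa>S[OF v]] \<kappa>\<alpha>[of v] True by (simp add: \<kappa>v)
    have "((\<lambda>v. \<phi> (\<kappa> v)) has_derivative (\<lambda>u. g v \<bullet> hp u)) (at v within ?V)"
      unfolding has_derivative_within_alt
    proof (intro conjI allI impI)
      show "bounded_linear (\<lambda>u. g v \<bullet> hp u)"
        by (rule bounded_linear_compose[OF bounded_linear_inner_right hp_bounded_linear])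
      fix e :: real assume "0 < e"
      have vS: "v \<in> S" using \<kappa>S[OF v] \<kappa>v by simp
      obtain d where d: "0 < d" "\<And>y. y \<in> S \<Longrightarrow> norm (y - v) < d \<Longrightarrow> norm (\<phi> y - \<phi> v - g v \<bullet> (y - v)) \<le> e * norm (y - v)"
        using g[OF vS] \<open>0 < e\<close> unfolding has_derivative_within_alt by blast
      show "\<exists>d>0. \<forall>y\<in>?V. norm (y - v) < d \<longrightarrow> norm (\<phi> (\<kappa> y) - \<phi> (\<kappa> v) - g v \<bullet> hp (y - v)) \<le> e * norm (y - v)"
      proof (intro exI[of _ d] conjI d ballI impI)
        fix y assume y: "y \<in> ?V" "norm (y - v) < d"
        have "wp y = wp (y - v)" using True by (simp add: wp_diff)
        then have kd: "\<kappa> y - v = \<kappa> (y - v)" unfolding \<kappa>_def hp_diff using vh by (simp add: algebra_simps)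
        then have nk: "norm (\<kappa> y - v) = norm (y - v)" using \<kappa>_norm by simp
        have gk: "g v \<bullet> (\<kappa> y - v) = g v \<bullet> hp (y - v)"
          unfolding kd unfolding \<kappa>_def using ga by (simp add: inner_add_right)
        show "norm (\<phi> (\<kappa> y) - \<phi> (\<kappa> v) - g v \<bullet> hp (y - v)) \<le> e * norm (y - v)"
          using d(2)[OF \<kappa>S[OF y(1)]] y(2) nk gk by (simp only: \<kappa>v)
      qed
    qed
    then show ?thesis using True by (simp add: \<kappa>v)
  qed
qed

text \<open>The derivative of a folded even function is built from linear functions and folded even
  smooth functions, namely the \<open>H\<close>-components of the gradient and the quotient of its
  \<alpha>-component by the coordinate along \<alpha>. Induction on the order applies to these
  again.\<close>

lemma fold_smooth:
  assumes "smooth_on \<Sigma> (\<Sigma> \<inter> ball 0 r) \<phi>" "\<And>x. x \<in> \<Sigma> \<inter> ball 0 r \<Longrightarrow> \<phi> (rf x) = \<phi> x"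
  shows "smooth_on nu (nu \<inter> ball 0 r) (\<lambda>v. \<phi> (\<kappa> v))"
proof -
  let ?S = "\<Sigma> \<inter> ball 0 r" and ?V = "nu \<inter> ball 0 r"
  have rS: "ropen \<Sigma> ?S" by (rule ropen_ball[OF sub\<Sigma>])
  have step: "\<exists>g \<xi>. (\<forall>v\<in>?V. ((\<lambda>v. \<phi> (\<kappa> v)) has_derivative (\<lambda>u. g (\<kappa> v) \<bullet> hp u + \<xi> (\<kappa> v) * (wp v \<bullet> u))) (at v within ?V))
     \<and> (\<forall>h\<in>H. smooth_on \<Sigma> ?S (\<lambda>x. g x \<bullet> h) \<and> (\<forall>x\<in>?S. g (rf x) \<bullet> h = g x \<bullet> h))
     \<and> smooth_on \<Sigma> ?S \<xi> \<and> (\<forall>x\<in>?S. \<xi> (rf x) = \<xi> x)"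
    if \<phi>: "smooth_on \<Sigma> ?S \<phi>" and ev: "\<forall>x\<in>?S. \<phi> (rf x) = \<phi> x" for \<phi>
  proof -
    obtain g where g: "\<And>x. x \<in> ?S \<Longrightarrow> (\<phi> has_derivative (\<lambda>h. g x \<bullet> h)) (at x within ?S)"
      "\<And>x. g x \<in> \<Sigma>" "\<And>c. smooth_on \<Sigma> ?S (\<lambda>x. g x \<bullet> c)" "continuous_on ?S g"
      by (rule smooth_gradient[OF \<phi> rS]) blast
    have rfS: "rf x \<in> ?S" if "x \<in> ?S" for x using that rf\<Sigma> rf_norm by simp
    have grf: "g (rf x) \<bullet> rf h = g x \<bullet> h" if x: "x \<in> ?S" and h: "h \<in> \<Sigma>" for x h
    proof -
      have "(\<phi> has_derivative (\<lambda>h. g (rf x) \<bullet> h)) (at (rf x) within rf ` ?S)"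
        by (rule has_derivative_subset[OF g(1)[OF rfS[OF x]]]) (use rfS in blast)
      from has_derivative_in_compose[OF bounded_linear_imp_has_derivative[OF rf_bounded_linear] this]
      have "((\<lambda>x. \<phi> (rf x)) has_derivative (\<lambda>h. g (rf x) \<bullet> rf h)) (at x within ?S)" .
      then have "(\<phi> has_derivative (\<lambda>h. g (rf x) \<bullet> rf h)) (at x within ?S)"
        by (rule has_derivative_transform[OF x, rotated]) (use ev in auto)
      from ropen_derivative_unique[OF rS x h this g(1)[OF x]] show ?thesis .
    qed
    have odd: "g (rf x) \<bullet> \<alpha> = - (g x \<bullet> \<alpha>)" if "x \<in> ?S" for x
      using grf[OF that \<alpha>\<Sigma>] by (simp add: rf_def[of \<alpha>] \<alpha>1 inner_diff_right)
    obtain \<xi> where \<xi>: "smooth_on \<Sigma> ?S \<xi>" "\<And>x. x \<in> ?S \<Longrightarrow> g x \<bullet> \<alpha> = (x \<bullet> \<alpha>) * \<xi> x"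
      "\<And>x. x \<in> ?S \<Longrightarrow> \<xi> (rf x) = \<xi> x"
      by (rule even_quotient[OF g(3)[of \<alpha>] odd]) blast+
    have "g (rf x) \<bullet> h = g x \<bullet> h" if "h \<in> H" "x \<in> ?S" for h x
      using grf[OF that(2) H\<Sigma>[OF that(1)]] that(1) rf_H[of h] by (simp add: H_def)
    moreover have "((\<lambda>v. \<phi> (\<kappa> v)) has_derivative (\<lambda>u. g (\<kappa> v) \<bullet> hp u + \<xi> (\<kappa> v) * (wp v \<bullet> u))) (at v within ?V)"
      if "v \<in> ?V" for v
      by (rule fold_derivative[OF refl g(1) \<xi>(2) that])
    ultimately show ?thesis using g(3) \<xi>(1,3)
      by (intro exI[of _ g] exI[of _ \<xi>] conjI ballI)
  qed
  have "Ck k nu ?V (\<lambda>v. \<phi> (\<kappa> v))" if "smooth_on \<Sigma> ?S \<phi>" "\<forall>x\<in>?S. \<phi> (rf x) = \<phi> x" for k \<phi>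
    using that
  proof (induction k arbitrary: \<phi>)
    case 0
    from step[OF 0] obtain g \<xi> where
      D: "\<forall>v\<in>?V. ((\<lambda>v. \<phi> (\<kappa> v)) has_derivative (\<lambda>u. g (\<kappa> v) \<bullet> hp u + \<xi> (\<kappa> v) * (wp v \<bullet> u))) (at v within ?V)"
      by (elim exE conjE)
    have "continuous_on ?V (\<lambda>v. \<phi> (\<kappa> v))" by (rule has_derivative_continuous_on[OF bspec[OF D]])
    then show ?case by (simp only: Ck.simps)
  next
    case (Suc k)
    from step[OF Suc.prems] obtain g \<xi> where
      D: "\<forall>v\<in>?V. ((\<lambda>v. \<phi> (\<kappa> v)) has_derivative (\<lambda>u. g (\<kappa> v) \<bullet> hp u + \<xi> (\<kappa> v) * (wp v \<bullet> u))) (at v within ?V)"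
      and gh: "\<forall>h\<in>H. smooth_on \<Sigma> ?S (\<lambda>x. g x \<bullet> h) \<and> (\<forall>x\<in>?S. g (rf x) \<bullet> h = g x \<bullet> h)"
      and \<xi>: "smooth_on \<Sigma> ?S \<xi>" "\<forall>x\<in>?S. \<xi> (rf x) = \<xi> x"
      by (elim exE conjE)
    have "continuous_on ?V (\<lambda>v. \<phi> (\<kappa> v))" by (rule has_derivative_continuous_on[OF bspec[OF D]])
    moreover have "Ck k nu ?V (\<lambda>v. g (\<kappa> v) \<bullet> hp u + \<xi> (\<kappa> v) * (wp v \<bullet> u))" for u
    proof (intro Ck_add Ck_mult)
      show "Ck k nu ?V (\<lambda>v. g (\<kappa> v) \<bullet> hp u)"
        using gh hpH[of u] by (intro Suc.IH) auto
      show "Ck k nu ?V (\<lambda>v. \<xi> (\<kappa> v))" using \<xi> by (intro Suc.IH) auto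
      show "Ck k nu ?V (\<lambda>v. wp v \<bullet> u)"
        by (intro Ck_bounded_linear bounded_linear_compose[OF bounded_linear_inner_left wp_bounded_linear])
    qed
    ultimately show ?case unfolding Ck.simps
      by (intro conjI exI[of _ "\<lambda>v u. g (\<kappa> v) \<bullet> hp u + \<xi> (\<kappa> v) * (wp v \<bullet> u)"] ballI)
         (assumption | rule bspec[OF D], assumption)+
  qed
  then show ?thesis using assms unfolding smooth_on_def[of nu] by blast
qed

text \<open>\<open>tau v u\<close> is the \<open>\<Sigma>\<close>-component of \<open>u\<close> after an element of \<open>K1\<close> carrying \<open>v\<close> to \<open>\<kappa> v\<close>.\<close>

definition tau :: "'v \<Rightarrow> 'v \<Rightarrow> 'v" where "tau v u = hp u + ((wp v \<bullet> u) / norm (wp v)) *\<^sub>R \<alpha>"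

text \<open>Expanding the arguments along \<alpha>, at most one of them contributes an \<alpha>-component because
  the form is alternating; that component is odd in the reflection and absorbs the factor
  1 / norm (wp v).\<close>

lemma alternating_fold:
  assumes ml: "\<And>z. z \<in> \<Sigma> \<inter> ball 0 r \<Longrightarrow> mlin p (t z)"
    and smooth_germ: "\<And>ws. length ws = p \<Longrightarrow> smooth_on \<Sigma> (\<Sigma> \<inter> ball 0 r) (\<lambda>z. t z ws)"
    and rfl: "\<And>z ws. z \<in> \<Sigma> \<inter> ball 0 r \<Longrightarrow> length ws = p \<Longrightarrow> set ws \<subseteq> \<Sigma> \<Longrightarrow> t (rf z) (map rf ws) = t z ws"
    and alt: "\<And>z xs ys zs w. z \<in> \<Sigma> \<inter> ball 0 r \<Longrightarrow> length (xs @ w # ys @ w # zs) = p \<Longrightarrow> t z (xs @ w # ys @ w # zs) = 0"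
  shows "length (ws1 @ ws2) = p \<Longrightarrow>
    (set ws2 \<subseteq> H \<longrightarrow> (\<exists>F. smooth_on nu (nu \<inter> ball 0 r) F \<and> (\<forall>v\<in>nu \<inter> ball 0 r. wp v \<noteq> 0 \<longrightarrow> t (\<kappa> v) (map (tau v) ws1 @ ws2) = F v))) \<and>
    (\<forall>us zs. ws2 = us @ \<alpha> # zs \<and> set us \<subseteq> H \<and> set zs \<subseteq> H \<longrightarrow> (\<exists>F. smooth_on nu (nu \<inter> ball 0 r) F \<and> (\<forall>v\<in>nu \<inter> ball 0 r. wp v \<noteq> 0 \<longrightarrow> t (\<kappa> v) (map (tau v) ws1 @ ws2) / norm (wp v) = F v)))"
proof (induction ws1 arbitrary: ws2 rule: rev_induct)
  case Nil
  have \<kappa>S: "\<kappa> v \<in> \<Sigma> \<inter> ball 0 r" if "v \<in> nu \<inter> ball 0 r" for v using that \<kappa>\<Sigma> \<kappa>_norm by simp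
  have len: "length ws2 = p" using Nil by simp
  have mapH: "map rf us = us" if "set us \<subseteq> H" for us
    using that by (intro map_idI rf_H) (auto simp: H_def)
  show ?case
  proof (intro conjI impI allI, goal_cases)
    case 1
    have "t (rf x) ws2 = t x ws2" if "x \<in> \<Sigma> \<inter> ball 0 r" for x
      using rfl[OF that len] 1 mapH[OF 1] H\<Sigma> by auto
    from fold_smooth[OF smooth_germ[OF len] this] show ?case by (intro exI[of _ "\<lambda>v. t (\<kappa> v) ws2"]) simp
  next
    case (2 us zs)
    then have ws2: "ws2 = us @ \<alpha> # zs" and H2: "set us \<subseteq> H" "set zs \<subseteq> H" by auto
    have odd: "t (rf x) ws2 = - t x ws2" if x: "x \<in> \<Sigma> \<inter> ball 0 r" for x
    proof -
      have lin: "linear (\<lambda>w. t x (us @ w # zs))" by (rule mlinD[OF ml[OF x]]) (use len ws2 in simp)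
      have "rf (- \<alpha>) = \<alpha>" by (simp add: rf_def \<alpha>1 scaleR_2)
      then have "t (rf x) ws2 = t (rf x) (map rf (us @ (- \<alpha>) # zs))" using mapH H2 by (simp add: ws2)
      also have "\<dots> = t x (us @ (- \<alpha>) # zs)"
        using len ws2 H2 H\<Sigma> subspace_neg[OF sub\<Sigma> \<alpha>\<Sigma>] by (intro rfl x) auto
      also have "\<dots> = - t x ws2" using linear_neg[OF lin] by (simp add: ws2)
      finally show ?thesis .
    qed
    obtain \<xi> where \<xi>: "smooth_on \<Sigma> (\<Sigma> \<inter> ball 0 r) \<xi>" "\<And>x. x \<in> \<Sigma> \<inter> ball 0 r \<Longrightarrow> t x ws2 = (x \<bullet> \<alpha>) * \<xi> x"
      "\<And>x. x \<in> \<Sigma> \<inter> ball 0 r \<Longrightarrow> \<xi> (rf x) = \<xi> x"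
      by (rule even_quotient[OF smooth_germ[OF len] odd]) blast+
    show ?case
      by (intro exI[of _ "\<lambda>v. \<xi> (\<kappa> v)"] conjI fold_smooth \<xi>) (use \<xi>(2)[OF \<kappa>S] \<kappa>\<alpha> in auto)
  qed
next
  case (snoc u ws1)
  have len: "length ws1 + length ws2 + 1 = p" using snoc.prems by simp
  have \<kappa>S: "\<kappa> v \<in> \<Sigma> \<inter> ball 0 r" if "v \<in> nu \<inter> ball 0 r" for v using that \<kappa>\<Sigma> \<kappa>_norm by simp
  have exp: "t (\<kappa> v) (map (tau v) (ws1 @ [u]) @ ws2) = t (\<kappa> v) (map (tau v) ws1 @ hp u # ws2)
     + (wp v \<bullet> u) * (t (\<kappa> v) (map (tau v) ws1 @ \<alpha> # ws2) / norm (wp v))" if v: "v \<in> nu \<inter> ball 0 r" for v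
  proof -
    have lin: "linear (\<lambda>w. t (\<kappa> v) (map (tau v) ws1 @ w # ws2))"
      by (rule mlinD[OF ml[OF \<kappa>S[OF v]]]) (use len in simp)
    show ?thesis using linear_add[OF lin, of "hp u" "((wp v \<bullet> u) / norm (wp v)) *\<^sub>R \<alpha>"] linear_cmul[OF lin, of "(wp v \<bullet> u) / norm (wp v)" \<alpha>]
      by (simp add: tau_def)
  qed
  have IH: "length (ws1 @ w # ws2) = p" for w using len by simp
  show ?case
  proof (intro conjI impI allI, goal_cases)
    case 1
    then have s: "set (hp u # ws2) \<subseteq> H" using hpH by auto
    obtain F1 where F1: "smooth_on nu (nu \<inter> ball 0 r) F1" "\<forall>v\<in>nu \<inter> ball 0 r. wp v \<noteq> 0 \<longrightarrow> t (\<kappa> v) (map (tau v) ws1 @ hp u # ws2) = F1 v"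
      using snoc.IH[OF IH[of "hp u"]] s by blast
    have "\<alpha> # ws2 = [] @ \<alpha> # ws2 \<and> set [] \<subseteq> H \<and> set ws2 \<subseteq> H" using 1 by simp
    then obtain F2 where F2: "smooth_on nu (nu \<inter> ball 0 r) F2" "\<forall>v\<in>nu \<inter> ball 0 r. wp v \<noteq> 0 \<longrightarrow> t (\<kappa> v) (map (tau v) ws1 @ \<alpha> # ws2) / norm (wp v) = F2 v"
      using snoc.IH[OF IH[of \<alpha>]] by blast
    have "smooth_on nu (nu \<inter> ball 0 r) (\<lambda>v. F1 v + (wp v \<bullet> u) * F2 v)"
      by (intro smooth_add smooth_mult F1 F2 smooth_bounded_linear
         bounded_linear_compose[OF bounded_linear_inner_left wp_bounded_linear])
    moreover have "t (\<kappa> v) (map (tau v) (ws1 @ [u]) @ ws2) = F1 v + (wp v \<bullet> u) * F2 v" if "v \<in> nu \<inter> ball 0 r" "wp v \<noteq> 0" for v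
      using exp[OF that(1)] bspec[OF F1(2) that(1)] bspec[OF F2(2) that(1)] that(2) by presburger
    ultimately show ?case by blast
  next
    case (2 us zs)
    then have ws2: "ws2 = us @ \<alpha> # zs" and H2: "set us \<subseteq> H" "set zs \<subseteq> H" by auto
    have "hp u # ws2 = (hp u # us) @ \<alpha> # zs \<and> set (hp u # us) \<subseteq> H \<and> set zs \<subseteq> H" using H2 hpH ws2 by auto
    then obtain F1 where F1: "smooth_on nu (nu \<inter> ball 0 r) F1" "\<forall>v\<in>nu \<inter> ball 0 r. wp v \<noteq> 0 \<longrightarrow> t (\<kappa> v) (map (tau v) ws1 @ hp u # ws2) / norm (wp v) = F1 v"
      using snoc.IH[OF IH[of "hp u"]] by blast
    have "t (\<kappa> v) (map (tau v) (ws1 @ [u]) @ ws2) / norm (wp v) = F1 v" if "v \<in> nu \<inter> ball 0 r" "wp v \<noteq> 0" for v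
    proof -
      have "t (\<kappa> v) (map (tau v) ws1 @ \<alpha> # us @ \<alpha> # zs) = 0"
        by (rule alt[OF \<kappa>S[OF that(1)]]) (use len ws2 in simp)
      then show ?thesis unfolding exp[OF that(1)] using bspec[OF F1(2) that(1)] that(2) by (simp add: ws2)
    qed
    then show ?case using F1(1) by blast
  qed
qed

end

lemma ropen_open: assumes "subspace T" "open U" shows "ropen T (T \<inter> U)"
  unfolding ropen_def
proof (intro conjI assms ballI)
  fix x assume x: "x \<in> T \<inter> U"
  then obtain e where e: "0 < e" "ball x e \<subseteq> U" using assms(2) open_contains_ball by blast
  have "x + h \<in> T \<inter> U" if "h \<in> T" "norm h < e" for h
  proof -
    have "x + h \<in> ball x e" using that(2) by (simp add: dist_norm)
    then show ?thesis using x that(1) e(2) subspace_add[OF assms(1)] by blast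
  qed
  then show "\<exists>\<delta>>0. \<forall>h\<in>T. norm h < \<delta> \<longrightarrow> x + h \<in> T \<inter> U" using e(1) by blast
qed simp

section \<open>Germs along the slice at generic points of a wall\<close>

context rank_one
begin

definition smooth_germ :: "'v \<Rightarrow> ('v \<Rightarrow> real) \<Rightarrow> bool" where
  "smooth_germ x b \<longleftrightarrow> (\<exists>\<epsilon>>0. smooth_on nu (nu \<inter> ball x \<epsilon>) b)"

text \<open>Agreement with a smooth function is asked at regular points only, because a tensor field
  has meaningful values nowhere else.\<close>

definition reg_germ :: "'v \<Rightarrow> ('v \<Rightarrow> real) \<Rightarrow> bool" where
  "reg_germ x F \<longleftrightarrow> (\<exists>\<epsilon>>0. \<exists>b. smooth_on nu (nu \<inter> ball x \<epsilon>) b \<and> (\<forall>v\<in>nu \<inter> ball x \<epsilon>. reg v \<longrightarrow> F v = b v))"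

lemma smooth_shrink: "smooth_on nu (nu \<inter> ball x \<epsilon>) b \<Longrightarrow> \<epsilon>' \<le> \<epsilon> \<Longrightarrow> smooth_on nu (nu \<inter> ball x \<epsilon>') b"
  by (erule smooth_subset) auto

lemma smooth_germ_smooth: "(\<And>\<epsilon>. smooth_on nu (nu \<inter> ball x \<epsilon>) b) \<Longrightarrow> smooth_germ x b"
  unfolding smooth_germ_def by (intro exI[of _ 1]) simp

lemma smooth_germ_op2:
  assumes "smooth_germ x b" "smooth_germ x c"
    and op: "\<And>S. smooth_on nu S b \<Longrightarrow> smooth_on nu S c \<Longrightarrow> smooth_on nu S d"
  shows "smooth_germ x d"
proof -
  obtain e1 where e1: "0 < e1" "smooth_on nu (nu \<inter> ball x e1) b" using assms(1) by (auto simp: smooth_germ_def)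
  obtain e2 where e2: "0 < e2" "smooth_on nu (nu \<inter> ball x e2) c" using assms(2) by (auto simp: smooth_germ_def)
  have "smooth_on nu (nu \<inter> ball x (min e1 e2)) d"
    by (rule op[OF smooth_shrink[OF e1(2)] smooth_shrink[OF e2(2)]]) auto
  then show ?thesis unfolding smooth_germ_def using e1(1) e2(1) by (intro exI[of _ "min e1 e2"]) simp
qed

lemma smooth_germ_mult: "smooth_germ x b \<Longrightarrow> smooth_germ x c \<Longrightarrow> smooth_germ x (\<lambda>v. b v * c v)"
  by (erule (1) smooth_germ_op2) (rule smooth_mult)
lemma smooth_germ_diff: "smooth_germ x b \<Longrightarrow> smooth_germ x c \<Longrightarrow> smooth_germ x (\<lambda>v. b v - c v)"
  by (erule (1) smooth_germ_op2) (rule smooth_diff)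

lemma smooth_germ_inverse:
  assumes "smooth_germ x b" "x \<in> nu" "b x \<noteq> 0" shows "smooth_germ x (\<lambda>v. inverse (b v))"
    and "\<exists>\<epsilon>>0. \<forall>v\<in>nu \<inter> ball x \<epsilon>. b v \<noteq> 0"
proof -
  obtain e1 where e1: "0 < e1" "smooth_on nu (nu \<inter> ball x e1) b" using assms(1) by (auto simp: smooth_germ_def)
  have "x \<in> nu \<inter> ball x e1" using assms(2) e1(1) by simp
  from continuous_on_iff[THEN iffD1, OF smooth_continuous[OF e1(2)], rule_format, OF this, of "\<bar>b x\<bar>"]
  obtain d where d: "0 < d" "\<And>v. v \<in> nu \<inter> ball x e1 \<Longrightarrow> dist v x < d \<Longrightarrow> dist (b v) (b x) < \<bar>b x\<bar>"
    using assms(3) by auto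
  have nz: "b v \<noteq> 0" if v: "v \<in> nu \<inter> ball x (min e1 d)" for v
  proof
    assume "b v = 0"
    moreover have "dist (b v) (b x) < \<bar>b x\<bar>" by (rule d(2)) (use v in \<open>auto simp: dist_commute\<close>)
    ultimately show False by (simp add: dist_real_def)
  qed
  then show "\<exists>\<epsilon>>0. \<forall>v\<in>nu \<inter> ball x \<epsilon>. b v \<noteq> 0" using e1(1) d(1) by (intro exI[of _ "min e1 d"]) simp
  have "smooth_on nu (nu \<inter> ball x (min e1 d)) (\<lambda>v. inverse (b v))"
    by (rule smooth_inverse[OF smooth_shrink[OF e1(2)] nz]) auto
  then show "smooth_germ x (\<lambda>v. inverse (b v))" unfolding smooth_germ_def using e1(1) d(1) by (intro exI[of _ "min e1 d"]) simp
qed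

lemma reg_germ_op2:
  assumes "reg_germ x F1" "reg_germ x F2"
    and op: "\<And>S b c. smooth_on nu S b \<Longrightarrow> smooth_on nu S c \<Longrightarrow> smooth_on nu S (\<lambda>v. f2 (b v) (c v))"
  shows "reg_germ x (\<lambda>v. f2 (F1 v) (F2 v))"
proof -
  obtain e1 b where e1: "0 < e1" "smooth_on nu (nu \<inter> ball x e1) b" "\<forall>v\<in>nu \<inter> ball x e1. reg v \<longrightarrow> F1 v = b v"
    using assms(1) by (auto simp: reg_germ_def)
  obtain e2 c where e2: "0 < e2" "smooth_on nu (nu \<inter> ball x e2) c" "\<forall>v\<in>nu \<inter> ball x e2. reg v \<longrightarrow> F2 v = c v"
    using assms(2) by (auto simp: reg_germ_def)
  have "smooth_on nu (nu \<inter> ball x (min e1 e2)) (\<lambda>v. f2 (b v) (c v))"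
    by (rule op[OF smooth_shrink[OF e1(2)] smooth_shrink[OF e2(2)]]) auto
  then show ?thesis unfolding reg_germ_def using e1(1,3) e2(1,3)
    by (intro exI[of _ "min e1 e2"] conjI exI[of _ "\<lambda>v. f2 (b v) (c v)"]) auto
qed

lemma reg_germ_add: "reg_germ x F1 \<Longrightarrow> reg_germ x F2 \<Longrightarrow> reg_germ x (\<lambda>v. F1 v + F2 v)"
  by (rule reg_germ_op2) (auto intro: smooth_add)
lemma reg_germ_diff: "reg_germ x F1 \<Longrightarrow> reg_germ x F2 \<Longrightarrow> reg_germ x (\<lambda>v. F1 v - F2 v)"
  by (rule reg_germ_op2) (auto intro: smooth_diff)
lemma reg_germ_mult: "reg_germ x F1 \<Longrightarrow> reg_germ x F2 \<Longrightarrow> reg_germ x (\<lambda>v. F1 v * F2 v)"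
  by (rule reg_germ_op2) (auto intro: smooth_mult)
lemma smooth_germ_sx: "smooth_germ x b \<Longrightarrow> reg_germ x b"
  unfolding smooth_germ_def reg_germ_def by blast
lemma reg_germ_const: "reg_germ x (\<lambda>v. c)"
  by (rule smooth_germ_sx) (rule smooth_germ_smooth, simp)
lemma reg_germ_sum: "(\<And>i. i \<in> I \<Longrightarrow> reg_germ x (F i)) \<Longrightarrow> reg_germ x (\<lambda>v. \<Sum>i\<in>I. F i v)"
  by (induction I rule: infinite_finite_induct) (auto intro: reg_germ_add reg_germ_const)
lemma smooth_germ_linear: "bounded_linear b \<Longrightarrow> smooth_germ x b"
  by (rule smooth_germ_smooth) (rule smooth_bounded_linear)

lemma reg_germ_cong:
  assumes "reg_germ x F" "0 < \<epsilon>" "\<And>v. v \<in> nu \<inter> ball x \<epsilon> \<Longrightarrow> reg v \<Longrightarrow> F' v = F v"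
  shows "reg_germ x F'"
proof -
  obtain e1 b where e1: "0 < e1" "smooth_on nu (nu \<inter> ball x e1) b" "\<forall>v\<in>nu \<inter> ball x e1. reg v \<longrightarrow> F v = b v"
    using assms(1) by (auto simp: reg_germ_def)
  show ?thesis unfolding reg_germ_def
    by (intro exI[of _ "min e1 \<epsilon>"] conjI exI[of _ b] smooth_shrink[OF e1(2)]) (use e1 assms in auto)
qed

text \<open>Gaussian elimination. The matrix is diagonal and invertible at \<open>x\<close>, so the
  pivot stays invertible nearby, and eliminating one unknown preserves this shape at
  \<open>x\<close>.\<close>

lemma reg_germ_system:
  assumes "finite I" and x: "x \<in> nu"
  shows "(\<And>i j. i \<in> I \<Longrightarrow> j \<in> I \<Longrightarrow> smooth_germ x (b i j)) \<Longrightarrow> (\<And>i. i \<in> I \<Longrightarrow> b i i x \<noteq> 0) \<Longrightarrow>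
    (\<And>i j. i \<in> I \<Longrightarrow> j \<in> I \<Longrightarrow> i \<noteq> j \<Longrightarrow> b i j x = 0) \<Longrightarrow> (\<And>i. i \<in> I \<Longrightarrow> reg_germ x (R i)) \<Longrightarrow>
    \<exists>\<epsilon>>0. \<forall>v\<in>nu \<inter> ball x \<epsilon>. reg v \<longrightarrow> (\<forall>i\<in>I. (\<Sum>j\<in>I. b i j v * D j v) = R i v) \<Longrightarrow>
    \<forall>j\<in>I. reg_germ x (D j)"
  using assms(1)
proof (induction I arbitrary: b R rule: finite_induct)
  case empty then show ?case by simp
next
  case (insert k I)
  obtain e0 where e0: "0 < e0" and eq: "\<And>v i. v \<in> nu \<inter> ball x e0 \<Longrightarrow> reg v \<Longrightarrow> i \<in> insert k I \<Longrightarrow> (\<Sum>j\<in>insert k I. b i j v * D j v) = R i v"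
    using insert.prems(5) by blast
  have bk: "smooth_germ x (b k k)" "b k k x \<noteq> 0" using insert.prems(1,2) by auto
  obtain e1 where e1: "0 < e1" "\<forall>v\<in>nu \<inter> ball x e1. b k k v \<noteq> 0" using smooth_germ_inverse(2)[OF bk(1) x bk(2)] by blast
  define c where "c = (\<lambda>v. inverse (b k k v))"
  have c: "smooth_germ x c" unfolding c_def by (rule smooth_germ_inverse(1)[OF bk(1) x bk(2)])
  define e where "e = min e0 e1"
  have e: "0 < e" using e0 e1 by (simp add: e_def)
  have Dk: "D k v = c v * (R k v - (\<Sum>j\<in>I. b k j v * D j v))" if "v \<in> nu \<inter> ball x e" "reg v" for v
  proof -
    have "b k k v * D k v + (\<Sum>j\<in>I. b k j v * D j v) = R k v"
      using eq[of v k] that insert.hyps by (simp add: e_def)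
    moreover have "b k k v \<noteq> 0" using e1 that by (simp add: e_def)
    ultimately show ?thesis by (simp add: c_def field_simps)
  qed
  define b' where "b' i j = (\<lambda>v. b i j v - b i k v * c v * b k j v)" for i j
  define R' where "R' i = (\<lambda>v. R i v - b i k v * c v * R k v)" for i
  have "\<forall>j\<in>I. reg_germ x (D j)"
  proof (rule insert.IH[of b' R'])
    show "smooth_germ x (b' i j)" if "i \<in> I" "j \<in> I" for i j
      unfolding b'_def using that insert.prems(1) by (intro smooth_germ_diff smooth_germ_mult c) auto
    show "b' i i x \<noteq> 0" if "i \<in> I" for i
    proof -
      have "i \<noteq> k" using that insert.hyps by auto
      then have "b i k x = 0" using insert.prems(3)[of i k] that by simp
      then show ?thesis using insert.prems(2)[of i] that by (simp add: b'_def)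
    qed
    show "b' i j x = 0" if "i \<in> I" "j \<in> I" "i \<noteq> j" for i j
    proof -
      have "i \<noteq> k" using that insert.hyps by auto
      then have "b i k x = 0" using insert.prems(3)[of i k] that by simp
      then show ?thesis using insert.prems(3)[of i j] that by (simp add: b'_def)
    qed
    show "reg_germ x (R' i)" if "i \<in> I" for i
      unfolding R'_def
      by (intro reg_germ_diff reg_germ_mult smooth_germ_sx[OF c] smooth_germ_sx[OF insert.prems(1)] insert.prems(4)) (use that in auto)
    show "\<exists>\<epsilon>>0. \<forall>v\<in>nu \<inter> ball x \<epsilon>. reg v \<longrightarrow> (\<forall>i\<in>I. (\<Sum>j\<in>I. b' i j v * D j v) = R' i v)"
    proof (intro exI[of _ e] conjI e ballI impI)
      fix v i assume v: "v \<in> nu \<inter> ball x e" "reg v" and i: "i \<in> I"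
      have e1: "b i k v * D k v + (\<Sum>j\<in>I. b i j v * D j v) = R i v"
        using eq[of v i] v i insert.hyps by (simp add: e_def)
      have "(\<Sum>j\<in>I. b' i j v * D j v) = (\<Sum>j\<in>I. b i j v * D j v) - b i k v * c v * (\<Sum>j\<in>I. b k j v * D j v)"
        by (simp add: b'_def left_diff_distrib sum_subtractf sum_distrib_left mult.assoc)
      also have "\<dots> = R i v - b i k v * D k v - b i k v * c v * (\<Sum>j\<in>I. b k j v * D j v)" using e1 by simp
      also have "\<dots> = R' i v" unfolding Dk[OF v] R'_def by (simp add: algebra_simps)
      finally show "(\<Sum>j\<in>I. b' i j v * D j v) = R' i v" .
    qed
  qed
  moreover have "reg_germ x (D k)"
  proof (rule reg_germ_cong[OF _ e Dk])
    show "reg_germ x (\<lambda>v. c v * (R k v - (\<Sum>j\<in>I. b k j v * D j v)))"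
      using insert.prems(1,4) calculation by (intro reg_germ_mult reg_germ_diff reg_germ_sum smooth_germ_sx[OF c]) (auto intro: smooth_germ_sx)
  qed
  ultimately show ?case by simp
qed

lemma nu_decomp:
  obtains B where "finite B" "B \<subseteq> nu" "\<And>y. y = (\<Sum>c\<in>B. (y \<bullet> c) *\<^sub>R c) + (\<Sum>e\<in>E - E1. (y \<bullet> e) *\<^sub>R e)"
proof -
  obtain B where B: "B \<subseteq> nu" "pairwise orthogonal B" "\<And>b. b \<in> B \<Longrightarrow> norm b = 1"
     "independent B" "card B = dim nu" "span B = nu"
    using orthonormal_basis_subspace[OF subnu] by metis
  have finB: "finite B" using B(4) by (simp add: independent_imp_finite)
  have oB: "e \<bullet> e' = (if e = e' then 1 else 0)" if "e \<in> B" "e' \<in> B" for e e'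
    using B(2,3) that by (auto simp: pairwise_def orthogonal_def dot_square_norm)
  show thesis
  proof (rule that[OF finB B(1)])
    fix y
    define u where "u = y - (\<Sum>e\<in>E - E1. (y \<bullet> e) *\<^sub>R e)"
    have "u \<in> nu" unfolding nu_def
    proof (intro CollectI ballI)
      fix e assume e: "e \<in> E - E1"
      have "(\<Sum>e'\<in>E - E1. (y \<bullet> e') *\<^sub>R e') \<bullet> e = (\<Sum>e'\<in>E - E1. if e' = e then y \<bullet> e' else 0)"
        unfolding inner_sum_left using orthE e by (intro sum.cong) auto
      then show "u \<bullet> e = 0" using e finE by (simp add: u_def inner_diff_left)
    qed
    then have "u = (\<Sum>c\<in>B. (u \<bullet> c) *\<^sub>R c)" using B(6) by (intro orthonormal_expand[OF finB oB]) auto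
    also have "\<dots> = (\<Sum>c\<in>B. (y \<bullet> c) *\<^sub>R c)"
    proof (rule sum.cong)
      fix c assume "c \<in> B"
      then have "c \<in> nu" using B(1) by blast
      then have "(\<Sum>e\<in>E - E1. (y \<bullet> e) *\<^sub>R e) \<bullet> c = 0"
        unfolding inner_sum_left by (intro sum.neutral) (auto simp: nu_def inner_commute)
      then show "(u \<bullet> c) *\<^sub>R c = (y \<bullet> c) *\<^sub>R c" by (simp add: u_def inner_diff_left)
    qed simp
    finally show "y = (\<Sum>c\<in>B. (y \<bullet> c) *\<^sub>R c) + (\<Sum>e\<in>E - E1. (y \<bullet> e) *\<^sub>R e)"
      by (simp add: u_def algebra_simps)
  qed
qed

text \<open>Derivatives along the slice are those of the smooth germ. For the remaining directions,
  equivariance gives one equation for each \<open>XX i\<close> with \<open>i\<close> in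
  \<open>E - E1\<close>, expressing the derivative along \<open>XX i v\<close> algebraically. At
  \<open>x\<close> the vector \<open>XX i x\<close> is \<open>a i \<bullet> x\<close> times
  \<open>i\<close>, so the system for these derivatives is diagonal and invertible there.\<close>

lemma germ_step:
  assumes x: "x \<in> H" "x \<in> ball 0 r" and gen: "\<And>e. e \<in> E - E1 \<Longrightarrow> a e \<bullet> x \<noteq> 0"
    and t: "equiv_field q t"
    and t': "\<And>v ws. v \<in> ball 0 r \<Longrightarrow> reg v \<Longrightarrow> length ws = q \<Longrightarrow> ((\<lambda>v. t v ws) has_derivative (\<lambda>u. t' v (u # ws))) (at v)"
    and ge: "\<And>ws. length ws = q \<Longrightarrow> reg_germ x (\<lambda>v. t v ws)" and ws: "length ws = q"
  shows "reg_germ x (\<lambda>v. t' v (u # ws))"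
proof -
  have xnu: "x \<in> nu" by (rule Hnu[OF x(1)])
  define e0 where "e0 = r - norm x"
  have e0: "0 < e0" using x(2) by (simp add: e0_def)
  have ballr: "v \<in> ball 0 r" if "v \<in> ball x e0" for v
    using that norm_triangle_ineq[of x "v - x"] by (simp add: e0_def dist_norm norm_minus_commute)
  have nu_case: "reg_germ x (\<lambda>v. t' v (u # ws))" if u: "u \<in> nu" for u
  proof -
    obtain e1 b where e1: "0 < e1" "smooth_on nu (nu \<inter> ball x e1) b" "\<forall>v\<in>nu \<inter> ball x e1. reg v \<longrightarrow> t v ws = b v"
      using ge[OF ws] by (auto simp: reg_germ_def)
    define e where "e = min e0 e1"
    have e: "0 < e" using e0 e1 by (simp add: e_def)
    have bs: "smooth_on nu (nu \<inter> ball x e) b" by (rule smooth_shrink[OF e1(2)]) (simp add: e_def)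
    obtain g where g: "\<And>v. v \<in> nu \<inter> ball x e \<Longrightarrow> (b has_derivative (\<lambda>h. g v \<bullet> h)) (at v within nu \<inter> ball x e)"
      "\<And>v. g v \<in> nu" "\<And>c. smooth_on nu (nu \<inter> ball x e) (\<lambda>v. g v \<bullet> c)" "continuous_on (nu \<inter> ball x e) g"
      by (rule smooth_gradient[OF bs ropen_ball[OF subnu]]) blast
    have "t' v (u # ws) = g v \<bullet> u" if v: "v \<in> nu \<inter> ball x e" "reg v" for v
    proof -
      let ?S = "nu \<inter> (ball x e \<inter> {v. reg v})"
      have rS: "ropen nu ?S" by (intro ropen_open subnu open_Int open_ball open_reg)
      have vS: "v \<in> ?S" using v by simp
      have "v \<in> ball x e0" using v by (simp add: e_def)
      then have "((\<lambda>v. t v ws) has_derivative (\<lambda>u. t' v (u # ws))) (at v within ?S)"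
        using t'[OF ballr v(2) ws] has_derivative_at_withinI by blast
      then have "(b has_derivative (\<lambda>u. t' v (u # ws))) (at v within ?S)"
        by (rule has_derivative_transform[OF vS, rotated]) (use e1(3) in \<open>simp add: e_def\<close>)
      moreover have "(b has_derivative (\<lambda>h. g v \<bullet> h)) (at v within ?S)"
        by (rule has_derivative_subset[OF g(1)[OF v(1)]]) auto
      ultimately show ?thesis by (rule ropen_derivative_unique[OF rS vS u])
    qed
    then show ?thesis unfolding reg_germ_def using e g(3)[of u] by (intro exI[of _ e] conjI exI[of _ "\<lambda>v. g v \<bullet> u"]) auto
  qed
  obtain B where B: "finite B" "B \<subseteq> nu" "\<And>y. y = (\<Sum>c\<in>B. (y \<bullet> c) *\<^sub>R c) + (\<Sum>e\<in>E - E1. (y \<bullet> e) *\<^sub>R e)"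
    by (rule nu_decomp) blast
  have lin: "linear (\<lambda>u. t' v (u # ws))" if "v \<in> ball 0 r" "reg v" for v
    using t'[OF that ws] has_derivative_linear by blast
  have expand: "t' v (y # ws) = (\<Sum>c\<in>B. (y \<bullet> c) * t' v (c # ws)) + (\<Sum>e\<in>E - E1. (y \<bullet> e) * t' v (e # ws))"
    if v: "v \<in> ball 0 r" "reg v" for v y
  proof -
    have "t' v (y # ws) = t' v (((\<Sum>c\<in>B. (y \<bullet> c) *\<^sub>R c) + (\<Sum>e\<in>E - E1. (y \<bullet> e) *\<^sub>R e)) # ws)"
      by (rule arg_cong[OF B(3)])
    also have "\<dots> = t' v ((\<Sum>c\<in>B. (y \<bullet> c) *\<^sub>R c) # ws) + t' v ((\<Sum>e\<in>E - E1. (y \<bullet> e) *\<^sub>R e) # ws)"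
      by (rule linear_add[OF lin[OF v]])
    finally show ?thesis by (simp add: linear_sum[OF lin[OF v]] linear_cmul[OF lin[OF v]])
  qed
  have Ecase: "\<forall>e\<in>E - E1. reg_germ x (\<lambda>v. t' v (e # ws))"
  proof (rule reg_germ_system[where b = "\<lambda>e' e v. blinfun_apply (XX e') v \<bullet> e" and
        R = "\<lambda>e' v. (- act (XX e') (t v) ws) - (\<Sum>c\<in>B. (blinfun_apply (XX e') v \<bullet> c) * t' v (c # ws))"])
    show "finite (E - E1)" using finE by simp
    show "x \<in> nu" by (rule xnu)
    have bl: "bounded_linear (\<lambda>v. blinfun_apply X v \<bullet> c)" for X :: "'v \<Rightarrow>\<^sub>L 'v" and c
      by (rule bounded_linear_compose[OF bounded_linear_inner_left blinfun.bounded_linear_right])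
    show "smooth_germ x (\<lambda>v. blinfun_apply (XX i) v \<bullet> j)" for i j by (rule smooth_germ_linear[OF bl])
    show "blinfun_apply (XX i) x \<bullet> i \<noteq> 0" if "i \<in> E - E1" for i
      using that XXy[OF _ H\<Sigma>[OF x(1)], of i] orthE[of i i] gen[OF that] by simp
    show "blinfun_apply (XX i) x \<bullet> j = 0" if "i \<in> E - E1" "j \<in> E - E1" "i \<noteq> j" for i j
      using that XXy[OF _ H\<Sigma>[OF x(1)], of i] orthE[of i j] by simp
    show "reg_germ x (\<lambda>v. - act (XX i) (t v) ws - (\<Sum>c\<in>B. (blinfun_apply (XX i) v \<bullet> c) * t' v (c # ws)))" for i
    proof (intro reg_germ_diff reg_germ_sum reg_germ_mult)
      have "reg_germ x (\<lambda>v. (- 1) * act (XX i) (t v) ws)"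
        unfolding act_def by (intro reg_germ_mult reg_germ_const reg_germ_sum ge) (use ws in simp)
      then show "reg_germ x (\<lambda>v. - act (XX i) (t v) ws)" by simp
      show "reg_germ x (\<lambda>v. blinfun_apply (XX i) v \<bullet> c)" for c by (rule smooth_germ_sx[OF smooth_germ_linear[OF bl]])
      show "reg_germ x (\<lambda>v. t' v (c # ws))" if "c \<in> B" for c using nu_case that B(2) by blast
    qed
    show "\<exists>\<epsilon>>0. \<forall>v\<in>nu \<inter> ball x \<epsilon>. reg v \<longrightarrow> (\<forall>i\<in>E - E1. (\<Sum>j\<in>E - E1. blinfun_apply (XX i) v \<bullet> j * t' v (j # ws)) =
       - act (XX i) (t v) ws - (\<Sum>c\<in>B. (blinfun_apply (XX i) v \<bullet> c) * t' v (c # ws)))"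
    proof (intro exI[of _ e0] conjI e0 ballI impI)
      fix v i assume v: "v \<in> nu \<inter> ball x e0" "reg v" and i: "i \<in> E - E1"
      have vb: "v \<in> ball 0 r" using ballr v by simp
      have "t' v (blinfun_apply (XX i) v # ws) = - act (XX i) (t v) ws"
        by (rule field_L_derivative[OF t ws _ t'[OF vb v(2) ws]]) (use i XXL in simp)
      with expand[OF vb v(2), of "blinfun_apply (XX i) v"]
      show "(\<Sum>j\<in>E - E1. blinfun_apply (XX i) v \<bullet> j * t' v (j # ws)) =
         - act (XX i) (t v) ws - (\<Sum>c\<in>B. (blinfun_apply (XX i) v \<bullet> c) * t' v (c # ws))"
        by linarith
    qed
  qed
  show ?thesis
  proof (rule reg_germ_cong[OF _ e0])
    show "reg_germ x (\<lambda>v. (\<Sum>c\<in>B. (u \<bullet> c) * t' v (c # ws)) + (\<Sum>e\<in>E - E1. (u \<bullet> e) * t' v (e # ws)))"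
    proof (rule reg_germ_add)
      show "reg_germ x (\<lambda>v. \<Sum>c\<in>B. (u \<bullet> c) * t' v (c # ws))"
        by (rule reg_germ_sum) (rule reg_germ_mult[OF reg_germ_const nu_case[OF subsetD[OF B(2)]]])
      show "reg_germ x (\<lambda>v. \<Sum>e\<in>E - E1. (u \<bullet> e) * t' v (e # ws))"
        by (rule reg_germ_sum) (rule reg_germ_mult[OF reg_germ_const bspec[OF Ecase]])
    qed
    show "t' v (u # ws) = (\<Sum>c\<in>B. (u \<bullet> c) * t' v (c # ws)) + (\<Sum>e\<in>E - E1. (u \<bullet> e) * t' v (e # ws))"
      if "v \<in> nu \<inter> ball x e0" "reg v" for v
      by (rule expand) (use that ballr in auto)
  qed
qed

lemma generic_ray:
  assumes x: "x \<in> H" "x \<in> ball 0 r" and gen: "\<And>e. e \<in> E - E1 \<Longrightarrow> a e \<bullet> x \<noteq> 0"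
  shows "\<forall>\<^sub>F n in sequentially. reg (x + (1 / real (Suc n)) *\<^sub>R \<alpha>) \<and> x + (1 / real (Suc n)) *\<^sub>R \<alpha> \<in> ball 0 r"
proof -
  have x\<Sigma>: "x + s *\<^sub>R \<alpha> \<in> \<Sigma>" for s by (intro subspace_add subspace_scale sub\<Sigma> \<alpha>\<Sigma> H\<Sigma> x)
  have lim: "(\<lambda>n. x + (1 / real (Suc n)) *\<^sub>R \<alpha>) \<longlonglongrightarrow> x + 0 *\<^sub>R \<alpha>"
    by (intro tendsto_add tendsto_scaleR tendsto_const LIMSEQ_Suc[OF lim_1_over_n])
  have "\<forall>\<^sub>F n in sequentially. a e \<bullet> (x + (1 / real (Suc n)) *\<^sub>R \<alpha>) \<noteq> 0" if e: "e \<in> E" for e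
  proof (cases "e \<in> E1")
    case True
    then show ?thesis using a_E1_H[OF True x(1)] a_E1_nz[OF True] by (simp add: inner_add_right)
  next
    case False
    have "(\<lambda>n. a e \<bullet> (x + (1 / real (Suc n)) *\<^sub>R \<alpha>)) \<longlonglongrightarrow> a e \<bullet> (x + 0 *\<^sub>R \<alpha>)" by (rule tendsto_inner[OF tendsto_const lim])
    then show ?thesis by (rule tendsto_imp_eventually_ne) (use gen e False in simp)
  qed
  then have "\<forall>\<^sub>F n in sequentially. \<forall>e\<in>E. a e \<bullet> (x + (1 / real (Suc n)) *\<^sub>R \<alpha>) \<noteq> 0"
    using finE by (simp add: eventually_ball_finite)
  moreover have "\<forall>\<^sub>F n in sequentially. x + (1 / real (Suc n)) *\<^sub>R \<alpha> \<in> ball 0 r"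
    using topological_tendstoD[OF lim, of "ball 0 r"] x(2) by simp
  ultimately show ?thesis by eventually_elim (simp add: reg\<Sigma>[OF x\<Sigma>])
qed

text \<open>Approach \<open>x\<close> along the ray in direction \<alpha> and along its image under
  an element of \<open>K1\<close>. Both rays lie in the slice, where \<open>t\<close> has a
  continuous germ, so the limits agree. Hence the limiting tensor is \<open>K1\<close>-invariant,
  and differentiating along \<open>ex (s XX f)\<close> gives the claim.\<close>

lemma act_vanishes:
  assumes x: "x \<in> H" "x \<in> ball 0 r" and gen: "\<And>e. e \<in> E - E1 \<Longrightarrow> a e \<bullet> x \<noteq> 0"
    and t: "equiv_field q t" and ge: "\<And>ws. length ws = q \<Longrightarrow> reg_germ x (\<lambda>v. t v ws)"
    and Q: "\<And>ws. length ws = q \<Longrightarrow> continuous_on (\<Sigma> \<inter> ball 0 r) (Q ws)"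
    and tQ: "\<And>z ws. z \<in> \<Sigma> \<inter> ball 0 r \<Longrightarrow> reg z \<Longrightarrow> length ws = q \<Longrightarrow> t z ws = Q ws z"
    and ws: "length ws = q"
  shows "act (XX f) (\<lambda>ws. Q ws x) ws = 0"
proof -
  define z where "z n = x + (1 / real (Suc n)) *\<^sub>R \<alpha>" for n
  have ev: "\<forall>\<^sub>F n in sequentially. reg (z n) \<and> z n \<in> ball 0 r" unfolding z_def by (rule generic_ray[OF x gen])
  have z\<Sigma>: "z n \<in> \<Sigma>" for n unfolding z_def by (intro subspace_add subspace_scale sub\<Sigma> \<alpha>\<Sigma> H\<Sigma> x)
  have l0: "(\<lambda>n. 1 / real (Suc n)) \<longlonglongrightarrow> 0" using LIMSEQ_Suc[OF lim_1_over_n] by simp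
  have zx: "z \<longlonglongrightarrow> x"
  proof -
    have "(\<lambda>n. x + (1 / real (Suc n)) *\<^sub>R \<alpha>) \<longlonglongrightarrow> x + 0 *\<^sub>R \<alpha>" by (intro tendsto_intros l0)
    then show ?thesis by (simp add: z_def[abs_def])
  qed
  have limQ: "(\<lambda>n. t (z n) ws) \<longlonglongrightarrow> Q ws x" if ws: "length ws = q" for ws
  proof -
    have "\<forall>\<^sub>F n in sequentially. z n \<in> \<Sigma> \<inter> ball 0 r" using ev by eventually_elim (simp add: z\<Sigma>)
    then have "(\<lambda>n. Q ws (z n)) \<longlonglongrightarrow> Q ws x"
      using continuous_on_tendsto_compose[OF Q[OF ws] zx] x H\<Sigma> by simp
    moreover have "\<forall>\<^sub>F n in sequentially. Q ws (z n) = t (z n) ws"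
      using ev by eventually_elim (use tQ[OF _ _ ws] z\<Sigma> in auto)
    ultimately show ?thesis by (rule Lim_transform_eventually)
  qed
  have inv: "Q (map (blinfun_apply h) ws) x = Q ws x" if h: "h \<in> K1" and ws: "length ws = q" for h ws
  proof -
    have hG: "h \<in> G" by (rule K1_G[OF h])
    have lw: "length (map (blinfun_apply h) ws) = q" using ws by simp
    have hz: "blinfun_apply h (z n) = x + (1 / real (Suc n)) *\<^sub>R blinfun_apply h \<alpha>" for n
      unfolding z_def using K1_H[OF h x(1)] by (simp add: bl_simps)
    obtain e1 b where e1: "0 < e1" "smooth_on nu (nu \<inter> ball x e1) b"
       "\<forall>v\<in>nu \<inter> ball x e1. reg v \<longrightarrow> t v (map (blinfun_apply h) ws) = b v"
      using ge[OF lw] by (auto simp: reg_germ_def)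
    have xn: "x \<in> nu \<inter> ball x e1" using Hnu[OF x(1)] e1(1) by simp
    have gen_lim: "(\<lambda>n. t (y n) (map (blinfun_apply h) ws)) \<longlonglongrightarrow> b x"
      if y: "y \<longlonglongrightarrow> x" "\<And>n. y n \<in> nu" "\<forall>\<^sub>F n in sequentially. reg (y n)" for y
    proof -
      have nb: "\<forall>\<^sub>F n in sequentially. y n \<in> nu \<inter> ball x e1"
        using topological_tendstoD[OF y(1), of "ball x e1"] e1(1) y(2) by simp
      then have "(\<lambda>n. b (y n)) \<longlonglongrightarrow> b x"
        using continuous_on_tendsto_compose[OF smooth_continuous[OF e1(2)] y(1) xn] by simp
      moreover have "\<forall>\<^sub>F n in sequentially. b (y n) = t (y n) (map (blinfun_apply h) ws)"
        using nb y(3) by eventually_elim (use e1(3) in auto)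
      ultimately show ?thesis by (rule Lim_transform_eventually)
    qed
    have regz: "\<forall>\<^sub>F n in sequentially. reg (z n)" using ev by eventually_elim simp
    have "b x = Q (map (blinfun_apply h) ws) x"
      using LIMSEQ_unique[OF gen_lim[OF zx \<Sigma>nu[OF z\<Sigma>] regz] limQ[OF lw]] .
    moreover have "(\<lambda>n. t (blinfun_apply h (z n)) (map (blinfun_apply h) ws)) \<longlonglongrightarrow> b x"
    proof (rule gen_lim)
      have "(\<lambda>n. blinfun_apply h (z n)) \<longlonglongrightarrow> blinfun_apply h x" by (intro tendsto_intros zx)
      then show "(\<lambda>n. blinfun_apply h (z n)) \<longlonglongrightarrow> x" using K1_H[OF h x(1)] by simp
      show "blinfun_apply h (z n) \<in> nu" for n
        unfolding hz by (intro subspace_add subspace_scale subnu Hnu Nnu K1_N[OF h] \<alpha>N x)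
      show "\<forall>\<^sub>F n in sequentially. reg (blinfun_apply h (z n))" using regz by (simp add: reg_G[OF hG])
    qed
    then have "(\<lambda>n. t (z n) ws) \<longlonglongrightarrow> b x" using equiv_G[OF t hG ws] by simp
    from LIMSEQ_unique[OF this limQ[OF ws]] have "b x = Q ws x" .
    ultimately show ?thesis by simp
  qed
  \<comment> \<open>At the singular point \<open>x\<close>, multilinearity is available only as a
    limit of that of \<open>t\<close> at regular points.\<close>
  have ml: "mlin q (\<lambda>ws. Q ws x)"
    unfolding mlin_def
  proof (intro allI impI)
    fix xs ys :: "'v list" assume len: "length xs + length ys + 1 = q"
    have l: "length (xs @ w # ys) = q" for w using len by simp
    have lin: "linear (\<lambda>w. t v (xs @ w # ys))" for v by (rule mlinD[OF equiv_mlin[OF t] len])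
    show "linear (\<lambda>w. Q (xs @ w # ys) x)"
    proof (rule linearI)
      fix w w' c
      have "(\<lambda>n. t (z n) (xs @ w # ys) + t (z n) (xs @ w' # ys)) \<longlonglongrightarrow> Q (xs @ w # ys) x + Q (xs @ w' # ys) x"
        by (intro tendsto_add limQ l)
      then have "(\<lambda>n. t (z n) (xs @ (w + w') # ys)) \<longlonglongrightarrow> Q (xs @ w # ys) x + Q (xs @ w' # ys) x"
        by (simp add: linear_add[OF lin])
      from LIMSEQ_unique[OF limQ[OF l] this]
      show "Q (xs @ (w + w') # ys) x = Q (xs @ w # ys) x + Q (xs @ w' # ys) x" .
      have "(\<lambda>n. c *\<^sub>R t (z n) (xs @ w # ys)) \<longlonglongrightarrow> c *\<^sub>R Q (xs @ w # ys) x"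
        by (intro tendsto_scaleR tendsto_const limQ l)
      then have "(\<lambda>n. t (z n) (xs @ (c *\<^sub>R w) # ys)) \<longlonglongrightarrow> c *\<^sub>R Q (xs @ w # ys) x"
        by (simp add: linear_cmul[OF lin])
      from LIMSEQ_unique[OF limQ[OF l] this]
      show "Q (xs @ (c *\<^sub>R w) # ys) x = c *\<^sub>R Q (xs @ w # ys) x" .
    qed
  qed
  show ?thesis
    by (rule act_zero_of_invariant) (use ml ws inv[OF ex_K1[OF fE1] ws] XXL[OF fE] in auto)
qed

end

section \<open>Extension across the singular set\<close>

lemma mlin_Cons: "mlin (Suc q) t \<Longrightarrow> mlin q (\<lambda>ws. t (w # ws))"
  unfolding mlin_def
proof (intro allI impI)
  fix xs ys :: "'a list"
  assume t: "\<forall>xs ys. length xs + length ys + 1 = Suc q \<longrightarrow> linear (\<lambda>w. t (xs @ w # ys))" and l: "length xs + length ys + 1 = q"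
  show "linear (\<lambda>w'. t (w # xs @ w' # ys))"
    using t[rule_format, of "w # xs" ys] l by simp
qed

lemma mlin_family_bounded:
  fixes t :: "'z \<Rightarrow> 'v::euclidean_space list \<Rightarrow> real"
  shows "(\<And>z. z \<in> Z \<Longrightarrow> mlin q (t z)) \<Longrightarrow>
    (\<And>bs. set bs \<subseteq> Basis \<Longrightarrow> length bs = q \<Longrightarrow> \<exists>C. \<forall>z\<in>Z. \<bar>t z bs\<bar> \<le> C) \<Longrightarrow>
    \<exists>C. \<forall>z\<in>Z. \<forall>ws. length ws = q \<and> (\<forall>w\<in>set ws. norm w \<le> R) \<longrightarrow> \<bar>t z ws\<bar> \<le> C"
proof (induction q arbitrary: t)
  case 0 from 0(2)[of "[]"] show ?case by simp
next
  case (Suc q)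
  have "\<exists>C. \<forall>z\<in>Z. \<forall>ws. length ws = q \<and> (\<forall>w\<in>set ws. norm w \<le> R) \<longrightarrow> \<bar>t z (b # ws)\<bar> \<le> C" if b: "b \<in> Basis" for b
  proof (rule Suc.IH)
    show "mlin q (\<lambda>ws. t z (b # ws))" if "z \<in> Z" for z by (rule mlin_Cons[OF Suc.prems(1)[OF that]])
    show "\<exists>C. \<forall>z\<in>Z. \<bar>t z (b # bs)\<bar> \<le> C" if "set bs \<subseteq> Basis" "length bs = q" for bs
      using Suc.prems(2)[of "b # bs"] b that by simp
  qed
  then obtain C where C: "\<And>b z ws. b \<in> Basis \<Longrightarrow> z \<in> Z \<Longrightarrow> length ws = q \<Longrightarrow> (\<forall>w\<in>set ws. norm w \<le> R) \<Longrightarrow> \<bar>t z (b # ws)\<bar> \<le> C b"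
    by metis
  show ?case
  proof (intro exI[of _ "\<Sum>b\<in>Basis. R * C b"] ballI allI impI)
    fix z and ws :: "'v list" assume z: "z \<in> Z" and ws: "length ws = Suc q \<and> (\<forall>w\<in>set ws. norm w \<le> R)"
    then obtain w ws' where w: "ws = w # ws'" "length ws' = q" "norm w \<le> R" "\<forall>w\<in>set ws'. norm w \<le> R"
      by (cases ws) auto
    have "t z ws = (\<Sum>b\<in>Basis. (w \<bullet> b) * t z (b # ws'))"
      using mlin_expand[OF Suc.prems(1)[OF z], of "[]" ws' w] w by simp
    also have "\<bar>\<dots>\<bar> \<le> (\<Sum>b\<in>Basis. R * C b)"
    proof (intro order_trans[OF sum_abs] sum_mono)
      fix b :: 'v assume b: "b \<in> Basis"
      have "\<bar>w \<bullet> b\<bar> \<le> R" using Basis_le_norm[OF b, of w] w(3) by simp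
      then show "\<bar>(w \<bullet> b) * t z (b # ws')\<bar> \<le> R * C b"
        unfolding abs_mult using C[OF b z w(2,4)] by (intro mult_mono) auto
    qed
    finally show "\<bar>t z ws\<bar> \<le> (\<Sum>b\<in>Basis. R * C b)" .
  qed
qed

context roots
begin

text \<open>Every singular orbit meets a wall, of dimension one less than \<Sigma>, and has
  dimension below \<open>card E\<close>. This leaves codimension two, hence room for the line
  spanned by \<open>u\<close>.\<close>

lemma negligible_singular: "negligible {v + \<tau> *\<^sub>R u | v \<tau>. \<not> reg v}"
proof -
  define M where "M e d = {blinfun_apply g x + w | g x w. g \<in> G \<and> x \<in> {x\<in>\<Sigma>. a e \<bullet> x = 0} \<and> dim (LX x) = d \<and> w \<in> span {u}}" for e d
  have "negligible (M e d)" if e: "e \<in> E" and d: "d < card E" for e d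
    unfolding M_def
  proof (rule negligible_lowdim_orbits)
    show sQ: "subspace {x\<in>\<Sigma>. a e \<bullet> x = 0}" using sub\<Sigma> by (auto simp: subspace_def inner_add_right)
    show "subspace (span {u})" by simp
    have "{x\<in>\<Sigma>. a e \<bullet> x = 0} \<noteq> \<Sigma>" using x0\<Sigma> a_x0[OF e] by force
    then have "dim {x\<in>\<Sigma>. a e \<bullet> x = 0} < dim \<Sigma>"
      using subspace_dim_equal[OF sQ sub\<Sigma>] by (force simp: not_le[symmetric])
    moreover have "dim (span {u}) \<le> 1" using dim_le_card'[of "{u}"] by simp
    moreover have "card E + dim \<Sigma> = DIM('v)" using dimSp cardE by simp
    ultimately show "d + dim {x\<in>\<Sigma>. a e \<bullet> x = 0} + dim (span {u}) < DIM('v)" using d by linarith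
  qed
  then have "negligible (\<Union>(e, d)\<in>E \<times> {..<card E}. M e d)"
    using finE by (intro negligible_Union) auto
  then show ?thesis
  proof (rule negligible_subset, safe)
    fix v \<tau> assume v: "\<not> reg v"
    obtain g where g: "g \<in> G" "blinfun_apply g v \<in> \<Sigma>" using meet\<Sigma> by blast
    let ?x = "blinfun_apply g v"
    have "\<not> reg ?x" using v reg_G[OF g(1)] by simp
    then obtain e where e: "e \<in> E" "a e \<bullet> ?x = 0" using reg\<Sigma>[OF g(2)] by blast
    have "{e\<in>E. a e \<bullet> ?x \<noteq> 0} \<subset> E" using e by blast
    then have "dim (LX ?x) < card E" unfolding dimLX\<Sigma>[OF g(2)] by (rule psubset_card_mono[OF finE])
    moreover have "v + \<tau> *\<^sub>R u = blinfun_apply (gi g) ?x + \<tau> *\<^sub>R u" using g(1) by simp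
    then have "v + \<tau> *\<^sub>R u \<in> M e (dim (LX ?x))"
      unfolding M_def using gi_G[OF g(1)] g(2) e(2) span_scale[OF span_base[of u "{u}"], of \<tau>]
      by (intro CollectI exI[of _ "gi g"] exI[of _ ?x] exI[of _ "\<tau> *\<^sub>R u"]) simp
    ultimately show "v + \<tau> *\<^sub>R u \<in> (\<Union>(e, d)\<in>E \<times> {..<card E}. M e d)" using e(1) by blast
  qed
qed

text \<open>A point outside the null set swept out by singular points moving parallel to
  \<open>u\<close> has its whole line in direction \<open>u\<close> regular.\<close>

lemma regular_segment:
  assumes "0 < \<delta>" shows "\<exists>z. norm z < \<delta> \<and> (\<forall>s. reg (y + z + s *\<^sub>R u))"
proof -
  let ?N = "{v + \<tau> *\<^sub>R u | v \<tau>. \<not> reg v}"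
  have "\<not> ball y \<delta> \<subseteq> ?N"
    using negligible_subset[OF negligible_singular] open_not_negligible[OF open_ball, of y \<delta>] assms by auto
  then obtain v where v: "v \<in> ball y \<delta>" "v \<notin> ?N" by blast
  have "reg (y + (v - y) + s *\<^sub>R u)" for s
  proof (rule ccontr)
    assume n: "\<not> ?thesis"
    have "v = (v + s *\<^sub>R u) + (- s) *\<^sub>R u" by simp
    then have "v \<in> ?N" using n by (intro CollectI exI[of _ "v + s *\<^sub>R u"] exI[of _ "- s"]) simp
    then show False using v by blast
  qed
  then show ?thesis using v(1) by (intro exI[of _ "v - y"]) (simp add: dist_norm norm_minus_commute)
qed

lemma regular_dense: "0 < \<delta> \<Longrightarrow> \<exists>v. norm (v - y) < \<delta> \<and> reg v"
proof -
  assume "0 < \<delta>"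
  from regular_segment[OF this, of y 0] obtain z where "norm z < \<delta>" "reg (y + z)" by auto
  then show ?thesis by (intro exI[of _ "y + z"]) simp
qed

lemma regular_limit:
  assumes v: "v \<in> ball 0 r"
  shows "\<exists>y. (\<forall>n::nat. y n \<in> ball 0 r \<and> reg (y n)) \<and> y \<longlonglongrightarrow> v"
proof -
  have "\<forall>n::nat. \<exists>y. norm (y - v) < min (r - norm v) (1 / real (Suc n)) \<and> reg y"
    using v by (intro allI regular_dense) simp
  from choice[OF this] obtain y where y: "\<And>n::nat. norm (y n - v) < min (r - norm v) (1 / real (Suc n))" "\<And>n. reg (y n)" by blast
  have "y n \<in> ball 0 r" for n
    using y(1)[of n] norm_triangle_ineq[of v "y n - v"] by simp
  moreover have l0: "(\<lambda>n. 1 / real (Suc n)) \<longlonglongrightarrow> 0" by (rule LIMSEQ_Suc[OF lim_1_over_n])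
  have "(\<lambda>n. y n - v) \<longlonglongrightarrow> 0" by (rule Lim_null_comparison[OF _ l0]) (use y(1) in \<open>simp add: less_imp_le\<close>)
  then have "y \<longlonglongrightarrow> v" by (rule LIM_zero_cancel)
  ultimately show ?thesis using y(2) by blast
qed

text \<open>The segment is shifted slightly to consist of regular points, and continuity of
  \<open>F\<close> at the two regular ends removes the shift. \<open>L0 = 0\<close> gives a
  Lipschitz bound; \<open>L0\<close> a limit of derivatives gives differentiability.\<close>

lemma regular_mean_value:
  fixes F :: "'v \<Rightarrow> real"
  assumes U: "open U" "convex U" and ab: "y \<in> U" "reg y" "z \<in> U" "reg z" and L0: "linear L0"
    and D: "\<And>v. v \<in> U \<Longrightarrow> reg v \<Longrightarrow> (F has_derivative D v) (at v)"
    and bd: "\<And>v u. v \<in> U \<Longrightarrow> reg v \<Longrightarrow> \<bar>D v u - L0 u\<bar> \<le> \<epsilon> * norm u"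
  shows "\<bar>F z - F y - L0 (z - y)\<bar> \<le> \<epsilon> * norm (z - y)"
proof -
  obtain d1 where d1: "0 < d1" "ball y d1 \<subseteq> U" using U ab open_contains_ball by blast
  obtain d2 where d2: "0 < d2" "ball z d2 \<subseteq> U" using U ab open_contains_ball by blast
  define u where "u = z - y"
  have "\<forall>n. \<exists>w. norm w < min (min d1 d2) (1 / real (Suc n)) \<and> (\<forall>s. reg (y + w + s *\<^sub>R u))"
    using d1 d2 by (intro allI regular_segment) simp
  from choice[OF this] obtain w where w: "\<And>n. norm (w n) < min (min d1 d2) (1 / real (Suc n))"
    "\<And>n s. reg (y + w n + s *\<^sub>R u)" by blast
  have est: "\<bar>F (z + w n) - F (y + w n) - L0 u\<bar> \<le> \<epsilon> * norm u" for n
  proof -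
    let ?p = "\<lambda>s. y + w n + s *\<^sub>R u"
    have e0: "y + w n \<in> U" using d1(2) w(1)[of n] by (auto simp: dist_norm)
    have e1: "z + w n \<in> U" using d2(2) w(1)[of n] by (auto simp: dist_norm)
    have pU: "?p s \<in> U" if "s \<in> {0..1}" for s
    proof -
      have "?p s = (1 - s) *\<^sub>R (y + w n) + s *\<^sub>R (z + w n)" by (simp add: u_def algebra_simps)
      then show ?thesis using convexD[OF U(2) e0 e1, of "1 - s" s] that by simp
    qed
    have "((\<lambda>s. F (?p s)) has_derivative (\<lambda>h. D (?p s) (h *\<^sub>R u))) (at s within {0..1})" if "s \<in> {0..1}" for s
    proof (rule has_derivative_compose[where g = F])
      show "(?p has_derivative (\<lambda>h. h *\<^sub>R u)) (at s within {0..1})" by (auto intro!: derivative_eq_intros)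
      show "(F has_derivative D (?p s)) (at (?p s))" by (rule D[OF pU[OF that] w(2)])
    qed
    then obtain s where s: "s \<in> {0<..<1}" "F (?p 1) - F (?p 0) = D (?p s) ((1 - 0) *\<^sub>R u)"
      using mvt_simple[of 0 1 "\<lambda>s. F (?p s)" "\<lambda>s h. D (?p s) (h *\<^sub>R u)"] by auto
    have "F (z + w n) - F (y + w n) = D (?p s) u"
      using s(2) by (simp add: u_def algebra_simps)
    then show ?thesis using bd[OF pU w(2), of s u] s(1) by simp
  qed
  have l0: "(\<lambda>n. 1 / real (Suc n)) \<longlonglongrightarrow> 0" using LIMSEQ_Suc[OF lim_1_over_n] by simp
  have "w \<longlonglongrightarrow> 0" by (rule Lim_null_comparison[OF _ l0]) (use w(1) in \<open>simp add: less_imp_le\<close>)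
  then have "(\<lambda>n. y + w n) \<longlonglongrightarrow> y + 0" "(\<lambda>n. z + w n) \<longlonglongrightarrow> z + 0" by (intro tendsto_add tendsto_const; assumption)+
  then have ly: "(\<lambda>n. y + w n) \<longlonglongrightarrow> y" and lz: "(\<lambda>n. z + w n) \<longlonglongrightarrow> z" by simp_all
  have "(\<lambda>n. F (y + w n)) \<longlonglongrightarrow> F y" "(\<lambda>n. F (z + w n)) \<longlonglongrightarrow> F z"
    using isCont_tendsto_compose[OF has_derivative_continuous[OF D[OF ab(1,2)]] ly]
      isCont_tendsto_compose[OF has_derivative_continuous[OF D[OF ab(3,4)]] lz] by simp_all
  then have "(\<lambda>n. \<bar>F (z + w n) - F (y + w n) - L0 u\<bar>) \<longlonglongrightarrow> \<bar>F z - F y - L0 u\<bar>" by (intro tendsto_intros)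
  then have "\<bar>F z - F y - L0 u\<bar> \<le> \<epsilon> * norm u" by (rule LIMSEQ_le_const2) (use est in simp)
  then show ?thesis unfolding u_def .
qed

text \<open>The singular set has codimension at least two, so derivative bounds on the regular set are
  Lipschitz bounds; this turns local boundedness of all derivatives into smooth extendability.\<close>

lemma extension_smooth:
  fixes T :: "nat \<Rightarrow> 'v \<Rightarrow> 'v list \<Rightarrow> real" and p :: nat
  assumes D: "\<And>k v ws. v \<in> ball 0 r \<Longrightarrow> reg v \<Longrightarrow> length ws = k + p \<Longrightarrow>
        ((\<lambda>v. T k v ws) has_derivative (\<lambda>u. T (Suc k) v (u # ws))) (at v)"
    and bd: "\<And>k r' ws. r' < r \<Longrightarrow> length ws = k + p \<Longrightarrow> \<exists>C. \<forall>v\<in>ball 0 r'. reg v \<longrightarrow> \<bar>T k v ws\<bar> \<le> C"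
  obtains F :: "'v list \<Rightarrow> 'v \<Rightarrow> real" where
    "\<And>ws. length ws = p \<Longrightarrow> smooth_on UNIV (ball 0 r) (F ws)"
    "\<And>ws v. length ws = p \<Longrightarrow> v \<in> ball 0 r \<Longrightarrow> reg v \<Longrightarrow> F ws v = T 0 v ws"
proof -
  define RB where "RB = ball 0 r \<inter> {v. reg v}"
  have openRB: "open RB" unfolding RB_def by (intro open_Int open_ball open_reg)
  have lin: "linear (\<lambda>u. T (Suc k) v (u # ws))" if "v \<in> RB" "length ws = k + p" for k v ws
    using D[of v ws k] that has_derivative_linear unfolding RB_def by blast
  have expandT: "T (Suc k) v (u # ws) = (\<Sum>b\<in>Basis. (u \<bullet> b) * T (Suc k) v (b # ws))"
    if "v \<in> RB" "length ws = k + p" for k v u ws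
  proof -
    have "T (Suc k) v (u # ws) = T (Suc k) v ((\<Sum>b\<in>Basis. (u \<bullet> b) *\<^sub>R b) # ws)" by (simp add: euclidean_representation)
    then show ?thesis by (simp add: linear_sum[OF lin[OF that]] linear_cmul[OF lin[OF that]])
  qed
  have approx: "\<exists>y. (\<forall>n::nat. y n \<in> RB) \<and> y \<longlonglongrightarrow> v" if "v \<in> ball 0 r" for v
    using regular_limit[OF that] by (simp add: RB_def)
  have lips: "\<exists>C\<ge>0. \<forall>y\<in>RB \<inter> ball 0 r'. \<forall>z\<in>RB \<inter> ball 0 r'. \<bar>T k z ws - T k y ws\<bar> \<le> C * norm (z - y)"
    if r': "r' < r" and ws: "length ws = k + p" for k r' ws
  proof -
    have "\<forall>b. \<exists>C. \<forall>v\<in>ball 0 r'. reg v \<longrightarrow> \<bar>T (Suc k) v (b # ws)\<bar> \<le> C"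
      using bd[OF r'] ws by simp
    from choice[OF this] obtain C where C: "\<And>b v. v \<in> ball 0 r' \<Longrightarrow> reg v \<Longrightarrow> \<bar>T (Suc k) v (b # ws)\<bar> \<le> C b" by blast
    define CC where "CC = (\<Sum>b\<in>Basis. \<bar>C b\<bar>)"
    have CC: "0 \<le> CC" by (simp add: CC_def sum_nonneg)
    have bT: "\<bar>T (Suc k) v (u # ws) - 0\<bar> \<le> CC * norm u" if v: "v \<in> ball 0 r'" "reg v" for v u
    proof -
      have vR: "v \<in> RB" using v r' by (simp add: RB_def)
      have "\<bar>T (Suc k) v (u # ws)\<bar> \<le> (\<Sum>b\<in>Basis. norm u * \<bar>C b\<bar>)"
        unfolding expandT[OF vR ws, of u]
      proof (rule order_trans[OF sum_abs], rule sum_mono)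
        fix b :: 'v assume b: "b \<in> Basis"
        have "\<bar>T (Suc k) v (b # ws)\<bar> \<le> \<bar>C b\<bar>" using C[OF v, of b] by linarith
        then show "\<bar>(u \<bullet> b) * T (Suc k) v (b # ws)\<bar> \<le> norm u * \<bar>C b\<bar>"
          unfolding abs_mult by (rule mult_mono[OF Basis_le_norm[OF b]]) simp_all
      qed
      also have "\<dots> = CC * norm u" unfolding CC_def sum_distrib_left[symmetric] by (rule mult.commute)
      finally show ?thesis by simp
    qed
    have "\<bar>T k z ws - T k y ws\<bar> \<le> CC * norm (z - y)" if yz: "y \<in> RB \<inter> ball 0 r'" "z \<in> RB \<inter> ball 0 r'" for y z
    proof -
      have D': "((\<lambda>v. T k v ws) has_derivative (\<lambda>u. T (Suc k) v (u # ws))) (at v)" if v: "v \<in> ball 0 r'" "reg v" for v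
        by (rule D[OF _ v(2) ws]) (use v(1) r' in simp)
      have y: "y \<in> ball 0 r'" "reg y" and z: "z \<in> ball 0 r'" "reg z" using yz by (simp_all add: RB_def)
      have "\<bar>T k z ws - T k y ws - 0\<bar> \<le> CC * norm (z - y)"
        by (rule regular_mean_value[OF open_ball convex_ball y z linear_zero D' bT])
      then show ?thesis by simp
    qed
    then show ?thesis using CC by blast
  qed
  have conv: "\<exists>l. \<forall>y. (\<forall>n::nat. y n \<in> RB) \<and> y \<longlonglongrightarrow> v \<longrightarrow> (\<lambda>n. T k (y n) ws) \<longlonglongrightarrow> l"
    if v: "v \<in> ball 0 r" and ws: "length ws = k + p" for v k ws
  proof -
    obtain r' where r': "norm v < r'" "r' < r" using v dense[of "norm v" r] by auto
    obtain C where C: "0 \<le> C" "\<And>y z. y \<in> RB \<inter> ball 0 r' \<Longrightarrow> z \<in> RB \<inter> ball 0 r' \<Longrightarrow> \<bar>T k z ws - T k y ws\<bar> \<le> C * norm (z - y)"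
      using lips[OF r'(2) ws] by blast
    have evb: "\<forall>\<^sub>F n in sequentially. y n \<in> RB \<inter> ball 0 r'" if "\<forall>n::nat. y n \<in> RB" "y \<longlonglongrightarrow> v" for y
      using topological_tendstoD[OF that(2), of "ball 0 r'"] r'(1) that(1) by simp
    have cmp: "(\<lambda>n. T k (y n) ws - T k (z n) ws) \<longlonglongrightarrow> 0"
      if y: "\<forall>n::nat. y n \<in> RB" "y \<longlonglongrightarrow> v" and z: "\<forall>n::nat. z n \<in> RB" "z \<longlonglongrightarrow> v" for y z
    proof (rule Lim_null_comparison)
      show "\<forall>\<^sub>F n in sequentially. norm (T k (y n) ws - T k (z n) ws) \<le> C * norm (y n - z n)"
        using evb[OF y] evb[OF z] by eventually_elim (use C(2) in auto)
      have "(\<lambda>n. C * norm (y n - z n)) \<longlonglongrightarrow> C * norm (v - v)" by (intro tendsto_intros y z)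
      then show "(\<lambda>n. C * norm (y n - z n)) \<longlonglongrightarrow> 0" by simp
    qed
    obtain y where y: "\<forall>n::nat. y n \<in> RB" "y \<longlonglongrightarrow> v" using approx[OF v] by blast
    have "Cauchy (\<lambda>n. T k (y n) ws)"
      unfolding Cauchy_def
    proof (intro allI impI)
      fix e :: real assume e: "0 < e"
      have "Cauchy y" by (rule LIMSEQ_imp_Cauchy[OF y(2)])
      moreover have "0 < e / (C + 1)" using e C(1) by simp
      ultimately obtain M where M: "\<And>m n. m \<ge> M \<Longrightarrow> n \<ge> M \<Longrightarrow> dist (y m) (y n) < e / (C + 1)" unfolding Cauchy_def by blast
      obtain M' where M': "\<And>n. n \<ge> M' \<Longrightarrow> y n \<in> RB \<inter> ball 0 r'" using evb[OF y] unfolding eventually_sequentially by blast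
      show "\<exists>M. \<forall>m\<ge>M. \<forall>n\<ge>M. dist (T k (y m) ws) (T k (y n) ws) < e"
      proof (intro exI[of _ "max M M'"] allI impI)
        fix m n assume mn: "max M M' \<le> m" "max M M' \<le> n"
        have "dist (T k (y m) ws) (T k (y n) ws) \<le> C * norm (y m - y n)"
          using C(2)[of "y n" "y m"] M' mn by (simp add: dist_real_def)
        also have "\<dots> \<le> (C + 1) * norm (y m - y n)" by (simp add: algebra_simps)
        also have "\<dots> < (C + 1) * (e / (C + 1))"
          using M[of m n] mn C(1) by (intro mult_strict_left_mono) (auto simp: dist_norm)
        also have "\<dots> = e" using C(1) by simp
        finally show "dist (T k (y m) ws) (T k (y n) ws) < e" .
      qed
    qed
    then obtain l where l: "(\<lambda>n. T k (y n) ws) \<longlonglongrightarrow> l" using Cauchy_convergent convergent_def by blast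
    show ?thesis
    proof (intro exI[of _ l] allI impI)
      fix z assume z: "(\<forall>n. z n \<in> RB) \<and> z \<longlonglongrightarrow> v"
      from tendsto_add[OF cmp[of z y] l] z y show "(\<lambda>n. T k (z n) ws) \<longlonglongrightarrow> l" by simp
    qed
  qed
  \<comment> \<open>The limit along all regular sequences tending to \<open>v\<close>; by
    \<open>conv\<close> it exists and does not depend on the sequence.\<close>
  define F where "F k ws v = (SOME l. \<forall>y. (\<forall>n::nat. y n \<in> RB) \<and> y \<longlonglongrightarrow> v \<longrightarrow> (\<lambda>n. T k (y n) ws) \<longlonglongrightarrow> l)" for k ws v
  have Flim: "(\<lambda>n. T k (y n) ws) \<longlonglongrightarrow> F k ws v"
    if "v \<in> ball 0 r" "length ws = k + p" "\<And>n::nat. y n \<in> RB" "y \<longlonglongrightarrow> v" for v k ws y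
  proof -
    have "\<forall>y. (\<forall>n::nat. y n \<in> RB) \<and> y \<longlonglongrightarrow> v \<longrightarrow> (\<lambda>n. T k (y n) ws) \<longlonglongrightarrow> F k ws v"
      unfolding F_def by (rule someI_ex[OF conv[OF that(1,2)]])
    then show ?thesis using that(3,4) by blast
  qed
  have FT: "F k ws v = T k v ws" if "v \<in> RB" "length ws = k + p" for k ws v
  proof -
    have "(\<lambda>n::nat. T k v ws) \<longlonglongrightarrow> F k ws v"
      using that by (intro Flim) (auto simp: RB_def)
    then show ?thesis by (simp add: LIMSEQ_const_iff)
  qed
  have Fder: "(F k ws has_derivative (\<lambda>u. F (Suc k) (u # ws) v)) (at v)"
    if v: "v \<in> ball 0 r" and ws: "length ws = k + p" for k ws v
  proof -
    define L0 where "L0 u = (\<Sum>b\<in>Basis. (u \<bullet> b) * F (Suc k) (b # ws) v)" for u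
    have ws': "length (u # ws) = Suc k + p" for u using ws by simp
    obtain y0 where y0: "\<forall>n::nat. y0 n \<in> RB" "y0 \<longlonglongrightarrow> v" using approx[OF v] by blast
    have FL: "F (Suc k) (u # ws) v = L0 u" for u
    proof -
      have "(\<lambda>n. \<Sum>b\<in>Basis. (u \<bullet> b) * T (Suc k) (y0 n) (b # ws)) \<longlonglongrightarrow> L0 u"
        unfolding L0_def using y0 by (intro tendsto_intros Flim v ws') auto
      then have "(\<lambda>n. T (Suc k) (y0 n) (u # ws)) \<longlonglongrightarrow> L0 u"
        using expandT[OF spec[OF y0(1)] ws, of _ u] by simp
      from LIMSEQ_unique[OF Flim[OF v ws' _ y0(2)] this] y0(1) show ?thesis by simp
    qed
    have linL0: "linear L0" unfolding L0_def
      by (intro linear_compose_sum ballI linearI) (auto simp: inner_add_left algebra_simps)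
    have "(F k ws has_derivative L0) (at v)"
      unfolding has_derivative_at_alt
    proof (intro conjI allI impI)
      show "bounded_linear L0" using linL0 linear_conv_bounded_linear by blast
      fix e :: real assume e: "0 < e"
      define e' where "e' = e / real DIM('v)"
      have e': "0 < e'" using e by (simp add: e'_def)
      \<comment> \<open>Sequential convergence is upgraded to a uniform neighbourhood, separately
        for each basis vector; the factor \<open>DIM('v)\<close> in \<open>e'\<close> pays for
        summing over the basis.\<close>
      have "\<exists>d>0. \<forall>y\<in>RB \<inter> ball v d. \<bar>T (Suc k) y (b # ws) - F (Suc k) (b # ws) v\<bar> < e'" for b
      proof (rule ccontr)
        assume neg: "\<not> ?thesis"
        have "\<forall>n::nat. \<exists>y. y \<in> RB \<inter> ball v (1 / real (Suc n)) \<and> e' \<le> \<bar>T (Suc k) y (b # ws) - F (Suc k) (b # ws) v\<bar>"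
        proof
          fix n :: nat
          have "0 < 1 / real (Suc n)" by simp
          then show "\<exists>y. y \<in> RB \<inter> ball v (1 / real (Suc n)) \<and> e' \<le> \<bar>T (Suc k) y (b # ws) - F (Suc k) (b # ws) v\<bar>"
            using neg by (meson not_le)
        qed
        from choice[OF this] obtain y where y: "\<And>n::nat. y n \<in> RB \<inter> ball v (1 / real (Suc n))"
          "\<And>n. e' \<le> \<bar>T (Suc k) (y n) (b # ws) - F (Suc k) (b # ws) v\<bar>" by blast
        have l0: "(\<lambda>n. 1 / real (Suc n)) \<longlonglongrightarrow> 0" using LIMSEQ_Suc[OF lim_1_over_n] by simp
        have "(\<lambda>n. y n - v) \<longlonglongrightarrow> 0"
          by (rule Lim_null_comparison[OF _ l0]) (use y(1) in \<open>auto simp: dist_norm norm_minus_commute less_imp_le\<close>)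
        then have "y \<longlonglongrightarrow> v" by (rule LIM_zero_cancel)
        then have "(\<lambda>n. T (Suc k) (y n) (b # ws)) \<longlonglongrightarrow> F (Suc k) (b # ws) v" using y(1) by (intro Flim v ws') auto
        from tendstoD[OF this e'] obtain n where "\<bar>T (Suc k) (y n) (b # ws) - F (Suc k) (b # ws) v\<bar> < e'"
          unfolding eventually_sequentially dist_real_def by blast
        then show False using y(2)[of n] by linarith
      qed
      then have "\<forall>b. \<exists>d. d>0 \<and> (\<forall>y\<in>RB \<inter> ball v d. \<bar>T (Suc k) y (b # ws) - F (Suc k) (b # ws) v\<bar> < e')" by blast
      from choice[OF this] obtain dd where dd: "\<And>b. 0 < dd b"
        "\<And>b y. y \<in> RB \<inter> ball v (dd b) \<Longrightarrow> \<bar>T (Suc k) y (b # ws) - F (Suc k) (b # ws) v\<bar> < e'" by blast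
      define d where "d = min (r - norm v) (Min (dd ` Basis))"
      have d: "0 < d" "d \<le> r - norm v" using v dd(1) by (auto simp: d_def)
      have dle: "d \<le> dd b" if "b \<in> Basis" for b using that by (auto simp: d_def min_le_iff_disj)
      have dr: "ball v d \<subseteq> ball 0 r"
      proof
        fix y assume "y \<in> ball v d"
        then show "y \<in> ball 0 r" using norm_triangle_ineq[of v "y - v"] d(2) by (simp add: dist_norm norm_minus_commute)
      qed
      have bdT: "\<bar>T (Suc k) y (u # ws) - L0 u\<bar> \<le> e * norm u" if y: "y \<in> ball v d" "reg y" for y u
      proof -
        have yR: "y \<in> RB" using y dr by (auto simp: RB_def)
        have "T (Suc k) y (u # ws) - L0 u = (\<Sum>b\<in>Basis. (u \<bullet> b) * (T (Suc k) y (b # ws) - F (Suc k) (b # ws) v))"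
          unfolding expandT[OF yR ws, of u] L0_def by (simp add: right_diff_distrib sum_subtractf)
        also have "\<bar>\<dots>\<bar> \<le> (\<Sum>b\<in>(Basis::'v set). norm u * e')"
        proof (intro order_trans[OF sum_abs] sum_mono)
          fix b :: 'v assume b: "b \<in> Basis"
          have "\<bar>T (Suc k) y (b # ws) - F (Suc k) (b # ws) v\<bar> < e'" using dd(2)[of y b] y dle[OF b] yR by simp
          then show "\<bar>(u \<bullet> b) * (T (Suc k) y (b # ws) - F (Suc k) (b # ws) v)\<bar> \<le> norm u * e'"
            unfolding abs_mult using Basis_le_norm[OF b, of u] by (intro mult_mono) auto
        qed
        also have "\<dots> = e * norm u" by (simp add: e'_def)
        finally show ?thesis .
      qed
      have reg_est: "\<bar>T k z ws - T k y ws - L0 (z - y)\<bar> \<le> e * norm (z - y)"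
        if "y \<in> ball v d" "reg y" "z \<in> ball v d" "reg z" for y z
      proof -
        have D': "((\<lambda>v. T k v ws) has_derivative (\<lambda>u. T (Suc k) x (u # ws))) (at x)" if x: "x \<in> ball v d" "reg x" for x
          by (rule D[OF subsetD[OF dr x(1)] x(2) ws])
        show ?thesis by (rule regular_mean_value[OF open_ball convex_ball that linL0 D' bdT])
      qed
      show "\<exists>d>0. \<forall>y. norm (y - v) < d \<longrightarrow> norm (F k ws y - F k ws v - L0 (y - v)) \<le> e * norm (y - v)"
      proof (intro exI[of _ d] conjI d allI impI)
        fix y assume "norm (y - v) < d"
        then have y: "y \<in> ball v d" by (simp add: dist_norm norm_minus_commute)
        then have yr: "y \<in> ball 0 r" using dr by blast
        obtain z where z: "\<forall>n::nat. z n \<in> RB" "z \<longlonglongrightarrow> y" using approx[OF yr] by blast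
        \<comment> \<open>The estimate between regular points passes to \<open>y\<close> and
          \<open>v\<close> by approximating both with regular sequences.\<close>
        have contL0: "(\<lambda>n. L0 (z n - y0 n)) \<longlonglongrightarrow> L0 (y - v)"
          by (rule bounded_linear.tendsto[OF linear_conv_bounded_linear[THEN iffD1, OF linL0] tendsto_diff[OF z(2) y0(2)]])
        have lim1: "(\<lambda>n. \<bar>T k (z n) ws - T k (y0 n) ws - L0 (z n - y0 n)\<bar>) \<longlonglongrightarrow> \<bar>F k ws y - F k ws v - L0 (y - v)\<bar>"
          using z y0 by (intro tendsto_intros contL0 Flim yr v ws) auto
        have lim2: "(\<lambda>n. e * norm (z n - y0 n)) \<longlonglongrightarrow> e * norm (y - v)" by (intro tendsto_intros z y0)
        have "\<forall>\<^sub>F n in sequentially. \<bar>T k (z n) ws - T k (y0 n) ws - L0 (z n - y0 n)\<bar> \<le> e * norm (z n - y0 n)"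
        proof -
          have "\<forall>\<^sub>F n in sequentially. z n \<in> ball v d" using topological_tendstoD[OF z(2), of "ball v d"] y by simp
          moreover have "\<forall>\<^sub>F n in sequentially. y0 n \<in> ball v d" using topological_tendstoD[OF y0(2), of "ball v d"] d by simp
          ultimately show ?thesis
            by eventually_elim (use reg_est z(1) y0(1) in \<open>auto simp: RB_def\<close>)
        qed
        then have "\<bar>F k ws y - F k ws v - L0 (y - v)\<bar> \<le> e * norm (y - v)"
          by (rule tendsto_le[OF trivial_limit_sequentially lim2 lim1])
        then show "norm (F k ws y - F k ws v - L0 (y - v)) \<le> e * norm (y - v)" by simp
      qed
    qed
    then show ?thesis using FL by simp
  qed
  show thesis
  proof (rule that[of "F 0"])
    fix ws :: "'v list" assume ws: "length ws = p"
    show "smooth_on UNIV (ball 0 r) (F 0 ws)"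
    proof (rule smooth_coinduct[where F = "{F k ws | k ws. length ws = k + p}"])
      show "F 0 ws \<in> {F k ws | k ws. length ws = k + p}" using ws by force
      fix h assume "h \<in> {F k ws | k ws. length ws = k + p}"
      then obtain k ws where h: "h = F k ws" "length ws = k + p" by blast
      show "\<exists>Df. (\<forall>x\<in>ball 0 r. (h has_derivative Df x) (at x within ball 0 r)) \<and>
          (\<forall>u\<in>UNIV. (\<lambda>x. Df x u) \<in> {F k ws | k ws. length ws = k + p})"
      proof (intro exI[of _ "\<lambda>x u. F (Suc k) (u # ws) x"] conjI ballI)
        show "(h has_derivative (\<lambda>u. F (Suc k) (u # ws) x)) (at x within ball 0 r)" if "x \<in> ball 0 r" for x
          unfolding h(1) by (rule has_derivative_at_withinI[OF Fder[OF that h(2)]])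
        show "(\<lambda>x. F (Suc k) (u # ws) x) \<in> {F k ws | k ws. length ws = k + p}" for u
          using h(2) by (intro CollectI exI[of _ "Suc k"] exI[of _ "u # ws"]) simp
      qed
    qed
    show "F 0 ws v = T 0 v ws" if "v \<in> ball 0 r" "reg v" for v
      using that ws by (intro FT) (auto simp: RB_def)
  qed
qed

end

section \<open>Extension of Weyl invariant forms\<close>

context cogroup
begin

lemma orbit_tangent_G:
  assumes g: "g \<in> G" and u: "u \<in> orbit_tangent K x"
  shows "blinfun_apply g u \<in> orbit_tangent K (blinfun_apply g x)"
proof -
  obtain c :: "real \<Rightarrow> 'v" where c: "\<And>t. c t \<in> orbit K x" "c 0 = x" "(c has_vector_derivative u) (at 0)"
    using u by (auto simp: orbit_tangent_def)
  have "blinfun_apply g (c t) \<in> orbit K (blinfun_apply g x)" for t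
  proof -
    obtain k where k: "k \<in> K" "c t = k x" using c(1)[of t] by (auto simp: orbit_def)
    define h where "h = (g o\<^sub>L Blinfun k) o\<^sub>L gi g"
    have "h \<in> G" unfolding h_def using g Blinfun_G(1)[OF k(1)] by simp
    moreover have "blinfun_apply g (c t) = blinfun_apply h (blinfun_apply g x)"
      using g k Blinfun_G(2)[OF k(1)] by (simp add: h_def)
    ultimately show ?thesis unfolding orbit_def G_def by blast
  qed
  moreover have "((\<lambda>t. blinfun_apply g (c t)) has_vector_derivative blinfun_apply g u) (at 0)"
    by (rule bounded_linear.has_vector_derivative[OF blinfun.bounded_linear_right c(3)])
  ultimately show ?thesis unfolding orbit_tangent_def using c(2) by (intro CollectI exI[of _ "\<lambda>t. blinfun_apply g (c t)"]) simp
qed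

end

locale form_ext = roots K \<Sigma> E a XX x0 for K :: "('v::euclidean_space \<Rightarrow> 'v) set" and \<Sigma> E a XX x0 +
  fixes r :: real and p :: nat and \<omega> :: "'v \<Rightarrow> (nat \<Rightarrow> 'v) \<Rightarrow> real"
  assumes r: "0 < r" and \<omega>: "\<omega> \<in> inv_forms_on (weyl K \<Sigma>) p \<Sigma> (\<Sigma> \<inter> ball 0 r)"
begin

lemma w_alt: "z \<in> \<Sigma> \<inter> ball 0 r \<Longrightarrow> alt_form p \<Sigma> (\<omega> z)"
  and w_smooth: "\<forall>i<p. v i \<in> \<Sigma> \<Longrightarrow> smooth_on \<Sigma> (\<Sigma> \<inter> ball 0 r) (\<lambda>x. \<omega> x v)"
  and w_out: "z \<notin> \<Sigma> \<inter> ball 0 r \<Longrightarrow> \<omega> z = (\<lambda>v. 0)"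
  using \<omega> unfolding inv_forms_on_def forms_def by blast+

lemma w_cong: "z \<in> \<Sigma> \<inter> ball 0 r \<Longrightarrow> (\<And>i. i < p \<Longrightarrow> v i = w i) \<Longrightarrow> \<omega> z v = \<omega> z w"
  by (rule w_alt[unfolded alt_form_def, THEN conjunct1, rule_format])

lemma w_out_arg: "z \<in> \<Sigma> \<inter> ball 0 r \<Longrightarrow> i < p \<Longrightarrow> v i \<notin> \<Sigma> \<Longrightarrow> \<omega> z v = 0"
  by (rule w_alt[unfolded alt_form_def, THEN conjunct2, THEN conjunct1, rule_format]) (assumption, intro exI conjI)

lemma w_lin: "z \<in> \<Sigma> \<inter> ball 0 r \<Longrightarrow> i < p \<Longrightarrow> (\<forall>j<p. v j \<in> \<Sigma>) \<Longrightarrow> y \<in> \<Sigma> \<Longrightarrow> y' \<in> \<Sigma> \<Longrightarrow>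
    \<omega> z (v(i := c *\<^sub>R y + y')) = c * \<omega> z (v(i := y)) + \<omega> z (v(i := y'))"
  by (rule w_alt[unfolded alt_form_def, THEN conjunct2, THEN conjunct2, THEN conjunct1, rule_format]) simp_all

lemma w_eq_args: "z \<in> \<Sigma> \<inter> ball 0 r \<Longrightarrow> i < p \<Longrightarrow> j < p \<Longrightarrow> i \<noteq> j \<Longrightarrow> v i = v j \<Longrightarrow> \<omega> z v = 0"
  by (rule w_alt[unfolded alt_form_def, THEN conjunct2, THEN conjunct2, THEN conjunct2, rule_format])

lemma w_zero_arg: assumes z: "z \<in> \<Sigma> \<inter> ball 0 r" and i: "i < p" "v i = 0" and v: "\<forall>j<p. v j \<in> \<Sigma>"
  shows "\<omega> z v = 0"
proof -
  have "\<omega> z (v(i := 1 *\<^sub>R 0 + 0)) = 1 * \<omega> z (v(i := 0)) + \<omega> z (v(i := 0))"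
    by (rule w_lin[OF z i(1) v]) (use subspace_0[OF sub\<Sigma>] in auto)
  moreover have "v(i := 0) = v" using i(2) by auto
  ultimately show ?thesis by simp
qed

lemma w_inv:
  assumes g: "g \<in> G" "\<And>s. s \<in> \<Sigma> \<Longrightarrow> blinfun_apply g s \<in> \<Sigma>" and z: "z \<in> \<Sigma> \<inter> ball 0 r" and v: "\<And>i. v i \<in> \<Sigma>"
  shows "\<omega> (blinfun_apply g z) (\<lambda>i. blinfun_apply g (v i)) = \<omega> z v"
proof -
  let ?h = "restrict (blinfun_apply g) \<Sigma>"
  have "?h \<in> weyl K \<Sigma>"
    unfolding weyl_def using g(1) G_image\<Sigma>[OF g] by (auto simp: G_def)
  moreover have "invariant_form (weyl K \<Sigma>) p \<Sigma> (\<Sigma> \<inter> ball 0 r) \<omega>" using \<omega> by (simp add: inv_forms_on_def)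
  ultimately have "\<omega> (?h z) (?h \<circ> v) = \<omega> z v" using z v unfolding invariant_form_def by blast
  moreover have "?h \<circ> v = (\<lambda>i. blinfun_apply g (v i))" using v by (auto simp: fun_eq_iff)
  moreover have "?h z = blinfun_apply g z" using z by simp
  ultimately show ?thesis by simp
qed

text \<open>Projected to \<Sigma>, and padded by 0 so that every entry lies in \<Sigma>, as the Weyl
  group elements are \<open>restrict\<close>ed maps. Thus \<open>tt\<close> is the horizontal
  extension of \<omega> at points of \<Sigma>.\<close>

definition lf :: "'v list \<Rightarrow> nat \<Rightarrow> 'v" where "lf ws = (\<lambda>i. if i < p then pr \<Sigma> (ws ! i) else 0)"
definition tt :: "'v \<Rightarrow> 'v list \<Rightarrow> real" where "tt z ws = \<omega> z (lf ws)"

lemma lf\<Sigma>: "lf ws i \<in> \<Sigma>" by (simp add: lf_def pr_in[OF sub\<Sigma>] subspace_0[OF sub\<Sigma>])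

lemma tt_smooth: "smooth_on \<Sigma> (\<Sigma> \<inter> ball 0 r) (\<lambda>z. tt z ws)"
  unfolding tt_def by (rule w_smooth) (use lf\<Sigma> in blast)

lemma tt_mlin: assumes z: "z \<in> \<Sigma> \<inter> ball 0 r" shows "mlin p (tt z)"
  unfolding mlin_def
proof (intro allI impI)
  fix xs ys :: "'v list" assume l: "length xs + length ys + 1 = p"
  let ?i = "length xs"
  define v0 where "v0 = lf (xs @ 0 # ys)"
  have v0: "v0 j \<in> \<Sigma>" for j unfolding v0_def by (rule lf\<Sigma>)
  have up: "lf (xs @ w # ys) = v0(?i := pr \<Sigma> w)" for w
    using l by (auto simp: v0_def lf_def fun_eq_iff nth_append nth_Cons')
  have i: "?i < p" using l by simp
  have lin: "\<omega> z (v0(?i := c *\<^sub>R y + y')) = c * \<omega> z (v0(?i := y)) + \<omega> z (v0(?i := y'))"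
    if "y \<in> \<Sigma>" "y' \<in> \<Sigma>" for c y y'
    by (rule w_lin[OF z i _ that]) (use v0 in blast)
  have S: "pr \<Sigma> w \<in> \<Sigma>" for w by (rule pr_in[OF sub\<Sigma>])
  have zero: "\<omega> z (v0(?i := 0)) = 0"
    by (rule w_zero_arg[OF z i]) (use v0 subspace_0[OF sub\<Sigma>] in auto)
  show "linear (\<lambda>w. tt z (xs @ w # ys))"
  proof (rule linearI)
    fix w w' c
    show "tt z (xs @ (w + w') # ys) = tt z (xs @ w # ys) + tt z (xs @ w' # ys)"
      unfolding tt_def up using lin[OF S S, of 1 w w'] by (simp add: pr_add[OF sub\<Sigma>])
    show "tt z (xs @ (c *\<^sub>R w) # ys) = c *\<^sub>R tt z (xs @ w # ys)"
      unfolding tt_def up using lin[OF S subspace_0[OF sub\<Sigma>], of c w] zero by (simp add: pr_scale[OF sub\<Sigma>])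
  qed
qed

lemma tt_alt_index:
  assumes z: "z \<in> \<Sigma> \<inter> ball 0 r" and ij: "i < p" "j < p" "i \<noteq> j" "pr \<Sigma> (ws ! i) = pr \<Sigma> (ws ! j)"
  shows "tt z ws = 0"
  unfolding tt_def by (rule w_eq_args[OF z ij(1-3)]) (use ij in \<open>simp add: lf_def\<close>)

lemma tt_alt:
  assumes z: "z \<in> \<Sigma> \<inter> ball 0 r" and l: "length (xs @ w # ys @ w # zs) = p"
  shows "tt z (xs @ w # ys @ w # zs) = 0"
proof (rule tt_alt_index[OF z])
  show "length xs < p" "length xs + length ys + 1 < p" "length xs \<noteq> length xs + length ys + 1" using l by auto
  show "pr \<Sigma> ((xs @ w # ys @ w # zs) ! length xs) = pr \<Sigma> ((xs @ w # ys @ w # zs) ! (length xs + length ys + 1))"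
    by (simp add: nth_append)
qed

lemma tt_pr_cong:
  assumes "length ws = p" "\<And>u. pr \<Sigma> (h u) = pr \<Sigma> (h' u)"
  shows "tt z (map h ws) = tt z (map h' ws)"
proof -
  have "lf (map h ws) = lf (map h' ws)" using assms by (auto simp: lf_def fun_eq_iff)
  then show ?thesis by (simp add: tt_def)
qed

text \<open>An orthogonal map preserving \<Sigma> commutes with the projection onto it.\<close>

lemma tt_norm:
  assumes g: "g \<in> G" "\<And>s. s \<in> \<Sigma> \<Longrightarrow> blinfun_apply g s \<in> \<Sigma>" and z: "z \<in> \<Sigma> \<inter> ball 0 r" and ws: "length ws = p"
  shows "tt (blinfun_apply g z) (map (blinfun_apply g) ws) = tt z ws"
proof -
  have pc: "pr \<Sigma> (blinfun_apply g u) = blinfun_apply g (pr \<Sigma> u)" for u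
  proof (rule pr_unique[OF sub\<Sigma> g(2)[OF pr_in[OF sub\<Sigma>]]])
    fix s assume "s \<in> \<Sigma>"
    then have "s \<in> blinfun_apply g ` \<Sigma>" using G_image\<Sigma>[OF g] by simp
    then obtain s' where s': "s = blinfun_apply g s'" "s' \<in> \<Sigma>" by (rule imageE)
    have "(blinfun_apply g u - blinfun_apply g (pr \<Sigma> u)) \<bullet> s = blinfun_apply g (u - pr \<Sigma> u) \<bullet> blinfun_apply g s'"
      by (simp add: s'(1) bl_simps)
    also have "\<dots> = 0" using g(1) pr_orth[OF sub\<Sigma> s'(2)] by simp
    finally show "(blinfun_apply g u - blinfun_apply g (pr \<Sigma> u)) \<bullet> s = 0" .
  qed
  have "lf (map (blinfun_apply g) ws) = (\<lambda>i. blinfun_apply g (lf ws i))"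
    using ws by (auto simp: lf_def fun_eq_iff pc blinfun.zero_right)
  then show ?thesis unfolding tt_def using w_inv[OF g z lf\<Sigma>] by simp
qed

definition RB :: "'v set" where "RB = ball 0 r \<inter> {v. reg v}"

lemma openRB: "open RB" unfolding RB_def by (intro open_Int open_ball open_reg)

lemma RB_G: "g \<in> G \<Longrightarrow> blinfun_apply g v \<in> RB \<longleftrightarrow> v \<in> RB"
  by (simp add: RB_def reg_G)

text \<open>The first \<open>k\<close> entries of the argument list of \<open>T k\<close> are directions of differentiation, the last one applied
  first; the choice of \<open>g\<close> is immaterial by Weyl invariance.\<close>

primrec T :: "nat \<Rightarrow> 'v \<Rightarrow> 'v list \<Rightarrow> real" where
  "T 0 = (\<lambda>v ws. if v \<in> RB then
       (let g = (SOME g. g \<in> G \<and> blinfun_apply g v \<in> \<Sigma>) in tt (blinfun_apply g v) (map (blinfun_apply g) ws)) else 0)"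
| "T (Suc k) = (\<lambda>v ws. if v \<in> RB then frechet_derivative (\<lambda>v. T k v (tl ws)) (at v) (hd ws) else 0)"

text \<open>Independence of the choice: two elements carrying a regular point into \<Sigma> differ
  by one that maps \<Sigma> to itself, and \<open>tt\<close> is invariant under those.\<close>

lemma T0_eq:
  assumes v: "v \<in> RB" and g: "g \<in> G" "blinfun_apply g v \<in> \<Sigma>" and ws: "length ws = p"
  shows "T 0 v ws = tt (blinfun_apply g v) (map (blinfun_apply g) ws)"
proof -
  define h where "h = (SOME g. g \<in> G \<and> blinfun_apply g v \<in> \<Sigma>)"
  have h: "h \<in> G \<and> blinfun_apply h v \<in> \<Sigma>" unfolding h_def by (rule someI_ex) (use meet\<Sigma> in blast)
  then have hG: "h \<in> G" by simp
  define k where "k = g o\<^sub>L gi h"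
  have kG: "k \<in> G" unfolding k_def using g h by simp
  let ?z = "blinfun_apply h v"
  have kz: "blinfun_apply k ?z = blinfun_apply g v" unfolding k_def using h by simp
  have zr: "?z \<in> \<Sigma> \<inter> ball 0 r" "reg ?z" using h v by (auto simp: RB_def reg_G[OF hG])
  have kS: "blinfun_apply k s \<in> \<Sigma>" if "s \<in> \<Sigma>" for s
    by (rule reg_normalizer[OF kG _ _ zr(2) that]) (use h kz g in auto)
  have "tt (blinfun_apply k ?z) (map (blinfun_apply k) (map (blinfun_apply h) ws)) = tt ?z (map (blinfun_apply h) ws)"
    by (rule tt_norm[OF kG kS zr(1)]) (simp_all add: ws)
  moreover have "map (blinfun_apply k) (map (blinfun_apply h) ws) = map (blinfun_apply g) ws"
    using hG by (simp add: k_def)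
  ultimately have "tt ?z (map (blinfun_apply h) ws) = tt (blinfun_apply g v) (map (blinfun_apply g) ws)"
    unfolding kz by (simp only:)
  then show ?thesis using v by (simp add: h_def[symmetric] Let_def)
qed

lemma T0_\<Sigma>: assumes "x \<in> \<Sigma> \<inter> RB" "length ws = p" shows "T 0 x ws = tt x ws"
  using T0_eq[of x id_blinfun ws] assms by (simp add: map_idI)

lemma T_out: "v \<notin> RB \<Longrightarrow> T k v ws = 0" by (cases k) auto

declare T.simps [simp del]

lemma mlin_zero: "mlin q (\<lambda>ws. 0)" by (simp add: mlin_def linear_zero)

lemma equiv_T0: "equiv_field p (T 0)"
  unfolding equiv_field_def
proof (intro conjI allI ballI impI)
  fix v
  show "mlin p (T 0 v)"
  proof (cases "v \<in> RB")
    case False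
    then have "T 0 v = (\<lambda>ws. 0)" by (auto simp: fun_eq_iff T_out)
    then show ?thesis by (simp only: mlin_zero)
  next
    case True
    obtain g where g: "g \<in> G" "blinfun_apply g v \<in> \<Sigma>" using meet\<Sigma> by blast
    have z: "blinfun_apply g v \<in> \<Sigma> \<inter> ball 0 r" using g True by (simp add: RB_def)
    show ?thesis unfolding mlin_def
    proof (intro allI impI)
      fix xs ys :: "'v list" assume l: "length xs + length ys + 1 = p"
      have "linear (\<lambda>w. tt (blinfun_apply g v) (map (blinfun_apply g) xs @ w # map (blinfun_apply g) ys))"
        by (rule mlinD[OF tt_mlin[OF z]]) (use l in simp)
      from linear_compose[OF bounded_linear.linear[OF blinfun.bounded_linear_right] this]
      have "linear (\<lambda>w. tt (blinfun_apply g v) (map (blinfun_apply g) (xs @ w # ys)))" by (simp add: o_def)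
      moreover have "T 0 v (xs @ w # ys) = tt (blinfun_apply g v) (map (blinfun_apply g) (xs @ w # ys))" for w
        by (rule T0_eq[OF True g]) (use l in simp)
      ultimately show "linear (\<lambda>w. T 0 v (xs @ w # ys))" by (simp only:)
    qed
  qed
next
  fix k v and ws :: "'v list" assume k: "k \<in> G" and ws: "length ws = p"
  show "T 0 (blinfun_apply k v) (map (blinfun_apply k) ws) = T 0 v ws"
  proof (cases "v \<in> RB")
    case False then show ?thesis using RB_G[OF k] by (simp only: T_out not_False_eq_True)
  next
    case True
    obtain g where g: "g \<in> G" "blinfun_apply g v \<in> \<Sigma>" using meet\<Sigma> by blast
    have g': "g o\<^sub>L gi k \<in> G" "blinfun_apply (g o\<^sub>L gi k) (blinfun_apply k v) \<in> \<Sigma>" using g k by auto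
    have "T 0 (blinfun_apply k v) (map (blinfun_apply k) ws)
        = tt (blinfun_apply (g o\<^sub>L gi k) (blinfun_apply k v)) (map (blinfun_apply (g o\<^sub>L gi k)) (map (blinfun_apply k) ws))"
      by (rule T0_eq[OF _ g']) (use True RB_G[OF k] ws in auto)
    also have "\<dots> = tt (blinfun_apply g v) (map (blinfun_apply g) ws)" using k by (simp add: o_def)
    also have "\<dots> = T 0 v ws" by (rule T0_eq[OF True g ws, symmetric])
    finally show ?thesis .
  qed
qed

definition section_values :: "nat \<Rightarrow> ('v list \<Rightarrow> 'v \<Rightarrow> real) \<Rightarrow> bool" where
  "section_values k q \<longleftrightarrow> (\<forall>ws. length ws = k + p \<longrightarrow> smooth_on \<Sigma> (\<Sigma> \<inter> ball 0 r) (q ws) \<and> (\<forall>x\<in>\<Sigma> \<inter> RB. T k x ws = q ws x))"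

definition smooth_level :: "nat \<Rightarrow> bool" where "smooth_level k \<longleftrightarrow> equiv_field (k + p) (T k) \<and> (\<exists>q. section_values k q)"

text \<open>Equivariance moves the question to a regular point of \<Sigma>, where the smooth values
  on \<Sigma> provide differentiability within \<Sigma>.\<close>

lemma smooth_level_derivative:
  assumes gk: "smooth_level k" and v: "v \<in> RB" and ws: "length ws = k + p"
  shows "((\<lambda>v. T k v ws) has_derivative (\<lambda>u. T (Suc k) v (u # ws))) (at v)"
proof -
  have eq: "equiv_field (k + p) (T k)" using gk by (simp add: smooth_level_def)
  obtain q where q: "\<And>ws. length ws = k + p \<Longrightarrow> smooth_on \<Sigma> (\<Sigma> \<inter> ball 0 r) (q ws)"
    "\<And>ws x. length ws = k + p \<Longrightarrow> x \<in> \<Sigma> \<inter> RB \<Longrightarrow> T k x ws = q ws x"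
    using gk unfolding smooth_level_def section_values_def by blast
  have dS: "(\<lambda>v. T k v ws) differentiable (at x within \<Sigma> \<inter> RB)" if x: "x \<in> \<Sigma> \<inter> RB" and ws: "length ws = k + p" for x ws
  proof -
    obtain g where g: "\<And>x. x \<in> \<Sigma> \<inter> ball 0 r \<Longrightarrow> (q ws has_derivative (\<lambda>h. g x \<bullet> h)) (at x within \<Sigma> \<inter> ball 0 r)"
      "\<And>x. g x \<in> \<Sigma>" "\<And>c. smooth_on \<Sigma> (\<Sigma> \<inter> ball 0 r) (\<lambda>x. g x \<bullet> c)" "continuous_on (\<Sigma> \<inter> ball 0 r) g"
      by (rule smooth_gradient[OF q(1)[OF ws] ropen_ball[OF sub\<Sigma>]]) blast
    have "(q ws has_derivative (\<lambda>h. g x \<bullet> h)) (at x within \<Sigma> \<inter> RB)"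
      by (rule has_derivative_subset[OF g(1)]) (use x in \<open>auto simp: RB_def\<close>)
    then have "((\<lambda>v. T k v ws) has_derivative (\<lambda>h. g x \<bullet> h)) (at x within \<Sigma> \<inter> RB)"
      by (rule has_derivative_transform[OF x, rotated]) (rule q(2)[OF ws])
    then show ?thesis by (auto simp: differentiable_def)
  qed
  obtain g where g: "g \<in> G" "blinfun_apply g v \<in> \<Sigma>" using meet\<Sigma> by blast
  let ?x = "blinfun_apply g v"
  have x: "?x \<in> \<Sigma>" "reg ?x" "?x \<in> RB" using g v RB_G[OF g(1)] by (auto simp: RB_def)
  have "(\<lambda>v. T k v (map (blinfun_apply g) ws)) differentiable (at ?x)"
    by (rule equiv_field_differentiable[OF eq x(1,2) openRB x(3) dS]) (use x ws in auto)
  then obtain D where D: "((\<lambda>v. T k v (map (blinfun_apply g) ws)) has_derivative D) (at ?x)" by (auto simp: differentiable_def)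
  have "((\<lambda>v. T k (blinfun_apply g v) (map (blinfun_apply g) ws)) has_derivative (\<lambda>u. D (blinfun_apply g u))) (at v)"
    by (rule has_derivative_compose[OF bounded_linear_imp_has_derivative[OF blinfun.bounded_linear_right] D])
  then have "(\<lambda>v. T k v ws) differentiable (at v)"
    using equiv_G[OF eq g(1) ws] by (auto simp: differentiable_def)
  then have "((\<lambda>v. T k v ws) has_derivative frechet_derivative (\<lambda>v. T k v ws) (at v)) (at v)"
    by (simp add: frechet_derivative_works)
  moreover have "(\<lambda>u. T (Suc k) v (u # ws)) = frechet_derivative (\<lambda>v. T k v ws) (at v)"
    using v by (simp add: fun_eq_iff T.simps(2))
  ultimately show ?thesis by (simp only:)
qed

text \<open>Each identity for \<open>T k\<close> is differentiated, and uniqueness of the derivative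
  transfers it to \<open>T (Suc k)\<close>. The new slot is linear because it is a direction of
  differentiation.\<close>

lemma equiv_Suc: assumes gk: "smooth_level k" shows "equiv_field (Suc k + p) (T (Suc k))"
proof -
  have eq: "equiv_field (k + p) (T k)" using gk by (simp add: smooth_level_def)
  note D = smooth_level_derivative[OF gk]
  show ?thesis unfolding equiv_field_def
  proof (intro conjI allI ballI impI)
    fix v
    show "mlin (Suc k + p) (T (Suc k) v)"
    proof (cases "v \<in> RB")
      case False
      then have "T (Suc k) v = (\<lambda>ws. 0)" by (auto simp: fun_eq_iff T_out)
      then show ?thesis by (simp only: mlin_zero)
    next
      case True
      show ?thesis unfolding mlin_def
      proof (intro allI impI)
        fix xs ys :: "'v list" assume l: "length xs + length ys + 1 = Suc k + p"
        show "linear (\<lambda>w. T (Suc k) v (xs @ w # ys))"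
        proof (cases xs)
          case Nil
          then show ?thesis using has_derivative_linear[OF D[OF True, of ys]] l by simp
        next
          case (Cons u xs')
          have l': "length xs' + length ys + 1 = k + p" using l Cons by simp
          have lw: "length (xs' @ w # ys) = k + p" for w using l' by simp
          have lin: "linear (\<lambda>w. T k v (xs' @ w # ys))" for v by (rule mlinD[OF equiv_mlin[OF eq] l'])
          show ?thesis
          proof (rule linearI)
            fix w w' c
            have "((\<lambda>v. T k v (xs' @ w # ys) + T k v (xs' @ w' # ys)) has_derivative
                (\<lambda>u. T (Suc k) v (u # xs' @ w # ys) + T (Suc k) v (u # xs' @ w' # ys))) (at v)"
              by (rule has_derivative_add[OF D[OF True lw] D[OF True lw]])
            then have "((\<lambda>v. T k v (xs' @ (w + w') # ys)) has_derivative
                (\<lambda>u. T (Suc k) v (u # xs' @ w # ys) + T (Suc k) v (u # xs' @ w' # ys))) (at v)"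
              by (simp only: linear_add[OF lin])
            from fun_cong[OF has_derivative_unique[OF D[OF True lw] this], of u]
            show "T (Suc k) v (xs @ (w + w') # ys) = T (Suc k) v (xs @ w # ys) + T (Suc k) v (xs @ w' # ys)"
              unfolding Cons append_Cons .
            have "((\<lambda>v. c *\<^sub>R T k v (xs' @ w # ys)) has_derivative (\<lambda>u. c *\<^sub>R T (Suc k) v (u # xs' @ w # ys))) (at v)"
              by (rule has_derivative_scaleR_right[OF D[OF True lw]])
            then have "((\<lambda>v. T k v (xs' @ (c *\<^sub>R w) # ys)) has_derivative (\<lambda>u. c *\<^sub>R T (Suc k) v (u # xs' @ w # ys))) (at v)"
              by (simp only: linear_cmul[OF lin])
            from fun_cong[OF has_derivative_unique[OF D[OF True lw] this], of u]
            show "T (Suc k) v (xs @ (c *\<^sub>R w) # ys) = c *\<^sub>R T (Suc k) v (xs @ w # ys)"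
              unfolding Cons append_Cons .
          qed
        qed
      qed
    qed
  next
    fix g v and us :: "'v list" assume g: "g \<in> G" and us: "length us = Suc k + p"
    show "T (Suc k) (blinfun_apply g v) (map (blinfun_apply g) us) = T (Suc k) v us"
    proof (cases "v \<in> RB")
      case False then show ?thesis using RB_G[OF g] by (simp only: T_out not_False_eq_True)
    next
      case True
      obtain u ws where w: "us = u # ws" "length ws = k + p" using us by (cases us) auto
      have gv: "blinfun_apply g v \<in> RB" using True RB_G[OF g] by simp
      have lm: "length (map (blinfun_apply g) ws) = k + p" using w by simp
      have "((\<lambda>v. T k (blinfun_apply g v) (map (blinfun_apply g) ws)) has_derivative
          (\<lambda>u. T (Suc k) (blinfun_apply g v) (blinfun_apply g u # map (blinfun_apply g) ws))) (at v)"
        by (rule has_derivative_compose[OF bounded_linear_imp_has_derivative[OF blinfun.bounded_linear_right] D[OF gv lm]])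
      then have "((\<lambda>v. T k v ws) has_derivative
          (\<lambda>u. T (Suc k) (blinfun_apply g v) (blinfun_apply g u # map (blinfun_apply g) ws))) (at v)"
        by (simp only: equiv_G[OF eq g w(2)])
      from fun_cong[OF has_derivative_unique[OF this D[OF True w(2)]], of u]
      show ?thesis unfolding w(1) list.map .
    qed
  qed
qed

end

section \<open>The derivatives of the extended form at a single wall\<close>

locale form_rank = form_ext K \<Sigma> E a XX x0 r p \<omega> + rank_one K \<Sigma> E a XX x0 f
  for K :: "('v::euclidean_space \<Rightarrow> 'v) set" and \<Sigma> E a XX x0 r p \<omega> f
begin

lemma rf_reflection: "\<exists>g\<in>G. \<forall>s\<in>\<Sigma>. blinfun_apply g s = rf s"
proof -
  obtain g where g: "g \<in> K1" "blinfun_apply g \<alpha> = - \<alpha>" using reflection by blast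
  have "blinfun_apply g s = rf s" if s: "s \<in> \<Sigma>" for s
  proof -
    have H: "s - (s \<bullet> \<alpha>) *\<^sub>R \<alpha> \<in> H" using prH[of s] s sub\<Sigma> by simp
    have "blinfun_apply g s = blinfun_apply g (s - (s \<bullet> \<alpha>) *\<^sub>R \<alpha>) + (s \<bullet> \<alpha>) *\<^sub>R blinfun_apply g \<alpha>"
      by (simp add: bl_simps)
    also have "\<dots> = (s - (s \<bullet> \<alpha>) *\<^sub>R \<alpha>) + (s \<bullet> \<alpha>) *\<^sub>R (- \<alpha>)" using K1_H[OF g(1) H] g(2) by simp
    also have "\<dots> = rf s" unfolding rf_def mult_2 scaleR_left_distrib by simp
    finally show ?thesis .
  qed
  then show ?thesis using K1_G[OF g(1)] by blast
qed

lemma tt_rf: assumes z: "z \<in> \<Sigma> \<inter> ball 0 r" and ws: "length ws = p" "set ws \<subseteq> \<Sigma>"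
  shows "tt (rf z) (map rf ws) = tt z ws"
proof -
  obtain g where g: "g \<in> G" "\<forall>s\<in>\<Sigma>. blinfun_apply g s = rf s" using rf_reflection by blast
  have "map rf ws = map (blinfun_apply g) ws" using g(2) ws(2) by auto
  moreover have "tt (blinfun_apply g z) (map (blinfun_apply g) ws) = tt z ws"
    by (rule tt_norm[OF g(1) _ z ws(1)]) (use g(2) rf\<Sigma> in simp)
  moreover have "blinfun_apply g z = rf z" using g(2) z by blast
  ultimately show ?thesis by (simp only:)
qed

text \<open>A regular point of the slice is off \<open>H\<close>, and an element of
  \<open>K1\<close> carries it to \<open>\<kappa> v\<close> in \<Sigma>. After this motion the
  \<Sigma>-components of the arguments are given by \<open>tau\<close>, so
  \<open>alternating_fold\<close> applies to the resulting expression.\<close>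

lemma germ_0:
  assumes x: "x \<in> ball 0 r" and ws: "length ws = p"
  shows "reg_germ x (\<lambda>v. T 0 v ws)"
proof -
  obtain F where F: "smooth_on nu (nu \<inter> ball 0 r) F"
     "\<forall>v\<in>nu \<inter> ball 0 r. wp v \<noteq> 0 \<longrightarrow> tt (\<kappa> v) (map (tau v) ws @ []) = F v"
    using alternating_fold[where t = tt and p = p and r = r and ?ws1.0 = ws and ?ws2.0 = "[]", OF tt_mlin tt_smooth tt_rf tt_alt] ws by auto
  have eq: "T 0 v ws = F v" if v: "v \<in> nu \<inter> ball 0 r" "reg v" for v
  proof -
    have wn: "wp v \<noteq> 0"
    proof
      assume "wp v = 0"
      then have vh: "v = hp v" by (simp add: wp_def)
      have "v \<in> H" using hpH[of v] vh[symmetric] by simp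
      then show False using a_E1_H[OF fE1] reg\<Sigma>[OF H\<Sigma>] v(2) fE by blast
    qed
    obtain g where g: "g \<in> K1" "blinfun_apply g (norm (wp v) *\<^sub>R \<alpha>) = wp v" using transitive[OF wpN] v by blast
    have gG: "g \<in> G" by (rule K1_G[OF g(1)])
    have "blinfun_apply g (\<kappa> v) = v"
      unfolding \<kappa>_def blinfun.add_right g(2) using K1_H[OF g(1) hpH] by (simp add: wp_def)
    then have gk: "blinfun_apply (gi g) v = \<kappa> v" using gi_left[OF gG, of "\<kappa> v"] by simp
    have ga: "blinfun_apply g \<alpha> = (1 / norm (wp v)) *\<^sub>R wp v"
    proof -
      have "norm (wp v) *\<^sub>R blinfun_apply g \<alpha> = wp v" using g(2) by (simp add: bl_simps)
      then have "(1 / norm (wp v)) *\<^sub>R (norm (wp v) *\<^sub>R blinfun_apply g \<alpha>) = (1 / norm (wp v)) *\<^sub>R wp v" by simp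
      then show ?thesis using wn by simp
    qed
    have tS: "tau v u \<in> \<Sigma>" for u
      unfolding tau_def by (intro subspace_add subspace_scale sub\<Sigma> \<alpha>\<Sigma> H\<Sigma> hpH)
    \<comment> \<open>The component in \<open>H\<close> is unchanged because \<open>K1\<close> fixes
      \<open>H\<close>. The \<alpha>-component is the inner product of \<open>u\<close> with the
      image of \<alpha>, the unit vector along \<open>wp v\<close>.\<close>
    have prt: "pr \<Sigma> (blinfun_apply (gi g) u) = tau v u" for u
    proof (rule pr_unique[OF sub\<Sigma> tS])
      fix y assume y: "y \<in> \<Sigma>"
      define h where "h = y - (y \<bullet> \<alpha>) *\<^sub>R \<alpha>"
      have hH: "h \<in> H" using prH[of y] y sub\<Sigma> by (simp add: h_def)
      have yh: "y = h + (y \<bullet> \<alpha>) *\<^sub>R \<alpha>" by (simp add: h_def)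
      have ah: "\<alpha> \<bullet> h = 0" using hH by (simp add: H_def inner_commute)
      have 1: "(blinfun_apply (gi g) u - tau v u) \<bullet> h = 0"
        unfolding inner_diff_left gi_inner[OF gG] K1_H[OF g(1) hH] tau_def inner_add_left
        using hp_inner[OF hH, of u] ah by simp
      have 2: "(blinfun_apply (gi g) u - tau v u) \<bullet> \<alpha> = 0"
        unfolding inner_diff_left gi_inner[OF gG] ga tau_def inner_add_left
        using hp_\<alpha>[of u] \<alpha>1 by (simp add: inner_commute)
      have "(blinfun_apply (gi g) u - tau v u) \<bullet> y
          = (blinfun_apply (gi g) u - tau v u) \<bullet> h + (y \<bullet> \<alpha>) * ((blinfun_apply (gi g) u - tau v u) \<bullet> \<alpha>)"
        by (subst yh) (simp add: inner_add_right)
      then show "(blinfun_apply (gi g) u - tau v u) \<bullet> y = 0" using 1 2 by simp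
    qed
    have "T 0 v ws = tt (\<kappa> v) (map (blinfun_apply (gi g)) ws)"
      using T0_eq[of v "gi g" ws] v gG gk \<kappa>\<Sigma> ws by (simp add: RB_def)
    also have "\<dots> = tt (\<kappa> v) (map (tau v) ws)"
      by (rule tt_pr_cong[OF ws]) (simp add: prt pr_self[OF sub\<Sigma> tS])
    also have "\<dots> = F v" using F(2) v wn by simp
    finally show ?thesis .
  qed
  define e where "e = r - norm x"
  have e: "0 < e" using x by (simp add: e_def)
  have sub: "nu \<inter> ball x e \<subseteq> nu \<inter> ball 0 r"
  proof
    fix y assume "y \<in> nu \<inter> ball x e"
    then show "y \<in> nu \<inter> ball 0 r" using norm_triangle_ineq[of x "y - x"] by (simp add: e_def dist_norm norm_minus_commute)
  qed
  have "smooth_on nu (nu \<inter> ball x e) F" by (rule smooth_subset[OF F(1) order_refl sub])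
  then show ?thesis unfolding reg_germ_def using e eq sub by (intro exI[of _ e] conjI exI[of _ F]) blast+
qed

lemma germ_all:
  assumes x: "x \<in> H" "x \<in> ball 0 r" and gen: "\<And>e. e \<in> E - E1 \<Longrightarrow> a e \<bullet> x \<noteq> 0"
  shows "(\<forall>j<k. smooth_level j) \<Longrightarrow> length ws = k + p \<Longrightarrow> reg_germ x (\<lambda>v. T k v ws)"
proof (induction k arbitrary: ws)
  case 0 then show ?case using germ_0[OF x(2)] by simp
next
  case (Suc k)
  have gk: "smooth_level k" "\<forall>j<k. smooth_level j" using Suc.prems(1) by auto
  obtain u us where us: "ws = u # us" "length us = k + p" using Suc.prems(2) by (cases ws) auto
  show ?case unfolding us(1)
  proof (rule germ_step[OF x gen])
    show "equiv_field (k + p) (T k)" using gk(1) by (simp add: smooth_level_def)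
    show "((\<lambda>v. T k v ws) has_derivative (\<lambda>u. T (Suc k) v (u # ws))) (at v)"
      if "v \<in> ball 0 r" "reg v" "length ws = k + p" for v ws
      by (rule smooth_level_derivative[OF gk(1)]) (use that in \<open>auto simp: RB_def\<close>)
    show "reg_germ x (\<lambda>v. T k v ws)" if "length ws = k + p" for ws by (rule Suc.IH[OF gk(2) that])
    show "length us = k + p" by (rule us(2))
  qed
qed

text \<open>\<open>act_vanishes\<close> covers the points of the wall on no other wall. Any point of
  the wall is a limit of such points, by a small shift in a generic direction of
  \<open>H\<close>.\<close>

lemma act_vanishes_all:
  assumes gk: "\<forall>j\<le>k. smooth_level j" and Q: "section_values k q" and x: "x \<in> \<Sigma> \<inter> ball 0 r" "a f \<bullet> x = 0" and ws: "length ws = k + p"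
  shows "act (XX f) (\<lambda>ws. q ws x) ws = 0"
proof -
  have xH: "x \<in> H"
  proof -
    have "norm (a f) * (x \<bullet> \<alpha>) = 0" using x(2) arg_cong[OF a_f, of "\<lambda>u. u \<bullet> x"] by (simp add: inner_commute)
    then show ?thesis using x a_nz[OF fE] by (simp add: H_def)
  qed
  obtain y where y: "y \<in> H" "\<forall>e\<in>E - E1. a e \<bullet> y \<noteq> 0" using generic_H by blast
  define z where "z n = x + (1 / real (Suc n)) *\<^sub>R y" for n
  have zH: "z n \<in> H" for n unfolding z_def by (intro subspace_add subspace_scale subH xH y)
  have l0: "(\<lambda>n. 1 / real (Suc n)) \<longlonglongrightarrow> 0" using LIMSEQ_Suc[OF lim_1_over_n] by simp
  have "(\<lambda>n. x + (1 / real (Suc n)) *\<^sub>R y) \<longlonglongrightarrow> x + 0 *\<^sub>R y" by (intro tendsto_intros l0)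
  then have zx: "z \<longlonglongrightarrow> x" by (simp add: z_def[abs_def])
  have "\<forall>\<^sub>F n in sequentially. a e \<bullet> z n \<noteq> 0" if e: "e \<in> E - E1" for e
  proof (cases "a e \<bullet> x = 0")
    case True
    have "a e \<bullet> y \<noteq> 0" using y e by blast
    then show ?thesis using True by (simp add: z_def inner_add_right)
  next
    case False
    have "(\<lambda>n. a e \<bullet> z n) \<longlonglongrightarrow> a e \<bullet> x" by (intro tendsto_intros zx)
    then show ?thesis using False by (rule tendsto_imp_eventually_ne)
  qed
  then have "\<forall>\<^sub>F n in sequentially. \<forall>e\<in>E - E1. a e \<bullet> z n \<noteq> 0"
    using finE by (simp add: eventually_ball_finite)
  moreover have ball: "\<forall>\<^sub>F n in sequentially. z n \<in> ball 0 r"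
    using topological_tendstoD[OF zx, of "ball 0 r"] x by simp
  ultimately have ev: "\<forall>\<^sub>F n in sequentially. act (XX f) (\<lambda>ws. q ws (z n)) ws = 0"
  proof eventually_elim
    case (elim n)
    show ?case
    proof (rule act_vanishes[where t = "T k" and q = "k + p" and r = r])
      show "z n \<in> H" by (rule zH)
      show "z n \<in> ball 0 r" using elim by simp
      show "a e \<bullet> z n \<noteq> 0" if "e \<in> E - E1" for e using elim that by blast
      show "equiv_field (k + p) (T k)" using gk by (simp add: smooth_level_def)
      show "reg_germ (z n) (\<lambda>v. T k v ws)" if "length ws = k + p" for ws
        by (rule germ_all[OF zH _ _ _ that]) (use elim gk in auto)
      show "continuous_on (\<Sigma> \<inter> ball 0 r) (q ws)" if "length ws = k + p" for ws
        using Q that smooth_continuous unfolding section_values_def by blast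
      show "T k y ws = q ws y" if "y \<in> \<Sigma> \<inter> ball 0 r" "reg y" "length ws = k + p" for y ws
        using Q that unfolding section_values_def RB_def by blast
      show "length ws = k + p" by (rule ws)
    qed
  qed
  have "(\<lambda>n. act (XX f) (\<lambda>ws. q ws (z n)) ws) \<longlonglongrightarrow> act (XX f) (\<lambda>ws. q ws x) ws"
    unfolding act_def
  proof (rule tendsto_sum)
    fix i assume "i \<in> {..<length ws}"
    have l: "length (ws[i := blinfun_apply (XX f) (ws ! i)]) = k + p" using ws by simp
    have "continuous_on (\<Sigma> \<inter> ball 0 r) (q (ws[i := blinfun_apply (XX f) (ws ! i)]))"
      using Q l smooth_continuous unfolding section_values_def by blast
    from continuous_on_tendsto_compose[OF this zx x(1)]
    show "(\<lambda>n. q (ws[i := blinfun_apply (XX f) (ws ! i)]) (z n)) \<longlonglongrightarrow> q (ws[i := blinfun_apply (XX f) (ws ! i)]) x"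
      using ball zH H\<Sigma> by (auto elim!: eventually_mono)
  qed
  then have "(\<lambda>n. 0) \<longlonglongrightarrow> act (XX f) (\<lambda>ws. q ws x) ws" by (rule Lim_transform_eventually) (use ev in auto)
  then show ?thesis by (simp add: LIMSEQ_const_iff)
qed

end

context form_ext
begin

text \<open>The new first argument is split into its \<Sigma>-part, handled by the gradient of
  \<open>q\<close>, and multiples of the \<open>e\<close> in \<open>E\<close>. For the latter the
  equivariance equation is divided by the root: Hadamard removes the factor along \<alpha>, the
  constant \<open>norm (a e)\<close> remains.\<close>

lemma Q_Suc: assumes gk: "\<forall>j\<le>k. smooth_level j" shows "\<exists>q. section_values (Suc k) q"
proof -
  obtain q where Q: "section_values k q" using gk unfolding smooth_level_def by blast
  then have q: "\<And>ws. length ws = k + p \<Longrightarrow> smooth_on \<Sigma> (\<Sigma> \<inter> ball 0 r) (q ws)"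
    "\<And>ws x. length ws = k + p \<Longrightarrow> x \<in> \<Sigma> \<inter> RB \<Longrightarrow> T k x ws = q ws x"
    unfolding section_values_def by blast+
  have smooth_level_k: "smooth_level k" using gk by simp
  have eq: "equiv_field (k + p) (T k)" using smooth_level_k by (simp add: smooth_level_def)
  note D = smooth_level_derivative[OF smooth_level_k]
  have E_dir: "\<exists>c. smooth_on \<Sigma> (\<Sigma> \<inter> ball 0 r) c \<and> (\<forall>x\<in>\<Sigma> \<inter> RB. T (Suc k) x (e # ws) = c x)"
    if e: "e \<in> E" and ws: "length ws = k + p" for e ws
  proof -
    interpret R: form_rank K \<Sigma> E a XX x0 r p \<omega> e by unfold_locales (rule e)
    let ?A = "\<lambda>x. act (XX e) (\<lambda>ws. q ws x) ws"
    have sA: "smooth_on \<Sigma> (\<Sigma> \<inter> ball 0 r) ?A"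
      unfolding act_def by (intro smooth_sum q(1)) (use ws in simp)
    have van: "?A x = 0" if "x \<in> \<Sigma> \<inter> ball 0 r" "x \<bullet> R.\<alpha> = 0" for x
    proof (rule R.act_vanishes_all[OF gk Q that(1) _ ws])
      show "a e \<bullet> x = 0" using arg_cong[OF R.a_f, of "\<lambda>u. u \<bullet> x"] that(2) by (simp add: inner_commute)
    qed
    obtain c where c: "smooth_on \<Sigma> (\<Sigma> \<inter> ball 0 r) c" "\<And>x. x \<in> \<Sigma> \<inter> ball 0 r \<Longrightarrow> ?A x = (x \<bullet> R.\<alpha>) * c x"
    proof (rule hadamard_division[OF sub\<Sigma> R.\<alpha>\<Sigma> R.\<alpha>1(2) refl sA van])
      fix q assume "smooth_on \<Sigma> (\<Sigma> \<inter> ball 0 r) q" "\<And>x. x \<in> \<Sigma> \<inter> ball 0 r \<Longrightarrow> ?A x = (x \<bullet> R.\<alpha>) * q x"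
      then show thesis by (rule that)
    qed
    have "T (Suc k) x (e # ws) = - (1 / norm (a e)) * c x" if x: "x \<in> \<Sigma> \<inter> RB" for x
    proof -
      have xR: "x \<in> RB" and x\<Sigma>: "x \<in> \<Sigma>" and xb: "x \<in> \<Sigma> \<inter> ball 0 r" and xreg: "reg x" using x by (auto simp: RB_def)
      have lin: "linear (\<lambda>u. T (Suc k) x (u # ws))" by (rule has_derivative_linear[OF D[OF xR ws]])
      have "(a e \<bullet> x) * T (Suc k) x (e # ws) = T (Suc k) x (blinfun_apply (XX e) x # ws)"
        unfolding XXy[OF e x\<Sigma>] using linear_cmul[OF lin, of "a e \<bullet> x" e] by simp
      also have "\<dots> = - act (XX e) (T k x) ws"
        by (rule field_L_derivative[OF eq ws XXL[OF e] D[OF xR ws]])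
      also have "act (XX e) (T k x) ws = ?A x"
        unfolding act_def using q(2)[OF _ x] ws by (intro sum.cong) auto
      also have "\<dots> = (x \<bullet> R.\<alpha>) * c x" by (rule c(2)[OF xb])
      finally have 1: "(a e \<bullet> x) * T (Suc k) x (e # ws) = - ((x \<bullet> R.\<alpha>) * c x)" .
      have 2: "a e \<bullet> x = norm (a e) * (x \<bullet> R.\<alpha>)" using arg_cong[OF R.a_f, of "\<lambda>u. u \<bullet> x"] by (simp add: inner_commute)
      have "a e \<bullet> x \<noteq> 0" using reg\<Sigma>[OF x\<Sigma>] xreg e by blast
      then have n: "x \<bullet> R.\<alpha> \<noteq> 0" "norm (a e) \<noteq> 0" using 2 by auto
      have "(x \<bullet> R.\<alpha>) * (norm (a e) * T (Suc k) x (e # ws)) = (x \<bullet> R.\<alpha>) * (- c x)"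
        using 1 unfolding 2 by (simp add: mult_ac)
      then have "norm (a e) * T (Suc k) x (e # ws) = - c x" by (rule mult_left_cancel[OF n(1), THEN iffD1])
      then show ?thesis using n(2) by (simp add: field_simps)
    qed
    then show ?thesis
      by (intro exI[of _ "\<lambda>x. - (1 / norm (a e)) * c x"] conjI smooth_cmult c(1)) blast
  qed
  have all: "\<exists>c. smooth_on \<Sigma> (\<Sigma> \<inter> ball 0 r) c \<and> (\<forall>x\<in>\<Sigma> \<inter> RB. T (Suc k) x us = c x)" if us: "length us = Suc k + p" for us
  proof -
    obtain u ws where w: "us = u # ws" "length ws = k + p" using us by (cases us) auto
    obtain g where g: "\<And>x. x \<in> \<Sigma> \<inter> ball 0 r \<Longrightarrow> (q ws has_derivative (\<lambda>h. g x \<bullet> h)) (at x within \<Sigma> \<inter> ball 0 r)"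
      "\<And>x. g x \<in> \<Sigma>" "\<And>c. smooth_on \<Sigma> (\<Sigma> \<inter> ball 0 r) (\<lambda>x. g x \<bullet> c)" "continuous_on (\<Sigma> \<inter> ball 0 r) g"
      by (rule smooth_gradient[OF q(1)[OF w(2)] ropen_ball[OF sub\<Sigma>]]) blast
    have gS: "T (Suc k) x (s # ws) = g x \<bullet> s" if x: "x \<in> \<Sigma> \<inter> RB" and s: "s \<in> \<Sigma>" for x s
    proof -
      have rS: "ropen \<Sigma> (\<Sigma> \<inter> RB)" by (rule ropen_open[OF sub\<Sigma> openRB])
      have xR: "x \<in> RB" using x by simp
      have "((\<lambda>v. T k v ws) has_derivative (\<lambda>u. T (Suc k) x (u # ws))) (at x within \<Sigma> \<inter> RB)"
        by (rule has_derivative_at_withinI[OF D[OF xR w(2)]])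
      then have "(q ws has_derivative (\<lambda>u. T (Suc k) x (u # ws))) (at x within \<Sigma> \<inter> RB)"
        by (rule has_derivative_transform[OF x, rotated]) (simp only: q(2)[OF w(2)])
      moreover have "(q ws has_derivative (\<lambda>h. g x \<bullet> h)) (at x within \<Sigma> \<inter> RB)"
        by (rule has_derivative_subset[OF g(1)]) (use x in \<open>auto simp: RB_def\<close>)
      ultimately show ?thesis by (rule ropen_derivative_unique[OF rS x s])
    qed
    have "\<forall>e\<in>E. \<exists>c. smooth_on \<Sigma> (\<Sigma> \<inter> ball 0 r) c \<and> (\<forall>x\<in>\<Sigma> \<inter> RB. T (Suc k) x (e # ws) = c x)"
      using E_dir w(2) by blast
    from bchoice[OF this] obtain c where c: "\<And>e. e \<in> E \<Longrightarrow> smooth_on \<Sigma> (\<Sigma> \<inter> ball 0 r) (c e)"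
      "\<And>e x. e \<in> E \<Longrightarrow> x \<in> \<Sigma> \<inter> RB \<Longrightarrow> T (Suc k) x (e # ws) = c e x" by blast
    have "T (Suc k) x us = g x \<bullet> pr \<Sigma> u + (\<Sum>e\<in>E. (u \<bullet> e) * c e x)" if x: "x \<in> \<Sigma> \<inter> RB" for x
    proof -
      have xR: "x \<in> RB" using x by simp
      have lin: "linear (\<lambda>u. T (Suc k) x (u # ws))" by (rule has_derivative_linear[OF D[OF xR w(2)]])
      have "T (Suc k) x (u # ws) = T (Suc k) x ((pr \<Sigma> u + (\<Sum>e\<in>E. (u \<bullet> e) *\<^sub>R e)) # ws)"
        by (rule arg_cong[OF decomp])
      also have "\<dots> = T (Suc k) x (pr \<Sigma> u # ws) + T (Suc k) x ((\<Sum>e\<in>E. (u \<bullet> e) *\<^sub>R e) # ws)"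
        by (rule linear_add[OF lin])
      also have "T (Suc k) x ((\<Sum>e\<in>E. (u \<bullet> e) *\<^sub>R e) # ws) = (\<Sum>e\<in>E. (u \<bullet> e) * T (Suc k) x (e # ws))"
        using linear_sum[OF lin, of "\<lambda>e. (u \<bullet> e) *\<^sub>R e" E] linear_cmul[OF lin] by simp
      also have "\<dots> = (\<Sum>e\<in>E. (u \<bullet> e) * c e x)" using c(2)[OF _ x] by (intro sum.cong) auto
      finally show ?thesis unfolding w(1) gS[OF x pr_in[OF sub\<Sigma>]] .
    qed
    moreover have "smooth_on \<Sigma> (\<Sigma> \<inter> ball 0 r) (\<lambda>x. g x \<bullet> pr \<Sigma> u + (\<Sum>e\<in>E. (u \<bullet> e) * c e x))"
      by (intro smooth_add smooth_sum smooth_cmult c(1) g(3))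
    ultimately show ?thesis by blast
  qed
  have "\<forall>us. \<exists>c. length us = Suc k + p \<longrightarrow> smooth_on \<Sigma> (\<Sigma> \<inter> ball 0 r) c \<and> (\<forall>x\<in>\<Sigma> \<inter> RB. T (Suc k) x us = c x)"
    using all by blast
  from choice[OF this] obtain c where "\<forall>us. length us = Suc k + p \<longrightarrow> smooth_on \<Sigma> (\<Sigma> \<inter> ball 0 r) (c us) \<and> (\<forall>x\<in>\<Sigma> \<inter> RB. T (Suc k) x us = c us x)" ..
  then show ?thesis unfolding section_values_def by (intro exI[of _ c])
qed

lemma smooth_level_all: "smooth_level k"
proof (induction k rule: less_induct)
  case (less k)
  show ?case
  proof (cases k)
    case 0
    have "section_values 0 (\<lambda>ws x. tt x ws)"
      unfolding section_values_def using tt_smooth T0_\<Sigma> by simp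
    then show ?thesis unfolding smooth_level_def 0 using equiv_T0 by auto
  next
    case (Suc j)
    then have g: "\<forall>i\<le>j. smooth_level i" using less by simp
    have "equiv_field (Suc j + p) (T (Suc j))" by (rule equiv_Suc) (use g in simp)
    moreover have "\<exists>q. section_values (Suc j) q" by (rule Q_Suc[OF g])
    ultimately show ?thesis unfolding smooth_level_def Suc by (rule conjI)
  qed
qed

text \<open>On \<Sigma> the smooth values are bounded over compact sets. Carrying \<open>v\<close>
  into \<Sigma> rotates the arguments uncontrollably but preserves their norms, so the bound has to
  be uniform over all arguments of norm at most \<open>R\<close>.\<close>

lemma T_bounded:
  assumes r': "r' < r" and ws: "length ws = k + p"
  shows "\<exists>C. \<forall>v\<in>ball 0 r'. reg v \<longrightarrow> \<bar>T k v ws\<bar> \<le> C"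
proof -
  have eq: "equiv_field (k + p) (T k)" using smooth_level_all by (simp add: smooth_level_def)
  obtain q where "section_values k q" using smooth_level_all unfolding smooth_level_def by blast
  then have q: "\<And>ws. length ws = k + p \<Longrightarrow> smooth_on \<Sigma> (\<Sigma> \<inter> ball 0 r) (q ws)"
    "\<And>ws x. length ws = k + p \<Longrightarrow> x \<in> \<Sigma> \<inter> RB \<Longrightarrow> T k x ws = q ws x"
    unfolding section_values_def by blast+
  define Z where "Z = \<Sigma> \<inter> RB \<inter> cball 0 r'"
  have b: "\<exists>C. \<forall>z\<in>Z. \<bar>T k z bs\<bar> \<le> C" if l: "length bs = k + p" for bs
  proof -
    have "compact (\<Sigma> \<inter> cball 0 r')" by (intro closed_Int_compact closed_subspace sub\<Sigma> compact_cball)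
    moreover have "continuous_on (\<Sigma> \<inter> cball 0 r') (q bs)"
      by (rule continuous_on_subset[OF smooth_continuous[OF q(1)[OF l]]]) (use r' in auto)
    ultimately have "bounded (q bs ` (\<Sigma> \<inter> cball 0 r'))" using compact_continuous_image compact_imp_bounded by blast
    then obtain C where C: "\<forall>y\<in>q bs ` (\<Sigma> \<inter> cball 0 r'). norm y \<le> C" unfolding bounded_iff by blast
    have "\<bar>T k z bs\<bar> \<le> C" if "z \<in> Z" for z
      using C that q(2)[OF l, of z] by (auto simp: Z_def)
    then show ?thesis by blast
  qed
  define R where "R = (\<Sum>w\<leftarrow>ws. norm w)"
  have R: "norm w \<le> R" if "w \<in> set ws" for w
    unfolding R_def using that by (auto intro!: member_le_sum_list)
  obtain C where C: "\<forall>z\<in>Z. \<forall>ws. length ws = k + p \<and> (\<forall>w\<in>set ws. norm w \<le> R) \<longrightarrow> \<bar>T k z ws\<bar> \<le> C"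
    using mlin_family_bounded[where t = "T k" and q = "k + p" and Z = Z and R = R] equiv_mlin[OF eq] b by blast
  have "\<bar>T k v ws\<bar> \<le> C" if v: "v \<in> ball 0 r'" "reg v" for v
  proof -
    obtain g where g: "g \<in> G" "blinfun_apply g v \<in> \<Sigma>" using meet\<Sigma> by blast
    have "blinfun_apply g v \<in> Z" using g v r' by (simp add: Z_def RB_def reg_G)
    moreover have "length (map (blinfun_apply g) ws) = k + p \<and> (\<forall>w\<in>set (map (blinfun_apply g) ws). norm w \<le> R)"
      using ws R g(1) by auto
    ultimately have "\<bar>T k (blinfun_apply g v) (map (blinfun_apply g) ws)\<bar> \<le> C" using C by blast
    then show ?thesis by (simp only: equiv_G[OF eq g(1) ws])
  qed
  then show ?thesis by blast
qed

lemma RB_eq: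
  fixes F1 F2 :: "'v \<Rightarrow> real"
  assumes "continuous_on (ball 0 r) F1" "continuous_on (ball 0 r) F2" "\<And>v. v \<in> RB \<Longrightarrow> F1 v = F2 v" and v: "v \<in> ball 0 r"
  shows "F1 v = F2 v"
proof -
  obtain y where y: "\<And>n::nat. y n \<in> RB" "y \<longlonglongrightarrow> v" using regular_limit[OF v] unfolding RB_def by blast
  have yb: "\<forall>\<^sub>F n in sequentially. y n \<in> ball 0 r" using y(1) by (simp add: RB_def)
  have "(\<lambda>n. F1 (y n)) \<longlonglongrightarrow> F1 v" by (rule continuous_on_tendsto_compose[OF assms(1) y(2) v yb])
  moreover have "(\<lambda>n. F2 (y n)) \<longlonglongrightarrow> F2 v" by (rule continuous_on_tendsto_compose[OF assms(2) y(2) v yb])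
  ultimately show ?thesis using assms(3)[OF y(1)] LIMSEQ_unique by simp
qed

lemma extension_exists: "\<exists>\<eta>\<in>basic_forms K p (ball 0 r). pullback_incl p \<Sigma> (\<Sigma> \<inter> ball 0 r) \<eta> = \<omega>"
proof -
  obtain F :: "'v list \<Rightarrow> 'v \<Rightarrow> real" where F: "\<And>ws. length ws = p \<Longrightarrow> smooth_on UNIV (ball 0 r) (F ws)"
    "\<And>ws v. length ws = p \<Longrightarrow> v \<in> ball 0 r \<Longrightarrow> reg v \<Longrightarrow> F ws v = T 0 v ws"
  proof (rule extension_smooth[of r p T])
    show "((\<lambda>v. T k v ws) has_derivative (\<lambda>u. T (Suc k) v (u # ws))) (at v)"
      if "v \<in> ball 0 r" "reg v" "length ws = k + p" for k v ws
      by (rule smooth_level_derivative[OF smooth_level_all]) (use that in \<open>auto simp: RB_def\<close>)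
    show "\<exists>C. \<forall>v\<in>ball 0 r'. reg v \<longrightarrow> \<bar>T k v ws\<bar> \<le> C" if "r' < r" "length ws = k + p" for k r' ws
      by (rule T_bounded[OF that])
    fix F :: "'v list \<Rightarrow> 'v \<Rightarrow> real" assume "\<And>ws. length ws = p \<Longrightarrow> smooth_on UNIV (ball 0 r) (F ws)"
    "\<And>ws v. length ws = p \<Longrightarrow> v \<in> ball 0 r \<Longrightarrow> reg v \<Longrightarrow> F ws v = T 0 v ws"
    then show thesis by (rule that)
  qed
  have FT: "F ws v = T 0 v ws" if "length ws = p" "v \<in> RB" for ws v using F(2) that by (simp add: RB_def)
  have Fc: "continuous_on (ball 0 r) (F ws)" if "length ws = p" for ws by (rule smooth_continuous[OF F(1)[OF that]])
  have FS: "F ws x = tt x ws" if x: "x \<in> \<Sigma> \<inter> ball 0 r" and ws: "length ws = p" for x ws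
  proof -
    \<comment> \<open>Every root has value 1 at \<open>x0\<close>, so for large n all roots are
      nonzero at \<open>z n\<close>; the values at singular points of \<Sigma> are then limits
      within \<Sigma>.\<close>
    define z where "z n = x + (1 / real (Suc n)) *\<^sub>R x0" for n
    have z\<Sigma>: "z n \<in> \<Sigma>" for n unfolding z_def using x by (intro subspace_add subspace_scale sub\<Sigma> x0\<Sigma>) auto
    have l0: "(\<lambda>n. 1 / real (Suc n)) \<longlonglongrightarrow> 0" using LIMSEQ_Suc[OF lim_1_over_n] by simp
    have "(\<lambda>n. x + (1 / real (Suc n)) *\<^sub>R x0) \<longlonglongrightarrow> x + 0 *\<^sub>R x0" by (intro tendsto_intros l0)
    then have zx: "z \<longlonglongrightarrow> x" by (simp add: z_def[abs_def])
    have "\<forall>\<^sub>F n in sequentially. a e \<bullet> z n \<noteq> 0" if e: "e \<in> E" for e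
    proof (cases "a e \<bullet> x = 0")
      case True
      then show ?thesis using a_x0[OF e] by (simp add: z_def inner_add_right)
    next
      case False
      have "(\<lambda>n. a e \<bullet> z n) \<longlonglongrightarrow> a e \<bullet> x" by (intro tendsto_intros zx)
      then show ?thesis using False by (rule tendsto_imp_eventually_ne)
    qed
    then have "\<forall>\<^sub>F n in sequentially. \<forall>e\<in>E. a e \<bullet> z n \<noteq> 0" using finE by (simp add: eventually_ball_finite)
    moreover have ball: "\<forall>\<^sub>F n in sequentially. z n \<in> ball 0 r"
      using topological_tendstoD[OF zx, of "ball 0 r"] x by simp
    ultimately have ev: "\<forall>\<^sub>F n in sequentially. F ws (z n) = tt (z n) ws"
    proof eventually_elim
      case (elim n)
      then have "z n \<in> \<Sigma> \<inter> RB" using reg\<Sigma>[OF z\<Sigma>] z\<Sigma> by (simp add: RB_def)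
      then show ?case using FT[OF ws] T0_\<Sigma>[OF _ ws] by simp
    qed
    have "(\<lambda>n. F ws (z n)) \<longlonglongrightarrow> F ws x"
      using continuous_on_tendsto_compose[OF Fc[OF ws] zx] x ball by simp
    moreover have "(\<lambda>n. tt (z n) ws) \<longlonglongrightarrow> tt x ws"
      using continuous_on_tendsto_compose[OF smooth_continuous[OF tt_smooth] zx x] ball z\<Sigma> by simp
    from Lim_transform_eventually[OF this] ev have "(\<lambda>n. F ws (z n)) \<longlonglongrightarrow> tt x ws" by (simp add: eq_commute)
    ultimately show ?thesis by (rule LIMSEQ_unique)
  qed
  \<comment> \<open>Within this proof \<open>L\<close> converts the first \<open>p\<close> entries
    of a sequence into a list; it is not the Lie algebra.\<close>
  define L where "L v = map v [0..<p]" for v :: "nat \<Rightarrow> 'v"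
  have Ll: "length (L v) = p" for v by (simp add: L_def)
  have Lupd: "L (v(i := y)) = (L v)[i := y]" if "i < p" for v i y
    using that by (intro nth_equalityI) (auto simp: L_def nth_list_update)
  define \<eta> where "\<eta> = (\<lambda>x v. if x \<in> ball 0 r then F (L v) x else 0)"
  have "\<eta> \<in> forms p UNIV (ball 0 r)"
    unfolding forms_def
  proof (intro CollectI conjI allI impI ballI)
    show "\<eta> x = (\<lambda>v. 0)" if "x \<notin> ball 0 r" for x using that by (auto simp: \<eta>_def)
    show "smooth_on UNIV (ball 0 r) (\<lambda>x. \<eta> x v)" for v
      by (rule smooth_cong[OF F(1)[OF Ll[of v]]]) (simp add: \<eta>_def)
    fix x :: 'v assume x: "x \<in> ball 0 r"
    have \<eta>x: "\<eta> x v = F (L v) x" for v using x by (simp add: \<eta>_def)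
    show "alt_form p UNIV (\<eta> x)"
      unfolding alt_form_def \<eta>x
    proof (intro conjI allI impI)
      show "F (L v) x = F (L w) x" if "\<forall>i<p. v i = w i" for v w
      proof -
        have "L v = L w" using that by (auto simp: L_def)
        then show ?thesis by simp
      qed
      show "F (L v) x = 0" if "\<exists>i<p. v i \<notin> UNIV" for v using that by simp
      show "F (L (v(i := c *\<^sub>R y + z))) x = c * F (L (v(i := y))) x + F (L (v(i := z))) x" if i: "i < p" for v i c y z
      proof (rule RB_eq[OF Fc[OF Ll] _ _ x])
        show "continuous_on (ball 0 r) (\<lambda>x. c * F (L (v(i := y))) x + F (L (v(i := z))) x)"
          by (intro continuous_intros Fc Ll)
        fix w assume w: "w \<in> RB"
        let ?xs = "take i (L v)" and ?ys = "drop (Suc i) (L v)"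
        have up: "L (v(i := u)) = ?xs @ u # ?ys" for u
          using Lupd[OF i] i Ll by (simp add: upd_conv_take_nth_drop)
        have lin: "linear (\<lambda>u. T 0 w (?xs @ u # ?ys))"
          by (rule mlinD[OF equiv_mlin[OF equiv_T0]]) (use i Ll[of v] in simp)
        have "T 0 w (L (v(i := c *\<^sub>R y + z))) = c * T 0 w (L (v(i := y))) + T 0 w (L (v(i := z)))"
          unfolding up using linear_add[OF lin, of "c *\<^sub>R y" z] linear_cmul[OF lin, of c y] by simp
        then show "F (L (v(i := c *\<^sub>R y + z))) w = c * F (L (v(i := y))) w + F (L (v(i := z))) w"
          by (simp only: FT[OF Ll w])
      qed
      show "F (L v) x = 0" if ij: "i < p" "j < p" "i \<noteq> j" "v i = v j" for v i j
      proof (rule RB_eq[OF Fc[OF Ll] _ _ x])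
        fix w assume w: "w \<in> RB"
        obtain g where g: "g \<in> G" "blinfun_apply g w \<in> \<Sigma>" using meet\<Sigma> by blast
        have "T 0 w (L v) = tt (blinfun_apply g w) (map (blinfun_apply g) (L v))" by (rule T0_eq[OF w g Ll])
        also have "\<dots> = 0"
          by (rule tt_alt_index[of _ i j]) (use g w ij in \<open>auto simp: RB_def L_def\<close>)
        finally show "F (L v) w = 0" by (simp only: FT[OF Ll w])
      qed simp
    qed
  qed
  moreover have inv: "\<eta> (blinfun_apply g x) (blinfun_apply g \<circ> v) = \<eta> x v" if g: "g \<in> G" and x: "x \<in> ball 0 r" for g x v
  proof -
    have "F (L (blinfun_apply g \<circ> v)) (blinfun_apply g x) = F (L v) x"
    proof (rule RB_eq[OF _ Fc[OF Ll] _ x])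
      show "continuous_on (ball 0 r) (\<lambda>x. F (L (blinfun_apply g \<circ> v)) (blinfun_apply g x))"
        by (rule continuous_on_compose2[OF Fc[OF Ll]]) (use g in \<open>auto intro!: continuous_intros\<close>)
      fix w assume w: "w \<in> RB"
      have "T 0 (blinfun_apply g w) (map (blinfun_apply g) (L v)) = T 0 w (L v)"
        by (rule equiv_G[OF equiv_T0 g Ll])
      moreover have "map (blinfun_apply g) (L v) = L (blinfun_apply g \<circ> v)" by (simp add: L_def)
      moreover have "blinfun_apply g w \<in> RB" using w RB_G[OF g] by simp
      ultimately show "F (L (blinfun_apply g \<circ> v)) (blinfun_apply g w) = F (L v) w"
        using FT[OF Ll w] FT[OF Ll, of "blinfun_apply g w"] by simp
    qed
    then show ?thesis using x g by (simp add: \<eta>_def)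
  qed
  have "invariant_form K p UNIV (ball 0 r) \<eta>"
    unfolding invariant_form_def
  proof (intro ballI allI impI)
    fix k v and x :: 'v assume "k \<in> K" "x \<in> ball 0 r"
    then show "\<eta> (k x) (k \<circ> v) = \<eta> x v" using inv[OF Blinfun_G(1), of k x v] Blinfun_G(2)[of k] by simp
  qed
  moreover have "horizontal_form K p (ball 0 r) \<eta>"
    unfolding horizontal_form_def
  proof (intro ballI allI impI)
    fix x v assume x: "x \<in> ball 0 r" and "\<exists>i<p. v i \<in> orbit_tangent K x"
    then obtain i where i: "i < p" "v i \<in> orbit_tangent K x" by blast
    obtain g where g: "g \<in> G" "blinfun_apply g x \<in> \<Sigma>" using meet\<Sigma> by blast
    let ?x = "blinfun_apply g x" and ?v = "blinfun_apply g \<circ> v"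
    have xS: "?x \<in> \<Sigma> \<inter> ball 0 r" using g x by simp
    have "\<eta> x v = \<eta> ?x ?v" by (rule inv[OF g(1) x, symmetric])
    also have "\<dots> = tt ?x (L ?v)" using FS[OF xS Ll] xS by (simp add: \<eta>_def)
    \<comment> \<open>The moved vector is tangent to the orbit at a point of \<Sigma>, regular or
      not, hence projects to 0 in \<Sigma>.\<close>
    also have "\<dots> = 0" unfolding tt_def
    proof (rule w_zero_arg[OF xS i(1)])
      have "blinfun_apply g (v i) \<in> orbit_tangent K ?x" by (rule orbit_tangent_G[OF g(1) i(2)])
      then have "pr \<Sigma> (blinfun_apply g (v i)) = 0" using orth\<Sigma>[OF g(2)] by (intro pr_orth_zero sub\<Sigma>)
      then show "lf (L ?v) i = 0" using i(1) by (simp add: lf_def L_def)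
    qed (use lf\<Sigma> in blast)
    finally show "\<eta> x v = 0" .
  qed
  ultimately have "\<eta> \<in> basic_forms K p (ball 0 r)" by (simp add: basic_forms_def)
  moreover have "pullback_incl p \<Sigma> (\<Sigma> \<inter> ball 0 r) \<eta> = \<omega>"
  proof (intro ext)
    fix x v
    show "pullback_incl p \<Sigma> (\<Sigma> \<inter> ball 0 r) \<eta> x v = \<omega> x v"
    proof (cases "x \<in> \<Sigma> \<inter> ball 0 r")
      case x: True
      show ?thesis
      proof (cases "\<forall>i<p. v i \<in> \<Sigma>")
        case True
        have "\<eta> x v = tt x (L v)" using FS[OF x Ll] x by (simp add: \<eta>_def)
        also have "\<dots> = \<omega> x v" unfolding tt_def
          by (rule w_cong[OF x]) (use True sub\<Sigma> in \<open>simp add: lf_def L_def\<close>)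
        finally show ?thesis using x True by (simp add: pullback_incl_def)
      next
        case False
        then show ?thesis using w_out_arg[OF x] by (auto simp: pullback_incl_def)
      qed
    next
      case False
      then show ?thesis using w_out[OF False] by (simp only: pullback_incl_def if_False simp_thms)
    qed
  qed
  ultimately show ?thesis by blast
qed

end

section \<open>Restriction to \<Sigma>: well defined, injective and onto\<close>

context roots
begin

lemma basicD:
  assumes "\<eta> \<in> basic_forms K p (ball 0 r)"
  shows "x \<in> ball 0 r \<Longrightarrow> alt_form p UNIV (\<eta> x)" "x \<notin> ball 0 r \<Longrightarrow> \<eta> x = (\<lambda>v. 0)"
    "smooth_on UNIV (ball 0 r) (\<lambda>x. \<eta> x v)"
    "g \<in> G \<Longrightarrow> x \<in> ball 0 r \<Longrightarrow> \<eta> (blinfun_apply g x) (blinfun_apply g \<circ> v) = \<eta> x v"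
    "x \<in> ball 0 r \<Longrightarrow> i < p \<Longrightarrow> v i \<in> orbit_tangent K x \<Longrightarrow> \<eta> x v = 0"
proof -
  have f: "\<eta> \<in> forms p UNIV (ball 0 r)" and i: "invariant_form K p UNIV (ball 0 r) \<eta>" and h: "horizontal_form K p (ball 0 r) \<eta>"
    using assms by (simp_all add: basic_forms_def)
  show "x \<in> ball 0 r \<Longrightarrow> alt_form p UNIV (\<eta> x)" "x \<notin> ball 0 r \<Longrightarrow> \<eta> x = (\<lambda>v. 0)"
    "smooth_on UNIV (ball 0 r) (\<lambda>x. \<eta> x v)" using f unfolding forms_def by blast+
  show "\<eta> (blinfun_apply g x) (blinfun_apply g \<circ> v) = \<eta> x v" if "g \<in> G" "x \<in> ball 0 r"
    by (rule i[unfolded invariant_form_def, rule_format, of "blinfun_apply g" x v]) (use that in \<open>auto simp: G_def\<close>)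
  show "x \<in> ball 0 r \<Longrightarrow> i < p \<Longrightarrow> v i \<in> orbit_tangent K x \<Longrightarrow> \<eta> x v = 0"
    using h unfolding horizontal_form_def by blast
qed

lemma pullback_inv_form:
  assumes \<eta>: "\<eta> \<in> basic_forms K p (ball 0 r)"
  shows "pullback_incl p \<Sigma> (\<Sigma> \<inter> ball 0 r) \<eta> \<in> inv_forms_on (weyl K \<Sigma>) p \<Sigma> (\<Sigma> \<inter> ball 0 r)"
proof -
  let ?S = "\<Sigma> \<inter> ball 0 r" and ?P = "pullback_incl p \<Sigma> (\<Sigma> \<inter> ball 0 r) \<eta>"
  have Pin: "?P x v = \<eta> x v" if "x \<in> ?S" "\<forall>i<p. v i \<in> \<Sigma>" for x v using that by (simp add: pullback_incl_def)
  have cong: "\<eta> x v = \<eta> x w" if "x \<in> ball 0 r" "\<And>i. i < p \<Longrightarrow> v i = w i" for x v w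
    by (rule conjunct1[OF basicD(1)[OF \<eta> that(1), unfolded alt_form_def], rule_format]) (rule that(2))
  have "?P \<in> forms p \<Sigma> ?S"
    unfolding forms_def
  proof (intro CollectI conjI allI impI ballI)
    show "?P x = (\<lambda>v. 0)" if "x \<notin> ?S" for x using that by (auto simp: pullback_incl_def)
    show "smooth_on \<Sigma> ?S (\<lambda>x. ?P x v)" if v: "\<forall>i<p. v i \<in> \<Sigma>" for v
    proof (rule smooth_cong)
      show "smooth_on \<Sigma> ?S (\<lambda>x. \<eta> x v)" by (rule smooth_subset[OF basicD(3)[OF \<eta>]]) auto
      show "\<eta> x v = ?P x v" if "x \<in> ?S" for x by (rule Pin[OF that v, symmetric])
    qed
    fix x assume x: "x \<in> ?S"
    then have alt: "alt_form p UNIV (\<eta> x)" using basicD(1)[OF \<eta>] by simp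
    have xb: "x \<in> ball 0 r" using x by simp
    show "alt_form p \<Sigma> (?P x)"
      unfolding alt_form_def
    proof (intro conjI allI impI)
      show "?P x v = ?P x w" if "\<forall>i<p. v i = w i" for v w
        using that cong[OF xb, of v w] by (auto simp: pullback_incl_def)
      show "?P x v = 0" if "\<exists>i<p. v i \<notin> \<Sigma>" for v using that by (auto simp: pullback_incl_def)
      show "?P x (v(i := c *\<^sub>R y + z)) = c * ?P x (v(i := y)) + ?P x (v(i := z))"
        if "i < p" "\<forall>j<p. v j \<in> \<Sigma>" "y \<in> \<Sigma>" "z \<in> \<Sigma>" for i v c y z
      proof -
        have "c *\<^sub>R y + z \<in> \<Sigma>" using that sub\<Sigma> by (intro subspace_add subspace_scale)
        moreover have "\<eta> x (v(i := c *\<^sub>R y + z)) = c * \<eta> x (v(i := y)) + \<eta> x (v(i := z))"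
          by (rule alt[unfolded alt_form_def, THEN conjunct2, THEN conjunct2, THEN conjunct1, rule_format]) (use that in auto)
        ultimately show ?thesis using that x by (simp add: Pin)
      qed
      show "?P x v = 0" if "i < p" "j < p" "i \<noteq> j" "v i = v j" for v i j
      proof -
        have "\<eta> x v = 0"
          by (rule alt[unfolded alt_form_def, THEN conjunct2, THEN conjunct2, THEN conjunct2, rule_format, OF that])
        then show ?thesis by (simp add: pullback_incl_def)
      qed
    qed
  qed
  moreover have "invariant_form (weyl K \<Sigma>) p \<Sigma> ?S ?P"
    unfolding invariant_form_def
  proof (intro ballI allI impI)
    fix h x v assume h: "h \<in> weyl K \<Sigma>" and x: "x \<in> ?S" and v: "\<forall>i<p. v i \<in> \<Sigma>"
    obtain k where k: "k \<in> K" "k ` \<Sigma> = \<Sigma>" "h = restrict k \<Sigma>" using h by (auto simp: weyl_def)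
    define g where "g = Blinfun k"
    have g: "g \<in> G" "blinfun_apply g = k" using Blinfun_G[OF k(1)] by (auto simp: g_def)
    have kS: "k s \<in> \<Sigma>" if "s \<in> \<Sigma>" for s using k(2) that by blast
    have xb: "x \<in> ball 0 r" using x by simp
    have nk: "norm (k x) = norm x" using G_norm[OF g(1), of x] g(2) by simp
    have hx: "h x = k x" using x k(3) by simp
    have kx: "k x \<in> ?S" using x kS nk by simp
    have "?P (h x) (h \<circ> v) = \<eta> (k x) (h \<circ> v)"
      unfolding hx by (rule Pin[OF kx]) (use v k(3) kS in auto)
    \<comment> \<open>Entries from index \<open>p\<close> on may lie outside \<Sigma>, where
      \<open>h\<close> is undefined; only the first \<open>p\<close> entries agree, which suffices
      for the form.\<close>
    also have "\<dots> = \<eta> (k x) (k \<circ> v)" by (rule cong) (use kx v k(3) in auto)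
    also have "\<dots> = \<eta> x v" using basicD(4)[OF \<eta> g(1) xb, of v] g(2) by simp
    also have "\<dots> = ?P x v" by (rule Pin[OF x v, symmetric])
    finally show "?P (h x) (h \<circ> v) = ?P x v" .
  qed
  ultimately show ?thesis by (simp add: inv_forms_on_def)
qed

text \<open>At a regular point the complement of \<Sigma> consists of orbit directions, so a
  horizontal form does not change when its arguments are projected to \<Sigma>, one at a
  time.\<close>

lemma basic_eq_on_section:
  assumes \<eta>: "\<eta> \<in> basic_forms K p (ball 0 r)" and x: "x \<in> \<Sigma> \<inter> ball 0 r" "reg x"
  shows "\<eta> x v = pullback_incl p \<Sigma> (\<Sigma> \<inter> ball 0 r) \<eta> x (\<lambda>i. pr \<Sigma> (v i))"
proof -
  have xb: "x \<in> ball 0 r" using x by simp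
  have alt: "alt_form p UNIV (\<eta> x)" by (rule basicD(1)[OF \<eta> xb])
  have step: "\<eta> x (w(i := pr \<Sigma> (w i))) = \<eta> x w" if i: "i < p" for w i
  proof -
    have "\<eta> x (w(i := 1 *\<^sub>R pr \<Sigma> (w i) + (w i - pr \<Sigma> (w i))))
        = 1 * \<eta> x (w(i := pr \<Sigma> (w i))) + \<eta> x (w(i := w i - pr \<Sigma> (w i)))"
      by (rule alt[unfolded alt_form_def, THEN conjunct2, THEN conjunct2, THEN conjunct1, rule_format]) (use i in auto)
    moreover have "\<eta> x (w(i := w i - pr \<Sigma> (w i))) = 0"
    proof (rule basicD(5)[OF \<eta> xb i])
      have "w i - pr \<Sigma> (w i) \<in> LX x" unfolding reg_LX[OF IntD1[OF x(1)] x(2)]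
        using pr_orth[OF sub\<Sigma>] by (simp add: Sp_def)
      then show "(w(i := w i - pr \<Sigma> (w i))) i \<in> orbit_tangent K x"
        using L_orbit_tangent by (auto simp: LX_def)
    qed
    moreover have "w(i := 1 *\<^sub>R pr \<Sigma> (w i) + (w i - pr \<Sigma> (w i))) = w" by auto
    ultimately show ?thesis by simp
  qed
  have "\<eta> x (\<lambda>j. if j < m then pr \<Sigma> (v j) else v j) = \<eta> x v" if "m \<le> p" for m
    using that
  proof (induction m)
    case (Suc m)
    let ?w = "\<lambda>j. if j < m then pr \<Sigma> (v j) else v j"
    have "(\<lambda>j. if j < Suc m then pr \<Sigma> (v j) else v j) = ?w(m := pr \<Sigma> (?w m))"
      by (auto simp: fun_eq_iff less_Suc_eq)
    then show ?case using step[of m ?w] Suc by simp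
  qed simp
  from this[of p] have "\<eta> x v = \<eta> x (\<lambda>j. if j < p then pr \<Sigma> (v j) else v j)" by simp
  also have "\<dots> = \<eta> x (\<lambda>i. pr \<Sigma> (v i))"
    by (rule alt[unfolded alt_form_def, THEN conjunct1, rule_format]) simp
  also have "\<dots> = pullback_incl p \<Sigma> (\<Sigma> \<inter> ball 0 r) \<eta> x (\<lambda>i. pr \<Sigma> (v i))"
    using x pr_in[OF sub\<Sigma>] by (simp add: pullback_incl_def)
  finally show ?thesis .
qed

lemma pullback_injective:
  assumes \<eta>: "\<eta>1 \<in> basic_forms K p (ball 0 r)" "\<eta>2 \<in> basic_forms K p (ball 0 r)"
    and eq: "pullback_incl p \<Sigma> (\<Sigma> \<inter> ball 0 r) \<eta>1 = pullback_incl p \<Sigma> (\<Sigma> \<inter> ball 0 r) \<eta>2"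
  shows "\<eta>1 = \<eta>2"
proof (intro ext)
  fix x v
  show "\<eta>1 x v = \<eta>2 x v"
  proof (cases "x \<in> ball 0 r")
    case False then show ?thesis using basicD(2)[OF \<eta>(1)] basicD(2)[OF \<eta>(2)] by simp
  next
    case x: True
    have regular: "\<eta>1 y v = \<eta>2 y v" if y: "y \<in> ball 0 r" "reg y" for y
    proof -
      obtain g where g: "g \<in> G" "blinfun_apply g y \<in> \<Sigma>" using meet\<Sigma> by blast
      have z: "blinfun_apply g y \<in> \<Sigma> \<inter> ball 0 r" "reg (blinfun_apply g y)" using g y reg_G[OF g(1)] by auto
      have "\<eta>1 (blinfun_apply g y) (blinfun_apply g \<circ> v) = \<eta>2 (blinfun_apply g y) (blinfun_apply g \<circ> v)"
        using basic_eq_on_section[OF \<eta>(1) z] basic_eq_on_section[OF \<eta>(2) z] eq by simp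
      then show ?thesis using basicD(4)[OF \<eta>(1) g(1) y(1)] basicD(4)[OF \<eta>(2) g(1) y(1)] by simp
    qed
    obtain y where y: "\<And>n::nat. y n \<in> ball 0 r" "\<And>n. reg (y n)" and yx: "y \<longlonglongrightarrow> x" using regular_limit[OF x] by blast
    have ev: "\<forall>\<^sub>F n in sequentially. y n \<in> ball 0 r" using y(1) by simp
    have "(\<lambda>n. \<eta>1 (y n) v) \<longlonglongrightarrow> \<eta>1 x v"
      by (rule continuous_on_tendsto_compose[OF smooth_continuous[OF basicD(3)[OF \<eta>(1)]] yx x ev])
    moreover have "(\<lambda>n. \<eta>2 (y n) v) \<longlonglongrightarrow> \<eta>2 x v"
      by (rule continuous_on_tendsto_compose[OF smooth_continuous[OF basicD(3)[OF \<eta>(2)]] yx x ev])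
    ultimately show ?thesis using regular[OF y] LIMSEQ_unique by simp
  qed
qed

lemma restriction_bij:
  assumes r: "0 < r"
  shows "bij_betw (pullback_incl p \<Sigma> (\<Sigma> \<inter> ball 0 r)) (basic_forms K p (ball 0 r))
     (inv_forms_on (weyl K \<Sigma>) p \<Sigma> (\<Sigma> \<inter> ball 0 r))"
  unfolding bij_betw_def
proof (intro conjI inj_onI)
  show "\<eta>1 = \<eta>2" if "\<eta>1 \<in> basic_forms K p (ball 0 r)" "\<eta>2 \<in> basic_forms K p (ball 0 r)"
    "pullback_incl p \<Sigma> (\<Sigma> \<inter> ball 0 r) \<eta>1 = pullback_incl p \<Sigma> (\<Sigma> \<inter> ball 0 r) \<eta>2" for \<eta>1 \<eta>2
    by (rule pullback_injective[OF that])
  show "pullback_incl p \<Sigma> (\<Sigma> \<inter> ball 0 r) ` basic_forms K p (ball 0 r) = inv_forms_on (weyl K \<Sigma>) p \<Sigma> (\<Sigma> \<inter> ball 0 r)"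
  proof
    show "pullback_incl p \<Sigma> (\<Sigma> \<inter> ball 0 r) ` basic_forms K p (ball 0 r) \<subseteq> inv_forms_on (weyl K \<Sigma>) p \<Sigma> (\<Sigma> \<inter> ball 0 r)"
      using pullback_inv_form by blast
    show "inv_forms_on (weyl K \<Sigma>) p \<Sigma> (\<Sigma> \<inter> ball 0 r) \<subseteq> pullback_incl p \<Sigma> (\<Sigma> \<inter> ball 0 r) ` basic_forms K p (ball 0 r)"
    proof
      fix \<omega> assume w: "\<omega> \<in> inv_forms_on (weyl K \<Sigma>) p \<Sigma> (\<Sigma> \<inter> ball 0 r)"
      interpret W: form_ext K \<Sigma> E a XX x0 r p \<omega> by unfold_locales (fact r, fact w)
      show "\<omega> \<in> pullback_incl p \<Sigma> (\<Sigma> \<inter> ball 0 r) ` basic_forms K p (ball 0 r)"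
        using W.extension_exists by blast
    qed
  qed
qed

end

theorem theorem1:
  fixes K :: "('v::euclidean_space \<Rightarrow> 'v) set" and \<Sigma> :: "'v set" and r :: real and p :: nat
  assumes "compact_orth_group K"
    and "is_section K \<Sigma>"
    and "0 < r"
  shows "bij_betw (pullback_incl p \<Sigma> (\<Sigma> \<inter> ball 0 r))
           (basic_forms K p (ball 0 r))
           (inv_forms_on (weyl K \<Sigma>) p \<Sigma> (\<Sigma> \<inter> ball 0 r))"
proof -
  interpret polar K \<Sigma> by unfold_locales (fact assms)+
  obtain E a XX x0 where *: "x0 \<in> \<Sigma>" "finite E" "\<forall>e\<in>E. \<forall>f\<in>E. e \<bullet> f = (if e = f then 1 else 0)" "span E = Sp"
    "\<forall>e\<in>E. a e \<in> \<Sigma> \<and> a e \<bullet> x0 = 1 \<and> XX e \<in> L \<and> (\<forall>y\<in>\<Sigma>. blinfun_apply (XX e) y = (a e \<bullet> y) *\<^sub>R e)"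
    "\<forall>X\<in>L. \<forall>y\<in>\<Sigma>. blinfun_apply X y = (\<Sum>e\<in>E. ((blinfun_apply X x0 \<bullet> e) * (a e \<bullet> y)) *\<^sub>R e)"
    using ex_roots by (elim exE conjE) (rule that; assumption)
  interpret roots K \<Sigma> E a XX x0
  proof unfold_locales
    show "x0 \<in> \<Sigma>" "finite E" "span E = Sp" by (fact *)+
    show "e \<bullet> f = (if e = f then 1 else 0)" if "e \<in> E" "f \<in> E" for e f using *(3) that by blast
    show "a e \<in> \<Sigma>" "a e \<bullet> x0 = 1" "XX e \<in> L" if "e \<in> E" for e using *(5) that by blast+
    show "blinfun_apply (XX e) y = (a e \<bullet> y) *\<^sub>R e" if "e \<in> E" "y \<in> \<Sigma>" for e y using *(5) that by blast
    show "blinfun_apply X y = (\<Sum>e\<in>E. ((blinfun_apply X x0 \<bullet> e) * (a e \<bullet> y)) *\<^sub>R e)" if "X \<in> L" "y \<in> \<Sigma>" for X y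
      using *(6) that by blast
  qed
  show ?thesis by (rule restriction_bij[OF assms(3)])
qed

end
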